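(* Let $m\ge2$, $d\ge1$, $\sigma$ an invertible real $m\times m$ matrix and $A_1,\dots,A_d$ real $m\times m$ matrices, $G_l:=A_l\sigma-\sigma^*A_l^*$. Assume the Hörmander condition: there is $\lambda>0$ with $\sum_{i,j=1}^m\big|\sum_{l=1}^d(G_l)_{ij}a_l\big|^2\ge\lambda|a|^2$ for all $a\in\mathbb{R}^d$; and assume (A2): for all $l,l',l''\in\{1,\dots,d\}$, $A_l^*=-A_l$, $\sigma A_l=A_l\sigma$, $A_lA_{l'}=A_{l'}A_l$, and the matrices $A_l\sigma$, $A_lA_{l'}A_{l''}\sigma$ and $A_l\sigma^2\sigma^*$ are skew-symmetric. Then for every $f\in\mathcal{B}_b(\mathbb{R}^{m+d})$ and $t>0$, $$\Gamma(P_tf)\le\frac{m+2d}{2t}\big\{P_tf^2-(P_tf)^2\big\}.$$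
   Context: On $\mathbb{R}^{m+d}$ with coordinates $(x,y)$, $X_i=\sum_{k=1}^m\sigma_{ki}\partial_{x_k}+\sum_{l=1}^d(A_lx)_i\partial_{y_l}$ ($1\le i\le m$), $L=\frac12\sum_iX_i^2$, $\Gamma(f)=\frac12\sum_{i=1}^m(X_if)^2$. $P_t$ is the Markov semigroup of the solution of $dX(t)=\sigma dB(t)$, $dY_l(t)=\langle A_lX(t),dB(t)\rangle$ ($1\le l\le d$, $B$ an $m$-dimensional Brownian motion), i.e. $P_tf(x,y)=\mathbb{E}f(X(t),Y(t))$ for the solution started at $(x,y)$. *)

theory Defs
  imports "HOL-Analysis.Analysis" "HOL-Probability.Probability"
begin

definition brownian_motion :: "'a measure \<Rightarrow> (real \<Rightarrow> 'a \<Rightarrow> real^'m) \<Rightarrow> bool" where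
  "brownian_motion M B \<longleftrightarrow>
     prob_space M \<and>
     (\<forall>t. B t \<in> borel_measurable M) \<and>
     (AE \<omega> in M. B 0 \<omega> = 0) \<and>
     (AE \<omega> in M. continuous_on {0..} (\<lambda>t. B t \<omega>)) \<and>
     (\<forall>s t. 0 \<le> s \<longrightarrow> s < t \<longrightarrow>
        distributed M lborel (\<lambda>\<omega>. B t \<omega> - B s \<omega>)
          (\<lambda>z. \<Prod>i\<in>UNIV. ennreal (normal_density 0 (sqrt (t - s)) (z $ i)))) \<and>
     (\<forall>(ts::nat \<Rightarrow> real) n. 0 \<le> ts 0 \<longrightarrow> (\<forall>k<n. ts k \<le> ts (Suc k)) \<longrightarrow>
        prob_space.indep_vars M (\<lambda>_. borel) (\<lambda>k \<omega>. B (ts (Suc k)) \<omega> - B (ts k) \<omega>) {..<n})"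

definition tendsto_in_prob :: "'a measure \<Rightarrow> (nat \<Rightarrow> 'a \<Rightarrow> real) \<Rightarrow> ('a \<Rightarrow> real) \<Rightarrow> bool" where
  "tendsto_in_prob M S Y \<longleftrightarrow>
     (\<forall>e>0. (\<lambda>n. measure M {\<omega> \<in> space M. dist (S n \<omega>) (Y \<omega>) > e}) \<longlonglongrightarrow> 0)"

text \<open>Ito integral \<open>\<integral>_0^t \<langle>H(s), dB(s)\<rangle>\<close> of a continuous adapted integrand H
  (here H(s) = A_l X(s)), characterised as the limit in probability of the
  left-point Riemann sums along the dyadic partitions of [0,t].\<close>
definition ito_integral_is ::
  "'a measure \<Rightarrow> (real \<Rightarrow> 'a \<Rightarrow> real^'m) \<Rightarrow> (real \<Rightarrow> 'a \<Rightarrow> real^'m) \<Rightarrow> real \<Rightarrow> ('a \<Rightarrow> real) \<Rightarrow> bool" where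
  "ito_integral_is M B H t I \<longleftrightarrow>
     I \<in> borel_measurable M \<and>
     tendsto_in_prob M
       (\<lambda>n \<omega>. \<Sum>k<2^n. H (real k * t / 2^n) \<omega> \<bullet>
                (B (real (Suc k) * t / 2^n) \<omega> - B (real k * t / 2^n) \<omega>)) I"

definition Xproc :: "real^'m^'m \<Rightarrow> (real \<Rightarrow> 'a \<Rightarrow> real^'m) \<Rightarrow> real^'m \<Rightarrow> real \<Rightarrow> 'a \<Rightarrow> real^'m" where
  "Xproc \<sigma> B x t \<omega> = x + \<sigma> *v B t \<omega>"

definition Yproc ::
  "'a measure \<Rightarrow> real^'m^'m \<Rightarrow> ('d \<Rightarrow> real^'m^'m) \<Rightarrow> (real \<Rightarrow> 'a \<Rightarrow> real^'m)
     \<Rightarrow> (real^'m) \<times> (real^'d) \<Rightarrow> real \<Rightarrow> 'a \<Rightarrow> real^'d" where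
  "Yproc M \<sigma> A B z t \<omega> = (\<chi> l. snd z $ l +
      (SOME I. ito_integral_is M B (\<lambda>s \<omega>'. A l *v Xproc \<sigma> B (fst z) s \<omega>') t I) \<omega>)"

definition Psg ::
  "'a measure \<Rightarrow> real^'m^'m \<Rightarrow> ('d \<Rightarrow> real^'m^'m) \<Rightarrow> (real \<Rightarrow> 'a \<Rightarrow> real^'m)
     \<Rightarrow> real \<Rightarrow> ((real^'m) \<times> (real^'d) \<Rightarrow> real) \<Rightarrow> (real^'m) \<times> (real^'d) \<Rightarrow> real" where
  "Psg M \<sigma> A B t f z =
     prob_space.expectation M (\<lambda>\<omega>. f (Xproc \<sigma> B (fst z) t \<omega>, Yproc M \<sigma> A B z t \<omega>))"

definition vfield :: "real^'m^'m \<Rightarrow> ('d \<Rightarrow> real^'m^'m) \<Rightarrow> 'm \<Rightarrow> (real^'m) \<times> (real^'d) \<Rightarrow> (real^'m) \<times> (real^'d)" where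
  "vfield \<sigma> A i z = ((\<chi> k. \<sigma> $ k $ i), (\<chi> l. (A l *v fst z) $ i))"

definition Xop :: "real^'m^'m \<Rightarrow> ('d \<Rightarrow> real^'m^'m) \<Rightarrow> 'm \<Rightarrow> ((real^'m) \<times> (real^'d) \<Rightarrow> real) \<Rightarrow> (real^'m) \<times> (real^'d) \<Rightarrow> real" where
  "Xop \<sigma> A i g z = frechet_derivative g (at z) (vfield \<sigma> A i z)"

definition Gamma_op :: "real^'m^'m \<Rightarrow> ('d \<Rightarrow> real^'m^'m) \<Rightarrow> ((real^'m) \<times> (real^'d) \<Rightarrow> real) \<Rightarrow> (real^'m) \<times> (real^'d) \<Rightarrow> real" where
  "Gamma_op \<sigma> A g z = 1/2 * (\<Sum>i\<in>UNIV. (Xop \<sigma> A i g z)^2)"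

definition skew :: "real^'m^'m \<Rightarrow> bool" where
  "skew N \<longleftrightarrow> transpose N = - N"

end

theory Submission
  imports Defs
begin

text \<open>Write \<open>x = \<sigma> u\<close>. In the coordinates \<open>(u, y)\<close> the process is \<open>g W_t\<close>, where \<open>g\<close> is its starting
  point and \<open>W\<close> a left-invariant diffusion on the step-two group with product
  \<open>(b, y) (b', y') = (b + b', y + y' + \<beta>(b, b'))\<close>, \<open>\<beta>(b, b')_l = \<langle>A_l \<sigma> b, b'\<rangle>\<close>; hence
  \<open>P_t f (g) = E f(g W_t)\<close>. The law of \<open>W\<close> is stable: \<open>W_1\<close> is \<open>v w\<close> with independent factors, \<open>v\<close>
  distributed as \<open>W_\<epsilon>\<close> and \<open>w\<close> as a dilation of \<open>W_1\<close> by \<open>(1 - \<epsilon>)^(1/2)\<close>. A dilation by \<open>r\<close> adds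
  \<open>Q ln r\<close> to the entropy, \<open>Q = m + 2 d\<close>, so the mutual information of \<open>v\<close> and \<open>W_1\<close> is about
  \<open>Q \<epsilon> / 2\<close>. Testing it, through the Donsker--Varadhan formula, on \<open>c (f(g W_1) - P_1 f(g)) \<langle>u, v\<rangle>\<close>
  gives to first order in \<open>\<epsilon>\<close> that \<open>c X_u P_1 f \<le> c^2 |u|^2 Var / 2 + Q / 2\<close> for all \<open>c\<close>, which is the
  bound, for those \<open>f\<close> that have second order expansions along the group.

  Mollification turns this into a horizontal Lipschitz bound in total variation. Commutators then
  give vertical Hoelder continuity, and \<open>\<Delta>_z = (\<Delta>_2z - \<Delta>_z^2) / 2\<close> together with the semigroup
  property improves it to Lipschitz continuity. So \<open>P_t f\<close> is a uniform limit of smooth functions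
  with converging derivatives, and the bound passes to all bounded measurable \<open>f\<close>.\<close>

section \<open>Comparing probability measures\<close>

text \<open>The entropy argument needs a density with integrable logarithm, while the vertical
  density of the endpoint law is not under control. Only its horizontal marginal is visibly bounded,
  so a vertical Gaussian of size \<open>1/j\<close> is added. Being central, it respects the
  stability identity once a matching amount of noise is put into the small factor, and its bias of
  order \<open>1/j\<close> vanishes in the first order limit. The linear test is truncated at the
  fourth root of the duration \<open>1/j\<close> of the small factor: this tends to 0, so the
  exponential becomes quadratic to leading order, but slower than the increments of size
  \<open>1 / sqrt j\<close>, so the truncation is not felt in the limit.

  Stability is an exact identity for Gaussian random walks on the group. It passes to the limit
  along grids with \<open>c * 2^n\<close> steps, hence for rational ratios of durations. Skewness of
  \<open>A l ** \<sigma>\<close> makes \<open>beta\<close> alternating, and the Hoermander condition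
  makes its values span the vertical space. The constant stays sharp because
  \<open>ln x \<le> x - 1\<close> is exact to first order at 1, because the optimisation over
  \<open>c\<close> is explicit, and because the later approximations lose only a factor tending to
  1.\<close>

lemma compact_measure_le_of_continuous:
  fixes N1 N2 :: "'a::euclidean_space measure" and C :: real
  assumes prob: "prob_space N1" "prob_space N2"
    and sets [measurable_cong]: "sets N1 = sets borel" "sets N2 = sets borel"
    and C: "\<And>h. continuous_on UNIV h \<Longrightarrow> (\<And>x. \<bar>h x\<bar> \<le> 1) \<Longrightarrow> (\<integral>x. h x \<partial>N1) - (\<integral>x. h x \<partial>N2) \<le> C"
    and K: "compact K"
  shows "2 * (measure N1 K - measure N2 K) \<le> C"
proof (cases "K = {}")
  case True
  have "0 \<le> C" using C[of "\<lambda>_. 0"] by auto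
  then show ?thesis using True by simp
next
  case ne: False
  interpret N1: prob_space N1 by fact
  interpret N2: prob_space N2 by fact
  \<comment> \<open>Lipschitz cut-offs that decrease to the indicator of the compact set as the
    slope \<open>n\<close> grows.\<close>
  define h :: "nat \<Rightarrow> 'a \<Rightarrow> real" where "h n x = max 0 (1 - real n * infdist x K)" for n x
  have hc: "continuous_on UNIV (h n)" for n
    unfolding h_def by (intro continuous_intros)
  have [measurable]: "h n \<in> borel_measurable borel" for n
    by (rule borel_measurable_continuous_onI[OF hc])
  have [measurable]: "K \<in> sets borel" using K by (simp add: borel_compact)
  have h01: "0 \<le> h n x" "h n x \<le> 1" for n x
    by (auto simp: h_def infdist_nonneg)
  have lim: "(\<lambda>n. h n x) \<longlonglongrightarrow> indicator K x" for x
  proof (cases "x \<in> K")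
    case True
    then show ?thesis using ne by (simp add: h_def)
  next
    case False
    then have d: "infdist x K > 0"
      using K ne by (metis compact_imp_closed in_closed_iff_infdist_zero infdist_nonneg less_eq_real_def)
    obtain n0 where n0: "1 / infdist x K < real n0" using reals_Archimedean2 by blast
    have "h n x = 0" if "n \<ge> n0" for n
    proof -
      have "1 < real n0 * infdist x K" using n0 d by (simp add: field_simps)
      also have "\<dots> \<le> real n * infdist x K" using that d by (intro mult_right_mono) auto
      finally show ?thesis by (simp add: h_def)
    qed
    then have "eventually (\<lambda>n. h n x = indicator K x) sequentially"
      using False unfolding eventually_sequentially by (auto intro!: exI[of _ n0])
    then show ?thesis by (rule tendsto_eventually)
  qed
  have L: "(\<lambda>n. \<integral>x. h n x \<partial>N) \<longlonglongrightarrow> measure N K" if N: "prob_space N" and [measurable_cong]: "sets N = sets borel" for N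
  proof -
    interpret prob_space N by fact
    have "(\<lambda>n. \<integral>x. h n x \<partial>N) \<longlonglongrightarrow> (\<integral>x. indicator K x \<partial>N)"
      by (rule integral_dominated_convergence[where w="\<lambda>_. 1"]) (use lim h01 in \<open>auto simp: abs_of_nonneg\<close>)
    then show ?thesis using sets_eq_imp_space_eq[OF that(2)] by simp
  qed
  have "2 * ((\<integral>x. h n x \<partial>N1) - (\<integral>x. h n x \<partial>N2)) \<le> C" for n
  proof -
    have i: "integrable N1 (h n)" "integrable N2 (h n)"
      by (rule N1.integrable_const_bound[where B=1] N2.integrable_const_bound[where B=1];
          use h01 in \<open>auto simp: abs_of_nonneg\<close>)+
    \<comment> \<open>Test functions take values in \<open>[-1, 1]\<close>; rescaling the cut-off
      from \<open>[0, 1]\<close> to that range produces the factor 2 of the statement.\<close>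
    have "(\<integral>x. 2 * h n x - 1 \<partial>N1) - (\<integral>x. 2 * h n x - 1 \<partial>N2) \<le> C"
    proof (rule C)
      show "continuous_on UNIV (\<lambda>x. 2 * h n x - 1)" by (intro continuous_intros hc)
      show "\<bar>2 * h n x - 1\<bar> \<le> 1" for x using h01[of n x] by auto
    qed
    then show ?thesis using i by (simp add: N1.prob_space N2.prob_space)
  qed
  moreover have "(\<lambda>n. 2 * ((\<integral>x. h n x \<partial>N1) - (\<integral>x. h n x \<partial>N2))) \<longlonglongrightarrow> 2 * (measure N1 K - measure N2 K)"
    by (intro tendsto_intros L) fact+
  ultimately show ?thesis by (intro LIMSEQ_le_const2) auto
qed

text \<open>Inner regularity of finite Borel measures replaces the set by a compact subset of nearly
  full \<open>N1\<close> measure, and passing to a subset only lowers the \<open>N2\<close>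
  measure.\<close>

lemma measure_le_of_continuous:
  fixes N1 N2 :: "'a::euclidean_space measure" and C :: real
  assumes prob: "prob_space N1" "prob_space N2"
    and sets [measurable_cong]: "sets N1 = sets borel" "sets N2 = sets borel"
    and C: "\<And>h. continuous_on UNIV h \<Longrightarrow> (\<And>x. \<bar>h x\<bar> \<le> 1) \<Longrightarrow> (\<integral>x. h x \<partial>N1) - (\<integral>x. h x \<partial>N2) \<le> C"
    and A [measurable]: "A \<in> sets borel"
  shows "2 * (measure N1 A - measure N2 A) \<le> C"
proof (rule field_le_epsilon)
  fix e :: real assume e: "e > 0"
  interpret N1: prob_space N1 by fact
  interpret N2: prob_space N2 by fact
  have "emeasure N1 A = (SUP K\<in>{K. K \<subseteq> A \<and> compact K}. emeasure N1 K)"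
    by (rule inner_regular) (use sets in auto)
  \<comment> \<open>In \<open>ennreal\<close> a negative number becomes 0, so the strict inequality
    fails for a null set; that case is kept apart and served by the empty set.\<close>
  moreover have "ennreal (measure N1 A - e / 2) < emeasure N1 A \<or> measure N1 A = 0"
    using e zero_less_measure_iff[of N1 A] by (auto simp: N1.emeasure_eq_measure intro!: ennreal_lessI)
  ultimately have "(\<exists>K. K \<subseteq> A \<and> compact K \<and> ennreal (measure N1 A - e / 2) < emeasure N1 K) \<or> measure N1 A = 0"
    by (auto simp: less_SUP_iff)
  then obtain K where K: "K \<subseteq> A" "compact K" "measure N1 A - e / 2 \<le> measure N1 K"
  proof (elim disjE exE conjE)
    fix K assume K: "K \<subseteq> A" "compact K" "ennreal (measure N1 A - e / 2) < emeasure N1 K"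
    then have "measure N1 A - e / 2 \<le> measure N1 K"
      by (metis N1.emeasure_eq_measure ennreal_less_iff ennreal_neg less_eq_real_def linorder_not_le measure_nonneg order.trans)
    with K that show thesis by blast
  next
    assume "measure N1 A = 0"
    then show thesis using e by (intro that[of "{}"]) auto
  qed
  have "measure N2 K \<le> measure N2 A"
    by (rule N2.finite_measure_mono) (use K in auto)
  moreover have "2 * (measure N1 K - measure N2 K) \<le> C"
    by (rule compact_measure_le_of_continuous[OF prob sets C K(2)])
  ultimately show "2 * (measure N1 A - measure N2 A) \<le> C + e" using K(3) by argo
qed

text \<open>The sum counts the levels \<open>k / n\<close> up to \<open>x\<close>, hence equals the
  floor of \<open>n * x\<close>: a discrete layer cake formula for values in
  \<open>[0, 1]\<close>.\<close>

lemma floor_layer_sum: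
  assumes "n > 0" "0 \<le> x" "x \<le> (1::real)"
  shows "\<bar>x - (\<Sum>k=1..n. if x \<ge> real k / real n then 1 else 0) / real n\<bar> \<le> 1 / real n"
proof -
  define m where "m = nat \<lfloor>real n * x\<rfloor>"
  have "real n * x \<le> real n" by (rule mult_left_le) (use assms in auto)
  then have mn: "m \<le> n" by (simp add: m_def nat_le_iff floor_le_iff)
  have "k \<in> {1..n} \<and> x \<ge> real k / real n \<longleftrightarrow> k \<in> {1..m}" for k
  proof -
    have "x \<ge> real k / real n \<longleftrightarrow> real k \<le> real n * x" using assms by (simp add: pos_divide_le_eq mult.commute)
    also have "\<dots> \<longleftrightarrow> int k \<le> \<lfloor>real n * x\<rfloor>" by (simp add: le_floor_iff)
    also have "\<dots> \<longleftrightarrow> k \<le> m" using assms by (simp add: m_def le_nat_iff)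
    finally show ?thesis using mn by auto
  qed
  then have "{k \<in> {1..n}. x \<ge> real k / real n} = {1..m}" by blast
  then have s: "(\<Sum>k=1..n. if x \<ge> real k / real n then 1 else (0::real)) = real m"
    by (simp flip: sum.inter_filter)
  have "real m \<le> real n * x" "real n * x < real m + 1"
    using assms by (auto simp: m_def)
  then have "\<bar>real n * x - real m\<bar> \<le> 1" by linarith
  moreover have "x - real m / real n = (real n * x - real m) / real n" using assms by (simp add: diff_divide_distrib)
  ultimately show ?thesis unfolding s using assms by (simp add: divide_right_mono)
qed

text \<open>A function with values in \<open>[0, 1]\<close> is, up to \<open>1/n\<close>, an average
  of indicators of its superlevel sets. An average of the set-wise differences obeys the same bound,
  so the constant \<open>C\<close> is preserved.\<close>

lemma integral_diff_le_of_measure_diff_le: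
  fixes N1 N2 :: "'a measure" and C :: real
  assumes prob: "prob_space N1" "prob_space N2"
    and sets: "sets N2 = sets N1"
    and C: "\<And>A. A \<in> sets N1 \<Longrightarrow> 2 * (measure N1 A - measure N2 A) \<le> C"
    and g [measurable]: "g \<in> borel_measurable N1" and b: "\<And>x. \<bar>g x\<bar> \<le> 1"
  shows "(\<integral>x. g x \<partial>N1) - (\<integral>x. g x \<partial>N2) \<le> C"
proof -
  interpret N1: prob_space N1 by fact
  interpret N2: prob_space N2 by fact
  note [measurable_cong] = sets
  define f where "f x = (g x + 1) / 2" for x
  have [measurable]: "f \<in> borel_measurable N1" unfolding f_def by measurable
  have f01: "0 \<le> f x" "f x \<le> 1" for x using b[of x] by (auto simp: f_def)
  define s :: "nat \<Rightarrow> 'a \<Rightarrow> real" where "s n x = (\<Sum>k=1..n. indicator {x \<in> space N1. f x \<ge> real k / real n} x) / real n" for n x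
  have sp: "space N2 = space N1" by (rule sets_eq_imp_space_eq) fact
  have i: "integrable N1 f" "integrable N2 f"
    by (rule N1.integrable_const_bound[where B=1] N2.integrable_const_bound[where B=1];
        use f01 in \<open>auto simp: abs_of_nonneg\<close>)+
  have gf: "g x = 2 * f x - 1" for x by (simp add: f_def field_simps)
  have "(\<integral>x. g x \<partial>N1) - (\<integral>x. g x \<partial>N2) = 2 * ((\<integral>x. f x \<partial>N1) - (\<integral>x. f x \<partial>N2))"
    unfolding gf using i by (simp add: N1.prob_space N2.prob_space)
  also have "\<dots> \<le> C"
  proof (rule field_le_epsilon)
    fix e :: real assume e: "e > 0"
    \<comment> \<open>Two approximation errors \<open>1/n\<close>, doubled by the passage from
      \<open>g\<close> to \<open>f\<close>, have to fit into \<open>e\<close>.\<close>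
    obtain n where n: "n > 0" "4 / e < real n" using reals_Archimedean2[of "4 / e"] e
      by (metis divide_pos_pos of_nat_0_less_iff order_less_trans zero_less_numeral)
    have si: "integrable N1 (s n)" "integrable N2 (s n)"
      unfolding s_def by (intro integrable_divide_zero Bochner_Integration.integrable_sum integrable_real_indicator;
          simp add: sp N1.emeasure_eq_measure N2.emeasure_eq_measure sets)+
    have close: "\<bar>f x - s n x\<bar> \<le> 1 / real n" if "x \<in> space N1" for x
    proof -
      have "s n x = (\<Sum>k=1..n. if f x \<ge> real k / real n then 1 else 0) / real n"
        unfolding s_def using that by (intro arg_cong2[where f="(/)"] sum.cong) auto
      then show ?thesis using floor_layer_sum[OF n(1) f01, of x] by simp
    qed
    have "\<bar>(\<integral>x. f x \<partial>N1) - (\<integral>x. s n x \<partial>N1)\<bar> \<le> 1 / n"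
    proof -
      have "\<bar>\<integral>x. f x - s n x \<partial>N1\<bar> \<le> (\<integral>x. \<bar>f x - s n x\<bar> \<partial>N1)" by (rule integral_abs_bound)
      also have "\<dots> \<le> (\<integral>x. 1 / n \<partial>N1)" by (rule integral_mono) (use i si close in auto)
      finally show ?thesis using i si by (simp add: N1.prob_space)
    qed
    moreover have "\<bar>(\<integral>x. f x \<partial>N2) - (\<integral>x. s n x \<partial>N2)\<bar> \<le> 1 / n"
    proof -
      have "\<bar>\<integral>x. f x - s n x \<partial>N2\<bar> \<le> (\<integral>x. \<bar>f x - s n x\<bar> \<partial>N2)" by (rule integral_abs_bound)
      also have "\<dots> \<le> (\<integral>x. 1 / n \<partial>N2)" by (rule integral_mono) (use i si close sp in auto)
      finally show ?thesis using i si by (simp add: N2.prob_space)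
    qed
    moreover have "2 * ((\<integral>x. s n x \<partial>N1) - (\<integral>x. s n x \<partial>N2)) \<le> C"
    proof -
      define A where "A k = {x \<in> space N1. f x \<ge> real k / real n}" for k
      have A [measurable]: "A k \<in> sets N1" for k unfolding A_def by measurable
      have sA: "A k \<subseteq> space N1" for k by (auto simp: A_def)
      have "(\<integral>x. s n x \<partial>N1) = (\<Sum>k=1..n. measure N1 (A k)) / n"
        unfolding s_def A_def[symmetric] using A
        by (simp add: Bochner_Integration.integral_sum N1.emeasure_eq_measure Int_absorb2 sA)
      moreover have "(\<integral>x. s n x \<partial>N2) = (\<Sum>k=1..n. measure N2 (A k)) / n"
        unfolding s_def A_def[symmetric] using A
        by (simp add: Bochner_Integration.integral_sum N2.emeasure_eq_measure Int_absorb2 sA sp sets)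
      ultimately have "2 * ((\<integral>x. s n x \<partial>N1) - (\<integral>x. s n x \<partial>N2)) = (\<Sum>k=1..n. 2 * (measure N1 (A k) - measure N2 (A k))) / n"
        by (simp add: sum_subtractf sum_distrib_left[symmetric] diff_divide_distrib)
      also have "\<dots> \<le> (\<Sum>k=1..n. C) / n"
        by (intro divide_right_mono sum_mono C A) auto
      finally show ?thesis using n by simp
    qed
    moreover have "4 * (1 / real n) \<le> e" using n e by (simp add: field_simps)
    ultimately show "2 * ((\<integral>x. f x \<partial>N1) - (\<integral>x. f x \<partial>N2)) \<le> C + e" by argo
  qed
  finally show ?thesis .
qed

text \<open>Continuous tests already compute the total variation distance. Estimates proved for
  regular functions are carried by this to measurable ones with the same constant.\<close>

lemma integral_diff_le_of_continuous:
  fixes N1 N2 :: "'a::euclidean_space measure" and C :: real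
  assumes prob: "prob_space N1" "prob_space N2"
    and sets: "sets N1 = sets borel" "sets N2 = sets borel"
    and C: "\<And>h. continuous_on UNIV h \<Longrightarrow> (\<And>x. \<bar>h x\<bar> \<le> 1) \<Longrightarrow> (\<integral>x. h x \<partial>N1) - (\<integral>x. h x \<partial>N2) \<le> C"
    and g: "g \<in> borel_measurable borel" and b: "\<And>x. \<bar>g x\<bar> \<le> 1"
  shows "(\<integral>x. g x \<partial>N1) - (\<integral>x. g x \<partial>N2) \<le> C"
proof (rule integral_diff_le_of_measure_diff_le[OF prob _ _ _ b])
  show "sets N2 = sets N1" using sets by simp
  show "g \<in> borel_measurable N1" using g by (subst measurable_cong_sets[OF sets(1) refl])
  show "2 * (measure N1 A - measure N2 A) \<le> C" if "A \<in> sets N1" for A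
    by (rule measure_le_of_continuous[OF prob sets C]) (use that sets in auto)
qed

section \<open>Gaussian measures\<close>

lemma lborel_integral_prod:
  fixes h :: "'a::euclidean_space \<Rightarrow> real \<Rightarrow> real"
  assumes "\<And>b. b \<in> Basis \<Longrightarrow> integrable lborel (h b)"
  shows "integrable lborel (\<lambda>x::'a. \<Prod>b\<in>Basis. h b (x \<bullet> b))"
    and "(\<integral>x. (\<Prod>b\<in>Basis. h b ((x::'a) \<bullet> b)) \<partial>lborel) = (\<Prod>b\<in>Basis. \<integral>t. h b t \<partial>lborel)"
proof -
  interpret product_sigma_finite "\<lambda>_::'a. lborel :: real measure" ..
  have [measurable]: "h b \<in> borel_measurable borel" if "b \<in> Basis" for b
    using assms[OF that] by (simp add: integrable_iff_bounded)
  have M: "(\<lambda>f. \<Sum>b\<in>Basis. f b *\<^sub>R b) \<in> (\<Pi>\<^sub>M b\<in>Basis. lborel) \<rightarrow>\<^sub>M (borel :: 'a measure)"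
    by measurable
  have P: "(\<lambda>x::'a. \<Prod>b\<in>Basis. h b (x \<bullet> b)) \<in> borel_measurable borel" by measurable
  show "integrable lborel (\<lambda>x::'a. \<Prod>b\<in>Basis. h b (x \<bullet> b))"
    unfolding lborel_eq[where 'a='a]
    by (subst integrable_distr_eq[OF M P]) (use product_integrable_prod[of Basis h] assms in simp)
  show "(\<integral>x. (\<Prod>b\<in>Basis. h b ((x::'a) \<bullet> b)) \<partial>lborel) = (\<Prod>b\<in>Basis. \<integral>t. h b t \<partial>lborel)"
    unfolding lborel_eq[where 'a='a]
    by (subst integral_distr[OF M P]) (use product_integral_prod[of Basis h] assms in simp)
qed

definition gauss_density :: "'a::euclidean_space \<Rightarrow> real" where
  "gauss_density x = (\<Prod>b\<in>Basis. std_normal_density (x \<bullet> b))"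

definition gauss :: "'a::euclidean_space measure" where
  "gauss = density lborel gauss_density"

lemma gauss_density_eq:
  "gauss_density (x::'a::euclidean_space) = (1 / sqrt (2 * pi)) ^ DIM('a) * exp (- (norm x)\<^sup>2 / 2)"
proof -
  have "exp (- (norm x)\<^sup>2 / 2) = (\<Prod>b\<in>Basis. exp (- (x \<bullet> b)\<^sup>2 / 2))"
    unfolding power2_norm_eq_inner
    by (subst euclidean_inner) (simp add: exp_sum[symmetric] sum_divide_distrib sum_negf power2_eq_square)
  then show ?thesis
    by (simp add: gauss_density_def std_normal_density_def prod.distrib prod_dividef power_one_over)
qed

lemma gauss_density_pos: "0 < gauss_density x"
  by (simp add: gauss_density_eq)

lemma borel_measurable_gauss_density [measurable]: "gauss_density \<in> borel_measurable borel"
  unfolding gauss_density_def by measurable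

lemma sets_gauss [measurable_cong, simp]: "sets gauss = sets borel"
  and space_gauss [simp]: "space gauss = UNIV"
  by (auto simp: gauss_def)

lemma integrable_gauss_density: "integrable lborel (gauss_density :: 'a::euclidean_space \<Rightarrow> real)"
  and integral_gauss_density: "(\<integral>x. gauss_density (x::'a) \<partial>lborel) = 1"
  unfolding gauss_density_def
  using lborel_integral_prod[of "\<lambda>_::'a. std_normal_density"] by simp_all

lemma prob_space_gauss: "prob_space (gauss :: 'a::euclidean_space measure)"
proof
  have "emeasure (gauss :: 'a measure) UNIV = (\<integral>\<^sup>+x. gauss_density (x::'a) \<partial>lborel)"
    by (simp add: gauss_def emeasure_density)
  also have "\<dots> = 1"
    using integrable_gauss_density integral_gauss_density
    by (subst nn_integral_eq_integral) (auto simp: gauss_density_pos less_imp_le)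
  finally show "emeasure (gauss :: 'a measure) (space gauss) = 1" by simp
qed

interpretation gauss: prob_space "gauss :: 'a::euclidean_space measure"
  by (rule prob_space_gauss)

lemma gauss_density_le: "gauss_density (x::'a::euclidean_space) \<le> (1 / sqrt (2 * pi)) ^ DIM('a)"
  by (auto simp: gauss_density_eq intro!: mult_left_le)

lemma integral_gauss_eq:
  fixes f :: "'a::euclidean_space \<Rightarrow> real"
  assumes [measurable]: "f \<in> borel_measurable borel"
  shows "integrable gauss f \<longleftrightarrow> integrable lborel (\<lambda>x. gauss_density x * f x)"
    and "(\<integral>x. f x \<partial>gauss) = (\<integral>x. gauss_density x * f x \<partial>lborel)"
  unfolding gauss_def
  by (subst integrable_density integral_density; auto simp: gauss_density_pos less_imp_le)+

lemma gauss_basis_moment: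
  assumes i: "i \<in> Basis" and j: "j \<in> Basis"
  shows "integrable gauss (\<lambda>x::'a::euclidean_space. (x \<bullet> i) * (x \<bullet> j))"
    and "(\<integral>x. (x \<bullet> i) * (x \<bullet> j) \<partial>gauss) = i \<bullet> j"
proof -
  \<comment> \<open>The product form separates the coordinates; for \<open>i = j\<close> both
    conditionals fire and produce the second moment of that coordinate.\<close>
  define h where "h b t = std_normal_density t * ((if b = i then t else 1) * (if b = j then t else 1))" for b :: 'a and t
  have m1: "has_bochner_integral lborel (\<lambda>x. std_normal_density x * x) 0"
    using std_normal_moment_odd[of 0] by simp
  have m2: "has_bochner_integral lborel (\<lambda>x. std_normal_density x * (x * x)) 1"
    using std_normal_moment_even[of 1] by (simp add: power2_eq_square)
  have m0: "has_bochner_integral lborel std_normal_density 1"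
    by (simp add: has_bochner_integral_iff)
  have hb: "has_bochner_integral lborel (h b) (if b = i \<and> b = j then 1 else if b = i \<or> b = j then 0 else 1)" for b
    unfolding h_def using m0 m1 m2 by simp
  have eq: "gauss_density x * ((x \<bullet> i) * (x \<bullet> j)) = (\<Prod>b\<in>Basis. h b (x \<bullet> b))" for x
    using i j by (simp add: h_def gauss_density_def prod.distrib prod.delta)
  have ih: "integrable lborel (h b)" for b using hb by (simp add: has_bochner_integral_iff)
  show "integrable gauss (\<lambda>x::'a::euclidean_space. (x \<bullet> i) * (x \<bullet> j))"
    by (subst integral_gauss_eq; simp add: eq lborel_integral_prod(1) ih)
  have "(\<integral>x. (x \<bullet> i) * (x \<bullet> j) \<partial>gauss) = (\<Prod>b\<in>Basis. \<integral>t. h b t \<partial>lborel)"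
    by (subst integral_gauss_eq; simp add: eq lborel_integral_prod(2) ih)
  also have "\<dots> = (\<Prod>b\<in>Basis. if b = i \<and> b = j then 1 else if b = i \<or> b = j then 0 else 1)"
    using hb by (intro prod.cong) (auto simp: has_bochner_integral_iff)
  also have "\<dots> = i \<bullet> j"
  proof (cases "i = j")
    case True
    then show ?thesis using i by (auto intro!: prod.neutral simp: inner_same_Basis)
  next
    case False
    then have "(\<Prod>b\<in>Basis. if b = i \<and> b = j then 1 else if b = i \<or> b = j then 0 else (1::real)) = 0"
      using i by (intro prod_zero bexI[of _ i]) auto
    then show ?thesis using False i j by (simp add: inner_not_same_Basis)
  qed
  finally show "(\<integral>x. (x \<bullet> i) * (x \<bullet> j) \<partial>gauss) = i \<bullet> j" .
qed

lemma gauss_moment: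
  fixes u v :: "'a::euclidean_space"
  shows "integrable gauss (\<lambda>x. (x \<bullet> u) * (x \<bullet> v))"
    and "(\<integral>x. (x \<bullet> u) * (x \<bullet> v) \<partial>gauss) = u \<bullet> v"
proof -
  have eq: "(x \<bullet> u) * (x \<bullet> v) = (\<Sum>i\<in>Basis. \<Sum>j\<in>Basis. (u \<bullet> i) * (v \<bullet> j) * ((x \<bullet> i) * (x \<bullet> j)))" for x :: 'a
    by (subst euclidean_inner[of x u], subst euclidean_inner[of x v])
       (simp add: sum_product algebra_simps)
  show "integrable gauss (\<lambda>x. (x \<bullet> u) * (x \<bullet> v))"
    unfolding eq by (intro Bochner_Integration.integrable_sum integrable_mult_right gauss_basis_moment)
  have "(\<integral>x. (x \<bullet> u) * (x \<bullet> v) \<partial>gauss) = (\<Sum>i\<in>Basis. \<Sum>j\<in>Basis. (u \<bullet> i) * (v \<bullet> j) * (i \<bullet> j))"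
    unfolding eq
    by (subst Bochner_Integration.integral_sum, (intro Bochner_Integration.integrable_sum integrable_mult_right gauss_basis_moment; assumption),
        intro sum.cong refl, subst Bochner_Integration.integral_sum)
       (auto intro!: integrable_mult_right gauss_basis_moment sum.cong simp: gauss_basis_moment)
  also have "\<dots> = (\<Sum>i\<in>Basis. (u \<bullet> i) * (v \<bullet> i))"
    by (intro sum.cong refl) (simp add: inner_Basis if_distrib sum.delta cong: if_cong)
  finally show "(\<integral>x. (x \<bullet> u) * (x \<bullet> v) \<partial>gauss) = u \<bullet> v"
    by (simp add: euclidean_inner[of u v])
qed

lemma gauss_norm_moment: "integrable gauss (\<lambda>x::'a::euclidean_space. (norm x)\<^sup>2)"
proof -
  have "(norm x)\<^sup>2 = (\<Sum>i\<in>Basis. (x \<bullet> i) * (x \<bullet> i))" for x :: 'a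
    unfolding power2_norm_eq_inner by (rule euclidean_inner)
  then show ?thesis by (simp add: gauss_basis_moment)
qed

lemma nn_integral_lborel_affine:
  fixes t :: "'a::euclidean_space"
  assumes [measurable]: "f \<in> borel_measurable borel" and c: "c > 0"
  shows "(\<integral>\<^sup>+x. f x \<partial>lborel) = (\<integral>\<^sup>+x. ennreal (c ^ DIM('a)) * f (t + c *\<^sub>R x) \<partial>lborel)"
  using c by (subst lborel_affine[where c=c and t=t])
    (auto simp: nn_integral_density nn_integral_distr ennreal_power abs_of_pos)

lemma gauss_uminus: "distr gauss borel uminus = (gauss :: 'a::euclidean_space measure)"
proof -
  have l: "distr lborel borel uminus = (lborel :: 'a measure)"
    using lborel_affine[of "-1" "0::'a"] by (simp add: density_1)
  have g: "gauss_density \<circ> uminus = (gauss_density :: 'a \<Rightarrow> real)" by (auto simp: gauss_density_eq)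
  have "distr gauss borel uminus = (density (distr lborel borel uminus) gauss_density :: 'a measure)"
    unfolding gauss_def using g
    by (subst density_distr) (auto simp: fun_eq_iff o_def cong: distr_cong)
  then show ?thesis by (simp add: l gauss_def)
qed

text \<open>Completing the square,
  \<open>|x|^2 + |s - a x|^2 / b^2 = |s|^2 + |x - a s|^2 / b^2\<close> whenever \<open>a^2 + b^2 = 1\<close>.\<close>
lemma gauss_convolution:
  fixes a b :: real
  assumes ab: "a\<^sup>2 + b\<^sup>2 = 1" and b: "b > 0"
  shows "distr (gauss \<Otimes>\<^sub>M gauss) borel (\<lambda>(x, y). a *\<^sub>R x + b *\<^sub>R y) = (gauss :: 'a::euclidean_space measure)"
proof (rule measure_eqI)
  fix A assume "A \<in> sets (distr (gauss \<Otimes>\<^sub>M gauss) borel (\<lambda>(x, y). a *\<^sub>R x + b *\<^sub>R y :: 'a))"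
  then have [measurable]: "A \<in> sets borel" by simp
  let ?g = "\<lambda>x. ennreal (gauss_density (x::'a))"
  have key: "gauss_density x * gauss_density ((1/b) *\<^sub>R (s - a *\<^sub>R x)) = gauss_density s * gauss_density (- (a / b) *\<^sub>R s + (1 / b) *\<^sub>R x)" for x s :: 'a
  proof -
    have "(norm x)\<^sup>2 + (norm ((1/b) *\<^sub>R (s - a *\<^sub>R x)))\<^sup>2 - (norm s)\<^sup>2 - (norm (- (a / b) *\<^sub>R s + (1 / b) *\<^sub>R x))\<^sup>2
        = ((x \<bullet> x) * (b\<^sup>2 + a\<^sup>2 - 1) + (s \<bullet> s) * (1 - b\<^sup>2 - a\<^sup>2)) / b\<^sup>2"
      unfolding power2_norm_eq_inner using b
      by (simp add: inner_diff_left inner_diff_right inner_add_left inner_add_right inner_commute[of x s] field_simps power2_eq_square)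
    also have "\<dots> = 0" using ab by (simp add: algebra_simps)
    finally show ?thesis
      by (simp add: gauss_density_eq exp_add[symmetric] flip: add_divide_distrib minus_add_distrib)
  qed
  have "emeasure (distr (gauss \<Otimes>\<^sub>M gauss) borel (\<lambda>(x, y). a *\<^sub>R x + b *\<^sub>R y)) A
      = (\<integral>\<^sup>+z. indicator A z \<partial>distr (gauss \<Otimes>\<^sub>M gauss) borel (\<lambda>(x, y). a *\<^sub>R x + b *\<^sub>R y))"
    by (rule nn_integral_indicator[symmetric]) simp
  also have "\<dots> = (\<integral>\<^sup>+p. indicator A (a *\<^sub>R fst p + b *\<^sub>R snd p) \<partial>(gauss \<Otimes>\<^sub>M gauss))"
    by (subst nn_integral_distr) (auto simp: split_beta')
  also have "\<dots> = (\<integral>\<^sup>+x. \<integral>\<^sup>+y. indicator A (a *\<^sub>R x + b *\<^sub>R y) \<partial>gauss \<partial>gauss)"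
    by (subst gauss.nn_integral_fst[symmetric]) auto
  also have "\<dots> = (\<integral>\<^sup>+x. \<integral>\<^sup>+y. ?g x * (?g y * indicator A (a *\<^sub>R x + b *\<^sub>R y)) \<partial>lborel \<partial>lborel)"
    by (simp add: gauss_def nn_integral_density nn_integral_cmult)
  \<comment> \<open>The inner variable is replaced by the value \<open>s\<close> of the sum. After
    Fubini and the identity \<open>key\<close>, the factor containing \<open>x\<close> is a shifted
    and scaled Gaussian of mass 1.\<close>
  also have "\<dots> = (\<integral>\<^sup>+x. \<integral>\<^sup>+s. ?g x * (ennreal ((1/b) ^ DIM('a)) * (?g ((1/b) *\<^sub>R (s - a *\<^sub>R x)) * indicator A s)) \<partial>lborel \<partial>lborel)"
  proof (rule nn_integral_cong)
    fix x :: 'a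
    have e: "- (a / b) *\<^sub>R x + (1 / b) *\<^sub>R s = (1/b) *\<^sub>R (s - a *\<^sub>R x)" for s
      by (simp add: algebra_simps)
    have e2: "a *\<^sub>R x + b *\<^sub>R ((1/b) *\<^sub>R (s - a *\<^sub>R x)) = s" for s using b by simp
    have "(\<integral>\<^sup>+y. ?g x * (?g y * indicator A (a *\<^sub>R x + b *\<^sub>R y)) \<partial>lborel)
      = (\<integral>\<^sup>+s. ennreal ((1/b) ^ DIM('a)) * (?g x * (?g (- (a / b) *\<^sub>R x + (1 / b) *\<^sub>R s) * indicator A (a *\<^sub>R x + b *\<^sub>R (- (a / b) *\<^sub>R x + (1 / b) *\<^sub>R s)))) \<partial>lborel)"
      by (rule nn_integral_lborel_affine) (use b in auto)
    also have "\<dots> = (\<integral>\<^sup>+s. ?g x * (ennreal ((1/b) ^ DIM('a)) * (?g ((1/b) *\<^sub>R (s - a *\<^sub>R x)) * indicator A s)) \<partial>lborel)"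
      unfolding e e2 by (simp only: mult.left_commute)
    finally show "(\<integral>\<^sup>+y. ?g x * (?g y * indicator A (a *\<^sub>R x + b *\<^sub>R y)) \<partial>lborel)
      = (\<integral>\<^sup>+s. ?g x * (ennreal ((1/b) ^ DIM('a)) * (?g ((1/b) *\<^sub>R (s - a *\<^sub>R x)) * indicator A s)) \<partial>lborel)" .
  qed
  also have "\<dots> = (\<integral>\<^sup>+s. \<integral>\<^sup>+x. ?g x * (ennreal ((1/b) ^ DIM('a)) * (?g ((1/b) *\<^sub>R (s - a *\<^sub>R x)) * indicator A s)) \<partial>lborel \<partial>lborel)"
    by (rule lborel_pair.Fubini') measurable
  also have "\<dots> = (\<integral>\<^sup>+s. ?g s * indicator A s \<partial>lborel)"
  proof (rule nn_integral_cong)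
    fix s :: 'a
    have "?g x * (ennreal ((1/b) ^ DIM('a)) * (?g ((1/b) *\<^sub>R (s - a *\<^sub>R x)) * indicator A s))
        = (?g s * indicator A s) * (ennreal ((1/b) ^ DIM('a)) * ?g (- (a / b) *\<^sub>R s + (1 / b) *\<^sub>R x))" for x
    proof -
      have k: "?g x * ?g ((1/b) *\<^sub>R (s - a *\<^sub>R x)) = ?g s * ?g (- (a / b) *\<^sub>R s + (1 / b) *\<^sub>R x)"
        using key[of x s] by (simp add: ennreal_mult'[symmetric] gauss_density_pos less_imp_le)
      have "?g x * (ennreal ((1/b) ^ DIM('a)) * (?g ((1/b) *\<^sub>R (s - a *\<^sub>R x)) * indicator A s))
          = (?g x * ?g ((1/b) *\<^sub>R (s - a *\<^sub>R x))) * (ennreal ((1/b) ^ DIM('a)) * indicator A s)"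
        by (simp only: ac_simps)
      then show ?thesis unfolding k by (simp only: ac_simps)
    qed
    then have "(\<integral>\<^sup>+x. ?g x * (ennreal ((1/b) ^ DIM('a)) * (?g ((1/b) *\<^sub>R (s - a *\<^sub>R x)) * indicator A s)) \<partial>lborel)
        = (?g s * indicator A s) * (\<integral>\<^sup>+x. ennreal ((1/b) ^ DIM('a)) * ?g (- (a / b) *\<^sub>R s + (1 / b) *\<^sub>R x) \<partial>lborel)"
      by (simp add: nn_integral_cmult)
    also have "(\<integral>\<^sup>+x. ennreal ((1/b) ^ DIM('a)) * ?g (- (a / b) *\<^sub>R s + (1 / b) *\<^sub>R x) \<partial>lborel) = (\<integral>\<^sup>+x. ?g x \<partial>lborel)"
      by (rule nn_integral_lborel_affine[symmetric]) (use b in auto)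
    also have "\<dots> = 1"
      using gauss.emeasure_space_1[where 'a='a] by (simp add: gauss_def emeasure_density)
    finally show "(\<integral>\<^sup>+x. ?g x * (ennreal ((1/b) ^ DIM('a)) * (?g ((1/b) *\<^sub>R (s - a *\<^sub>R x)) * indicator A s)) \<partial>lborel) = ?g s * indicator A s" by simp
  qed
  also have "\<dots> = emeasure gauss A" by (simp add: gauss_def emeasure_density)
  finally show "emeasure (distr (gauss \<Otimes>\<^sub>M gauss) borel (\<lambda>(x, y). a *\<^sub>R x + b *\<^sub>R y)) A = emeasure gauss A" .
qed simp

section \<open>Entropy on step-two groups\<close>

text \<open>Both halves are elementary. From above, domination by \<open>C\<close> times Lebesgue
  measure bounds the density. From below, \<open>ln x \<le> x - 1\<close> applied to the ratio of
  the Gaussian density to \<open>p\<close> leaves that ratio, whose integral is at most 1, and the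
  quadratic Gaussian exponent, whose mean is finite by \<open>m\<close>.\<close>

lemma exists_log_integrable_density:
  fixes N :: "'a::euclidean_space measure"
  assumes prob: "prob_space N" and sets [measurable_cong]: "sets N = sets borel"
    and C: "C > 0" "\<And>A. A \<in> sets borel \<Longrightarrow> emeasure N A \<le> ennreal C * emeasure lborel A"
    and m: "integrable N (\<lambda>x. (norm x)\<^sup>2)"
  obtains p where "p \<in> borel_measurable borel" "\<And>x. 0 \<le> p x" "N = density lborel p"
    "integrable N (\<lambda>x. ln (p x))"
proof -
  interpret N: prob_space N by fact
  have ac: "absolutely_continuous lborel N"
    unfolding absolutely_continuous_def
  proof
    fix A :: "'a set" assume "A \<in> null_sets lborel"
    then have "A \<in> sets borel" "emeasure N A \<le> 0" using C(2)[of A] by (auto simp: null_sets_def)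
    then show "A \<in> null_sets N" by (auto simp: sets)
  qed
  obtain D where D0: "D \<in> borel_measurable lborel" and D1: "AE x in lborel. RN_deriv lborel N x = ennreal (D x)"
    and D2: "AE x in N. 0 < D x" and D3: "\<And>x. 0 \<le> D x"
    using sigma_finite_measure.real_RN_deriv[OF sigma_finite_lborel N.finite_measure_axioms ac] sets by auto
  have [measurable]: "D \<in> borel_measurable borel" using D0 by simp
  have "N = density lborel (RN_deriv lborel N)"
    by (rule sigma_finite_measure.density_RN_deriv[OF sigma_finite_lborel ac, symmetric]) (simp add: sets)
  also have "\<dots> = density lborel D"
    by (rule density_cong) (use D1 in auto)
  finally have N: "N = density lborel D" .
  \<comment> \<open>The measure of \<open>?A\<close> is at least \<open>C + 1\<close> and at most
    \<open>C\<close> times its volume; the gap of 1 forces the volume to vanish.\<close>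
  let ?A = "{x. D x > C + 1}"
  have "ennreal (C + 1) * emeasure lborel ?A \<le> emeasure N ?A"
  proof -
    have "ennreal (C + 1) * emeasure lborel ?A = (\<integral>\<^sup>+x. ennreal (C + 1) * indicator ?A x \<partial>lborel)"
      by (simp add: nn_integral_cmult)
    also have "\<dots> \<le> (\<integral>\<^sup>+x. D x * indicator ?A x \<partial>lborel)"
      by (intro nn_integral_mono) (auto simp: indicator_def intro!: ennreal_leI)
    also have "\<dots> = emeasure N ?A"
      unfolding N by (subst emeasure_density) (auto intro!: nn_integral_cong simp: indicator_def)
    finally show ?thesis .
  qed
  then have le: "ennreal (C + 1) * emeasure lborel ?A \<le> ennreal C * emeasure lborel ?A"
    using C(2)[of ?A] by auto
  have fin: "emeasure lborel ?A \<noteq> \<infinity>"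
  proof
    assume "emeasure lborel ?A = \<infinity>"
    with \<open>ennreal (C + 1) * emeasure lborel ?A \<le> emeasure N ?A\<close> C(1) show False
      by (simp add: ennreal_mult_top N.emeasure_eq_measure top_unique)
  qed
  then have "emeasure lborel ?A = 0"
  proof -
    obtain r where r: "emeasure lborel ?A = ennreal r" "0 \<le> r" using fin by (cases "emeasure lborel ?A") auto
    from le have "ennreal ((C + 1) * r) \<le> ennreal (C * r)"
      by (simp only: ennreal_mult'' r)
    then have "(C + 1) * r \<le> C * r" using C(1) r by (subst (asm) ennreal_le_iff) auto
    then have "r = 0" using r by (simp add: algebra_simps)
    then show ?thesis using r by simp
  qed
  then have "AE x in lborel. D x \<le> C + 1"
    by (subst AE_iff_measurable[OF _ refl]) (auto simp: not_le)
  then have upper: "AE x in N. D x \<le> C + 1"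
    unfolding N by (subst AE_density) auto
  let ?g = "gauss_density :: 'a \<Rightarrow> real"
  have gD: "integrable N (\<lambda>x. ?g x / D x)"
  proof (rule integrableI_nonneg)
    have "(\<integral>\<^sup>+x. ennreal (?g x / D x) \<partial>N) = (\<integral>\<^sup>+x. ennreal (D x) * ennreal (?g x / D x) \<partial>lborel)"
      unfolding N by (subst nn_integral_density) auto
    also have "\<dots> \<le> (\<integral>\<^sup>+x. ennreal (?g x) \<partial>lborel)"
      using D3 by (intro nn_integral_mono) (auto simp: ennreal_mult'[symmetric] gauss_density_pos less_imp_le intro!: ennreal_leI)
    also have "\<dots> < \<infinity>" using integrable_gauss_density[where 'a='a]
      by (subst nn_integral_eq_integral) (auto simp: gauss_density_pos less_imp_le)
    finally show "(\<integral>\<^sup>+x. ennreal (?g x / D x) \<partial>N) < \<infinity>" .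
  qed (auto simp: D3 gauss_density_pos less_imp_le)
  let ?c = "real DIM('a) * ln (sqrt (2 * pi))"
  have lg: "- ln (?g x) = ?c + (norm x)\<^sup>2 / 2" for x
    by (simp add: gauss_density_eq ln_mult ln_realpow ln_div)
  have c0: "0 \<le> ?c"
    using pi_gt3 by (intro mult_nonneg_nonneg ln_ge_zero real_le_rsqrt) auto
  have "integrable N (\<lambda>x. \<bar>ln (C + 1)\<bar> + ?g x / D x + (?c + (norm x)\<^sup>2 / 2))"
    using gD m by (intro Bochner_Integration.integrable_add integrable_divide_zero) auto
  then have "integrable N (\<lambda>x. ln (D x))"
  proof (rule Bochner_Integration.integrable_bound)
    show "AE x in N. norm (ln (D x)) \<le> norm (\<bar>ln (C + 1)\<bar> + ?g x / D x + (?c + (norm x)\<^sup>2 / 2))"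
      using upper D2
    proof eventually_elim
      case (elim x)
      have "ln (D x) \<le> ln (C + 1)" using elim by simp
      moreover have "ln (?g x / D x) \<le> ?g x / D x - 1"
        using elim by (intro ln_le_minus_one) (auto simp: gauss_density_pos)
      then have "- ln (D x) \<le> ?g x / D x - 1 + (?c + (norm x)\<^sup>2 / 2)"
        using elim gauss_density_pos[of x] lg[of x] by (simp add: ln_div)
      moreover have "0 \<le> ?g x / D x" using elim gauss_density_pos[of x] by simp
      moreover have "0 \<le> (norm x)\<^sup>2 / 2" by simp
      ultimately show ?case using c0 unfolding real_norm_def by linarith
    qed
  qed simp
  with that[of D] D3 N show ?thesis by simp
qed

lemma borel_measurable_fst_snd [measurable (raw)]:
  fixes f :: "'x \<Rightarrow> 'a::second_countable_topology \<times> 'b::second_countable_topology"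
  assumes "f \<in> borel_measurable M"
  shows "(\<lambda>x. fst (f x)) \<in> borel_measurable M" "(\<lambda>x. snd (f x)) \<in> borel_measurable M"
  using assms by (simp_all add: borel_prod[symmetric])

text \<open>\<open>alt\<close> makes \<open>- g\<close> the inverse of \<open>g\<close> and turns
  horizontal straight lines through 0 into one-parameter subgroups. The Lie bracket is twice
  \<open>beta\<close>.\<close>

locale step2_group = bounded_bilinear beta
  for beta :: "'b::euclidean_space \<Rightarrow> 'b \<Rightarrow> 'c::euclidean_space" +
  assumes alt: "beta u u = 0"
begin

definition gm :: "'b \<times> 'c \<Rightarrow> 'b \<times> 'c \<Rightarrow> 'b \<times> 'c" (infixl "\<odot>" 70) where
  "g \<odot> k = (fst g + fst k, snd g + snd k + beta (fst g) (fst k))"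

definition dil :: "real \<Rightarrow> 'b \<times> 'c \<Rightarrow> 'b \<times> 'c" where
  "dil r g = (r *\<^sub>R fst g, r\<^sup>2 *\<^sub>R snd g)"

text \<open>The homogeneous dimension: vertical directions count twice because \<open>dil\<close>
  gives them weight 2, and \<open>r powr hdim\<close> is the Jacobian of \<open>dil r\<close>. This
  is the origin of \<open>m + 2 d\<close> in the theorem.\<close>

definition hdim :: real where
  "hdim = real DIM('b) + 2 * real DIM('c)"

lemma anti: "beta u v = - beta v u"
proof -
  have "beta (u + v) (u + v) = beta u v + beta v u"
    by (simp add: add_left add_right alt del: alt) (simp add: alt)
  then show ?thesis by (simp add: alt eq_neg_iff_add_eq_0)
qed

lemma gm_assoc: "g \<odot> k \<odot> h = g \<odot> (k \<odot> h)"
  by (simp add: gm_def add_left add_right)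

lemma gm_0 [simp]: "g \<odot> 0 = g" "0 \<odot> g = g"
  by (simp_all add: gm_def zero_left zero_right prod_eq_iff)

lemma gm_minus [simp]: "g \<odot> (- g) = 0" "- g \<odot> g = 0"
  by (simp_all add: gm_def minus_left minus_right alt prod_eq_iff)

lemma fst_gm [simp]: "fst (g \<odot> k) = fst g + fst k"
  and fst_dil [simp]: "fst (dil r g) = r *\<^sub>R fst g"
  and snd_dil [simp]: "snd (dil r g) = r\<^sup>2 *\<^sub>R snd g"
  by (simp_all add: gm_def dil_def)

lemma dil_gm: "dil r (g \<odot> k) = dil r g \<odot> dil r k"
  by (simp add: gm_def dil_def scaleR_left scaleR_right power2_eq_square algebra_simps)

lemma dil_dil [simp]: "dil r (dil s g) = dil (r * s) g"
  by (simp add: dil_def power_mult_distrib)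

lemma dil_1 [simp]: "dil 1 g = g"
  by (simp add: dil_def)

lemma continuous_on_gm [continuous_intros]:
  "continuous_on S f \<Longrightarrow> continuous_on S h \<Longrightarrow> continuous_on S (\<lambda>x. f x \<odot> h x)"
  unfolding gm_def by (intro continuous_intros continuous_on)

lemma continuous_on_dil [continuous_intros]:
  "continuous_on S f \<Longrightarrow> continuous_on S r \<Longrightarrow> continuous_on S (\<lambda>x. dil (r x) (f x))"
  unfolding dil_def by (intro continuous_intros)

lemma borel_measurable_gm [measurable (raw)]:
  assumes [measurable]: "f \<in> borel_measurable M" "h \<in> borel_measurable M"
  shows "(\<lambda>x. f x \<odot> h x) \<in> borel_measurable M"
  by (rule borel_measurable_continuous_Pair[OF assms]) (rule continuous_on_gm[OF continuous_on_fst[OF continuous_on_id] continuous_on_snd[OF continuous_on_id]])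

lemma borel_measurable_dil [measurable (raw)]:
  assumes [measurable]: "f \<in> borel_measurable M"
  shows "(\<lambda>x. dil r (f x)) \<in> borel_measurable M"
  unfolding dil_def by measurable

text \<open>For a fixed horizontal coordinate the translation only shifts the vertical one, so it is
  a shear composed with a translation and preserves volume.\<close>

lemma nn_integral_gm_left:
  assumes [measurable]: "f \<in> borel_measurable borel"
  shows "(\<integral>\<^sup>+w. f (v \<odot> w) \<partial>lborel) = (\<integral>\<^sup>+w. f w \<partial>lborel)"
proof -
  have "(\<integral>\<^sup>+w. f (v \<odot> w) \<partial>lborel) = (\<integral>\<^sup>+b. \<integral>\<^sup>+y. f (v \<odot> (b, y)) \<partial>lborel \<partial>lborel)"
    unfolding lborel_prod[symmetric] by (rule lborel.nn_integral_fst[symmetric]) (simp add: lborel_prod)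
  also have "\<dots> = (\<integral>\<^sup>+b. \<integral>\<^sup>+y. f (fst v + b, y) \<partial>lborel \<partial>lborel)"
  proof (rule nn_integral_cong)
    fix b
    show "(\<integral>\<^sup>+y. f (v \<odot> (b, y)) \<partial>lborel) = (\<integral>\<^sup>+y. f (fst v + b, y) \<partial>lborel)"
      by (subst (2) nn_integral_lborel_affine[where c=1 and t="snd v + beta (fst v) b"])
         (auto simp: gm_def add_ac)
  qed
  also have "\<dots> = (\<integral>\<^sup>+b. \<integral>\<^sup>+y. f (b, y) \<partial>lborel \<partial>lborel)"
    by (subst (2) nn_integral_lborel_affine[where c=1 and t="fst v"]) auto
  also have "\<dots> = (\<integral>\<^sup>+w. f w \<partial>lborel)"
    unfolding lborel_prod[symmetric] by (rule lborel.nn_integral_fst) (simp add: lborel_prod)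
  finally show ?thesis .
qed

lemma nn_integral_dil:
  assumes [measurable]: "f \<in> borel_measurable borel" and r: "r > 0"
  shows "(\<integral>\<^sup>+w. f w \<partial>lborel) = (\<integral>\<^sup>+w. ennreal (r powr hdim) * f (dil r w) \<partial>lborel)"
proof -
  have "(\<integral>\<^sup>+w. f w \<partial>lborel) = (\<integral>\<^sup>+b. \<integral>\<^sup>+y. f (b, y) \<partial>lborel \<partial>lborel)"
    unfolding lborel_prod[symmetric] by (rule lborel.nn_integral_fst[symmetric]) (simp add: lborel_prod)
  also have "\<dots> = (\<integral>\<^sup>+b. ennreal (r ^ DIM('b)) * (\<integral>\<^sup>+y. f (r *\<^sub>R b, y) \<partial>lborel) \<partial>lborel)"
    using r by (subst nn_integral_lborel_affine[where c=r and t=0]) auto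
  also have "\<dots> = (\<integral>\<^sup>+b. ennreal (r ^ DIM('b)) * (\<integral>\<^sup>+y. ennreal ((r\<^sup>2) ^ DIM('c)) * f (dil r (b, y)) \<partial>lborel) \<partial>lborel)"
    by (rule nn_integral_cong, subst nn_integral_lborel_affine[where c="r\<^sup>2" and t=0]) (use r in \<open>auto simp: dil_def\<close>)
  also have "\<dots> = (\<integral>\<^sup>+b. \<integral>\<^sup>+y. ennreal (r powr hdim) * f (dil r (b, y)) \<partial>lborel \<partial>lborel)"
  proof -
    have "r ^ DIM('b) * (r\<^sup>2) ^ DIM('c) = r powr hdim"
    proof -
      have "r powr hdim = r powr real (DIM('b) + 2 * DIM('c))" by (simp add: hdim_def)
      also have "\<dots> = r ^ (DIM('b) + 2 * DIM('c))" by (rule powr_realpow[OF r])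
      finally show ?thesis by (simp add: power_add power_mult)
    qed
    then have "ennreal (r ^ DIM('b)) * ennreal ((r\<^sup>2) ^ DIM('c)) = ennreal (r powr hdim)"
      using r by (simp add: ennreal_mult'[symmetric])
    then show ?thesis by (simp add: nn_integral_cmult mult.assoc[symmetric])
  qed
  also have "\<dots> = (\<integral>\<^sup>+w. ennreal (r powr hdim) * f (dil r w) \<partial>lborel)"
    unfolding lborel_prod[symmetric] by (rule lborel.nn_integral_fst) (simp add: lborel_prod)
  finally show ?thesis .
qed

text \<open>The Donsker--Varadhan lower bound for the mutual information of \<open>v\<close> and \<open>v \<odot> w\<close>. This
  information is the entropy difference of \<open>v \<odot> w\<close> and \<open>w\<close>, that is \<open>hdim * ln b\<close>, since left
  translations preserve Lebesgue measure.\<close>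
lemma entropy_inequality:
  fixes p :: "'b \<times> 'c \<Rightarrow> real" and T :: "'b \<times> 'c \<Rightarrow> 'b \<times> 'c \<Rightarrow> real"
  assumes p [measurable]: "p \<in> borel_measurable borel" and p0: "\<And>x. 0 \<le> p x"
    and K: "K = density lborel p" "prob_space K" and lnp: "integrable K (\<lambda>w. ln (p w))"
    and L: "prob_space L" and setsL [measurable_cong]: "sets L = sets borel" and b: "b > 0"
    and law: "distr (L \<Otimes>\<^sub>M K) borel (\<lambda>(v, w). v \<odot> w) = distr K borel (dil b)"
    and T [measurable]: "(\<lambda>(s, v). T s v) \<in> borel_measurable (borel \<Otimes>\<^sub>M borel)"
    and TC: "\<And>s v. \<bar>T s v\<bar> \<le> C"
  shows "(\<integral>(v, w). T (v \<odot> w) v \<partial>(L \<Otimes>\<^sub>M K)) \<le> (\<integral>(v, w). exp (T (dil b w) v) - 1 \<partial>(L \<Otimes>\<^sub>M K)) + hdim * ln b"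
proof -
  interpret K: prob_space K by fact
  interpret L: prob_space L by fact
  interpret LK: pair_prob_space L K ..
  have setsK [measurable_cong]: "sets K = sets borel" by (simp add: K)
  \<comment> \<open>The density of the law of \<open>dil b w\<close>, which by \<open>law\<close> is
    also the law of \<open>v \<odot> w\<close>.\<close>
  define p' where "p' s = b powr (- hdim) * p (dil (1 / b) s)" for s
  have [measurable]: "p' \<in> borel_measurable borel" unfolding p'_def by measurable
  have p'0: "0 \<le> p' s" for s by (simp add: p'_def p0)
  have Tm [measurable]: "(\<lambda>x. T (f x) (g x)) \<in> borel_measurable N"
    if [measurable]: "f \<in> borel_measurable N" "g \<in> borel_measurable N" for f g and N :: "'z measure"
    using measurable_compose[OF measurable_Pair[OF that] T] by simp
  have ppos: "AE w in K. p w > 0"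
    unfolding K using p0 by (subst AE_density) (auto simp: less_le)
  have dd: "dil (1 / b) (dil b w) = w" "dil b (dil (1 / b) w) = w" for w using b by auto
  have p'dil: "p' (dil b w) = b powr (- hdim) * p w" for w by (simp add: p'_def dd)
  have lnp': "integrable (L \<Otimes>\<^sub>M K) (\<lambda>(v, w). ln (p' (v \<odot> w)))"
    "(\<integral>(v, w). ln (p' (v \<odot> w)) \<partial>(L \<Otimes>\<^sub>M K)) = (\<integral>w. ln (p w) \<partial>K) - hdim * ln b"
    "AE (v, w) in L \<Otimes>\<^sub>M K. p' (v \<odot> w) > 0"
  proof -
    have ae: "AE w in K. ln (p' (dil b w)) = ln (p w) - hdim * ln b"
      using ppos by eventually_elim (use b in \<open>simp add: p'dil ln_mult ln_powr\<close>)
    have i: "integrable K (\<lambda>w. ln (p' (dil b w)))"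
      using lnp by (subst integrable_cong_AE[OF _ _ ae]) auto
    have id: "integrable (distr K borel (dil b)) (\<lambda>s. ln (p' s))"
      using i by (subst integrable_distr_eq) auto
    from id show "integrable (L \<Otimes>\<^sub>M K) (\<lambda>(v, w). ln (p' (v \<odot> w)))"
      unfolding law[symmetric] by (subst (asm) integrable_distr_eq) (auto simp: split_beta')
    have "(\<integral>(v, w). ln (p' (v \<odot> w)) \<partial>(L \<Otimes>\<^sub>M K)) = (\<integral>s. ln (p' s) \<partial>distr (L \<Otimes>\<^sub>M K) borel (\<lambda>(v, w). v \<odot> w))"
      by (subst integral_distr) (auto simp: split_beta')
    also have "\<dots> = (\<integral>w. ln (p' (dil b w)) \<partial>K)"
      unfolding law by (subst integral_distr) auto
    also have "\<dots> = (\<integral>w. ln (p w) - hdim * ln b \<partial>K)"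
      using ae by (intro integral_cong_AE) auto
    finally show "(\<integral>(v, w). ln (p' (v \<odot> w)) \<partial>(L \<Otimes>\<^sub>M K)) = (\<integral>w. ln (p w) \<partial>K) - hdim * ln b"
      using lnp by (simp add: K.prob_space)
    have "AE s in distr K borel (dil b). p' s > 0"
      using ppos b by (subst AE_distr_iff) (auto simp: p'dil)
    then show "AE (v, w) in L \<Otimes>\<^sub>M K. p' (v \<odot> w) > 0"
      unfolding law[symmetric] by (subst (asm) AE_distr_iff) (auto simp: split_beta')
  qed
  have ppos2: "AE (v, w) in L \<Otimes>\<^sub>M K. p w > 0"
  proof -
    have "AE x in L \<Otimes>\<^sub>M K. p (snd x) > 0"
      by (rule LK.AE_pair_measure) (use ppos in auto)
    then show ?thesis by (simp add: split_beta')
  qed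
  have lnp2: "integrable (L \<Otimes>\<^sub>M K) (\<lambda>(v, w). ln (p w))" "(\<integral>(v, w). ln (p w) \<partial>(L \<Otimes>\<^sub>M K)) = (\<integral>w. ln (p w) \<partial>K)"
  proof -
    show "integrable (L \<Otimes>\<^sub>M K) (\<lambda>(v, w). ln (p w))"
      using lnp by (intro LK.Fubini_integrable) (auto simp: split_beta')
    then show "(\<integral>(v, w). ln (p w) \<partial>(L \<Otimes>\<^sub>M K)) = (\<integral>w. ln (p w) \<partial>K)"
      by (subst LK.integral_fst'[symmetric]) (auto simp: split_beta' L.prob_space)
  qed
  \<comment> \<open>The exponential of the test times the likelihood ratio of the product of the
    marginals against the joint law of \<open>(v, v \<odot> w)\<close>: by left invariance, given
    \<open>v\<close>, the density of \<open>v \<odot> w\<close> at that point is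
    \<open>p w\<close>.\<close>
  define E where "E = (\<lambda>(v, w). exp (T (v \<odot> w) v) * p' (v \<odot> w) / p w)"
  have E0: "0 \<le> E x" for x by (auto simp: E_def split_beta' p0 p'0)
  have [measurable]: "E \<in> borel_measurable (L \<Otimes>\<^sub>M K)" unfolding E_def by measurable
  have bC: "\<bar>exp (T s v)\<bar> \<le> exp C" for s v using TC[of s v] by auto
  have iexp: "integrable (L \<Otimes>\<^sub>M K) (\<lambda>(v, w). exp (T (dil b w) v))"
    by (rule LK.integrable_const_bound[where B="exp C"]) (use bC in \<open>auto simp: split_beta'\<close>)
  have iT: "integrable (L \<Otimes>\<^sub>M K) (\<lambda>(v, w). T (v \<odot> w) v)"
    by (rule LK.integrable_const_bound[where B=C]) (use TC in \<open>auto simp: split_beta'\<close>)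
  \<comment> \<open>An inequality only, since the zero set of \<open>p\<close> drops out on the
    left.\<close>
  have nnE: "(\<integral>\<^sup>+x. E x \<partial>(L \<Otimes>\<^sub>M K)) \<le> (\<integral>\<^sup>+x. ennreal (case x of (v, w) \<Rightarrow> exp (T (dil b w) v)) \<partial>(L \<Otimes>\<^sub>M K))"
  proof -
    have "(\<integral>\<^sup>+x. E x \<partial>(L \<Otimes>\<^sub>M K)) = (\<integral>\<^sup>+v. \<integral>\<^sup>+w. E (v, w) \<partial>K \<partial>L)"
      by (subst K.nn_integral_fst[symmetric]) auto
    also have "\<dots> \<le> (\<integral>\<^sup>+v. \<integral>\<^sup>+w. exp (T (dil b w) v) \<partial>K \<partial>L)"
    proof (rule nn_integral_mono)
      fix v
      have "(\<integral>\<^sup>+w. E (v, w) \<partial>K) = (\<integral>\<^sup>+w. ennreal (p w) * ennreal (E (v, w)) \<partial>lborel)"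
        unfolding K by (subst nn_integral_density) (auto simp: E_def)
      also have "\<dots> \<le> (\<integral>\<^sup>+w. ennreal (exp (T (v \<odot> w) v) * p' (v \<odot> w)) \<partial>lborel)"
        using p0 p'0 by (intro nn_integral_mono) (auto simp: E_def ennreal_mult'[symmetric] intro!: ennreal_leI)
      also have "\<dots> = (\<integral>\<^sup>+s. ennreal (exp (T s v) * p' s) \<partial>lborel)"
        by (rule nn_integral_gm_left) measurable
      also have "\<dots> = (\<integral>\<^sup>+w. ennreal (b powr hdim) * ennreal (exp (T (dil b w) v) * p' (dil b w)) \<partial>lborel)"
        by (rule nn_integral_dil) (use b in auto)
      also have "\<dots> = (\<integral>\<^sup>+w. ennreal (p w) * ennreal (exp (T (dil b w) v)) \<partial>lborel)"
        using b p0 by (intro nn_integral_cong) (simp add: p'dil ennreal_mult'[symmetric] powr_minus field_simps)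
      also have "\<dots> = (\<integral>\<^sup>+w. exp (T (dil b w) v) \<partial>K)"
        unfolding K by (subst nn_integral_density) auto
      finally show "(\<integral>\<^sup>+w. E (v, w) \<partial>K) \<le> (\<integral>\<^sup>+w. exp (T (dil b w) v) \<partial>K)" .
    qed
    also have "\<dots> = (\<integral>\<^sup>+x. ennreal (case x of (v, w) \<Rightarrow> exp (T (dil b w) v)) \<partial>(L \<Otimes>\<^sub>M K))"
      by (subst K.nn_integral_fst[symmetric]) auto
    finally show ?thesis .
  qed
  have fin: "(\<integral>\<^sup>+x. ennreal (case x of (v, w) \<Rightarrow> exp (T (dil b w) v)) \<partial>(L \<Otimes>\<^sub>M K)) = ennreal (\<integral>(v, w). exp (T (dil b w) v) \<partial>(L \<Otimes>\<^sub>M K))"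
    using iexp by (intro nn_integral_eq_integral) (auto simp: split_beta')
  have iE: "integrable (L \<Otimes>\<^sub>M K) E"
    by (rule integrableI_nonneg) (use nnE fin E0 in \<open>auto simp: le_less_trans[OF _ ennreal_less_top]\<close>)
  have IE: "(\<integral>x. E x \<partial>(L \<Otimes>\<^sub>M K)) \<le> (\<integral>(v, w). exp (T (dil b w) v) \<partial>(L \<Otimes>\<^sub>M K))"
    using nnE unfolding fin
    by (subst (asm) nn_integral_eq_integral[OF iE]) (auto simp: E0 split_beta' intro!: integral_nonneg)
  \<comment> \<open>Integrates \<open>ln E \<le> E - 1\<close>; the logarithm of \<open>E\<close>
    splits into the test and the two entropy integrands.\<close>
  have "(\<integral>x. (case x of (v, w) \<Rightarrow> T (v \<odot> w) v) + (case x of (v, w) \<Rightarrow> ln (p' (v \<odot> w))) - (case x of (v, w) \<Rightarrow> ln (p w)) \<partial>(L \<Otimes>\<^sub>M K))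
      \<le> (\<integral>x. E x - 1 \<partial>(L \<Otimes>\<^sub>M K))"
  proof (rule integral_mono_AE)
    show "AE x in L \<Otimes>\<^sub>M K. (case x of (v, w) \<Rightarrow> T (v \<odot> w) v) + (case x of (v, w) \<Rightarrow> ln (p' (v \<odot> w))) - (case x of (v, w) \<Rightarrow> ln (p w)) \<le> E x - 1"
      using ppos2 lnp'(3)
    proof eventually_elim
      case (elim x)
      obtain v w where x: "x = (v, w)" by (cases x)
      have "ln (E x) \<le> E x - 1" using elim by (intro ln_le_minus_one) (auto simp: x E_def)
      then show ?case using elim by (simp add: x E_def ln_div ln_mult)
    qed
  qed (use iT lnp' lnp2 iE in auto)
  then show ?thesis using iT lnp' lnp2 iE IE iexp
    by (simp add: LK.prob_space split_beta')
qed

end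

section \<open>Taylor expansions and mollification\<close>

lemma bounded_support_integral:
  fixes f :: "'a::euclidean_space \<Rightarrow> real"
  assumes [measurable]: "f \<in> borel_measurable borel"
    and B: "\<And>x. \<bar>f x\<bar> \<le> B" and R: "\<And>x. norm x > R \<Longrightarrow> f x = 0"
  shows "integrable lborel f" "\<bar>\<integral>x. f x \<partial>lborel\<bar> \<le> B * measure lborel (cball (0::'a) R)"
proof -
  have le: "norm (f x) \<le> norm (B * indicator (cball 0 R) x)" for x
    using B[of x] R[of x] by (auto simp: indicator_def dist_norm)
  have c: "compact (cball (0::'a) R)" by simp
  have i: "integrable lborel (\<lambda>x. B * indicator (cball (0::'a) R) x :: real)"
    using emeasure_compact_finite[OF c] by (intro integrable_mult_right integrable_real_indicator) (auto simp: less_top)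
  show fi: "integrable lborel f"
    by (rule Bochner_Integration.integrable_bound[OF i]) (use le in auto)
  have "\<bar>\<integral>x. f x \<partial>lborel\<bar> \<le> (\<integral>x. \<bar>f x\<bar> \<partial>lborel)" by (rule integral_abs_bound)
  also have "\<dots> \<le> (\<integral>x. B * indicator (cball (0::'a) R) x \<partial>lborel)"
  proof (rule integral_mono)
    show "\<bar>f x\<bar> \<le> B * indicator (cball 0 R) x" for x
      using B[of x] R[of x] by (auto simp: indicator_def dist_norm)
  qed (use fi i in auto)
  finally show "\<bar>\<integral>x. f x \<partial>lborel\<bar> \<le> B * measure lborel (cball (0::'a) R)" by simp
qed

text \<open>The squared positive part has a Lipschitz derivative, so its remainder is bounded by the
  square of the step. This is the smoothness on which the mollifier is built.\<close>

lemma positive_part_square_taylor: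
  fixes s d :: real
  shows "\<bar>(max 0 (s + d))\<^sup>2 - (max 0 s)\<^sup>2 - 2 * max 0 s * d\<bar> \<le> d\<^sup>2"
proof -
  consider "s \<ge> 0" "s + d \<ge> 0" | "s \<ge> 0" "s + d < 0" | "s < 0" "s + d \<ge> 0" | "s < 0" "s + d < 0" by linarith
  then show ?thesis
  proof cases
    case 1
    then show ?thesis by (simp add: max_def power2_eq_square algebra_simps)
  next
    case 2
    have "- (s\<^sup>2) - 2 * s * d = d\<^sup>2 - (s + d)\<^sup>2" by (simp add: power2_eq_square algebra_simps)
    moreover have "(s + d)\<^sup>2 \<le> d\<^sup>2" using 2 by (intro abs_le_square_iff[THEN iffD1]) linarith
    moreover have "0 \<le> (s + d)\<^sup>2" by simp
    ultimately show ?thesis using 2 by (simp add: max_def)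
  next
    case 3
    have "(s + d)\<^sup>2 \<le> d\<^sup>2" using 3 by (intro abs_le_square_iff[THEN iffD1]) linarith
    with 3 show ?thesis by (simp add: max_def)
  next
    case 4
    then show ?thesis by (simp add: max_def)
  qed
qed

context step2_group
begin

lemma distr_gm_left: "distr lborel borel (\<lambda>w. v \<odot> w) = (lborel :: ('b \<times> 'c) measure)"
proof (rule measure_eqI)
  fix A assume "A \<in> sets (distr lborel borel (\<lambda>w. v \<odot> w))"
  then have [measurable]: "A \<in> sets borel" by simp
  have "emeasure (distr lborel borel (\<lambda>w. v \<odot> w)) A = (\<integral>\<^sup>+w. indicator A w \<partial>distr lborel borel (\<lambda>w. v \<odot> w))"
    by simp
  also have "\<dots> = (\<integral>\<^sup>+w. indicator A (v \<odot> w) \<partial>lborel)"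
    by (rule nn_integral_distr) auto
  also have "\<dots> = emeasure lborel A" by (subst nn_integral_gm_left) auto
  finally show "emeasure (distr lborel borel (\<lambda>w. v \<odot> w)) A = emeasure lborel A" .
qed simp

lemma integral_gm_left:
  fixes f :: "'b \<times> 'c \<Rightarrow> real"
  assumes [measurable]: "f \<in> borel_measurable borel"
  shows "(\<integral>w. f (v \<odot> w) \<partial>lborel) = (\<integral>w. f w \<partial>lborel)"
  by (subst (2) distr_gm_left[symmetric, of v], subst integral_distr) auto

text \<open>\<open>D g\<close> is the differential in left-invariant coordinates. The quadratic
  remainder is required for all \<open>k\<close>, not just small ones, so that it can be integrated
  against any law with a second moment.\<close>

definition taylor :: "('b \<times> 'c \<Rightarrow> real) \<Rightarrow> ('b \<times> 'c \<Rightarrow> 'b \<times> 'c) \<Rightarrow> real \<Rightarrow> bool" where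
  "taylor F D C \<longleftrightarrow> (\<forall>g k. \<bar>F (g \<odot> k) - F g - D g \<bullet> k\<bar> \<le> C * (norm k)\<^sup>2)"

lemma taylorD: "taylor F D C \<Longrightarrow> \<bar>F (g \<odot> k) - F g - D g \<bullet> k\<bar> \<le> C * (norm k)\<^sup>2"
  unfolding taylor_def by blast

text \<open>Testing with the unit vector along \<open>D g\<close> bounds the derivative. For steps
  longer than 1, boundedness of \<open>F\<close> and \<open>D\<close> gives at most a constant plus
  a linear term, and both are dominated by the square.\<close>

lemma taylor_local:
  assumes M: "\<And>g. \<bar>F g\<bar> \<le> M"
    and loc: "\<And>g k. norm k \<le> 1 \<Longrightarrow> \<bar>F (g \<odot> k) - F g - D g \<bullet> k\<bar> \<le> C * (norm k)\<^sup>2"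
  shows "norm (D g) \<le> 2 * M + C" "taylor F D (4 * M + C)"
proof -
  have M0: "0 \<le> M" using M[of 0] by linarith
  have C0: "0 \<le> C"
  proof -
    obtain k :: "'b \<times> 'c" where k: "norm k = 1" by (rule vector_choose_size[OF zero_le_one])
    then show ?thesis using loc[of k 0] by auto
  qed
  show D: "norm (D g) \<le> 2 * M + C" for g
  proof (cases "D g = 0")
    case False
    let ?k = "D g /\<^sub>R norm (D g)"
    have "D g \<bullet> ?k = norm (D g)" using False by (simp add: power2_norm_eq_inner[symmetric] power2_eq_square)
    moreover have "norm ?k = 1" using False by simp
    ultimately show ?thesis using loc[of ?k g] M[of g] M[of "g \<odot> ?k"] by auto
  qed (use M0 C0 in simp)
  show "taylor F D (4 * M + C)"
    unfolding taylor_def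
  proof (intro allI)
    fix g k
    show "\<bar>F (g \<odot> k) - F g - D g \<bullet> k\<bar> \<le> (4 * M + C) * (norm k)\<^sup>2"
    proof (cases "norm k \<le> 1")
      case True
      have "C * (norm k)\<^sup>2 \<le> (4 * M + C) * (norm k)\<^sup>2" using M0 by (intro mult_right_mono) auto
      then show ?thesis using loc[OF True, of g] by linarith
    next
      case False
      have "\<bar>D g \<bullet> k\<bar> \<le> norm (D g) * norm k" by (rule Cauchy_Schwarz_ineq2)
      also have "\<dots> \<le> (2 * M + C) * norm k" using D[of g] by (intro mult_right_mono) auto
      finally have "\<bar>F (g \<odot> k) - F g - D g \<bullet> k\<bar> \<le> 2 * M + (2 * M + C) * norm k"
        using M[of g] M[of "g \<odot> k"] by linarith
      also have "\<dots> \<le> 2 * M * (norm k)\<^sup>2 + (2 * M + C) * (norm k)\<^sup>2"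
      proof (intro add_mono mult_left_mono)
        show "2 * M \<le> 2 * M * (norm k)\<^sup>2" using False M0 mult_left_mono[of 1 "(norm k)\<^sup>2" "2 * M"] by (simp add: one_le_power)
        show "norm k \<le> (norm k)\<^sup>2" by (rule self_le_power) (use False in auto)
      qed (use M0 C0 in auto)
      finally show ?thesis by (simp add: algebra_simps)
    qed
  qed
qed

lemma taylor_derivative_measurable:
  assumes [measurable]: "F \<in> borel_measurable borel" and t: "taylor F D C"
  shows "D \<in> borel_measurable borel"
proof (subst borel_measurable_euclidean_space, rule ballI)
  fix e :: "'b \<times> 'c" assume e: "e \<in> Basis"
  show "(\<lambda>g. D g \<bullet> e) \<in> borel_measurable borel"
  proof (rule borel_measurable_LIMSEQ_real)
    show "(\<lambda>g. real (Suc n) * (F (g \<odot> (e /\<^sub>R real (Suc n))) - F g)) \<in> borel_measurable borel" for n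
      by measurable
    fix g
    have "\<bar>real (Suc n) * (F (g \<odot> (e /\<^sub>R real (Suc n))) - F g) - D g \<bullet> e\<bar> \<le> C * (1 / real (Suc n))" for n
    proof -
      let ?N = "real (Suc n)"
      have N: "?N > 0" by simp
      have "\<bar>?N * (F (g \<odot> (e /\<^sub>R ?N)) - F g) - D g \<bullet> e\<bar> = ?N * \<bar>F (g \<odot> (e /\<^sub>R ?N)) - F g - D g \<bullet> (e /\<^sub>R ?N)\<bar>"
      proof -
        have "?N * (F (g \<odot> (e /\<^sub>R ?N)) - F g) - D g \<bullet> e = ?N * (F (g \<odot> (e /\<^sub>R ?N)) - F g - D g \<bullet> (e /\<^sub>R ?N))"
          using N by (simp add: right_diff_distrib del: of_nat_Suc)
        then show ?thesis using N by (simp only: abs_mult abs_of_pos)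
      qed
      also have "\<dots> \<le> ?N * (C * (norm (e /\<^sub>R ?N))\<^sup>2)"
        by (intro mult_left_mono taylorD[OF t]) auto
      also have "\<dots> = C * (1 / ?N)" using e N by (simp add: power2_eq_square field_simps del: of_nat_Suc)
      finally show ?thesis .
    qed
    then have "\<forall>\<^sub>F n in sequentially. norm (real (Suc n) * (F (g \<odot> (e /\<^sub>R real (Suc n))) - F g) - D g \<bullet> e) \<le> C * (1 / real (Suc n))"
      by (intro always_eventually) auto
    moreover have "(\<lambda>n. C * (1 / real (Suc n))) \<longlonglongrightarrow> 0"
      by (intro tendsto_mult_right_zero LIMSEQ_Suc lim_1_over_n)
    ultimately have "(\<lambda>n. real (Suc n) * (F (g \<odot> (e /\<^sub>R real (Suc n))) - F g) - D g \<bullet> e) \<longlonglongrightarrow> 0"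
      by (rule Lim_null_comparison)
    then show "(\<lambda>n. real (Suc n) * (F (g \<odot> (e /\<^sub>R real (Suc n))) - F g)) \<longlonglongrightarrow> D g \<bullet> e"
      by (simp add: LIM_zero_iff)
  qed
qed

definition avg :: "('b \<times> 'c) measure \<Rightarrow> ('b \<times> 'c \<Rightarrow> real) \<Rightarrow> 'b \<times> 'c \<Rightarrow> real" where
  "avg N F g = (\<integral>w. F (g \<odot> w) \<partial>N)"

text \<open>The inner automorphism that conjugates \<open>k\<close> by \<open>w\<close>; it moves an
  increment of the base point past a random factor. In a step-two group it is linear in
  \<open>k\<close> and grows only linearly in \<open>w\<close>.\<close>

definition conj_by :: "'b \<times> 'c \<Rightarrow> 'b \<times> 'c \<Rightarrow> 'b \<times> 'c" where
  "conj_by w k = (fst k, snd k + 2 *\<^sub>R beta (fst k) (fst w))"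

lemma conj_by: "k \<odot> w = w \<odot> conj_by w k"
  using anti[of "fst k" "fst w"] by (simp add: gm_def conj_by_def scaleR_2)

lemma linear_conj_by: "linear (conj_by w)"
  by (rule linearI) (simp_all add: conj_by_def add_left scaleR_left algebra_simps)

lemma norm_conj_by:
  obtains K where "K \<ge> 0" "\<And>w k. norm (conj_by w k) \<le> norm k * (1 + K * norm w)"
proof -
  obtain K where K: "K > 0" "\<And>a b. norm (beta a b) \<le> norm a * norm b * K" using pos_bounded by blast
  show ?thesis
  proof (rule that[of "2 * K"])
    fix w k :: "'b \<times> 'c"
    have "conj_by w k = k + (0, 2 *\<^sub>R beta (fst k) (fst w))" by (simp add: conj_by_def prod_eq_iff)
    then have "norm (conj_by w k) \<le> norm k + norm (0::'b, 2 *\<^sub>R beta (fst k) (fst w))"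
      by (simp only: norm_triangle_ineq)
    also have "norm (0::'b, 2 *\<^sub>R beta (fst k) (fst w)) = 2 * norm (beta (fst k) (fst w))" by (simp add: norm_Pair real_sqrt_mult)
    also have "\<dots> \<le> 2 * (norm (fst k) * norm (fst w) * K)" using K(2)[of "fst k" "fst w"] by simp
    also have "\<dots> \<le> 2 * (norm k * norm w * K)"
      using K(1) norm_fst_le[of "fst k" "snd k"] norm_fst_le[of "fst w" "snd w"] by (intro mult_left_mono mult_right_mono mult_mono) auto
    finally show "norm (conj_by w k) \<le> norm k * (1 + 2 * K * norm w)" by (simp add: algebra_simps)
  qed (use K in auto)
qed

text \<open>Represents an integrated linear functional by a vector; this is how derivatives are
  pulled out of averages.\<close>

lemma inner_of_linear_integral:
  fixes l :: "'x \<Rightarrow> 'b \<times> 'c \<Rightarrow> real"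
  assumes i: "\<And>e. e \<in> Basis \<Longrightarrow> integrable N (\<lambda>w. l w e)" and lin: "\<And>w. linear (l w)"
  shows "(\<Sum>e\<in>Basis. (\<integral>w. l w e \<partial>N) *\<^sub>R e) \<bullet> k = (\<integral>w. l w k \<partial>N)" "integrable N (\<lambda>w. l w k)"
proof -
  have eq: "l w k = (\<Sum>e\<in>Basis. (k \<bullet> e) * l w e)" for w
  proof -
    have "l w k = l w (\<Sum>e\<in>Basis. (k \<bullet> e) *\<^sub>R e)" by (simp only: euclidean_representation)
    also have "\<dots> = (\<Sum>e\<in>Basis. (k \<bullet> e) * l w e)"
      using lin[of w] by (simp add: linear_sum linear_cmul)
    finally show ?thesis .
  qed
  show "integrable N (\<lambda>w. l w k)" unfolding eq using i by auto
  have "(\<integral>w. l w k \<partial>N) = (\<Sum>e\<in>Basis. (k \<bullet> e) * (\<integral>w. l w e \<partial>N))"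
    unfolding eq using i by (subst Bochner_Integration.integral_sum) auto
  then show "(\<Sum>e\<in>Basis. (\<integral>w. l w e \<partial>N) *\<^sub>R e) \<bullet> k = (\<integral>w. l w k \<partial>N)"
    by (simp add: inner_sum_left inner_commute[of k] mult.commute)
qed

lemma avg_measurable [measurable]:
  assumes [measurable]: "F \<in> borel_measurable borel" and "prob_space N" and [measurable_cong]: "sets N = sets borel"
  shows "avg N F \<in> borel_measurable borel"
proof -
  interpret prob_space N by fact
  have "(\<lambda>g. \<integral>w. F (g \<odot> w) \<partial>N) \<in> borel_measurable borel" by measurable
  then show ?thesis by (simp add: avg_def[abs_def])
qed

lemma avg_bound:
  assumes [measurable]: "F \<in> borel_measurable borel" and M: "\<And>g. \<bar>F g\<bar> \<le> M" and "prob_space N" and [measurable_cong]: "sets N = sets borel"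
  shows "\<bar>avg N F g\<bar> \<le> M" "integrable N (\<lambda>w. F (g \<odot> w))"
proof -
  interpret prob_space N by fact
  show i: "integrable N (\<lambda>w. F (g \<odot> w))"
    by (rule integrable_const_bound[where B=M]) (use M in auto)
  have "\<bar>avg N F g\<bar> \<le> (\<integral>w. \<bar>F (g \<odot> w)\<bar> \<partial>N)" unfolding avg_def by (rule integral_abs_bound)
  also have "\<dots> \<le> (\<integral>w. M \<partial>N)" by (rule integral_mono) (use i M in auto)
  finally show "\<bar>avg N F g\<bar> \<le> M" by (simp add: prob_space)
qed

text \<open>An increment \<open>k\<close> before the random factor \<open>w\<close> equals the
  increment \<open>conj_by w k\<close> after it. The expansion at \<open>g \<odot> w\<close> then
  applies, and its error grows like the square of the norm of \<open>w\<close>, which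
  \<open>m\<close> makes integrable.\<close>

lemma taylor_avg:
  assumes F [measurable]: "F \<in> borel_measurable borel" and M: "\<And>g. \<bar>F g\<bar> \<le> M" and t: "taylor F D C"
    and N: "prob_space N" and sN [measurable_cong]: "sets N = sets borel" and m: "integrable N (\<lambda>w. (norm w)\<^sup>2)"
  obtains D' C' where "taylor (avg N F) D' C'"
proof -
  interpret prob_space N by fact
  obtain K where K: "K \<ge> 0" "\<And>w k. norm (conj_by w k) \<le> norm k * (1 + K * norm w)"
    using norm_conj_by by blast
  have C0: "0 \<le> C"
  proof -
    obtain k :: "'b \<times> 'c" where k: "norm k = 1" by (rule vector_choose_size[OF zero_le_one])
    then show ?thesis using taylorD[OF t, of 0 k] by auto
  qed
  have Dm [measurable]: "D \<in> borel_measurable borel" by (rule taylor_derivative_measurable[OF F t])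
  have D: "norm (D g) \<le> 2 * M + C" for g
    by (rule taylor_local(1)[where F=F, OF M taylorD[OF t]])
  have MC: "0 \<le> 2 * M + C" using D[of 0] norm_ge_zero order_trans by blast
  have cjm [measurable]: "(\<lambda>w. conj_by w k) \<in> borel_measurable borel" for k
    unfolding conj_by_def by (intro borel_measurable_continuous_onI continuous_intros continuous_on)
  have sq: "(norm (conj_by w k))\<^sup>2 \<le> (norm k)\<^sup>2 * (2 + 2 * K\<^sup>2 * (norm w)\<^sup>2)" for w k
  proof -
    have "(norm (conj_by w k))\<^sup>2 \<le> (norm k * (1 + K * norm w))\<^sup>2" using K(2) by (intro power_mono) auto
    also have "\<dots> = (norm k)\<^sup>2 * (1 + K * norm w)\<^sup>2" by (simp add: power_mult_distrib)
    also have "(1 + K * norm w)\<^sup>2 \<le> 2 + 2 * K\<^sup>2 * (norm w)\<^sup>2"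
      using zero_le_power2[of "1 - K * norm w"] by (simp add: power2_eq_square algebra_simps)
    then have "(norm k)\<^sup>2 * (1 + K * norm w)\<^sup>2 \<le> (norm k)\<^sup>2 * (2 + 2 * K\<^sup>2 * (norm w)\<^sup>2)" by (intro mult_left_mono) auto
    finally show ?thesis .
  qed
  have i: "integrable N (\<lambda>w. D (g \<odot> w) \<bullet> conj_by w e)" for g e
  proof (rule Bochner_Integration.integrable_bound)
    show "integrable N (\<lambda>w. (2 * M + C) * (1 + (norm e)\<^sup>2 * (2 + 2 * K\<^sup>2 * (norm w)\<^sup>2)))"
      using m by (intro integrable_mult_right Bochner_Integration.integrable_add) auto
    have "norm (D (g \<odot> w) \<bullet> conj_by w e) \<le> norm ((2 * M + C) * (1 + (norm e)\<^sup>2 * (2 + 2 * K\<^sup>2 * (norm w)\<^sup>2)))" for w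
    proof -
      have "\<bar>D (g \<odot> w) \<bullet> conj_by w e\<bar> \<le> norm (D (g \<odot> w)) * norm (conj_by w e)" by (rule Cauchy_Schwarz_ineq2)
      also have "\<dots> \<le> (2 * M + C) * (1 + (norm (conj_by w e))\<^sup>2)"
      proof (intro mult_mono D MC)
        show "norm (conj_by w e) \<le> 1 + (norm (conj_by w e))\<^sup>2"
        proof -
          have "2 * norm (conj_by w e) \<le> 1 + (norm (conj_by w e))\<^sup>2"
            using zero_le_power2[of "norm (conj_by w e) - 1"] unfolding power2_diff by simp
          moreover have "0 \<le> norm (conj_by w e)" by simp
          ultimately show ?thesis by linarith
        qed
      qed auto
      also have "\<dots> \<le> (2 * M + C) * (1 + (norm e)\<^sup>2 * (2 + 2 * K\<^sup>2 * (norm w)\<^sup>2))"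
        using MC sq by (intro mult_left_mono add_left_mono) auto
      finally show ?thesis by simp
    qed
    then show "AE w in N. norm (D (g \<odot> w) \<bullet> conj_by w e) \<le> norm ((2 * M + C) * (1 + (norm e)\<^sup>2 * (2 + 2 * K\<^sup>2 * (norm w)\<^sup>2)))" by simp
  qed measurable
  define D' where "D' g = (\<Sum>e\<in>Basis. (\<integral>w. D (g \<odot> w) \<bullet> conj_by w e \<partial>N) *\<^sub>R e)" for g
  have D': "D' g \<bullet> k = (\<integral>w. D (g \<odot> w) \<bullet> conj_by w k \<partial>N)" for g k
    unfolding D'_def
  proof (rule inner_of_linear_integral(1)[OF i])
    show "linear (\<lambda>k. D (g \<odot> w) \<bullet> conj_by w k)" for w
      using linear_conj_by[of w] by (intro linearI) (simp_all add: linear_add linear_cmul inner_add_right)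
  qed
  show ?thesis
  proof (rule that[of D' "\<integral>w. C * (2 + 2 * K\<^sup>2 * (norm w)\<^sup>2) \<partial>N"], unfold taylor_def, intro allI)
    fix g k
    let ?h = "\<lambda>w. F (g \<odot> k \<odot> w) - F (g \<odot> w) - D (g \<odot> w) \<bullet> conj_by w k"
    have ih: "integrable N ?h"
      by (intro Bochner_Integration.integrable_diff i avg_bound(2)[OF F M N sN])
    have "\<bar>avg N F (g \<odot> k) - avg N F g - D' g \<bullet> k\<bar> = \<bar>\<integral>w. ?h w \<partial>N\<bar>"
      unfolding avg_def D' by (simp add: i avg_bound(2)[OF F M N sN])
    also have "\<dots> \<le> (\<integral>w. \<bar>?h w\<bar> \<partial>N)" by (rule integral_abs_bound)
    also have "\<dots> \<le> (\<integral>w. (norm k)\<^sup>2 * (C * (2 + 2 * K\<^sup>2 * (norm w)\<^sup>2)) \<partial>N)"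
    proof (rule integral_mono)
      show "integrable N (\<lambda>w. (norm k)\<^sup>2 * (C * (2 + 2 * K\<^sup>2 * (norm w)\<^sup>2)))" using m by auto
      fix w
      have "\<bar>?h w\<bar> \<le> C * (norm (conj_by w k))\<^sup>2"
        using taylorD[OF t, of "g \<odot> w" "conj_by w k"] by (simp add: gm_assoc conj_by[symmetric])
      also have "\<dots> \<le> C * ((norm k)\<^sup>2 * (2 + 2 * K\<^sup>2 * (norm w)\<^sup>2))" using sq C0 by (intro mult_left_mono) auto
      finally show "\<bar>?h w\<bar> \<le> (norm k)\<^sup>2 * (C * (2 + 2 * K\<^sup>2 * (norm w)\<^sup>2))" by (simp add: mult.left_commute)
    qed (use ih in auto)
    also have "\<dots> = (\<integral>w. C * (2 + 2 * K\<^sup>2 * (norm w)\<^sup>2) \<partial>N) * (norm k)\<^sup>2" by simp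
    finally show "\<bar>avg N F (g \<odot> k) - avg N F g - D' g \<bullet> k\<bar> \<le> (\<integral>w. C * (2 + 2 * K\<^sup>2 * (norm w)\<^sup>2) \<partial>N) * (norm k)\<^sup>2" .
  qed
qed

section \<open>Mollification by a compactly supported bump on the group\<close>

definition bump :: "real \<Rightarrow> 'b \<times> 'c \<Rightarrow> real" where
  "bump r k = (max 0 (r - (norm k)\<^sup>2))\<^sup>2"

definition mollify :: "real \<Rightarrow> ('b \<times> 'c \<Rightarrow> real) \<Rightarrow> 'b \<times> 'c \<Rightarrow> real" where
  "mollify r F g = (\<integral>k. F (g \<odot> k) * bump r k \<partial>lborel) / (\<integral>k. bump r k \<partial>lborel)"

lemma bump_measurable [measurable]: "bump r \<in> borel_measurable borel"
  unfolding bump_def by measurable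

lemma bump_nonneg: "0 \<le> bump r k"
  by (simp add: bump_def)

lemma bump_eq_0: "r \<le> (norm k)\<^sup>2 \<Longrightarrow> bump r k = 0"
  by (simp add: bump_def)

lemma bump_le: assumes "0 \<le> r" shows "bump r k \<le> r\<^sup>2"
proof -
  have "(norm k)\<^sup>2 \<ge> 0" by simp
  then show ?thesis unfolding bump_def by (intro power_mono) (use assms in auto)
qed

lemma bump_support: "0 < r \<Longrightarrow> r \<le> 1 \<Longrightarrow> 1 < norm k \<Longrightarrow> bump r k = 0"
proof (rule bump_eq_0)
  assume "r \<le> 1" "1 < norm k"
  moreover have "1 \<le> (norm k)\<^sup>2" using \<open>1 < norm k\<close> by (intro one_le_power) auto
  ultimately show "r \<le> (norm k)\<^sup>2" by linarith
qed

lemma integrable_bump: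
  assumes r: "0 < r" "r \<le> 1"
  shows "integrable lborel (bump r)"
  by (rule bounded_support_integral(1)[where B="r\<^sup>2" and R=1])
     (use r bump_le[of r] bump_nonneg bump_support[OF r] in \<open>auto simp: abs_of_nonneg\<close>)

lemma integral_bump_pos:
  assumes r: "0 < r" "r \<le> 1"
  shows "0 < (\<integral>k. bump r k \<partial>lborel)"
proof -
  have "0 \<le> (\<integral>k. bump r k \<partial>lborel)" by (rule Bochner_Integration.integral_nonneg) (rule bump_nonneg)
  moreover have "(\<integral>k. bump r k \<partial>lborel) \<noteq> 0"
  proof
    assume "(\<integral>k. bump r k \<partial>lborel) = 0"
    then have "AE k in lborel. bump r k = 0"
      by (subst (asm) integral_nonneg_eq_0_iff_AE[OF integrable_bump[OF r]]) (auto simp: bump_nonneg)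
    then have "emeasure lborel {k. bump r k \<noteq> 0} = 0"
      by (subst (asm) AE_iff_measurable[OF _ refl]) auto
    moreover have "{k. bump r k \<noteq> 0} = ball 0 (sqrt r)"
    proof -
      have "bump r k \<noteq> 0 \<longleftrightarrow> norm k < sqrt r" for k
        using real_sqrt_less_iff[of "(norm k)\<^sup>2" r] by (auto simp: bump_def max_def)
      then show ?thesis by (intro set_eqI) (simp only: mem_Collect_eq mem_ball_0)
    qed
    ultimately have "emeasure lborel (ball (0::'b \<times> 'c) (sqrt r)) = 0" by simp
    then show False using r
      using negligible_iff_null_sets negligible_imp_measurable open_not_negligible[of "ball (0::'b \<times> 'c) (sqrt r)"]
      by (auto simp: negligible_iff_null_sets null_sets_def emeasure_completion)
  qed
  ultimately show ?thesis by linarith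
qed

text \<open>The reference value \<open>c\<close> is free: 0 gives the sup bound, \<open>F g\<close>
  gives the approximation error on a ball of radius \<open>sqrt r\<close>.\<close>

lemma mollify_bound:
  assumes F [measurable]: "F \<in> borel_measurable borel" and M: "\<And>g. \<bar>F g\<bar> \<le> M" and r: "0 < r" "r \<le> 1"
  shows "integrable lborel (\<lambda>k. F (g \<odot> k) * bump r k)"
    and "(\<And>k. norm k \<le> sqrt r \<Longrightarrow> \<bar>F (g \<odot> k) - c\<bar> \<le> d) \<Longrightarrow> \<bar>mollify r F g - c\<bar> \<le> d"
proof -
  let ?Z = "\<integral>k. bump r k \<partial>lborel"
  have Z: "?Z > 0" by (rule integral_bump_pos[OF r])
  show i: "integrable lborel (\<lambda>k. F (g \<odot> k) * bump r k)"
  proof (rule Bochner_Integration.integrable_bound[of _ "\<lambda>k. M * bump r k"])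
    show "AE k in lborel. norm (F (g \<odot> k) * bump r k) \<le> norm (M * bump r k)"
      using M by (intro always_eventually) (auto simp: abs_mult bump_nonneg intro!: mult_right_mono order_trans[OF M])
  qed (use integrable_bump[OF r] in auto)
  assume d: "\<And>k. norm k \<le> sqrt r \<Longrightarrow> \<bar>F (g \<odot> k) - c\<bar> \<le> d"
  have "\<bar>\<integral>k. F (g \<odot> k) * bump r k - c * bump r k \<partial>lborel\<bar> \<le> (\<integral>k. \<bar>F (g \<odot> k) * bump r k - c * bump r k\<bar> \<partial>lborel)"
    by (rule integral_abs_bound)
  also have "\<dots> \<le> (\<integral>k. d * bump r k \<partial>lborel)"
  proof (rule integral_mono)
    fix k
    have "\<bar>F (g \<odot> k) * bump r k - c * bump r k\<bar> = \<bar>F (g \<odot> k) - c\<bar> * bump r k"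
      by (simp add: left_diff_distrib[symmetric] abs_mult bump_nonneg)
    also have "\<dots> \<le> d * bump r k"
    proof (cases "norm k \<le> sqrt r")
      case True
      then show ?thesis by (intro mult_right_mono d bump_nonneg)
    next
      case False
      then have "r \<le> (norm k)\<^sup>2" using r by (simp add: not_le real_sqrt_less_iff sqrt_le_D less_imp_le)
      then show ?thesis by (simp add: bump_eq_0)
    qed
    finally show "\<bar>F (g \<odot> k) * bump r k - c * bump r k\<bar> \<le> d * bump r k" .
  qed (use i integrable_bump[OF r] in auto)
  finally have "\<bar>(\<integral>k. F (g \<odot> k) * bump r k \<partial>lborel) - c * ?Z\<bar> \<le> d * ?Z"
    using i integrable_bump[OF r] by simp
  then have "\<bar>((\<integral>k. F (g \<odot> k) * bump r k \<partial>lborel) - c * ?Z) / ?Z\<bar> \<le> d"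
    using Z by (simp add: abs_divide pos_divide_le_eq)
  then show "\<bar>mollify r F g - c\<bar> \<le> d" using Z by (simp add: mollify_def diff_divide_distrib)
qed

lemma mollify_measurable [measurable]:
  assumes [measurable]: "F \<in> borel_measurable borel"
  shows "mollify r F \<in> borel_measurable borel"
proof -
  have "(\<lambda>g. (\<integral>k. F (g \<odot> k) * bump r k \<partial>lborel) / (\<integral>k. bump r k \<partial>lborel)) \<in> borel_measurable borel" by measurable
  then show ?thesis by (simp add: mollify_def[abs_def])
qed

text \<open>As a function of \<open>h\<close>, \<open>- h \<odot> k = k - shift k h\<close> is affine, so differentiating the
  mollifier only needs the second order expansion of \<open>bump\<close>.\<close>
definition shift :: "'b \<times> 'c \<Rightarrow> 'b \<times> 'c \<Rightarrow> 'b \<times> 'c" where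
  "shift k h = (fst h, snd h + beta (fst h) (fst k))"

lemma shift: "- h \<odot> k = k - shift k h"
  by (simp add: gm_def shift_def minus_left prod_eq_iff)

lemma linear_shift: "linear (shift k)"
  by (rule linearI) (simp_all add: shift_def add_left scaleR_left algebra_simps)

lemma bump_taylor:
  assumes r: "0 < r"
  shows "\<bar>bump r (k - v) - bump r k - 4 * max 0 (r - (norm k)\<^sup>2) * (k \<bullet> v)\<bar> \<le> (2 * norm k * norm v + (norm v)\<^sup>2)\<^sup>2 + 2 * r * (norm v)\<^sup>2"
proof -
  define s where "s = r - (norm k)\<^sup>2"
  \<comment> \<open>The change of the radial variable \<open>s\<close> when \<open>k\<close> moves
    to \<open>k - v\<close>; its linear part yields the derivative, its quadratic part joins the
    remainder.\<close>
  define d where "d = 2 * (k \<bullet> v) - (norm v)\<^sup>2"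
  have sd: "r - (norm (k - v))\<^sup>2 = s + d"
    unfolding s_def d_def power2_norm_eq_inner by (simp add: inner_diff_left inner_diff_right inner_commute[of v k])
  have "\<bar>bump r (k - v) - bump r k - 2 * max 0 s * d\<bar> \<le> d\<^sup>2"
    unfolding bump_def sd using positive_part_square_taylor[of s d] by (simp add: s_def)
  moreover have "d\<^sup>2 \<le> (2 * norm k * norm v + (norm v)\<^sup>2)\<^sup>2"
  proof (rule abs_le_square_iff[THEN iffD1])
    have "\<bar>k \<bullet> v\<bar> \<le> norm k * norm v" by (rule Cauchy_Schwarz_ineq2)
    moreover have "0 \<le> norm k * norm v" "0 \<le> (norm v)\<^sup>2" by auto
    ultimately have "\<bar>d\<bar> \<le> 2 * norm k * norm v + (norm v)\<^sup>2" unfolding d_def by linarith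
    then show "\<bar>d\<bar> \<le> \<bar>2 * norm k * norm v + (norm v)\<^sup>2\<bar>" by linarith
  qed
  moreover have "\<bar>2 * max 0 s * d - 4 * max 0 s * (k \<bullet> v)\<bar> \<le> 2 * r * (norm v)\<^sup>2"
  proof -
    have "2 * max 0 s * d - 4 * max 0 s * (k \<bullet> v) = - (2 * max 0 s * (norm v)\<^sup>2)" by (simp add: d_def algebra_simps)
    moreover have "0 \<le> 2 * max 0 s * (norm v)\<^sup>2" by simp
    moreover have "2 * max 0 s * (norm v)\<^sup>2 \<le> 2 * r * (norm v)\<^sup>2"
      using r by (intro mult_right_mono) (auto simp: s_def)
    ultimately show ?thesis by linarith
  qed
  ultimately show ?thesis unfolding s_def by linarith
qed

text \<open>Left invariance of Lebesgue measure moves the translation from \<open>F\<close> to the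
  bump. All differentiation falls on the bump, whose remainder is uniform on a fixed ball, so a
  bounded measurable \<open>F\<close> acquires a second order expansion.\<close>

lemma taylor_mollify:
  assumes F [measurable]: "F \<in> borel_measurable borel" and M: "\<And>g. \<bar>F g\<bar> \<le> M" and r: "0 < r" "r \<le> 1"
  obtains D C where "taylor (mollify r F) D C"
proof -
  let ?Z = "\<integral>k. bump r k \<partial>lborel"
  have Z: "?Z > 0" by (rule integral_bump_pos[OF r])
  have M0: "0 \<le> M" using M[of 0] by linarith
  obtain K where K: "K > 0" "\<And>a b. norm (beta a b) \<le> norm a * norm b * K" using pos_bounded by blast
  have bK: "norm (0::'b, beta (fst a) (fst b)) \<le> norm a * norm b * K" for a b :: "'b \<times> 'c"
  proof -
    have "norm (0::'b, beta (fst a) (fst b)) = norm (beta (fst a) (fst b))" by (simp add: norm_Pair)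
    also have "\<dots> \<le> norm (fst a) * norm (fst b) * K" by (rule K)
    also have "\<dots> \<le> norm a * norm b * K"
      using K(1) norm_fst_le[of "fst a" "snd a"] norm_fst_le[of "fst b" "snd b"] by (intro mult_right_mono mult_mono) auto
    finally show ?thesis .
  qed
  have shift_le: "norm (shift k h) \<le> norm h * (1 + K * norm k)" for k h
  proof -
    have "shift k h = h + (0, beta (fst h) (fst k))" by (simp add: shift_def prod_eq_iff)
    then have "norm (shift k h) \<le> norm h + norm (0::'b, beta (fst h) (fst k))" by (simp only: norm_triangle_ineq)
    also have "\<dots> \<le> norm h + norm h * norm k * K" using bK by simp
    finally show ?thesis by (simp add: algebra_simps)
  qed
  \<comment> \<open>If \<open>h\<close> and \<open>- h \<odot> k\<close> have norm at most 1, the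
    product formula bounds the norm of \<open>k\<close> by \<open>1 + 1 + K\<close>; outside this
    ball every term of the remainder vanishes.\<close>
  define R where "R = 2 + K"
  have R1: "1 \<le> R" using K by (simp add: R_def)
  have shiftR: "norm (shift k h) \<le> norm h * (1 + K * R)" if "norm k \<le> R" for h k
  proof -
    have "norm h * (1 + K * norm k) \<le> norm h * (1 + K * R)" using that K by (intro mult_left_mono add_left_mono) auto
    then show ?thesis using shift_le[of k h] by linarith
  qed
  define l where "l g k h = F (g \<odot> k) * (4 * max 0 (r - (norm k)\<^sup>2) * (k \<bullet> shift k h))" for g k h
  have shm [measurable]: "(\<lambda>k. shift k h) \<in> borel_measurable borel" for h
    unfolding shift_def by (intro borel_measurable_continuous_onI continuous_intros continuous_on)
  have lm [measurable]: "(\<lambda>k. l g k h) \<in> borel_measurable borel" for g h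
    unfolding l_def by measurable
  have pos0: "max 0 (r - (norm k)\<^sup>2) = 0" if "norm k > 1" for k :: "'b \<times> 'c"
  proof -
    have "1 \<le> (norm k)\<^sup>2" using that by (intro one_le_power) auto
    then show ?thesis using r by simp
  qed
  have lR: "l g k h = 0" if "norm k > R" for g k h
    unfolding l_def using pos0[of k] that R1 by simp
  have li: "integrable lborel (\<lambda>k. l g k h)" for g h
  proof (rule bounded_support_integral(1)[where R=R and B="M * (4 * 1 * (R * (norm h * (1 + K * R))))"])
    fix k
    show "\<bar>l g k h\<bar> \<le> M * (4 * 1 * (R * (norm h * (1 + K * R))))"
    proof (cases "norm k \<le> R")
      case True
      have a: "\<bar>k \<bullet> shift k h\<bar> \<le> R * (norm h * (1 + K * R))"
        by (rule order_trans[OF Cauchy_Schwarz_ineq2]) (intro mult_mono True shiftR; use R1 in simp)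
      have b: "max 0 (r - (norm k)\<^sup>2) \<le> 1" using r by (simp add: add_increasing2 diff_le_eq)
      show ?thesis unfolding l_def abs_mult
        by (intro mult_mono M a) (use M0 b in auto)
    next
      case False
      have "0 \<le> M * (4 * 1 * (R * (norm h * (1 + K * R))))" using M0 R1 K by simp
      then show ?thesis using lR[of k g h] False by simp
    qed
  qed (auto simp: lR)
  define D where "D g = (\<Sum>e\<in>Basis. (\<integral>k. l g k e \<partial>lborel) *\<^sub>R e) /\<^sub>R ?Z" for g
  have D: "D g \<bullet> h = (\<integral>k. l g k h \<partial>lborel) / ?Z" for g h
  proof -
    have "(\<Sum>e\<in>Basis. (\<integral>k. l g k e \<partial>lborel) *\<^sub>R e) \<bullet> h = (\<integral>k. l g k h \<partial>lborel)"
    proof (rule inner_of_linear_integral(1)[OF li])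
      show "linear (l g k)" for k
        using linear_shift[of k] unfolding l_def[abs_def]
        by (intro linearI) (simp_all add: linear_add linear_cmul inner_add_right algebra_simps)
    qed
    then show ?thesis by (simp add: D_def divide_inverse mult.commute)
  qed
  \<comment> \<open>Comes from \<open>bump_taylor\<close> with the shift bounded by
    \<open>1 + K * R\<close> times the norm of \<open>h\<close>; \<open>norm h \<le> 1\<close>
    reduces the terms of higher order to second order.\<close>
  define c where "c = (2 * R * (1 + K * R) + (1 + K * R)\<^sup>2)\<^sup>2 + 2 * (1 + K * R)\<^sup>2"
  define V where "V = measure lborel (cball (0::'b \<times> 'c) R)"
  have loc: "\<bar>mollify r F (g \<odot> h) - mollify r F g - D g \<bullet> h\<bar> \<le> (M * c * V / ?Z) * (norm h)\<^sup>2" if h: "norm h \<le> 1" for g h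
  proof -
    let ?E = "\<lambda>k. F (g \<odot> k) * bump r (- h \<odot> k) - F (g \<odot> k) * bump r k - l g k h"
    have tr: "F (g \<odot> h \<odot> (- h \<odot> k)) = F (g \<odot> k)" for k
      by (simp add: gm_assoc[symmetric]) (simp add: gm_assoc)
    have "(\<integral>k. F (g \<odot> h \<odot> k) * bump r k \<partial>lborel) = (\<integral>k. F (g \<odot> h \<odot> (- h \<odot> k)) * bump r (- h \<odot> k) \<partial>lborel)"
      by (rule integral_gm_left[symmetric]) measurable
    then have I1: "(\<integral>k. F (g \<odot> h \<odot> k) * bump r k \<partial>lborel) = (\<integral>k. F (g \<odot> k) * bump r (- h \<odot> k) \<partial>lborel)" by (simp only: tr)
    have E0: "?E k = 0" if k: "norm k > R" for k
    proof -
      have "1 < norm (- h \<odot> k)"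
      proof (rule ccontr)
        assume a: "\<not> 1 < norm (- h \<odot> k)"
        have "k = h \<odot> (- h \<odot> k)" by (simp add: gm_assoc[symmetric])
        also have "\<dots> = h + (- h \<odot> k) + (0, beta (fst h) (fst (- h \<odot> k)))" by (simp add: gm_def prod_eq_iff)
        finally have kk: "k = h + (- h \<odot> k) + (0, beta (fst h) (fst (- h \<odot> k)))" .
        have "norm k \<le> norm h + norm (- h \<odot> k) + norm h * norm (- h \<odot> k) * K"
          using arg_cong[OF kk, of norm] bK[of h "- h \<odot> k"] norm_triangle_ineq[of "h + (- h \<odot> k)" "(0, beta (fst h) (fst (- h \<odot> k)))"] norm_triangle_ineq[of h "- h \<odot> k"] by linarith
        also have "\<dots> \<le> 1 + 1 + 1 * 1 * K" using a h K by (intro add_mono mult_mono) auto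
        finally show False using k by (simp add: R_def)
      qed
      then show ?thesis using bump_support[OF r] lR[OF k] bump_support[OF r, of k] k R1 by simp
    qed
    have EB: "\<bar>?E k\<bar> \<le> M * (c * (norm h)\<^sup>2)" for k
    proof (cases "norm k \<le> R")
      case True
      define B where "B = 1 + K * R"
      have B1: "1 \<le> B" using K R1 by (simp add: B_def)
      have v: "norm (shift k h) \<le> norm h * B" using shiftR[OF True] by (simp add: B_def)
      have "?E k = F (g \<odot> k) * (bump r (k - shift k h) - bump r k - 4 * max 0 (r - (norm k)\<^sup>2) * (k \<bullet> shift k h))"
        unfolding shift l_def by (simp add: algebra_simps)
      then have "\<bar>?E k\<bar> \<le> M * ((2 * norm k * norm (shift k h) + (norm (shift k h))\<^sup>2)\<^sup>2 + 2 * r * (norm (shift k h))\<^sup>2)"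
        using mult_mono[OF M[of "g \<odot> k"] bump_taylor[OF r(1), of k "shift k h"]] M0 by (simp add: abs_mult)
      also have "\<dots> \<le> M * ((2 * R * (norm h * B) + (norm h * B)\<^sup>2)\<^sup>2 + 2 * 1 * (norm h * B)\<^sup>2)"
        using v True r M0 R1 by (intro mult_left_mono add_mono power_mono mult_mono) auto
      also have "\<dots> \<le> M * ((2 * R * (norm h * B) + norm h * B\<^sup>2)\<^sup>2 + 2 * 1 * (norm h * B)\<^sup>2)"
      proof -
        have "(norm h * B)\<^sup>2 \<le> norm h * B\<^sup>2"
        proof -
          have "(norm h)\<^sup>2 \<le> norm h" using h by (simp add: power2_eq_square mult_left_le)
          then show ?thesis by (simp add: power_mult_distrib mult_right_mono)
        qed
        then show ?thesis using M0 R1 B1 by (intro mult_left_mono add_mono power_mono) auto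
      qed
      also have "\<dots> = M * (c * (norm h)\<^sup>2)"
        unfolding c_def B_def[symmetric] by (simp add: power2_eq_square algebra_simps)
      finally show ?thesis .
    next
      case False
      have "0 \<le> M * (c * (norm h)\<^sup>2)" using M0 by (simp add: c_def)
      then show ?thesis using E0[of k] False by simp
    qed
    have Em: "?E \<in> borel_measurable borel" by measurable
    have i1: "integrable lborel (\<lambda>k. F (g \<odot> k) * bump r k)" by (rule mollify_bound(1)[OF F M r])
    have "integrable lborel ?E" by (rule bounded_support_integral(1)[OF Em EB E0])
    then have "integrable lborel (\<lambda>k. ?E k + F (g \<odot> k) * bump r k + l g k h)"
      by (intro Bochner_Integration.integrable_add i1 li)
    then have i2: "integrable lborel (\<lambda>k. F (g \<odot> k) * bump r (- h \<odot> k))" by simp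
    have "\<bar>\<integral>k. ?E k \<partial>lborel\<bar> \<le> M * (c * (norm h)\<^sup>2) * V"
      unfolding V_def by (rule bounded_support_integral(2)[OF Em EB E0])
    moreover have "(\<integral>k. ?E k \<partial>lborel) = (\<integral>k. F (g \<odot> h \<odot> k) * bump r k \<partial>lborel) - (\<integral>k. F (g \<odot> k) * bump r k \<partial>lborel) - (\<integral>k. l g k h \<partial>lborel)"
      unfolding I1 using i1 i2 li by simp
    moreover have "mollify r F (g \<odot> h) - mollify r F g - D g \<bullet> h = ((\<integral>k. F (g \<odot> h \<odot> k) * bump r k \<partial>lborel) - (\<integral>k. F (g \<odot> k) * bump r k \<partial>lborel) - (\<integral>k. l g k h \<partial>lborel)) / ?Z"
      unfolding mollify_def D by (simp add: diff_divide_distrib)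
    ultimately have "\<bar>mollify r F (g \<odot> h) - mollify r F g - D g \<bullet> h\<bar> \<le> M * (c * (norm h)\<^sup>2) * V / ?Z"
      using Z by (simp add: abs_divide divide_right_mono)
    then show ?thesis by (simp add: algebra_simps)
  qed
  have bd: "\<bar>mollify r F g\<bar> \<le> M" for g
    using mollify_bound(2)[OF F M r, of g 0 M] M by simp
  show ?thesis by (rule that[OF taylor_local(2)[OF bd loc]])
qed

end

section \<open>Stable laws\<close>

lemma distr_pair_snd:
  assumes M: "prob_space M" and N: "sigma_finite_measure N"
  shows "distr (M \<Otimes>\<^sub>M N) N snd = N"
proof (rule measure_eqI)
  interpret M: prob_space M by fact
  interpret N: sigma_finite_measure N by fact
  fix A assume "A \<in> sets (distr (M \<Otimes>\<^sub>M N) N snd)"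
  then have A [measurable]: "A \<in> sets N" by simp
  have "snd -` A \<inter> space (M \<Otimes>\<^sub>M N) = space M \<times> A"
    using sets.sets_into_space[OF A] by (auto simp: space_pair_measure)
  then show "emeasure (distr (M \<Otimes>\<^sub>M N) N snd) A = emeasure N A"
    by (simp add: emeasure_distr N.emeasure_pair_measure_Times M.emeasure_space_1)
qed simp

lemma integral_pair_fst:
  fixes h :: "'x \<Rightarrow> real"
  assumes M: "sigma_finite_measure M" and N: "prob_space N" and [measurable]: "h \<in> borel_measurable M"
  shows "integrable M h \<Longrightarrow> integrable (M \<Otimes>\<^sub>M N) (\<lambda>p. h (fst p))"
    and "(\<integral>p. h (fst p) \<partial>(M \<Otimes>\<^sub>M N)) = (\<integral>x. h x \<partial>M)"
proof -
  note d = prob_space.distr_pair_fst[OF N, of M]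
  show "integrable M h \<Longrightarrow> integrable (M \<Otimes>\<^sub>M N) (\<lambda>p. h (fst p))"
    by (subst (asm) d[symmetric], subst (asm) integrable_distr_eq) auto
  show "(\<integral>p. h (fst p) \<partial>(M \<Otimes>\<^sub>M N)) = (\<integral>x. h x \<partial>M)"
    by (subst (2) d[symmetric], subst integral_distr) auto
qed

lemma integral_pair_snd:
  fixes h :: "'x \<Rightarrow> real"
  assumes M: "prob_space M" and N: "sigma_finite_measure N" and [measurable]: "h \<in> borel_measurable N"
  shows "integrable N h \<Longrightarrow> integrable (M \<Otimes>\<^sub>M N) (\<lambda>p. h (snd p))"
    and "(\<integral>p. h (snd p) \<partial>(M \<Otimes>\<^sub>M N)) = (\<integral>x. h x \<partial>N)"
proof -
  note d = distr_pair_snd[OF M N]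
  show "integrable N h \<Longrightarrow> integrable (M \<Otimes>\<^sub>M N) (\<lambda>p. h (snd p))"
    by (subst (asm) d[symmetric], subst (asm) integrable_distr_eq) auto
  show "(\<integral>p. h (snd p) \<partial>(M \<Otimes>\<^sub>M N)) = (\<integral>x. h x \<partial>N)"
    by (subst (2) d[symmetric], subst integral_distr) auto
qed

lemma exp_quadratic_upper:
  fixes x d :: real
  assumes "\<bar>x\<bar> \<le> d"
  shows "exp x - 1 \<le> x + exp d / 2 * x\<^sup>2"
proof -
  obtain t where t: "\<bar>t\<bar> \<le> \<bar>x\<bar>" "exp x = (\<Sum>m<2. (x ^ m) / fact m) + (exp t / fact 2) * x ^ 2"
    using Maclaurin_exp_le[of x 2] by blast
  then have "exp x = 1 + x + exp t / 2 * x\<^sup>2" by (simp add: numeral_2_eq_2)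
  moreover have "exp t / 2 * x\<^sup>2 \<le> exp d / 2 * x\<^sup>2" using t assms by (intro mult_right_mono) auto
  ultimately show ?thesis by linarith
qed

text \<open>The choice \<open>c = x / y\<close> balances the right hand side. For
  \<open>y = 0\<close> a large \<open>c\<close> contradicts a positive \<open>x\<close>.\<close>

lemma square_le_of_linear_quadratic:
  fixes x y z :: real
  assumes "\<And>c. 0 \<le> c \<Longrightarrow> c * x \<le> c\<^sup>2 * y / 2 + z / 2" and y: "0 \<le> y" and z: "0 \<le> z" and x: "0 \<le> x"
  shows "x\<^sup>2 \<le> y * z"
proof (cases "x = 0")
  case False
  then have x: "x > 0" using x by simp
  show ?thesis
  proof (cases "y = 0")
    case True
    have "(z + 1) / x * x \<le> z / 2" using assms(1)[of "(z + 1) / x"] x z True by simp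
    then show ?thesis using x z by simp
  next
    case False
    then have y: "y > 0" using y by simp
    have "x / y * x \<le> (x / y)\<^sup>2 * y / 2 + z / 2" using x y by (intro assms(1)) auto
    then have "x\<^sup>2 / y \<le> z" using y by (simp add: power2_eq_square field_simps)
    then show ?thesis using y by (simp add: field_simps)
  qed
qed (use y z in simp)

text \<open>The law of the group Brownian motion at time \<open>tau\<close>, reduced to what the
  entropy argument consumes. \<open>marginal\<close> bounds the density of the horizontal part.
  \<open>odd\<close> concerns truncated functionals because these serve as tests.
  \<open>stable\<close> is restricted to rational ratios of durations, the ones that grids can
  realise.\<close>

locale stable_law = step2_group beta + mu: prob_space mu
  for beta :: "'b::euclidean_space \<Rightarrow> 'b \<Rightarrow> 'c::euclidean_space" and mu :: "('b \<times> 'c) measure" +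
  fixes tau :: real
  assumes sets_mu [measurable_cong, simp]: "sets mu = sets borel"
    and marginal: "\<exists>C>0. \<forall>A\<in>sets borel. emeasure mu (fst -` A) \<le> ennreal C * emeasure lborel A"
    and moment2: "integrable mu (\<lambda>w. (norm w)\<^sup>2)"
    and tau_pos: "tau > 0"
    and covariance: "(\<integral>w. (fst w \<bullet> u) * (fst w \<bullet> v) \<partial>mu) = tau * (u \<bullet> v)"
    and odd: "(\<integral>w. (fst w \<bullet> u) * indicator {w. norm (fst w) \<le> r} w \<partial>mu) = 0"
    and stable: "1 \<le> p \<Longrightarrow> 1 \<le> q \<Longrightarrow>
      distr (mu \<Otimes>\<^sub>M mu) borel (\<lambda>(v, w). dil (sqrt (real p / real (p + q))) v \<odot> dil (sqrt (real q / real (p + q))) w) = mu"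
    and spanning: "span {beta u v |u v. True} = UNIV"
begin

lemma space_mu [simp]: "space mu = UNIV"
  using sets_eq_imp_space_eq[OF sets_mu] by simp

text \<open>The dilation that turns the duration of \<open>mu\<close> into \<open>1 + 1/j\<close>
  times this duration: a step of relative length \<open>1/j\<close> in front of a full copy.\<close>

definition bscale :: "nat \<Rightarrow> real" where
  "bscale j = sqrt (1 + 1 / real j)"

text \<open>Dilation multiplies the vertical noise by \<open>(bscale j)^2\<close>, hence its
  variance by the fourth power. The excess over the variance already present in \<open>kap j\<close>
  is what the small factor has to contribute.\<close>

definition vnoise :: "nat \<Rightarrow> real" where
  "vnoise j = sqrt ((bscale j) ^ 4 - 1)"

text \<open>\<open>kap j\<close> is \<open>mu\<close> smoothed by a vertical Gaussian of size \<open>1/j\<close>, which makes its entropy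
  finite; \<open>lam j\<close> is the law of a small increment of duration \<open>1/j\<close>, whose vertical noise is
  adjusted such that \<open>lam j\<close> followed by \<open>kap j\<close> is a dilation of \<open>kap j\<close>.\<close>
definition kap :: "nat \<Rightarrow> ('b \<times> 'c) measure" where
  "kap j = distr (mu \<Otimes>\<^sub>M gauss) borel (\<lambda>(w, n). (fst w, snd w + (1 / real j) *\<^sub>R n))"

definition lam :: "nat \<Rightarrow> ('b \<times> 'c) measure" where
  "lam j = distr (mu \<Otimes>\<^sub>M gauss) borel
     (\<lambda>(w, n). (sqrt (1 / real j) *\<^sub>R fst w, (1 / real j) *\<^sub>R snd w + (1 / real j * vnoise j) *\<^sub>R n))"

lemma sets_kap [measurable_cong, simp]: "sets (kap j) = sets borel"
  and sets_lam [measurable_cong, simp]: "sets (lam j) = sets borel"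
  by (simp_all add: kap_def lam_def)

interpretation mg: pair_prob_space mu "gauss :: 'c measure" ..

lemma kap_map_measurable [measurable]: "(\<lambda>(w, n). (fst w, snd w + (1 / real j) *\<^sub>R n)) \<in> mu \<Otimes>\<^sub>M gauss \<rightarrow>\<^sub>M (borel :: ('b \<times> 'c) measure)"
  by measurable

lemma lam_map_measurable [measurable]: "(\<lambda>(w, n). (sqrt (1 / real j) *\<^sub>R fst w, (1 / real j) *\<^sub>R snd w + (1 / real j * vnoise j) *\<^sub>R n)) \<in> mu \<Otimes>\<^sub>M gauss \<rightarrow>\<^sub>M (borel :: ('b \<times> 'c) measure)"
  by measurable

lemma prob_space_kap: "prob_space (kap j)"
  unfolding kap_def by (rule mg.prob_space_distr) (rule kap_map_measurable)

lemma prob_space_lam: "prob_space (lam j)"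
  unfolding lam_def by (rule mg.prob_space_distr) (rule lam_map_measurable)

lemma nn_integral_kap:
  assumes [measurable]: "h \<in> borel_measurable borel"
  shows "(\<integral>\<^sup>+x. h x \<partial>kap j) = (\<integral>\<^sup>+w. \<integral>\<^sup>+n. h (fst w, snd w + (1 / real j) *\<^sub>R n) \<partial>gauss \<partial>mu)"
proof -
  have "(\<integral>\<^sup>+x. h x \<partial>kap j) = (\<integral>\<^sup>+p. h (case p of (w, n) \<Rightarrow> (fst w, snd w + (1 / real j) *\<^sub>R n)) \<partial>(mu \<Otimes>\<^sub>M gauss))"
    unfolding kap_def by (rule nn_integral_distr[OF kap_map_measurable]) simp
  also have "\<dots> = (\<integral>\<^sup>+w. \<integral>\<^sup>+n. h (fst w, snd w + (1 / real j) *\<^sub>R n) \<partial>gauss \<partial>mu)"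
    by (subst gauss.nn_integral_fst[symmetric]) auto
  finally show ?thesis .
qed

lemma nn_integral_lam:
  assumes [measurable]: "h \<in> borel_measurable borel"
  shows "(\<integral>\<^sup>+x. h x \<partial>lam j) = (\<integral>\<^sup>+w. \<integral>\<^sup>+n. h (sqrt (1 / real j) *\<^sub>R fst w, (1 / real j) *\<^sub>R snd w + (1 / real j * vnoise j) *\<^sub>R n) \<partial>gauss \<partial>mu)"
proof -
  have "(\<integral>\<^sup>+x. h x \<partial>lam j) = (\<integral>\<^sup>+p. h (case p of (w, n) \<Rightarrow> (sqrt (1 / real j) *\<^sub>R fst w, (1 / real j) *\<^sub>R snd w + (1 / real j * vnoise j) *\<^sub>R n)) \<partial>(mu \<Otimes>\<^sub>M gauss))"
    unfolding lam_def by (rule nn_integral_distr[OF lam_map_measurable]) simp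
  also have "\<dots> = (\<integral>\<^sup>+w. \<integral>\<^sup>+n. h (sqrt (1 / real j) *\<^sub>R fst w, (1 / real j) *\<^sub>R snd w + (1 / real j * vnoise j) *\<^sub>R n) \<partial>gauss \<partial>mu)"
    by (subst gauss.nn_integral_fst[symmetric]) auto
  finally show ?thesis .
qed

lemma bscale_pos: "0 < bscale j"
  and bscale_sq: "(bscale j)\<^sup>2 = 1 + 1 / real j"
  and bscale_ge: "1 \<le> bscale j"
  by (simp_all add: bscale_def add_pos_nonneg add_nonneg_nonneg)

lemma vnoise_sq: "(vnoise j)\<^sup>2 = (bscale j) ^ 4 - 1" and vnoise_nonneg: "0 \<le> vnoise j"
  using bscale_ge[of j] by (simp_all add: vnoise_def one_le_power)

text \<open>Stability with ratio \<open>1 : j\<close>, dilated so that the second factor becomes an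
  undilated copy of \<open>mu\<close>.\<close>

lemma nn_integral_stable:
  assumes [measurable]: "G \<in> borel_measurable borel" and j: "1 \<le> j"
  shows "(\<integral>\<^sup>+v. \<integral>\<^sup>+w. G (dil (sqrt (1 / real j)) v \<odot> w) \<partial>mu \<partial>mu) = (\<integral>\<^sup>+w. G (dil (bscale j) w) \<partial>mu)"
proof -
  let ?p = "sqrt (1 / real (1 + j))" and ?q = "sqrt (real j / real (1 + j))"
  have M [measurable]: "(\<lambda>(v, w). dil ?p v \<odot> dil ?q w) \<in> mu \<Otimes>\<^sub>M mu \<rightarrow>\<^sub>M (borel :: ('b \<times> 'c) measure)" by measurable
  have s: "mu = distr (mu \<Otimes>\<^sub>M mu) borel (\<lambda>(v, w). dil ?p v \<odot> dil ?q w)"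
    using stable[of 1 j] j by simp
  have a: "1 + 1 / real j = real (1 + j) / real j" using j by (simp add: field_simps)
  have b1: "bscale j * ?p = sqrt (1 / real j)" and b2: "bscale j * ?q = 1"
    unfolding bscale_def a real_sqrt_mult[symmetric] using j by simp_all
  have "(\<integral>\<^sup>+w. G (dil (bscale j) w) \<partial>mu) = (\<integral>\<^sup>+w. G (dil (bscale j) w) \<partial>distr (mu \<Otimes>\<^sub>M mu) borel (\<lambda>(v, w). dil ?p v \<odot> dil ?q w))"
    using s by simp
  also have "\<dots> = (\<integral>\<^sup>+p. G (dil (bscale j) (case p of (v, w) \<Rightarrow> dil ?p v \<odot> dil ?q w)) \<partial>(mu \<Otimes>\<^sub>M mu))"
    by (rule nn_integral_distr[OF M]) simp
  also have "\<dots> = (\<integral>\<^sup>+v. \<integral>\<^sup>+w. G (dil (bscale j) (dil ?p v \<odot> dil ?q w)) \<partial>mu \<partial>mu)"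
    by (subst mu.nn_integral_fst[symmetric]) auto
  also have "\<dots> = (\<integral>\<^sup>+v. \<integral>\<^sup>+w. G (dil (sqrt (1 / real j)) v \<odot> w) \<partial>mu \<partial>mu)"
    by (simp only: dil_gm dil_dil b1 b2 dil_1)
  finally show ?thesis by simp
qed

lemma nn_integral_vertical:
  assumes [measurable]: "H \<in> borel_measurable (borel :: 'c measure)"
  shows "(\<integral>\<^sup>+x. \<integral>\<^sup>+y. H (vnoise j *\<^sub>R x + y) \<partial>gauss \<partial>gauss) = (\<integral>\<^sup>+n. H ((bscale j)\<^sup>2 *\<^sub>R n) \<partial>gauss)"
proof -
  let ?b = "bscale j"
  let ?f = "\<lambda>(x, y). (vnoise j / ?b\<^sup>2) *\<^sub>R x + (1 / ?b\<^sup>2) *\<^sub>R (y::'c)"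
  have b: "?b > 0" by (rule bscale_pos)
  have "(vnoise j / ?b\<^sup>2)\<^sup>2 + (1 / ?b\<^sup>2)\<^sup>2 = 1"
    using b by (simp add: power_divide vnoise_sq add_divide_distrib[symmetric])
  then have d: "gauss = distr (gauss \<Otimes>\<^sub>M gauss) borel ?f"
    by (intro gauss_convolution[symmetric]) (use b in auto)
  have M: "?f \<in> gauss \<Otimes>\<^sub>M gauss \<rightarrow>\<^sub>M borel" by measurable
  have "(\<integral>\<^sup>+n. H (?b\<^sup>2 *\<^sub>R n) \<partial>gauss) = (\<integral>\<^sup>+n. H (?b\<^sup>2 *\<^sub>R n) \<partial>distr (gauss \<Otimes>\<^sub>M gauss) borel ?f)"
    using d by simp
  also have "\<dots> = (\<integral>\<^sup>+p. H (?b\<^sup>2 *\<^sub>R ?f p) \<partial>(gauss \<Otimes>\<^sub>M gauss))"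
    by (rule nn_integral_distr[OF M]) simp
  also have "\<dots> = (\<integral>\<^sup>+x. \<integral>\<^sup>+y. H (?b\<^sup>2 *\<^sub>R ?f (x, y)) \<partial>gauss \<partial>gauss)"
    by (subst gauss.nn_integral_fst[symmetric]) auto
  also have "\<dots> = (\<integral>\<^sup>+x. \<integral>\<^sup>+y. H (vnoise j *\<^sub>R x + y) \<partial>gauss \<partial>gauss)"
    using b by (simp add: scaleR_add_right)
  finally show ?thesis by simp
qed

text \<open>The vertical noise is central, so it can be collected at the end of the product. The
  group parts combine by stability, the two noises by Gaussian convolution, and both results are
  dilated by the same \<open>bscale j\<close>.\<close>

lemma lam_kap_law:
  assumes j: "1 \<le> j"
  shows "distr (lam j \<Otimes>\<^sub>M kap j) borel (\<lambda>(v, w). v \<odot> w) = distr (kap j) borel (dil (bscale j))"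
proof (rule measure_eqI)
  fix A assume "A \<in> sets (distr (lam j \<Otimes>\<^sub>M kap j) borel (\<lambda>(v, w). v \<odot> w))"
  then have [measurable]: "A \<in> sets borel" by simp
  interpret K: prob_space "kap j" by (rule prob_space_kap)
  interpret gm: pair_sigma_finite "gauss :: 'c measure" mu ..
  let ?h = "indicator A :: _ \<Rightarrow> ennreal"
  let ?e = "1 / real j"
  let ?V = "\<lambda>w n. (sqrt ?e *\<^sub>R fst w, ?e *\<^sub>R snd w + (?e * vnoise j) *\<^sub>R n) :: 'b \<times> 'c"
  let ?K = "\<lambda>w n. (fst w, snd w + ?e *\<^sub>R n) :: 'b \<times> 'c"
  have e1: "?V w1 n1 \<odot> ?K w2 n2 = dil (sqrt ?e) w1 \<odot> w2 \<odot> (0, ?e *\<^sub>R (vnoise j *\<^sub>R n1 + n2))" for w1 n1 w2 n2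
    by (simp add: gm_def dil_def zero_right scaleR_add_right)
  have e2: "dil (bscale j) (?K w n) = dil (bscale j) w \<odot> (0, ?e *\<^sub>R ((bscale j)\<^sup>2 *\<^sub>R n))" for w n
    by (simp add: gm_def dil_def zero_right scaleR_add_right)
  have "emeasure (distr (lam j \<Otimes>\<^sub>M kap j) borel (\<lambda>(v, w). v \<odot> w)) A = (\<integral>\<^sup>+x. ?h x \<partial>distr (lam j \<Otimes>\<^sub>M kap j) borel (\<lambda>(v, w). v \<odot> w))"
    by simp
  also have "\<dots> = (\<integral>\<^sup>+p. ?h (fst p \<odot> snd p) \<partial>(lam j \<Otimes>\<^sub>M kap j))"
    by (subst nn_integral_distr) (auto simp: split_beta')
  also have "\<dots> = (\<integral>\<^sup>+v. \<integral>\<^sup>+w. ?h (v \<odot> w) \<partial>kap j \<partial>lam j)"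
    by (subst K.nn_integral_fst[symmetric]) auto
  also have "\<dots> = (\<integral>\<^sup>+w1. \<integral>\<^sup>+n1. \<integral>\<^sup>+w. ?h (?V w1 n1 \<odot> w) \<partial>kap j \<partial>gauss \<partial>mu)"
    by (rule nn_integral_lam) measurable
  also have "\<dots> = (\<integral>\<^sup>+w1. \<integral>\<^sup>+n1. \<integral>\<^sup>+w2. \<integral>\<^sup>+n2. ?h (?V w1 n1 \<odot> ?K w2 n2) \<partial>gauss \<partial>mu \<partial>gauss \<partial>mu)"
    by (intro nn_integral_cong nn_integral_kap) measurable
  also have "\<dots> = (\<integral>\<^sup>+w1. \<integral>\<^sup>+w2. \<integral>\<^sup>+n1. \<integral>\<^sup>+n2. ?h (?V w1 n1 \<odot> ?K w2 n2) \<partial>gauss \<partial>gauss \<partial>mu \<partial>mu)"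
    by (rule nn_integral_cong, rule gm.Fubini'[symmetric]) measurable
  also have "\<dots> = (\<integral>\<^sup>+w1. \<integral>\<^sup>+w2. \<integral>\<^sup>+n. ?h (dil (sqrt ?e) w1 \<odot> w2 \<odot> (0, ?e *\<^sub>R ((bscale j)\<^sup>2 *\<^sub>R n))) \<partial>gauss \<partial>mu \<partial>mu)"
    unfolding e1 by (rule nn_integral_cong, rule nn_integral_cong, rule nn_integral_vertical) measurable
  also have "\<dots> = (\<integral>\<^sup>+w. \<integral>\<^sup>+n. ?h (dil (bscale j) w \<odot> (0, ?e *\<^sub>R ((bscale j)\<^sup>2 *\<^sub>R n))) \<partial>gauss \<partial>mu)"
    by (rule nn_integral_stable[OF _ j]) measurable
  also have "\<dots> = (\<integral>\<^sup>+x. ?h (dil (bscale j) x) \<partial>kap j)"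
    unfolding e2[symmetric] by (rule nn_integral_kap[symmetric]) measurable
  also have "\<dots> = (\<integral>\<^sup>+x. ?h x \<partial>distr (kap j) borel (dil (bscale j)))"
    by (subst nn_integral_distr) auto
  also have "\<dots> = emeasure (distr (kap j) borel (dil (bscale j))) A" by simp
  finally show "emeasure (distr (lam j \<Otimes>\<^sub>M kap j) borel (\<lambda>(v, w). v \<odot> w)) A = emeasure (distr (kap j) borel (dil (bscale j))) A" .
qed simp

lemma nn_integral_marginal:
  obtains C where "C > 0" "\<And>h. h \<in> borel_measurable borel \<Longrightarrow> (\<integral>\<^sup>+w. h (fst w) \<partial>mu) \<le> ennreal C * (\<integral>\<^sup>+b. h b \<partial>lborel)"
proof -
  obtain C where C: "C > 0" "\<And>A. A \<in> sets borel \<Longrightarrow> emeasure mu (fst -` A) \<le> ennreal C * emeasure lborel A"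
    using marginal by blast
  have le: "distr mu borel fst \<le> density lborel (\<lambda>_. ennreal C)"
  proof (rule le_measure[THEN iffD2, OF _ ballI])
    show "sets (distr mu borel fst) = sets (density lborel (\<lambda>_. ennreal C))" by simp
    fix A assume "A \<in> sets (distr mu borel (fst :: _ \<Rightarrow> 'b))"
    then have A: "A \<in> sets borel" by simp
    then show "emeasure (distr mu borel fst) A \<le> emeasure (density lborel (\<lambda>_. ennreal C)) A"
      using C(2)[OF A] by (simp add: emeasure_distr emeasure_density nn_integral_cmult_indicator)
  qed
  show ?thesis
  proof (rule that[OF C(1)])
    fix h :: "'b \<Rightarrow> ennreal" assume [measurable]: "h \<in> borel_measurable borel"
    have "(\<integral>\<^sup>+w. h (fst w) \<partial>mu) = (\<integral>\<^sup>+b. h b \<partial>distr mu borel fst)"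
      by (subst nn_integral_distr) auto
    also have "\<dots> \<le> (\<integral>\<^sup>+b. h b \<partial>density lborel (\<lambda>_. ennreal C))"
      by (rule nn_integral_mono_measure) (use le in auto)
    also have "\<dots> = ennreal C * (\<integral>\<^sup>+b. h b \<partial>lborel)"
      by (simp add: nn_integral_density nn_integral_cmult)
    finally show "(\<integral>\<^sup>+w. h (fst w) \<partial>mu) \<le> ennreal C * (\<integral>\<^sup>+b. h b \<partial>lborel)" .
  qed
qed

text \<open>Given \<open>w\<close>, the vertical Gaussian has density at most a constant times
  \<open>j ^ DIM('c)\<close>; integrating the horizontal coordinate against its bounded marginal
  gives domination by Lebesgue measure on the whole group.\<close>

lemma kap_le_lborel:
  assumes j: "1 \<le> j"
  obtains C where "C > 0" "\<And>A. A \<in> sets borel \<Longrightarrow> emeasure (kap j) A \<le> ennreal C * emeasure lborel A"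
proof -
  obtain C where C: "C > 0" "\<And>h. h \<in> borel_measurable borel \<Longrightarrow> (\<integral>\<^sup>+w. h (fst w) \<partial>mu) \<le> ennreal C * (\<integral>\<^sup>+b. h b \<partial>lborel)"
    using nn_integral_marginal by blast
  let ?G = "(1 / sqrt (2 * pi)) ^ DIM('c)"
  let ?J = "real j ^ DIM('c)"
  show ?thesis
  proof (rule that[of "C * (?G * ?J)"])
    show "C * (?G * ?J) > 0" using C j by simp
    fix A :: "('b \<times> 'c) set" assume [measurable]: "A \<in> sets borel"
    let ?h = "indicator A :: _ \<Rightarrow> ennreal"
    have inner: "(\<integral>\<^sup>+n. ?h (b, y + (1 / real j) *\<^sub>R n) \<partial>gauss) \<le> ennreal (?G * ?J) * (\<integral>\<^sup>+y. ?h (b, y) \<partial>lborel)" for b and y :: 'c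
    proof -
      have "(\<integral>\<^sup>+n. ?h (b, y + (1 / real j) *\<^sub>R n) \<partial>gauss) = (\<integral>\<^sup>+n. ennreal (gauss_density n) * ?h (b, y + (1 / real j) *\<^sub>R n) \<partial>lborel)"
        unfolding gauss_def by (subst nn_integral_density) auto
      also have "\<dots> \<le> (\<integral>\<^sup>+n. ennreal ?G * ?h (b, y + (1 / real j) *\<^sub>R n) \<partial>lborel)"
        by (intro nn_integral_mono mult_right_mono ennreal_leI gauss_density_le) simp
      also have "\<dots> = ennreal ?G * (\<integral>\<^sup>+n. ?h (b, y + (1 / real j) *\<^sub>R n) \<partial>lborel)"
        by (rule nn_integral_cmult) measurable
      also have "(\<integral>\<^sup>+n. ?h (b, y + (1 / real j) *\<^sub>R n) \<partial>lborel) = ennreal ?J * (\<integral>\<^sup>+y. ?h (b, y) \<partial>lborel)"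
      proof -
        have "ennreal ?J * (\<integral>\<^sup>+y. ?h (b, y) \<partial>lborel) = ennreal ?J * (\<integral>\<^sup>+n. ennreal ((1 / real j) ^ DIM('c)) * ?h (b, y + (1 / real j) *\<^sub>R n) \<partial>lborel)"
          using j by (subst nn_integral_lborel_affine[where c="1 / real j" and t=y]) auto
        also have "\<dots> = ennreal ?J * (ennreal ((1 / real j) ^ DIM('c)) * (\<integral>\<^sup>+n. ?h (b, y + (1 / real j) *\<^sub>R n) \<partial>lborel))"
          by (subst nn_integral_cmult) auto
        also have "\<dots> = (\<integral>\<^sup>+n. ?h (b, y + (1 / real j) *\<^sub>R n) \<partial>lborel)"
          using j by (subst mult.assoc[symmetric], subst ennreal_mult'[symmetric]) (auto simp: power_one_over)
        finally show ?thesis by simp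
      qed
      also have "ennreal ?G * (ennreal ?J * (\<integral>\<^sup>+y. ?h (b, y) \<partial>lborel)) = ennreal (?G * ?J) * (\<integral>\<^sup>+y. ?h (b, y) \<partial>lborel)"
        by (simp add: ennreal_mult' mult.assoc)
      finally show ?thesis .
    qed
    have "emeasure (kap j) A = (\<integral>\<^sup>+x. ?h x \<partial>kap j)" by simp
    also have "\<dots> = (\<integral>\<^sup>+w. \<integral>\<^sup>+n. ?h (fst w, snd w + (1 / real j) *\<^sub>R n) \<partial>gauss \<partial>mu)"
      by (rule nn_integral_kap) measurable
    also have "\<dots> \<le> (\<integral>\<^sup>+w. ennreal (?G * ?J) * (\<integral>\<^sup>+y. ?h (fst w, y) \<partial>lborel) \<partial>mu)"
      by (intro nn_integral_mono inner)
    also have "\<dots> = ennreal (?G * ?J) * (\<integral>\<^sup>+w. (\<integral>\<^sup>+y. ?h (fst w, y) \<partial>lborel) \<partial>mu)"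
      by (rule nn_integral_cmult) measurable
    also have "\<dots> \<le> ennreal (?G * ?J) * (ennreal C * (\<integral>\<^sup>+b. (\<integral>\<^sup>+y. ?h (b, y) \<partial>lborel) \<partial>lborel))"
      by (intro mult_left_mono C(2)) auto
    also have "(\<integral>\<^sup>+b. (\<integral>\<^sup>+y. ?h (b, y) \<partial>lborel) \<partial>lborel) = emeasure lborel A"
    proof -
      have "(\<integral>\<^sup>+b. (\<integral>\<^sup>+y. ?h (b, y) \<partial>lborel) \<partial>lborel) = (\<integral>\<^sup>+x. ?h x \<partial>(lborel \<Otimes>\<^sub>M lborel))"
        by (rule lborel.nn_integral_fst) (simp add: lborel_prod)
      then show ?thesis by (simp add: lborel_prod)
    qed
    also have "ennreal (?G * ?J) * (ennreal C * emeasure lborel A) = ennreal (C * (?G * ?J)) * emeasure lborel A"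
      using C(1) by (subst ennreal_mult'[of C]) (auto simp: ac_simps)
    finally show "emeasure (kap j) A \<le> ennreal (C * (?G * ?J)) * emeasure lborel A" .
  qed
qed

lemma integrable_pair_norms:
  shows "integrable (mu \<Otimes>\<^sub>M (gauss :: 'c measure)) (\<lambda>p. (norm (fst p))\<^sup>2)"
    and "integrable (mu \<Otimes>\<^sub>M (gauss :: 'c measure)) (\<lambda>p. (norm (snd p))\<^sup>2)"
  using moment2 gauss_norm_moment[where 'a='c]
  by (auto intro!: integral_pair_fst(1)[where h="\<lambda>w. (norm w)\<^sup>2"] integral_pair_snd(1)[where h="\<lambda>w. (norm w)\<^sup>2"]
      prob_space_gauss mu.prob_space_axioms mu.sigma_finite_measure_axioms gauss.sigma_finite_measure_axioms)

lemma kap_moment2: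
  assumes j: "1 \<le> j"
  shows "integrable (kap j) (\<lambda>x. (norm x)\<^sup>2)"
proof -
  have "integrable (mu \<Otimes>\<^sub>M (gauss :: 'c measure)) (\<lambda>p. 2 * (norm (fst p))\<^sup>2 + 2 * (norm (snd p))\<^sup>2)"
    using integrable_pair_norms by auto
  then have "integrable (mu \<Otimes>\<^sub>M (gauss :: 'c measure)) (\<lambda>p. (norm (case p of (w, n) \<Rightarrow> (fst w, snd w + (1 / real j) *\<^sub>R n)))\<^sup>2)"
  proof (rule Bochner_Integration.integrable_bound)
    show "AE p in mu \<Otimes>\<^sub>M (gauss :: 'c measure). norm ((norm (case p of (w, n) \<Rightarrow> (fst w, snd w + (1 / real j) *\<^sub>R n)))\<^sup>2) \<le> norm (2 * (norm (fst p))\<^sup>2 + 2 * (norm (snd p))\<^sup>2)"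
    proof (rule AE_I2)
      fix p :: "('b \<times> 'c) \<times> 'c"
      obtain w n where p: "p = (w, n)" by (cases p)
      have "(fst w, snd w + (1 / real j) *\<^sub>R n) = w + (0, (1 / real j) *\<^sub>R n)" by (simp add: prod_eq_iff)
      then have "norm (fst w, snd w + (1 / real j) *\<^sub>R n) \<le> norm w + norm (0::'b, (1 / real j) *\<^sub>R n)"
        by (simp only: norm_triangle_ineq)
      also have "norm (0::'b, (1 / real j) *\<^sub>R n) \<le> norm n"
      proof -
        have "norm (0::'b, (1 / real j) *\<^sub>R n) = norm ((1 / real j) *\<^sub>R n)" by (simp only: norm_Pair) simp
        also have "\<dots> \<le> norm n" using j mult_left_mono[of 1 "real j" "norm n"] by (simp add: field_simps)
        finally show ?thesis .
      qed
      finally have "(norm (fst w, snd w + (1 / real j) *\<^sub>R n))\<^sup>2 \<le> (norm w + norm n)\<^sup>2" by (intro power_mono) auto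
      also have "\<dots> \<le> 2 * (norm w)\<^sup>2 + 2 * (norm n)\<^sup>2"
        using zero_le_power2[of "norm w - norm n"] unfolding power2_diff power2_sum by simp
      finally show "norm ((norm (case p of (w, n) \<Rightarrow> (fst w, snd w + (1 / real j) *\<^sub>R n)))\<^sup>2) \<le> norm (2 * (norm (fst p))\<^sup>2 + 2 * (norm (snd p))\<^sup>2)"
        by (simp add: p)
    qed
  qed measurable
  then show ?thesis unfolding kap_def
    by (subst integrable_distr_eq[OF kap_map_measurable]) auto
qed

end

section \<open>The derivative bound for smooth functions\<close>

lemma integral_pair_mult:
  fixes A :: "'x \<Rightarrow> real" and B :: "'y \<Rightarrow> real"
  assumes M: "prob_space M" and N: "prob_space N"
    and [measurable]: "A \<in> borel_measurable M" "B \<in> borel_measurable N"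
    and a: "\<And>x. \<bar>A x\<bar> \<le> a" and b: "\<And>y. \<bar>B y\<bar> \<le> b"
  shows "integrable (M \<Otimes>\<^sub>M N) (\<lambda>p. A (fst p) * B (snd p))"
    and "(\<integral>p. A (fst p) * B (snd p) \<partial>(M \<Otimes>\<^sub>M N)) = (\<integral>x. A x \<partial>M) * (\<integral>y. B y \<partial>N)"
proof -
  interpret M: prob_space M by fact
  interpret N: prob_space N by fact
  interpret MN: pair_prob_space M N ..
  show i: "integrable (M \<Otimes>\<^sub>M N) (\<lambda>p. A (fst p) * B (snd p))"
  proof (rule MN.integrable_const_bound[where B="a * b"])
    show "AE p in M \<Otimes>\<^sub>M N. norm (A (fst p) * B (snd p)) \<le> a * b"
    proof (rule AE_I2)
      fix p :: "'x \<times> 'y"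
      have "0 \<le> a" using a[of "fst p"] by linarith
      then show "norm (A (fst p) * B (snd p)) \<le> a * b"
        unfolding real_norm_def abs_mult using a b by (intro mult_mono) auto
    qed
  qed measurable
  show "(\<integral>p. A (fst p) * B (snd p) \<partial>(M \<Otimes>\<^sub>M N)) = (\<integral>x. A x \<partial>M) * (\<integral>y. B y \<partial>N)"
    by (subst MN.integral_fst'[OF i, symmetric]) simp
qed

context step2_group
begin

lemma taylor_continuous:
  assumes t: "taylor F D C"
  shows "continuous_on UNIV F"
proof (rule continuous_on_sequentiallyI)
  fix x :: "nat \<Rightarrow> 'b \<times> 'c" and a
  assume x: "x \<longlonglongrightarrow> a"
  define k where "k n = - a \<odot> x n" for n
  have xk: "x n = a \<odot> k n" for n by (simp add: k_def gm_assoc[symmetric])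
  have "continuous_on UNIV (\<lambda>y. - a \<odot> y)" by (intro continuous_intros)
  then have "(\<lambda>n. - a \<odot> x n) \<longlonglongrightarrow> - a \<odot> a"
    by (rule continuous_on_tendsto_compose[OF _ x]) auto
  then have k: "k \<longlonglongrightarrow> 0" by (simp add: k_def[abs_def])
  have "(\<lambda>n. F (x n) - F a) \<longlonglongrightarrow> 0"
  proof (rule Lim_null_comparison)
    show "\<forall>\<^sub>F n in sequentially. norm (F (x n) - F a) \<le> norm (D a) * norm (k n) + C * (norm (k n))\<^sup>2"
    proof (intro always_eventually allI)
      fix n
      show "norm (F (x n) - F a) \<le> norm (D a) * norm (k n) + C * (norm (k n))\<^sup>2"
        using taylorD[OF t, of a "k n"] Cauchy_Schwarz_ineq2[of "D a" "k n"] by (simp add: xk)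
    qed
    have "(\<lambda>n. norm (D a) * norm (k n) + C * (norm (k n))\<^sup>2) \<longlonglongrightarrow> norm (D a) * norm (0 :: 'b \<times> 'c) + C * (norm (0 :: 'b \<times> 'c))\<^sup>2"
      by (intro tendsto_intros k)
    then show "(\<lambda>n. norm (D a) * norm (k n) + C * (norm (k n))\<^sup>2) \<longlonglongrightarrow> 0" by simp
  qed
  then show "(\<lambda>n. F (x n)) \<longlonglongrightarrow> F a" by (simp add: LIM_zero_iff)
qed

end

context stable_law
begin

interpretation mg: pair_prob_space mu "gauss :: 'c measure" ..

text \<open>The cut-off makes the test of the entropy inequality bounded; it is symmetric, so the
  mean stays zero.\<close>

definition chi :: "real \<Rightarrow> 'b \<Rightarrow> 'b \<times> 'c \<Rightarrow> real" where
  "chi r u v = (fst v \<bullet> u) * indicator {v. norm (fst v) \<le> r} v"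

lemma chi_measurable [measurable]: "chi r u \<in> borel_measurable borel"
  unfolding chi_def[abs_def] by measurable

lemma chi_bound:
  assumes "0 \<le> r"
  shows "\<bar>chi r u v\<bar> \<le> norm u * r"
proof (cases "norm (fst v) \<le> r")
  case True
  have "\<bar>fst v \<bullet> u\<bar> \<le> norm (fst v) * norm u" by (rule Cauchy_Schwarz_ineq2)
  also have "\<dots> \<le> r * norm u" using True by (intro mult_right_mono) auto
  finally show ?thesis using True by (simp add: chi_def mult.commute)
qed (use assms in \<open>simp add: chi_def\<close>)

lemma integral_lam_fst:
  fixes h :: "'b \<Rightarrow> real"
  assumes [measurable]: "h \<in> borel_measurable borel"
  shows "(\<integral>v. h (fst v) \<partial>lam j) = (\<integral>w. h (sqrt (1 / real j) *\<^sub>R fst w) \<partial>mu)"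
proof -
  have "(\<integral>v. h (fst v) \<partial>lam j) = (\<integral>p. h (fst (case p of (w, n) \<Rightarrow> (sqrt (1 / real j) *\<^sub>R fst w, (1 / real j) *\<^sub>R snd w + (1 / real j * vnoise j) *\<^sub>R n))) \<partial>(mu \<Otimes>\<^sub>M gauss))"
    unfolding lam_def by (rule integral_distr[OF lam_map_measurable]) measurable
  also have "\<dots> = (\<integral>p. h (sqrt (1 / real j) *\<^sub>R fst (fst p)) \<partial>(mu \<Otimes>\<^sub>M (gauss :: 'c measure)))"
    by (simp add: split_beta')
  also have "\<dots> = (\<integral>w. h (sqrt (1 / real j) *\<^sub>R fst w) \<partial>mu)"
    by (rule integral_pair_fst(2)) (auto intro: mu.sigma_finite_measure_axioms prob_space_gauss)
  finally show ?thesis .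
qed

lemma integral_chi:
  assumes j: "1 \<le> j"
  shows "(\<integral>v. chi r u v \<partial>lam j) = 0"
proof -
  let ?e = "sqrt (1 / real j)"
  have e: "?e > 0" using j by simp
  have "(\<integral>v. chi r u v \<partial>lam j) = (\<integral>v. (fst v \<bullet> u) * indicator {b. norm b \<le> r} (fst v) \<partial>lam j)"
    by (simp add: chi_def indicator_def)
  also have "\<dots> = (\<integral>w. (?e *\<^sub>R fst w \<bullet> u) * indicator {b. norm b \<le> r} (?e *\<^sub>R fst w) \<partial>mu)"
    by (rule integral_lam_fst) measurable
  also have "\<dots> = (\<integral>w. ?e * ((fst w \<bullet> u) * indicator {w. norm (fst w) \<le> r / ?e} w) \<partial>mu)"
    using e by (intro Bochner_Integration.integral_cong) (auto simp: indicator_def pos_le_divide_eq mult.commute simp del: real_sqrt_divide)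
  also have "\<dots> = 0" using odd[of u "r / ?e"] by simp
  finally show ?thesis .
qed

lemma integrable_covariance: "integrable mu (\<lambda>w. (fst w \<bullet> u) * (fst w \<bullet> v))"
proof (rule Bochner_Integration.integrable_bound)
  show "integrable mu (\<lambda>w. norm u * norm v * (norm w)\<^sup>2)" using moment2 by simp
  show "AE w in mu. norm ((fst w \<bullet> u) * (fst w \<bullet> v)) \<le> norm (norm u * norm v * (norm w)\<^sup>2)"
  proof (rule AE_I2)
    fix w :: "'b \<times> 'c"
    have n: "norm (fst w) \<le> norm w" using norm_fst_le[of "fst w" "snd w"] by simp
    have "\<bar>fst w \<bullet> u\<bar> \<le> norm w * norm u" for u
      using Cauchy_Schwarz_ineq2[of "fst w" u] mult_right_mono[OF n, of "norm u"] by simp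
    then have "\<bar>fst w \<bullet> u\<bar> * \<bar>fst w \<bullet> v\<bar> \<le> (norm w * norm u) * (norm w * norm v)" by (intro mult_mono) auto
    then show "norm ((fst w \<bullet> u) * (fst w \<bullet> v)) \<le> norm (norm u * norm v * (norm w)\<^sup>2)"
      by (simp add: abs_mult power2_eq_square ac_simps)
  qed
qed measurable

lemma integral_chi_sq_le:
  assumes j: "1 \<le> j"
  shows "(\<integral>v. (chi r u v)\<^sup>2 \<partial>lam j) \<le> (1 / real j) * (tau * (norm u)\<^sup>2)"
proof -
  let ?e = "sqrt (1 / real j)"
  have "(\<integral>v. (chi r u v)\<^sup>2 \<partial>lam j) = (\<integral>v. ((fst v \<bullet> u) * indicator {b. norm b \<le> r} (fst v))\<^sup>2 \<partial>lam j)"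
    by (simp add: chi_def indicator_def)
  also have "\<dots> = (\<integral>w. ((?e *\<^sub>R fst w \<bullet> u) * indicator {b. norm b \<le> r} (?e *\<^sub>R fst w))\<^sup>2 \<partial>mu)"
    by (rule integral_lam_fst) measurable
  also have "\<dots> \<le> (\<integral>w. (1 / real j) * ((fst w \<bullet> u) * (fst w \<bullet> u)) \<partial>mu)"
  proof (rule integral_mono')
    show "integrable mu (\<lambda>w. (1 / real j) * ((fst w \<bullet> u) * (fst w \<bullet> u)))"
      using integrable_covariance by simp
    fix w
    have "((?e *\<^sub>R fst w \<bullet> u) * indicator {b. norm b \<le> r} (?e *\<^sub>R fst w))\<^sup>2 \<le> (?e *\<^sub>R fst w \<bullet> u)\<^sup>2"
      by (auto simp: indicator_def)
    also have "\<dots> = (1 / real j) * ((fst w \<bullet> u) * (fst w \<bullet> u))"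
      using j by (simp add: power_mult_distrib power2_eq_square[of "fst w \<bullet> u"] real_sqrt_pow2 del: real_sqrt_divide)
    finally show "((?e *\<^sub>R fst w \<bullet> u) * indicator {b. norm b \<le> r} (?e *\<^sub>R fst w))\<^sup>2 \<le> (1 / real j) * ((fst w \<bullet> u) * (fst w \<bullet> u))" .
  qed auto
  also have "\<dots> = (1 / real j) * (tau * (norm u)\<^sup>2)"
    using covariance[of u u] by (simp add: power2_norm_eq_inner)
  finally show ?thesis .
qed

text \<open>The test is \<open>c\<close> times the centred value of \<open>f\<close> times
  \<open>chi\<close>. Under the product of the marginals the linear term of the exponential
  factorises and vanishes because \<open>chi\<close> has mean zero; the quadratic term is a
  variance-like integral times the second moment of \<open>chi\<close>. The last summand is the
  entropy gain of the dilation by \<open>bscale j\<close>.\<close>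

lemma entropy_step:
  assumes f [measurable]: "f \<in> borel_measurable borel" and M: "\<And>g. \<bar>f g\<bar> \<le> M" and m: "\<bar>m\<bar> \<le> M"
    and c: "0 \<le> c" and r: "0 \<le> r" and j: "1 \<le> j"
  shows "c * (\<integral>v. (avg (kap j) f (g \<odot> v) - m) * chi r u v \<partial>lam j)
    \<le> exp (c * (2 * M) * (norm u * r)) / 2 * c\<^sup>2 * (\<integral>w. (f (g \<odot> dil (bscale j) w) - m)\<^sup>2 \<partial>kap j) * ((1 / real j) * (tau * (norm u)\<^sup>2))
      + hdim * ln (bscale j)"
proof -
  interpret K: prob_space "kap j" by (rule prob_space_kap)
  interpret L: prob_space "lam j" by (rule prob_space_lam)
  interpret LK: pair_prob_space "lam j" "kap j" ..
  obtain C where C: "C > 0" "\<And>A. A \<in> sets borel \<Longrightarrow> emeasure (kap j) A \<le> ennreal C * emeasure lborel A"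
    using kap_le_lborel[OF j] by blast
  obtain p where p: "p \<in> borel_measurable borel" "\<And>x. 0 \<le> p x" "kap j = density lborel p" "integrable (kap j) (\<lambda>w. ln (p w))"
    using exists_log_integrable_density[OF prob_space_kap sets_kap C kap_moment2[OF j]] by blast
  define T where "T s v = c * ((f (g \<odot> s) - m) * chi r u v)" for s v
  have fm: "\<bar>f x - m\<bar> \<le> 2 * M" for x using M[of x] m by linarith
  have M0: "0 \<le> M" using M[of 0] by linarith
  define d where "d = c * (2 * M) * (norm u * r)"
  have TC: "\<bar>T s v\<bar> \<le> d" for s v
  proof -
    have "\<bar>T s v\<bar> = c * (\<bar>f (g \<odot> s) - m\<bar> * \<bar>chi r u v\<bar>)" using c by (simp add: T_def abs_mult)
    also have "\<dots> \<le> c * ((2 * M) * (norm u * r))"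
      using c M0 by (intro mult_left_mono mult_mono fm chi_bound r) auto
    finally show ?thesis by (simp add: d_def)
  qed
  have Tm: "(\<lambda>(s, v). T s v) \<in> borel_measurable (borel \<Otimes>\<^sub>M borel)"
    unfolding T_def by measurable
  have Tm' [measurable]: "(\<lambda>x. T (a x) (b x)) \<in> borel_measurable N"
    if [measurable]: "a \<in> borel_measurable N" "b \<in> borel_measurable N" for a b and N :: "'z measure"
    unfolding T_def by measurable
  have main: "(\<integral>(v, w). T (v \<odot> w) v \<partial>(lam j \<Otimes>\<^sub>M kap j)) \<le> (\<integral>(v, w). exp (T (dil (bscale j) w) v) - 1 \<partial>(lam j \<Otimes>\<^sub>M kap j)) + hdim * ln (bscale j)"
    by (rule entropy_inequality[OF p(1,2,3) prob_space_kap p(4) prob_space_lam sets_lam bscale_pos lam_kap_law[OF j] Tm TC])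
  have i1: "integrable (lam j \<Otimes>\<^sub>M kap j) (\<lambda>p. T (fst p \<odot> snd p) (fst p))"
    by (rule LK.integrable_const_bound[where B=d]) (use TC in auto)
  have lhs: "(\<integral>(v, w). T (v \<odot> w) v \<partial>(lam j \<Otimes>\<^sub>M kap j)) = c * (\<integral>v. (avg (kap j) f (g \<odot> v) - m) * chi r u v \<partial>lam j)"
  proof -
    have "(\<integral>(v, w). T (v \<odot> w) v \<partial>(lam j \<Otimes>\<^sub>M kap j)) = (\<integral>v. \<integral>w. T (v \<odot> w) v \<partial>kap j \<partial>lam j)"
      using LK.integral_fst'[OF i1] by (simp add: split_beta')
    also have "\<dots> = (\<integral>v. c * ((avg (kap j) f (g \<odot> v) - m) * chi r u v) \<partial>lam j)"
    proof (intro Bochner_Integration.integral_cong refl)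
      fix v
      have "integrable (kap j) (\<lambda>w. f (g \<odot> v \<odot> w))" by (rule avg_bound(2)[OF f M prob_space_kap sets_kap])
      then show "(\<integral>w. T (v \<odot> w) v \<partial>kap j) = c * ((avg (kap j) f (g \<odot> v) - m) * chi r u v)"
        by (simp add: T_def avg_def gm_assoc[symmetric] K.prob_space)
    qed
    finally show ?thesis by simp
  qed
  define B where "B w = f (g \<odot> dil (bscale j) w) - m" for w
  have [measurable]: "B \<in> borel_measurable borel" unfolding B_def by measurable
  have Bb: "\<bar>B w\<bar> \<le> 2 * M" for w by (simp add: B_def fm)
  have Tb: "T (dil (bscale j) w) v = c * (chi r u v * B w)" for v w by (simp add: T_def B_def)
  have B2: "\<bar>(B w)\<^sup>2\<bar> \<le> (2 * M)\<^sup>2" for w using power_mono[OF Bb[of w], of 2] by simp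
  have c2: "\<bar>(chi r u v)\<^sup>2\<bar> \<le> (norm u * r)\<^sup>2" for v using power_mono[OF chi_bound[OF r, of u v], of 2] by simp
  have cm [measurable]: "chi r u \<in> borel_measurable (lam j)" "(\<lambda>v. (chi r u v)\<^sup>2) \<in> borel_measurable (lam j)" "B \<in> borel_measurable (kap j)" "(\<lambda>w. (B w)\<^sup>2) \<in> borel_measurable (kap j)"
    by measurable
  note P1 = integral_pair_mult[OF prob_space_lam prob_space_kap cm(1) cm(3) chi_bound[OF r] Bb]
  note P2 = integral_pair_mult[OF prob_space_lam prob_space_kap cm(2) cm(4) c2 B2]
  have "(\<integral>(v, w). exp (T (dil (bscale j) w) v) - 1 \<partial>(lam j \<Otimes>\<^sub>M kap j))
      \<le> (\<integral>p. c * (chi r u (fst p) * B (snd p)) + exp d / 2 * c\<^sup>2 * ((chi r u (fst p))\<^sup>2 * (B (snd p))\<^sup>2) \<partial>(lam j \<Otimes>\<^sub>M kap j))"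
  proof (rule integral_mono)
    have e: "exp (T s v) \<le> exp d" for s v using TC[of s v] by auto
    have e': "\<bar>exp (T s v) - 1\<bar> \<le> exp d + 1" for s v
      using e[of s v] exp_gt_zero[of "T s v"] exp_gt_zero[of d] by linarith
    show "integrable (lam j \<Otimes>\<^sub>M kap j) (\<lambda>(v, w). exp (T (dil (bscale j) w) v) - 1)"
      by (rule LK.integrable_const_bound[where B="exp d + 1"]) (use e' in \<open>auto simp: split_beta'\<close>)
    show "integrable (lam j \<Otimes>\<^sub>M kap j) (\<lambda>p. c * (chi r u (fst p) * B (snd p)) + exp d / 2 * c\<^sup>2 * ((chi r u (fst p))\<^sup>2 * (B (snd p))\<^sup>2))"
      by (intro Bochner_Integration.integrable_add integrable_mult_right P1(1) P2(1))
    fix x :: "('b \<times> 'c) \<times> ('b \<times> 'c)"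
    show "(case x of (v, w) \<Rightarrow> exp (T (dil (bscale j) w) v) - 1) \<le> c * (chi r u (fst x) * B (snd x)) + exp d / 2 * c\<^sup>2 * ((chi r u (fst x))\<^sup>2 * (B (snd x))\<^sup>2)"
      using exp_quadratic_upper[OF TC[of "dil (bscale j) (snd x)" "fst x"]]
      by (simp add: split_beta' Tb power_mult_distrib)
  qed
  also have "\<dots> = exp d / 2 * c\<^sup>2 * ((\<integral>v. (chi r u v)\<^sup>2 \<partial>lam j) * (\<integral>w. (B w)\<^sup>2 \<partial>kap j))"
    by (subst Bochner_Integration.integral_add) (use P1 P2 integral_chi[OF j, of r u] in simp_all)
  also have "\<dots> \<le> exp d / 2 * c\<^sup>2 * (((1 / real j) * (tau * (norm u)\<^sup>2)) * (\<integral>w. (B w)\<^sup>2 \<partial>kap j))"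
    by (intro mult_left_mono mult_right_mono integral_chi_sq_le j) auto
  finally show ?thesis using main lhs by (simp add: B_def d_def ac_simps)
qed

lemma vnoise_le: assumes j: "1 \<le> j" shows "vnoise j \<le> 2"
proof -
  have "(bscale j)\<^sup>2 \<le> 2" using j by (simp add: bscale_sq)
  then have "((bscale j)\<^sup>2)\<^sup>2 \<le> 2\<^sup>2" by (intro power_mono) auto
  then have "(vnoise j)\<^sup>2 \<le> 2\<^sup>2" by (simp add: vnoise_sq power_even_eq[symmetric])
  then show ?thesis by (rule power2_le_imp_le) simp
qed

text \<open>The smoothing bias is of order \<open>1/j\<close> because \<open>f\<close> varies at
  most linearly under small vertical steps. Multiplied by \<open>chi\<close>, of size
  \<open>1 / sqrt j\<close> under \<open>lam j\<close>, it is negligible against a main term of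
  order \<open>1/j\<close>.\<close>

lemma avg_kap_close:
  assumes f [measurable]: "f \<in> borel_measurable borel" and M: "\<And>g. \<bar>f g\<bar> \<le> M" and t: "taylor f D C"
  obtains C1 where "C1 \<ge> 0" "\<And>j h. 1 \<le> j \<Longrightarrow> \<bar>avg (kap j) f h - avg mu f h\<bar> \<le> C1 / real j"
proof -
  have Dg: "norm (D g) \<le> 2 * M + C" for g
    by (rule taylor_local(1)[where F=f, OF M taylorD[OF t]])
  have M0: "0 \<le> M" using M[of 0] by linarith
  have C0: "0 \<le> C"
  proof -
    obtain k :: "'b \<times> 'c" where k: "norm k = 1" by (rule vector_choose_size[OF zero_le_one])
    then show ?thesis using taylorD[OF t, of 0 k] by auto
  qed
  let ?P = "mu \<Otimes>\<^sub>M (gauss :: 'c measure)"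
  define L where "L = 2 * M + 2 * C"
  have L0: "0 \<le> L" using M0 C0 by (simp add: L_def)
  define I where "I = (\<integral>p. L * (1 + (norm (snd p))\<^sup>2) \<partial>?P)"
  have ii: "integrable ?P (\<lambda>p. L * (1 + (norm (snd p))\<^sup>2))"
    using integrable_pair_norms(2) by auto
  show ?thesis
  proof (rule that[of I])
    show "I \<ge> 0" unfolding I_def using L0 by (intro Bochner_Integration.integral_nonneg) auto
    fix j :: nat and h assume j: "1 \<le> j"
    let ?e = "1 / real j"
    have e: "0 < ?e" "?e \<le> 1" using j by auto
    have eq: "h \<odot> (fst w, snd w + ?e *\<^sub>R n) = h \<odot> w \<odot> (0, ?e *\<^sub>R n)" for w :: "'b \<times> 'c" and n
      by (simp add: gm_def zero_right)
    have "avg (kap j) f h = (\<integral>p. f (h \<odot> (case p of (w, n) \<Rightarrow> (fst w, snd w + ?e *\<^sub>R n))) \<partial>?P)"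
      unfolding avg_def kap_def by (rule integral_distr[OF kap_map_measurable]) measurable
    then have a1: "avg (kap j) f h = (\<integral>p. f (h \<odot> fst p \<odot> (0, ?e *\<^sub>R snd p)) \<partial>?P)"
      by (simp add: split_beta' eq)
    have a2: "avg mu f h = (\<integral>p. f (h \<odot> fst p) \<partial>?P)"
      unfolding avg_def by (rule integral_pair_fst(2)[symmetric]) (auto intro: mu.sigma_finite_measure_axioms prob_space_gauss)
    have i1: "integrable ?P (\<lambda>p. f (h \<odot> fst p \<odot> (0, ?e *\<^sub>R snd p)))" "integrable ?P (\<lambda>p. f (h \<odot> fst p))"
      by (rule mg.integrable_const_bound[where B=M]; use M in auto)+
    have "\<bar>avg (kap j) f h - avg mu f h\<bar> = \<bar>\<integral>p. f (h \<odot> fst p \<odot> (0, ?e *\<^sub>R snd p)) - f (h \<odot> fst p) \<partial>?P\<bar>"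
      unfolding a1 a2 using i1 by simp
    also have "\<dots> \<le> (\<integral>p. \<bar>f (h \<odot> fst p \<odot> (0, ?e *\<^sub>R snd p)) - f (h \<odot> fst p)\<bar> \<partial>?P)" by (rule integral_abs_bound)
    also have "\<dots> \<le> (\<integral>p. ?e * (L * (1 + (norm (snd p))\<^sup>2)) \<partial>?P)"
    proof (rule integral_mono)
      fix p :: "('b \<times> 'c) \<times> 'c"
      let ?k = "(0, ?e *\<^sub>R snd p) :: 'b \<times> 'c"
      define N where "N = norm (snd p)"
      have nk: "norm ?k = ?e * N" using e by (simp add: N_def norm_Pair)
      have N0: "0 \<le> N" by (simp add: N_def)
      have N1: "N \<le> 1 + N\<^sup>2"
      proof -
        have "2 * N \<le> 1 + N\<^sup>2" using zero_le_power2[of "N - 1"] unfolding power2_diff by simp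
        then show ?thesis using N0 by linarith
      qed
      have "\<bar>f (h \<odot> fst p \<odot> ?k) - f (h \<odot> fst p)\<bar> \<le> norm (D (h \<odot> fst p)) * norm ?k + C * (norm ?k)\<^sup>2"
        using taylorD[OF t, of "h \<odot> fst p" ?k] Cauchy_Schwarz_ineq2[of "D (h \<odot> fst p)" ?k] by linarith
      also have "\<dots> \<le> (2 * M + C) * (?e * N) + C * (?e * N)\<^sup>2"
        unfolding nk using N0 e by (intro add_mono mult_right_mono Dg) auto
      also have "(?e * N)\<^sup>2 \<le> ?e * N\<^sup>2"
      proof -
        have "?e * ?e \<le> ?e * 1" using e by (intro mult_left_mono) auto
        then have "?e * ?e * N\<^sup>2 \<le> ?e * N\<^sup>2" by (intro mult_right_mono) auto
        then show ?thesis by (simp only: power_mult_distrib power2_eq_square[of ?e])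
      qed
      then have "(?e * N)\<^sup>2 \<le> ?e * (1 + N\<^sup>2)"
        by (rule order_trans) (use e in \<open>intro mult_left_mono; simp\<close>)
      then have "(2 * M + C) * (?e * N) + C * (?e * N)\<^sup>2 \<le> (2 * M + C) * (?e * (1 + N\<^sup>2)) + C * (?e * (1 + N\<^sup>2))"
        using M0 C0 e N1 by (intro add_mono mult_left_mono) auto
      also have "\<dots> = ?e * (L * (1 + N\<^sup>2))"
      proof -
        have "(2 * M + C) * (x * y) + C * (x * y) = x * ((2 * M + 2 * C) * y)" for x y :: real
          by (simp add: algebra_simps)
        then show ?thesis unfolding L_def .
      qed
      finally show "\<bar>f (h \<odot> fst p \<odot> ?k) - f (h \<odot> fst p)\<bar> \<le> ?e * (L * (1 + (norm (snd p))\<^sup>2))" by (simp add: N_def)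
    qed (use i1 ii in auto)
    also have "\<dots> = ?e * I" unfolding I_def by (rule integral_mult_right_zero)
    finally show "\<bar>avg (kap j) f h - avg mu f h\<bar> \<le> I / real j" by simp
  qed
qed

text \<open>Under \<open>lam j\<close> the horizontal increment has size \<open>sqrt e\<close> with
  \<open>e = 1/j\<close>, so the linear term times \<open>chi\<close> is of order \<open>e\<close>
  and integrates to the covariance. Everything else is smaller by a factor \<open>sqrt e\<close>;
  dominated convergence on the fixed space \<open>?P\<close> makes this precise.\<close>

lemma first_order:
  assumes f [measurable]: "f \<in> borel_measurable borel" and M: "\<And>g. \<bar>f g\<bar> \<le> M" and tf: "taylor f Df Cf"
    and t: "taylor (avg mu f) D C"
  shows "(\<lambda>i. real (Suc i) * (\<integral>v. (avg (kap (Suc i)) f (g \<odot> v) - avg mu f g) * chi (sqrt (sqrt (1 / real (Suc i)))) u v \<partial>lam (Suc i)))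
    \<longlonglongrightarrow> tau * (fst (D g) \<bullet> u)"
proof -
  let ?P = "mu \<Otimes>\<^sub>M (gauss :: 'c measure)"
  obtain C1 where C1: "C1 \<ge> 0" "\<And>j h. 1 \<le> j \<Longrightarrow> \<bar>avg (kap j) f h - avg mu f h\<bar> \<le> C1 / real j"
    using avg_kap_close[OF f M tf] by blast
  have C0: "0 \<le> C"
  proof -
    obtain k :: "'b \<times> 'c" where k: "norm k = 1" by (rule vector_choose_size[OF zero_le_one])
    then show ?thesis using taylorD[OF t, of 0 k] by auto
  qed
  define e where "e i = 1 / real (Suc i)" for i
  have e0: "0 < e i" "e i \<le> 1" for i by (auto simp: e_def)
  have es: "sqrt (e i) * sqrt (e i) = e i" for i using e0[of i] by simp
  have sq1: "sqrt (e i) \<le> 1" for i using e0[of i] by simp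
  have sq0: "0 < sqrt (e i)" for i using e0[of i] by simp
  have et: "e \<longlonglongrightarrow> 0" unfolding e_def[abs_def] by (rule LIMSEQ_Suc) (rule lim_1_over_n)
  have set0: "(\<lambda>i. sqrt (e i)) \<longlonglongrightarrow> 0" using tendsto_real_sqrt[OF et] by simp
  \<comment> \<open>The fourth root of the step: it tends to 0, as the exponential factor requires,
    but slower than the increments of size \<open>sqrt e\<close>, so the truncation disappears
    pointwise.\<close>
  define r where "r i = sqrt (sqrt (e i))" for i
  have r1: "0 < r i" "r i \<le> 1" for i using e0[of i] by (auto simp: r_def)
  have rr: "r i * r i = sqrt (e i)" for i using e0[of i] by (simp add: r_def)
  define V where "V i p = (sqrt (e i) *\<^sub>R fst (fst p), e i *\<^sub>R snd (fst p) + (e i * vnoise (Suc i)) *\<^sub>R snd p)" for i and p :: "('b \<times> 'c) \<times> 'c"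
  define Phi where "Phi i p = real (Suc i) * ((avg (kap (Suc i)) f (g \<odot> V i p) - avg mu f g) * chi (r i) u (V i p))" for i p
  define one where "one i p = (indicator {v. norm (fst v) \<le> r i} (V i p) :: real)" for i p
  define Y where "Y p = (fst (D g) \<bullet> fst (fst p)) * (fst (fst p) \<bullet> u)" for p :: "('b \<times> 'c) \<times> 'c"
  define S where "S p = norm (fst p) + 2 * norm (snd p)" for p :: "('b \<times> 'c) \<times> 'c"
  have Vm [measurable]: "V i \<in> borel_measurable ?P" for i
    unfolding V_def[abs_def] by measurable
  have km [measurable]: "avg (kap j) f \<in> borel_measurable borel" for j
    by (rule avg_measurable[OF f prob_space_kap sets_kap])
  have S0: "0 \<le> S p" for p by (simp add: S_def)
  have b1: "norm (fst (fst p)) \<le> S p" for p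
    using norm_fst_le[of "fst (fst p)" "snd (fst p)"] by (simp add: S_def) (metis add.commute add_increasing mult_nonneg_nonneg norm_ge_zero zero_le_numeral)
  have ySp: "norm (snd (fst p) + vnoise (Suc i) *\<^sub>R snd p) \<le> S p" for i p
  proof -
    have "norm (snd (fst p) + vnoise (Suc i) *\<^sub>R snd p) \<le> norm (snd (fst p)) + vnoise (Suc i) * norm (snd p)"
      using norm_triangle_ineq[of "snd (fst p)" "vnoise (Suc i) *\<^sub>R snd p"] vnoise_nonneg[of "Suc i"] by simp
    also have "\<dots> \<le> norm (fst p) + 2 * norm (snd p)"
      using norm_snd_le[of "snd (fst p)" "fst (fst p)"] vnoise_le[of "Suc i"] by (intro add_mono mult_right_mono) auto
    finally show ?thesis by (simp add: S_def)
  qed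
  have VS: "(norm (V i p))\<^sup>2 \<le> 2 * (e i * (S p)\<^sup>2)" for i p
  proof -
    have "snd (V i p) = e i *\<^sub>R (snd (fst p) + vnoise (Suc i) *\<^sub>R snd p)" by (simp add: V_def scaleR_add_right)
    then have "norm (snd (V i p)) \<le> e i * S p" using ySp[of p i] e0[of i] by simp
    then have "(norm (snd (V i p)))\<^sup>2 \<le> (e i * S p)\<^sup>2" by (intro power_mono) auto
    also have "\<dots> \<le> e i * (S p)\<^sup>2"
      using e0[of i] by (simp add: power_mult_distrib power2_eq_square[of "e i"] mult_left_le mult_right_mono)
    finally have a: "(norm (snd (V i p)))\<^sup>2 \<le> e i * (S p)\<^sup>2" .
    have "(norm (fst (V i p)))\<^sup>2 = e i * (norm (fst (fst p)))\<^sup>2" using e0[of i] by (simp add: V_def power_mult_distrib)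
    also have "\<dots> \<le> e i * (S p)\<^sup>2" using e0[of i] b1[of p] by (intro mult_left_mono power_mono) auto
    finally have "(norm (fst (V i p)))\<^sup>2 \<le> e i * (S p)\<^sup>2" .
    with a show ?thesis by (simp add: norm_prod_def)
  qed
  define R where "R i p = avg (kap (Suc i)) f (g \<odot> V i p) - avg mu f g - D g \<bullet> V i p" for i p
  have Rb: "\<bar>R i p\<bar> \<le> C1 * e i + 2 * C * (e i * (S p)\<^sup>2)" for i p
  proof -
    have "\<bar>R i p\<bar> \<le> C1 * e i + C * (norm (V i p))\<^sup>2"
      using C1(2)[of "Suc i" "g \<odot> V i p"] taylorD[OF t, of g "V i p"] by (simp add: R_def e_def)
    also have "C * (norm (V i p))\<^sup>2 \<le> C * (2 * (e i * (S p)\<^sup>2))" using VS C0 by (intro mult_left_mono) auto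
    finally show ?thesis by simp
  qed
  have chiV: "chi (r i) u (V i p) = sqrt (e i) * ((fst (fst p) \<bullet> u) * one i p)" for i p
    by (simp add: chi_def one_def V_def)
  have DV: "D g \<bullet> V i p = sqrt (e i) * (fst (D g) \<bullet> fst (fst p)) + e i * (snd (D g) \<bullet> (snd (fst p) + vnoise (Suc i) *\<^sub>R snd p))" for i p
    by (simp add: V_def inner_prod_def inner_add_right algebra_simps)
  define err where "err i p = (sqrt (e i) * (snd (D g) \<bullet> (snd (fst p) + vnoise (Suc i) *\<^sub>R snd p)) + R i p / sqrt (e i)) * ((fst (fst p) \<bullet> u) * one i p)" for i p
  have PhiE: "Phi i p = Y p * one i p + err i p" for i p
  proof -
    have ie: "real (Suc i) = 1 / (sqrt (e i) * sqrt (e i))" by (simp only: es) (simp add: e_def)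
    have "Phi i p = (1 / (sqrt (e i) * sqrt (e i))) * ((D g \<bullet> V i p + R i p) * (sqrt (e i) * ((fst (fst p) \<bullet> u) * one i p)))"
      unfolding Phi_def chiV ie by (simp add: R_def)
    also have "\<dots> = (D g \<bullet> V i p + R i p) / sqrt (e i) * ((fst (fst p) \<bullet> u) * one i p)"
    proof -
      have "(1 / (s * s)) * (X * (s * Z)) = X / s * Z" if "s > 0" for s X Z :: real
        using that by (simp add: field_simps)
      then show ?thesis using sq0[of i] by blast
    qed
    also have "(D g \<bullet> V i p + R i p) / sqrt (e i) = (fst (D g) \<bullet> fst (fst p)) + sqrt (e i) * (snd (D g) \<bullet> (snd (fst p) + vnoise (Suc i) *\<^sub>R snd p)) + R i p / sqrt (e i)"
    proof -
      have "(x * a + (x * x) * b + c) / x = a + x * b + c / x" if "x > 0" for x a b c :: real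
        using that by (simp add: field_simps)
      from this[OF sq0[of i]] show ?thesis unfolding DV es .
    qed
    finally show ?thesis by (simp add: Y_def err_def algebra_simps)
  qed
  have ub: "\<bar>(fst (fst p) \<bullet> u) * one i p\<bar> \<le> norm u * S p" for i p
  proof -
    have "\<bar>fst (fst p) \<bullet> u\<bar> \<le> norm (fst (fst p)) * norm u" by (rule Cauchy_Schwarz_ineq2)
    also have "\<dots> \<le> S p * norm u" using b1 by (intro mult_right_mono) auto
    finally show ?thesis using S0[of p] by (simp add: one_def indicator_def mult.commute)
  qed
  \<comment> \<open>A second use of the truncation: one factor of the increment is bounded by a
    constant, so dominating the remainder takes second moments instead of third ones.\<close>
  have ub2: "sqrt (e i) * \<bar>(fst (fst p) \<bullet> u) * one i p\<bar> \<le> norm u" for i p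
  proof -
    have "\<bar>chi (r i) u (V i p)\<bar> \<le> norm u * r i" using r1[of i] by (intro chi_bound) auto
    also have "\<dots> \<le> norm u" using r1[of i] by (simp add: mult_left_le)
    finally show ?thesis unfolding chiV using sq0[of i] by (simp add: abs_mult)
  qed
  have errb: "\<bar>err i p\<bar> \<le> (norm (D g) * S p + C1) * (sqrt (e i) * \<bar>(fst (fst p) \<bullet> u) * one i p\<bar>) + 2 * C * (S p)\<^sup>2 * (sqrt (e i) * \<bar>(fst (fst p) \<bullet> u) * one i p\<bar>)" for i p
  proof -
    have d1: "\<bar>snd (D g) \<bullet> (snd (fst p) + vnoise (Suc i) *\<^sub>R snd p)\<bar> \<le> norm (D g) * S p"
    proof -
      have "\<bar>snd (D g) \<bullet> (snd (fst p) + vnoise (Suc i) *\<^sub>R snd p)\<bar> \<le> norm (snd (D g)) * norm (snd (fst p) + vnoise (Suc i) *\<^sub>R snd p)"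
        by (rule Cauchy_Schwarz_ineq2)
      also have "\<dots> \<le> norm (D g) * S p"
        using ySp norm_snd_le[of "snd (D g)" "fst (D g)"] by (intro mult_mono) auto
      finally show ?thesis .
    qed
    have "\<bar>R i p / sqrt (e i)\<bar> \<le> (C1 * e i + 2 * C * (e i * (S p)\<^sup>2)) / sqrt (e i)"
      using Rb[of i p] sq0[of i] by (simp add: abs_divide divide_right_mono)
    also have "\<dots> = C1 * (e i / sqrt (e i)) + 2 * C * (e i / sqrt (e i) * (S p)\<^sup>2)" by (simp add: add_divide_distrib)
    also have "e i / sqrt (e i) = sqrt (e i)" using real_div_sqrt[of "e i"] e0[of i] by simp
    finally have d2: "\<bar>R i p / sqrt (e i)\<bar> \<le> C1 * sqrt (e i) + 2 * C * (sqrt (e i) * (S p)\<^sup>2)" .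
    have "\<bar>sqrt (e i) * (snd (D g) \<bullet> (snd (fst p) + vnoise (Suc i) *\<^sub>R snd p)) + R i p / sqrt (e i)\<bar>
      \<le> sqrt (e i) * (norm (D g) * S p) + (C1 * sqrt (e i) + 2 * C * (sqrt (e i) * (S p)\<^sup>2))"
    proof (rule order_trans[OF abs_triangle_ineq add_mono[OF _ d2]])
      show "\<bar>sqrt (e i) * (snd (D g) \<bullet> (snd (fst p) + vnoise (Suc i) *\<^sub>R snd p))\<bar> \<le> sqrt (e i) * (norm (D g) * S p)"
        unfolding abs_mult using d1 e0[of i] by (intro mult_mono) auto
    qed
    then have "\<bar>err i p\<bar> \<le> (sqrt (e i) * (norm (D g) * S p) + (C1 * sqrt (e i) + 2 * C * (sqrt (e i) * (S p)\<^sup>2))) * \<bar>(fst (fst p) \<bullet> u) * one i p\<bar>"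
      unfolding err_def abs_mult[of "sqrt (e i) * (snd (D g) \<bullet> (snd (fst p) + vnoise (Suc i) *\<^sub>R snd p)) + R i p / sqrt (e i)"]
      by (intro mult_right_mono) auto
    then show ?thesis by (simp add: algebra_simps)
  qed
  have Sint: "integrable ?P (\<lambda>p. (S p)\<^sup>2)"
  proof (rule Bochner_Integration.integrable_bound)
    show "integrable ?P (\<lambda>p. 2 * (norm (fst p))\<^sup>2 + 8 * (norm (snd p))\<^sup>2)"
      using integrable_pair_norms by auto
    show "AE p in ?P. norm ((S p)\<^sup>2) \<le> norm (2 * (norm (fst p))\<^sup>2 + 8 * (norm (snd p))\<^sup>2)"
    proof (rule AE_I2)
      fix p :: "('b \<times> 'c) \<times> 'c"
      show "norm ((S p)\<^sup>2) \<le> norm (2 * (norm (fst p))\<^sup>2 + 8 * (norm (snd p))\<^sup>2)"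
        using zero_le_power2[of "norm (fst p) - 2 * norm (snd p)"] unfolding S_def power2_diff power2_sum
        by (simp add: power_mult_distrib)
    qed
  qed (unfold S_def[abs_def], measurable)
  define W where "W p = norm (D g) * norm u * (S p)\<^sup>2 + ((norm (D g) * (1 + (S p)\<^sup>2) + C1) * norm u + 2 * C * (S p)\<^sup>2 * norm u)" for p
  have Wint: "integrable ?P W" unfolding W_def using Sint by auto
  have dom: "norm (Phi i p) \<le> W p" for i p
  proof -
    have S1: "S p \<le> 1 + (S p)\<^sup>2"
    proof -
      have "2 * S p \<le> 1 + (S p)\<^sup>2" using zero_le_power2[of "S p - 1"] unfolding power2_diff by simp
      then show ?thesis using S0[of p] by linarith
    qed
    have "\<bar>Y p * one i p\<bar> \<le> norm (D g) * norm u * (S p)\<^sup>2"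
    proof -
      have "\<bar>fst (D g) \<bullet> fst (fst p)\<bar> \<le> norm (fst (D g)) * norm (fst (fst p))" by (rule Cauchy_Schwarz_ineq2)
      also have "\<dots> \<le> norm (D g) * S p" using b1[of p] norm_fst_le[of "fst (D g)" "snd (D g)"] by (intro mult_mono) auto
      finally have "\<bar>fst (D g) \<bullet> fst (fst p)\<bar> * \<bar>(fst (fst p) \<bullet> u) * one i p\<bar> \<le> (norm (D g) * S p) * (norm u * S p)"
        using S0[of p] by (intro mult_mono ub) auto
      then show ?thesis by (simp add: Y_def abs_mult power2_eq_square ac_simps)
    qed
    moreover have "\<bar>err i p\<bar> \<le> (norm (D g) * (1 + (S p)\<^sup>2) + C1) * norm u + 2 * C * (S p)\<^sup>2 * norm u"
    proof (rule order_trans[OF errb add_mono])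
      show "(norm (D g) * S p + C1) * (sqrt (e i) * \<bar>(fst (fst p) \<bullet> u) * one i p\<bar>) \<le> (norm (D g) * (1 + (S p)\<^sup>2) + C1) * norm u"
        using S0[of p] S1 C1(1) e0[of i] by (intro mult_mono ub2 add_mono mult_left_mono) (auto intro!: mult_nonneg_nonneg add_nonneg_nonneg)
      show "2 * C * (S p)\<^sup>2 * (sqrt (e i) * \<bar>(fst (fst p) \<bullet> u) * one i p\<bar>) \<le> 2 * C * (S p)\<^sup>2 * norm u"
        using C0 by (intro mult_left_mono ub2) auto
    qed
    ultimately show ?thesis unfolding PhiE W_def real_norm_def using abs_triangle_ineq[of "Y p * one i p" "err i p"] by linarith
  qed
  have lim: "(\<lambda>i. Phi i p) \<longlonglongrightarrow> Y p" for p
  proof -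
    have "\<forall>\<^sub>F i in sequentially. r i * norm (fst (fst p)) < 1"
    proof -
      have "r \<longlonglongrightarrow> 0" unfolding r_def[abs_def] using tendsto_real_sqrt[OF set0] by simp
      then have "(\<lambda>i. r i * norm (fst (fst p))) \<longlonglongrightarrow> 0" by (rule tendsto_mult_left_zero)
      then show ?thesis by (rule order_tendstoD) simp
    qed
    then have "\<forall>\<^sub>F i in sequentially. one i p = 1"
    proof eventually_elim
      case (elim i)
      have "sqrt (e i) * norm (fst (fst p)) = r i * (r i * norm (fst (fst p)))" by (simp add: rr[symmetric])
      also have "\<dots> \<le> r i * 1" using elim r1[of i] by (intro mult_left_mono) auto
      finally show ?case using e0[of i] by (simp add: one_def V_def)
    qed
    then have "(\<lambda>i. Y p * one i p) \<longlonglongrightarrow> Y p * 1"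
      by (intro tendsto_mult tendsto_const tendsto_eventually)
    moreover have "(\<lambda>i. err i p) \<longlonglongrightarrow> 0"
    proof (rule Lim_null_comparison)
      show "\<forall>\<^sub>F i in sequentially. norm (err i p) \<le> ((norm (D g) * S p + C1 + 2 * C * (S p)\<^sup>2) * (norm u * S p)) * sqrt (e i)"
      proof (intro always_eventually allI)
        fix i
        have "(norm (D g) * S p + C1 + 2 * C * (S p)\<^sup>2) * (sqrt (e i) * \<bar>(fst (fst p) \<bullet> u) * one i p\<bar>) \<le> (norm (D g) * S p + C1 + 2 * C * (S p)\<^sup>2) * (sqrt (e i) * (norm u * S p))"
          using S0[of p] C0 C1(1) e0[of i] by (intro mult_left_mono ub) auto
        then show "norm (err i p) \<le> ((norm (D g) * S p + C1 + 2 * C * (S p)\<^sup>2) * (norm u * S p)) * sqrt (e i)"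
          using errb[of i p] by (simp add: algebra_simps)
      qed
      show "(\<lambda>i. ((norm (D g) * S p + C1 + 2 * C * (S p)\<^sup>2) * (norm u * S p)) * sqrt (e i)) \<longlonglongrightarrow> 0"
        by (rule tendsto_mult_right_zero[OF set0])
    qed
    ultimately show ?thesis unfolding PhiE using tendsto_add by fastforce
  qed
  have "(\<lambda>i. \<integral>p. Phi i p \<partial>?P) \<longlonglongrightarrow> (\<integral>p. Y p \<partial>?P)"
  proof (rule integral_dominated_convergence[where w=W])
    show "Phi i \<in> borel_measurable ?P" for i unfolding Phi_def[abs_def] by measurable
    show "Y \<in> borel_measurable ?P" unfolding Y_def[abs_def] by measurable
  qed (use Wint lim dom in auto)
  moreover have "(\<integral>p. Y p \<partial>?P) = tau * (fst (D g) \<bullet> u)"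
  proof -
    have "(\<integral>p. Y p \<partial>?P) = (\<integral>w. (fst (D g) \<bullet> fst w) * (fst w \<bullet> u) \<partial>mu)"
      unfolding Y_def by (rule integral_pair_fst(2)) (auto intro: mu.sigma_finite_measure_axioms prob_space_gauss)
    also have "\<dots> = tau * (fst (D g) \<bullet> u)" using covariance[of "fst (D g)" u] by (simp add: inner_commute)
    finally show ?thesis .
  qed
  moreover have "(\<integral>p. Phi i p \<partial>?P) = real (Suc i) * (\<integral>v. (avg (kap (Suc i)) f (g \<odot> v) - avg mu f g) * chi (sqrt (sqrt (1 / real (Suc i)))) u v \<partial>lam (Suc i))" for i
  proof -
    have "(\<integral>v. (avg (kap (Suc i)) f (g \<odot> v) - avg mu f g) * chi (r i) u v \<partial>lam (Suc i))
      = (\<integral>p. (avg (kap (Suc i)) f (g \<odot> V i p) - avg mu f g) * chi (r i) u (V i p) \<partial>?P)"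
      unfolding lam_def by (subst integral_distr[OF lam_map_measurable]) (auto simp: V_def e_def split_beta')
    then show ?thesis unfolding Phi_def by (simp add: r_def e_def del: of_nat_Suc)
  qed
  ultimately show ?thesis by simp
qed

text \<open>Continuity of \<open>f\<close> lets the dilation and the vertical noise disappear in the
  limit.\<close>

lemma variance_kap_tendsto:
  fixes f :: "'b \<times> 'c \<Rightarrow> real"
  assumes f [measurable]: "f \<in> borel_measurable borel" and M: "\<And>g. \<bar>f g\<bar> \<le> M" and m: "\<bar>m\<bar> \<le> M"
    and cont: "continuous_on UNIV f"
  shows "(\<lambda>i. \<integral>w. (f (g \<odot> dil (bscale (Suc i)) w) - m)\<^sup>2 \<partial>kap (Suc i)) \<longlonglongrightarrow> (\<integral>w. (f (g \<odot> w) - m)\<^sup>2 \<partial>mu)"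
proof -
  let ?P = "mu \<Otimes>\<^sub>M (gauss :: 'c measure)"
  define H where "H i p = (f (g \<odot> dil (bscale (Suc i)) (fst (fst p), snd (fst p) + (1 / real (Suc i)) *\<^sub>R snd p)) - m)\<^sup>2" for i and p :: "('b \<times> 'c) \<times> 'c"
  have "(\<lambda>i. \<integral>p. H i p \<partial>?P) \<longlonglongrightarrow> (\<integral>p. (f (g \<odot> fst p) - m)\<^sup>2 \<partial>?P)"
  proof (rule integral_dominated_convergence[where w="\<lambda>_. (2 * M)\<^sup>2"])
    show "H i \<in> borel_measurable ?P" for i unfolding H_def[abs_def] by measurable
    show "AE p in ?P. (\<lambda>i. H i p) \<longlonglongrightarrow> (f (g \<odot> fst p) - m)\<^sup>2"
    proof (rule AE_I2)
      fix p :: "('b \<times> 'c) \<times> 'c"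
      have e: "(\<lambda>i. 1 / real (Suc i)) \<longlonglongrightarrow> 0" by (rule LIMSEQ_Suc) (rule lim_1_over_n)
      have "(\<lambda>i. sqrt (1 + 1 / real (Suc i))) \<longlonglongrightarrow> sqrt (1 + 0)" by (intro tendsto_intros e)
      then have b: "(\<lambda>i. bscale (Suc i)) \<longlonglongrightarrow> 1" by (simp add: bscale_def)
      have "(\<lambda>i. dil (bscale (Suc i)) (fst (fst p), snd (fst p) + (1 / real (Suc i)) *\<^sub>R snd p)) \<longlonglongrightarrow> (1 *\<^sub>R fst (fst p), 1\<^sup>2 *\<^sub>R (snd (fst p) + 0 *\<^sub>R snd p))"
        unfolding dil_def fst_conv snd_conv by (intro tendsto_intros b e)
      then have d: "(\<lambda>i. dil (bscale (Suc i)) (fst (fst p), snd (fst p) + (1 / real (Suc i)) *\<^sub>R snd p)) \<longlonglongrightarrow> fst p" by simp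
      have "continuous_on UNIV (\<lambda>x. f (g \<odot> x))"
        by (rule continuous_on_compose2[OF cont]) (auto intro: continuous_intros)
      then have "(\<lambda>i. f (g \<odot> dil (bscale (Suc i)) (fst (fst p), snd (fst p) + (1 / real (Suc i)) *\<^sub>R snd p))) \<longlonglongrightarrow> f (g \<odot> fst p)"
        by (rule continuous_on_tendsto_compose[OF _ d]) auto
      then show "(\<lambda>i. H i p) \<longlonglongrightarrow> (f (g \<odot> fst p) - m)\<^sup>2"
        unfolding H_def by (intro tendsto_intros)
    qed
    show "AE p in ?P. norm (H i p) \<le> (2 * M)\<^sup>2" for i
    proof (rule AE_I2)
      fix p :: "('b \<times> 'c) \<times> 'c"
      have "\<bar>f x - m\<bar> \<le> 2 * M" for x using M[of x] m by linarith
      then have "\<bar>f x - m\<bar>\<^sup>2 \<le> (2 * M)\<^sup>2" for x by (intro power_mono) auto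
      then show "norm (H i p) \<le> (2 * M)\<^sup>2" by (simp add: H_def)
    qed
  qed auto
  moreover have "(\<integral>p. H i p \<partial>?P) = (\<integral>w. (f (g \<odot> dil (bscale (Suc i)) w) - m)\<^sup>2 \<partial>kap (Suc i))" for i
    unfolding kap_def by (subst integral_distr[OF kap_map_measurable]) (auto simp: H_def[abs_def] split_beta')
  moreover have "(\<integral>p. (f (g \<odot> fst p) - m)\<^sup>2 \<partial>?P) = (\<integral>w. (f (g \<odot> w) - m)\<^sup>2 \<partial>mu)"
    by (rule integral_pair_fst(2)) (auto intro: mu.sigma_finite_measure_axioms prob_space_gauss)
  ultimately show ?thesis by simp
qed

lemma variance_avg:
  assumes f [measurable]: "f \<in> borel_measurable borel" and M: "\<And>g. \<bar>f g\<bar> \<le> M"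
  shows "(\<integral>w. (f (g \<odot> w) - avg mu f g)\<^sup>2 \<partial>mu) = avg mu (\<lambda>x. (f x)\<^sup>2) g - (avg mu f g)\<^sup>2"
proof -
  let ?m = "avg mu f g"
  have i1: "integrable mu (\<lambda>w. f (g \<odot> w))" by (rule avg_bound(2)[OF f M mu.prob_space_axioms sets_mu])
  have "\<bar>(f x)\<^sup>2\<bar> \<le> M\<^sup>2" for x using power_mono[OF M[of x], of 2] by simp
  then have i2: "integrable mu (\<lambda>w. (f (g \<odot> w))\<^sup>2)"
    by (intro avg_bound(2)[where F="\<lambda>x. (f x)\<^sup>2", OF _ _ mu.prob_space_axioms sets_mu]) auto
  have "(\<integral>w. (f (g \<odot> w) - ?m)\<^sup>2 \<partial>mu) = (\<integral>w. (f (g \<odot> w))\<^sup>2 - 2 * ?m * f (g \<odot> w) + ?m\<^sup>2 \<partial>mu)"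
    by (simp add: power2_diff algebra_simps)
  also have "\<dots> = avg mu (\<lambda>x. (f x)\<^sup>2) g - 2 * ?m * ?m + ?m\<^sup>2"
    using i1 i2 by (simp add: avg_def mu.prob_space[simplified])
  finally show ?thesis by (simp add: power2_eq_square)
qed

text \<open>\<open>entropy_step\<close> is multiplied by the number of steps and passed to the
  limit, where the information term becomes \<open>hdim / 2\<close>. Optimising over
  \<open>c\<close> produces the squared derivative.\<close>

lemma sharp_bound_taylor:
  assumes f [measurable]: "f \<in> borel_measurable borel" and M: "\<And>g. \<bar>f g\<bar> \<le> M" and tf: "taylor f Df Cf"
    and t: "taylor (avg mu f) D C"
  shows "tau * (fst (D g) \<bullet> u)\<^sup>2 \<le> hdim * (norm u)\<^sup>2 * (avg mu (\<lambda>x. (f x)\<^sup>2) g - (avg mu f g)\<^sup>2)"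
proof -
  let ?m = "avg mu f g"
  define V where "V = (\<integral>w. (f (g \<odot> w) - ?m)\<^sup>2 \<partial>mu)"
  have V0: "0 \<le> V" unfolding V_def by (intro Bochner_Integration.integral_nonneg) auto
  have mM: "\<bar>?m\<bar> \<le> M" by (rule avg_bound(1)[OF f M mu.prob_space_axioms sets_mu])
  have Q0: "0 \<le> hdim" by (simp add: hdim_def)
  have key: "c * (tau * (fst (D g) \<bullet> u)) \<le> c\<^sup>2 * (V * (tau * (norm u)\<^sup>2)) / 2 + hdim / 2" if c: "0 \<le> c" for c u
  proof -
    define r where "r i = sqrt (sqrt (1 / real (Suc i)))" for i
    define E where "E i = (\<integral>v. (avg (kap (Suc i)) f (g \<odot> v) - ?m) * chi (r i) u v \<partial>lam (Suc i))" for i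
    define W where "W i = (\<integral>w. (f (g \<odot> dil (bscale (Suc i)) w) - ?m)\<^sup>2 \<partial>kap (Suc i))" for i
    have e: "(\<lambda>i. 1 / real (Suc i)) \<longlonglongrightarrow> 0" by (rule LIMSEQ_Suc) (rule lim_1_over_n)
    have "(\<lambda>i. sqrt (sqrt (1 / real (Suc i)))) \<longlonglongrightarrow> sqrt (sqrt 0)" by (intro tendsto_real_sqrt e)
    then have rt: "r \<longlonglongrightarrow> 0" by (simp add: r_def[abs_def])
    have Et: "(\<lambda>i. real (Suc i) * E i) \<longlonglongrightarrow> tau * (fst (D g) \<bullet> u)"
      using first_order[OF f M tf t, of g u] by (simp add: E_def r_def)
    have Wt: "W \<longlonglongrightarrow> V"
      using variance_kap_tendsto[OF f M mM taylor_continuous[OF tf], of g] by (simp add: W_def[abs_def] V_def)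
    have "(\<lambda>i. exp (c * (2 * M) * (norm u * r i)) / 2 * c\<^sup>2 * W i * (tau * (norm u)\<^sup>2) + hdim / 2)
      \<longlonglongrightarrow> exp (c * (2 * M) * (norm u * 0)) / 2 * c\<^sup>2 * V * (tau * (norm u)\<^sup>2) + hdim / 2"
      by (intro tendsto_intros rt Wt) auto
    then have R: "(\<lambda>i. exp (c * (2 * M) * (norm u * r i)) / 2 * c\<^sup>2 * W i * (tau * (norm u)\<^sup>2) + hdim / 2)
      \<longlonglongrightarrow> c\<^sup>2 * (V * (tau * (norm u)\<^sup>2)) / 2 + hdim / 2" by (simp add: mult.assoc)
    have "c * (real (Suc i) * E i) \<le> exp (c * (2 * M) * (norm u * r i)) / 2 * c\<^sup>2 * W i * (tau * (norm u)\<^sup>2) + hdim / 2" for i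
    proof -
      let ?N = "real (Suc i)"
      have N: "?N > 0" by simp
      have "c * E i \<le> exp (c * (2 * M) * (norm u * r i)) / 2 * c\<^sup>2 * W i * ((1 / ?N) * (tau * (norm u)\<^sup>2)) + hdim * ln (bscale (Suc i))"
        unfolding E_def W_def by (rule entropy_step[OF f M mM c]) (auto simp: r_def)
      then have "?N * (c * E i) \<le> ?N * (exp (c * (2 * M) * (norm u * r i)) / 2 * c\<^sup>2 * W i * ((1 / ?N) * (tau * (norm u)\<^sup>2)) + hdim * ln (bscale (Suc i)))"
        using N by (intro mult_left_mono) auto
      also have "\<dots> = exp (c * (2 * M) * (norm u * r i)) / 2 * c\<^sup>2 * W i * (tau * (norm u)\<^sup>2) + hdim * (?N * ln (bscale (Suc i)))"
        by (simp add: distrib_left del: of_nat_Suc)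
      \<comment> \<open>\<open>bscale\<close> is a square root, so its logarithm is at most half the
        step length; this is the one half in \<open>hdim / 2\<close>.\<close>
      also have "?N * ln (bscale (Suc i)) \<le> 1 / 2"
      proof -
        have "ln (bscale (Suc i)) = ln (1 + 1 / ?N) / 2"
          unfolding bscale_def by (intro ln_sqrt) (simp add: add_pos_nonneg)
        also have "\<dots> \<le> (1 / ?N) / 2" by (intro divide_right_mono ln_add_one_self_le_self) auto
        finally have "?N * ln (bscale (Suc i)) \<le> ?N * ((1 / ?N) / 2)" using N by (intro mult_left_mono) auto
        also have "?N * ((1 / ?N) / 2) = 1 / 2" using N by (simp del: of_nat_Suc)
        finally show ?thesis .
      qed
      then have "hdim * (?N * ln (bscale (Suc i))) \<le> hdim * (1 / 2)" using Q0 by (intro mult_left_mono) auto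
      finally show ?thesis by (simp add: mult.left_commute del: of_nat_Suc)
    qed
    then show ?thesis
      by (intro LIMSEQ_le[OF tendsto_mult_left[OF Et] R]) blast
  qed
  have pos: "(tau * (fst (D g) \<bullet> u))\<^sup>2 \<le> (V * (tau * (norm u)\<^sup>2)) * hdim" if "0 \<le> fst (D g) \<bullet> u" for u
    by (rule square_le_of_linear_quadratic[OF key]) (use V0 tau_pos Q0 that in auto)
  have "(tau * (fst (D g) \<bullet> u))\<^sup>2 \<le> (V * (tau * (norm u)\<^sup>2)) * hdim"
    using pos[of u] pos[of "- u"] by (cases "0 \<le> fst (D g) \<bullet> u") auto
  then have "tau * (tau * (fst (D g) \<bullet> u)\<^sup>2) \<le> tau * (hdim * (norm u)\<^sup>2 * V)"
    by (simp add: power_mult_distrib power2_eq_square[of tau] ac_simps)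
  then show ?thesis using tau_pos by (simp add: V_def variance_avg[OF f M])
qed

end

section \<open>Regularity for bounded measurable functions\<close>

text \<open>The recursion \<open>x \<mapsto> (x + x^2) / 2\<close> at least halves \<open>x / (1 - 2 x)\<close>.\<close>
fun halving :: "nat \<Rightarrow> real" where
  "halving 0 = 1 / 4"
| "halving (Suc k) = halving k / 2 + (halving k)\<^sup>2 / 2"

lemma halving_bounds: "0 < halving k \<and> halving k \<le> 1 / 4 \<and> halving k / (1 - 2 * halving k) \<le> (1 / 2) * (1 / 2) ^ k"
proof (induction k)
  case (Suc k)
  define x where "x = halving k"
  have x: "0 < x" "x \<le> 1 / 4" "x / (1 - 2 * x) \<le> (1 / 2) * (1 / 2) ^ k" using Suc by (auto simp: x_def)
  have sq: "x\<^sup>2 \<le> x / 4" using x mult_left_mono[of x "1/4" x] by (simp add: power2_eq_square)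
  define y where "y = x / 2 + x\<^sup>2 / 2"
  have y: "0 < y" "y \<le> 1 / 4" using x sq by (auto simp: y_def intro: add_pos_nonneg)
  have "y / (1 - 2 * y) \<le> (x / (1 - 2 * x)) / 2"
  proof -
    have d1: "1 - 2 * y > 0" using y by linarith
    have d2: "1 - 2 * x > 0" using x by linarith
    \<comment> \<open>After expansion the two sides differ by \<open>x ^ 3\<close>.\<close>
    have "2 * y * (1 - 2 * x) \<le> x * (1 - 2 * y)"
      using x by (simp add: y_def power2_eq_square algebra_simps)
    then have "y * (2 * (1 - 2 * x)) \<le> x * (1 - 2 * y)" by (simp add: algebra_simps)
    then show ?thesis using d1 d2 by (simp add: divide_le_eq le_divide_eq field_simps)
  qed
  also have "\<dots> \<le> ((1 / 2) * (1 / 2) ^ k) / 2" using x(3) by (rule divide_right_mono) simp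
  also have "\<dots> = (1 / 2) * (1 / 2) ^ Suc k" by simp
  finally show ?case using y by (simp add: x_def y_def)
qed simp

lemma halving_le: "halving k \<le> (1 / 2) * (1 / 2) ^ k"
proof -
  have h: "0 < halving k" "halving k \<le> 1 / 4" "halving k / (1 - 2 * halving k) \<le> (1 / 2) * (1 / 2) ^ k"
    using halving_bounds[of k] by auto
  have "halving k * (1 - 2 * halving k) \<le> halving k * 1" using h by (intro mult_left_mono) auto
  then have "halving k \<le> halving k / (1 - 2 * halving k)" using h by (simp add: le_divide_eq)
  then show ?thesis using h by linarith
qed

context step2_group
begin

lemma mollify_tendsto:
  assumes F [measurable]: "F \<in> borel_measurable borel" and M: "\<And>g. \<bar>F g\<bar> \<le> M" and c: "continuous_on UNIV F"
  shows "(\<lambda>n. mollify (1 / real (Suc n)) F g) \<longlonglongrightarrow> F g"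
proof (rule tendstoI)
  fix d :: real assume d: "d > 0"
  have "continuous_on UNIV (\<lambda>k. F (g \<odot> k))"
    by (rule continuous_on_compose2[OF c]) (auto intro: continuous_intros)
  then obtain s where s: "s > 0" "\<And>k. dist k 0 < s \<Longrightarrow> dist (F (g \<odot> k)) (F (g \<odot> 0)) < d / 2"
    unfolding continuous_on_iff using d by (metis UNIV_I half_gt_zero)
  have "(\<lambda>n. sqrt (1 / real (Suc n))) \<longlonglongrightarrow> sqrt 0" by (intro tendsto_real_sqrt LIMSEQ_Suc lim_1_over_n)
  then have "\<forall>\<^sub>F n in sequentially. sqrt (1 / real (Suc n)) < s" using s(1) by (intro order_tendstoD(2)) auto
  then show "\<forall>\<^sub>F n in sequentially. dist (mollify (1 / real (Suc n)) F g) (F g) < d"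
  proof eventually_elim
    case (elim n)
    have "\<bar>mollify (1 / real (Suc n)) F g - F g\<bar> \<le> d / 2"
    proof (rule mollify_bound(2)[OF F M])
      fix k :: "'b \<times> 'c" assume "norm k \<le> sqrt (1 / real (Suc n))"
      then have "dist k 0 < s" using elim by simp
      then show "\<bar>F (g \<odot> k) - F g\<bar> \<le> d / 2" using s(2)[of k] by (simp add: dist_real_def)
    qed auto
    then show ?case using d by (simp add: dist_real_def)
  qed
qed

lemma central: "(0, z) \<odot> w = w \<odot> (0, z)"
  by (simp add: gm_def zero_left zero_right)

lemma gm_vertical: "g \<odot> (0, y) \<odot> (0, z) = g \<odot> (0, y + z)"
  by (simp add: gm_def zero_right add_ac)

lemma horizontal_vertical: "k = (fst k, 0) \<odot> (0, snd k)"
  by (simp add: gm_def zero_right prod_eq_iff)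

text \<open>Vertical motion is generated by horizontal loops; the factor 2 comes from the
  antisymmetry of \<open>beta\<close>.\<close>

lemma commutator_horizontal: "(u, 0) \<odot> (v, 0) \<odot> (- u, 0) \<odot> (- v, 0) = (0, 2 *\<^sub>R beta u v)"
  using anti[of v u] by (simp add: gm_def add_left minus_left minus_right alt scaleR_2)

lemma inner_dil: "D \<bullet> dil r k = dil r D \<bullet> k"
  by (simp add: inner_prod_def)

lemma norm_dil_le: "0 < r \<Longrightarrow> norm (dil r k) \<le> (r + r\<^sup>2) * norm k"
proof -
  assume r: "0 < r"
  have "dil r k = (r *\<^sub>R fst k, 0) + (0, r\<^sup>2 *\<^sub>R snd k)" by (simp add: dil_def)
  then have "norm (dil r k) \<le> norm (r *\<^sub>R fst k, 0::'c) + norm (0::'b, r\<^sup>2 *\<^sub>R snd k)" by (simp only: norm_triangle_ineq)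
  also have "\<dots> = r * norm (fst k) + r\<^sup>2 * norm (snd k)" using r by (simp add: norm_Pair)
  also have "\<dots> \<le> r * norm k + r\<^sup>2 * norm k"
    using r norm_fst_le[of "fst k" "snd k"] norm_snd_le[of "snd k" "fst k"] by (intro add_mono mult_left_mono) auto
  finally show ?thesis by (simp add: algebra_simps)
qed

lemma taylor_unique:
  assumes D: "\<And>e. e > 0 \<Longrightarrow> \<exists>d>0. \<forall>k. norm k < d \<longrightarrow> \<bar>u (g \<odot> k) - u g - D \<bullet> k\<bar> \<le> e * norm k"
    and D': "\<And>e. e > 0 \<Longrightarrow> \<exists>d>0. \<forall>k. norm k < d \<longrightarrow> \<bar>u (g \<odot> k) - u g - D' \<bullet> k\<bar> \<le> e * norm k"
  shows "D = D'"
proof (rule ccontr)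
  assume ne: "D \<noteq> D'"
  define h where "h = D - D'"
  have h: "norm h > 0" using ne by (simp add: h_def)
  \<comment> \<open>Both expansions together then allow a deviation of two thirds of the norm of
    \<open>h\<close> per unit length, less than what \<open>D - D'\<close> produces in its own
    direction.\<close>
  define e where "e = norm h / 3"
  have e: "e > 0" using h by (simp add: e_def)
  obtain d where d: "d > 0" "\<And>k. norm k < d \<Longrightarrow> \<bar>u (g \<odot> k) - u g - D \<bullet> k\<bar> \<le> e * norm k" using D[OF e] by blast
  obtain d' where d': "d' > 0" "\<And>k. norm k < d' \<Longrightarrow> \<bar>u (g \<odot> k) - u g - D' \<bullet> k\<bar> \<le> e * norm k" using D'[OF e] by blast
  define s where "s = min d d' / 2 / norm h"
  have s: "s > 0" using d d' h by (simp add: s_def)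
  let ?k = "s *\<^sub>R h"
  have m: "min d d' > 0" using d d' by simp
  have nk: "norm ?k = min d d' / 2" using s h abs_of_pos[OF m] by (simp add: s_def)
  have n1: "norm ?k < d" and n2: "norm ?k < d'" unfolding nk using m by linarith+
  have "\<bar>u (g \<odot> ?k) - u g - D \<bullet> ?k\<bar> \<le> e * norm ?k" "\<bar>u (g \<odot> ?k) - u g - D' \<bullet> ?k\<bar> \<le> e * norm ?k"
    using d(2)[OF n1] d'(2)[OF n2] .
  then have "\<bar>D \<bullet> ?k - D' \<bullet> ?k\<bar> \<le> 2 * (e * norm ?k)" by linarith
  moreover have "D \<bullet> ?k - D' \<bullet> ?k = s * (norm h)\<^sup>2"
    by (simp add: h_def power2_norm_eq_inner inner_diff_left inner_diff_right algebra_simps)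
  ultimately have "s * (norm h)\<^sup>2 \<le> 2 * (norm h / 3 * (s * norm h))" using s by (simp add: e_def)
  then have "s * (norm h)\<^sup>2 \<le> (2 / 3) * (s * (norm h)\<^sup>2)" by (simp add: power2_eq_square)
  then show False using s h by (simp add: mult_le_0_iff)
qed

end

context stable_law
begin

text \<open>The law at time \<open>a^2 * tau\<close>, since horizontal lengths scale like square
  roots of durations.\<close>

definition muS :: "real \<Rightarrow> ('b \<times> 'c) measure" where
  "muS a = distr mu borel (dil a)"

lemma measurable_dil [measurable]: "dil a \<in> borel \<rightarrow>\<^sub>M borel"
  by measurable

lemma sets_muS [measurable_cong, simp]: "sets (muS a) = sets borel"
  by (simp add: muS_def)

lemma prob_space_muS: "prob_space (muS a)"
  unfolding muS_def by (rule mu.prob_space_distr) simp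

lemma avg_muS_measurable [measurable]: "f \<in> borel_measurable borel \<Longrightarrow> avg (muS a) f \<in> borel_measurable borel"
  by (rule avg_measurable[OF _ prob_space_muS sets_muS])

lemma avg_mu_measurable [measurable]: "f \<in> borel_measurable borel \<Longrightarrow> avg mu f \<in> borel_measurable borel"
  by (rule avg_measurable[OF _ mu.prob_space_axioms sets_mu])

lemma avg_muS:
  assumes [measurable]: "f \<in> borel_measurable borel"
  shows "avg (muS a) f g = (\<integral>w. f (g \<odot> dil a w) \<partial>mu)"
  unfolding avg_def muS_def by (subst integral_distr) auto

lemma avg_muS_scale:
  assumes [measurable]: "f \<in> borel_measurable borel" and a: "a \<noteq> 0"
  shows "avg (muS a) f g = avg mu (\<lambda>x. f (dil a x)) (dil (1 / a) g)"
proof -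
  have "dil a (dil (1 / a) g \<odot> w) = g \<odot> dil a w" for w using a by (simp add: dil_gm)
  then show ?thesis using assms(1) by (simp add: avg_muS avg_def[of mu])
qed

lemma avg_semigroup:
  assumes f [measurable]: "f \<in> borel_measurable borel" and M: "\<And>g. \<bar>f g\<bar> \<le> M" and pq: "1 \<le> p" "1 \<le> q"
  shows "avg mu f g = avg (muS (sqrt (real p / real (p + q)))) (avg (muS (sqrt (real q / real (p + q)))) f) g"
proof -
  let ?a = "sqrt (real p / real (p + q))" and ?b = "sqrt (real q / real (p + q))"
  interpret mm: pair_prob_space mu mu ..
  have Mm: "(\<lambda>(v, w). dil ?a v \<odot> dil ?b w) \<in> mu \<Otimes>\<^sub>M mu \<rightarrow>\<^sub>M (borel :: ('b \<times> 'c) measure)" by measurable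
  have i: "integrable (mu \<Otimes>\<^sub>M mu) (\<lambda>x. f (g \<odot> (dil ?a (fst x) \<odot> dil ?b (snd x))))"
    by (rule mm.integrable_const_bound[where B=M]) (use M in auto)
  have "avg mu f g = (\<integral>x. f (g \<odot> x) \<partial>distr (mu \<Otimes>\<^sub>M mu) borel (\<lambda>(v, w). dil ?a v \<odot> dil ?b w))"
    unfolding avg_def stable[OF pq] ..
  also have "\<dots> = (\<integral>x. f (g \<odot> (dil ?a (fst x) \<odot> dil ?b (snd x))) \<partial>(mu \<Otimes>\<^sub>M mu))"
    by (subst integral_distr[OF Mm]) (auto simp: split_beta')
  also have "\<dots> = (\<integral>v. \<integral>w. f (g \<odot> (dil ?a v \<odot> dil ?b w)) \<partial>mu \<partial>mu)"
    using mm.integral_fst'[OF i] by simp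
  also have "\<dots> = avg (muS ?a) (avg (muS ?b) f) g"
    by (simp add: avg_muS gm_assoc)
  finally show ?thesis .
qed

text \<open>The constant of the sharp bound once the variance is estimated by the squared sup
  norm.\<close>

definition lipc :: real where "lipc = sqrt (hdim / tau)"

lemma lipc_nonneg: "0 \<le> lipc"
  using tau_pos by (simp add: lipc_def hdim_def)

text \<open>The line \<open>s \<mapsto> g \<odot> (s *\<^sub>R u, 0)\<close> is a coset of a
  one-parameter subgroup because \<open>beta u u = 0\<close>. The sharp bound controls the
  derivative along it and the mean value theorem integrates it. The constant does not see the Taylor
  data of \<open>f\<close>, which makes limits possible.\<close>

lemma horizontal_lipschitz_taylor:
  assumes f [measurable]: "f \<in> borel_measurable borel" and M: "\<And>g. \<bar>f g\<bar> \<le> M" and tf: "taylor f Df Cf"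
  shows "\<bar>avg mu f (g \<odot> (u, 0)) - avg mu f g\<bar> \<le> lipc * norm u * M"
proof -
  obtain D C where t: "taylor (avg mu f) D C"
    using taylor_avg[OF f M tf mu.prob_space_axioms sets_mu moment2] by blast
  have M0: "0 \<le> M" using M[of 0] by linarith
  have Db: "\<bar>fst (D h) \<bullet> u\<bar> \<le> lipc * norm u * M" for h
  proof -
    have "avg mu (\<lambda>x. (f x)\<^sup>2) h - (avg mu f h)\<^sup>2 \<le> M\<^sup>2"
    proof -
      have "\<bar>(f x)\<^sup>2\<bar> \<le> M\<^sup>2" for x using power_mono[OF M[of x], of 2] by simp
      then have "\<bar>avg mu (\<lambda>x. (f x)\<^sup>2) h\<bar> \<le> M\<^sup>2"
        by (intro avg_bound(1)[OF _ _ mu.prob_space_axioms sets_mu]) auto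
      then show ?thesis using zero_le_power2[of "avg mu f h"] by linarith
    qed
    then have "hdim * (norm u)\<^sup>2 * (avg mu (\<lambda>x. (f x)\<^sup>2) h - (avg mu f h)\<^sup>2) \<le> hdim * (norm u)\<^sup>2 * M\<^sup>2"
      by (intro mult_left_mono) (auto simp: hdim_def)
    then have "tau * (fst (D h) \<bullet> u)\<^sup>2 \<le> hdim * (norm u)\<^sup>2 * M\<^sup>2"
      using sharp_bound_taylor[OF f M tf t, of h u] by linarith
    then have "(fst (D h) \<bullet> u)\<^sup>2 \<le> hdim / tau * ((norm u)\<^sup>2 * M\<^sup>2)" using tau_pos by (simp add: field_simps)
    also have "\<dots> = (lipc * norm u * M)\<^sup>2"
      using tau_pos by (simp add: lipc_def power_mult_distrib real_sqrt_pow2 hdim_def mult.assoc)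
    finally have "\<bar>fst (D h) \<bullet> u\<bar> \<le> \<bar>lipc * norm u * M\<bar>" by (rule abs_le_square_iff[THEN iffD2])
    then show ?thesis using lipc_nonneg M0 by simp
  qed
  define phi where "phi s = avg mu f (g \<odot> (s *\<^sub>R u, 0))" for s
  define d where "d s = fst (D (g \<odot> (s *\<^sub>R u, 0))) \<bullet> u" for s
  have der: "DERIV phi s :> d s" for s
    unfolding DERIV_def
  proof (rule LIM_zero_cancel, rule Lim_null_comparison)
    have "norm ((phi (s + h) - phi s) / h - d s) \<le> C * (norm u)\<^sup>2 * \<bar>h\<bar>" if h: "h \<noteq> 0" for h
    proof -
      have e: "g \<odot> ((s + h) *\<^sub>R u, 0) = g \<odot> (s *\<^sub>R u, 0) \<odot> (h *\<^sub>R u, 0)"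
        by (simp add: gm_assoc) (simp add: gm_def scaleR_left scaleR_right alt scaleR_add_left)
      have "\<bar>phi (s + h) - phi s - h * d s\<bar> \<le> C * (norm (h *\<^sub>R u, 0::'c))\<^sup>2"
        using taylorD[OF t, of "g \<odot> (s *\<^sub>R u, 0)" "(h *\<^sub>R u, 0)"] unfolding phi_def d_def e by (simp add: inner_prod_def)
      also have "(norm (h *\<^sub>R u, 0::'c))\<^sup>2 = \<bar>h\<bar> * (\<bar>h\<bar> * (norm u)\<^sup>2)" by (simp add: norm_Pair power_mult_distrib power2_eq_square)
      finally have "\<bar>phi (s + h) - phi s - h * d s\<bar> / \<bar>h\<bar> \<le> C * (\<bar>h\<bar> * (\<bar>h\<bar> * (norm u)\<^sup>2)) / \<bar>h\<bar>"
        by (rule divide_right_mono) simp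
      moreover have "(phi (s + h) - phi s) / h - d s = (phi (s + h) - phi s - h * d s) / h" using h by (simp add: field_simps)
      ultimately show ?thesis using h by (simp add: abs_divide ac_simps)
    qed
    then show "\<forall>\<^sub>F h in at 0. norm ((phi (s + h) - phi s) / h - d s) \<le> C * (norm u)\<^sup>2 * \<bar>h\<bar>"
      by (auto simp: eventually_at intro!: exI[of _ 1])
    have "((\<lambda>h. C * (norm u)\<^sup>2 * \<bar>h\<bar>) \<longlongrightarrow> C * (norm u)\<^sup>2 * \<bar>0\<bar>) (at 0)" by (intro tendsto_intros)
    then show "((\<lambda>h. C * (norm u)\<^sup>2 * \<bar>h\<bar>) \<longlongrightarrow> 0) (at (0::real))" by simp
  qed
  obtain z where "phi 1 - phi 0 = (1 - 0) * d z" using MVT2[of 0 1 phi d] der by auto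
  then show ?thesis using Db[of "g \<odot> (z *\<^sub>R u, 0)"] by (simp add: phi_def d_def zero_prod_def[symmetric])
qed

text \<open>Mollifications keep the sup bound and converge pointwise, so the estimate survives
  dominated convergence.\<close>

lemma horizontal_lipschitz_continuous:
  assumes c: "continuous_on UNIV f" and M: "\<And>g. \<bar>f g\<bar> \<le> M"
  shows "\<bar>avg mu f (g \<odot> (u, 0)) - avg mu f g\<bar> \<le> lipc * norm u * M"
proof -
  have f [measurable]: "f \<in> borel_measurable borel" by (rule borel_measurable_continuous_onI[OF c])
  let ?F = "\<lambda>n. mollify (1 / real (Suc n)) f"
  have b: "\<bar>?F n h\<bar> \<le> M" for n h
    using mollify_bound(2)[OF f M, of "1 / real (Suc n)" h 0 M] M by simp
  have lim: "(\<lambda>n. avg mu (?F n) h) \<longlonglongrightarrow> avg mu f h" for h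
    unfolding avg_def
  proof (rule integral_dominated_convergence[where w="\<lambda>_. M"])
    show "AE w in mu. (\<lambda>n. ?F n (h \<odot> w)) \<longlonglongrightarrow> f (h \<odot> w)"
      by (rule AE_I2) (rule mollify_tendsto[OF f M c])
    show "(\<lambda>w. ?F n (h \<odot> w)) \<in> borel_measurable mu" for n
      using mollify_measurable[OF f, of "1 / real (Suc n)"] by measurable
  qed (use b in auto)
  have "\<bar>avg mu (?F n) (g \<odot> (u, 0)) - avg mu (?F n) g\<bar> \<le> lipc * norm u * M" for n
  proof -
    obtain D C where "taylor (?F n) D C" using taylor_mollify[OF f M, of "1 / real (Suc n)"] by auto
    then show ?thesis by (intro horizontal_lipschitz_taylor mollify_measurable f b)
  qed
  then show ?thesis
    by (intro LIMSEQ_le_const2[OF tendsto_rabs[OF tendsto_diff[OF lim lim]]]) auto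
qed

lemma horizontal_lipschitz:
  assumes f [measurable]: "f \<in> borel_measurable borel" and M: "\<And>g. \<bar>f g\<bar> \<le> M"
  shows "\<bar>avg mu f (g \<odot> (u, 0)) - avg mu f g\<bar> \<le> lipc * norm u * M"
proof -
  let ?N = "\<lambda>g. distr mu borel (\<lambda>w. g \<odot> w)"
  have pN: "prob_space (?N g)" for g by (rule mu.prob_space_distr) measurable
  have Nf: "(\<integral>x. h x \<partial>?N g) = avg mu h g" if [measurable]: "h \<in> borel_measurable borel" for h :: "'b \<times> 'c \<Rightarrow> real" and g
    unfolding avg_def by (subst integral_distr) auto
  have one: "(\<integral>x. h x \<partial>?N (g \<odot> (u, 0))) - (\<integral>x. h x \<partial>?N g) \<le> lipc * norm u"
    if [measurable]: "h \<in> borel_measurable borel" and h1: "\<And>x. \<bar>h x\<bar> \<le> 1" for h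
  proof (rule integral_diff_le_of_continuous[OF pN pN _ _ _ that])
    fix k :: "'b \<times> 'c \<Rightarrow> real" assume k: "continuous_on UNIV k" "\<And>x. \<bar>k x\<bar> \<le> 1"
    have [measurable]: "k \<in> borel_measurable borel" by (rule borel_measurable_continuous_onI[OF k(1)])
    show "(\<integral>x. k x \<partial>?N (g \<odot> (u, 0))) - (\<integral>x. k x \<partial>?N g) \<le> lipc * norm u"
      using horizontal_lipschitz_continuous[OF k, of g u] by (simp add: Nf)
  qed simp_all
  show ?thesis
  proof (cases "M = 0")
    case True
    then have "f = (\<lambda>_. 0)" using M by (auto simp: fun_eq_iff)
    then show ?thesis using True by (simp add: avg_def)
  next
    case False
    then have M0: "M > 0" using M[of 0] by linarith
    have "(avg mu f (g \<odot> (u, 0)) - avg mu f g) / M \<le> lipc * norm u"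
      using one[of "\<lambda>x. f x / M"] M M0 by (simp add: Nf diff_divide_distrib)
    moreover have "(avg mu f g - avg mu f (g \<odot> (u, 0))) / M \<le> lipc * norm u"
      using one[of "\<lambda>x. - f x / M"] M M0 by (simp add: Nf diff_divide_distrib)
    ultimately show ?thesis using M0 by (simp add: pos_divide_le_eq abs_le_iff)
  qed
qed

text \<open>A total variation bound for a central translation. Quantifying over all bounded
  measurable functions allows it to be reapplied to averages and to their differences in the
  doubling argument.\<close>

definition vert :: "'c \<Rightarrow> real \<Rightarrow> bool" where
  "vert z B \<longleftrightarrow> (\<forall>f g. f \<in> borel_measurable borel \<longrightarrow> (\<forall>x. \<bar>f x\<bar> \<le> 1) \<longrightarrow> \<bar>avg mu f (g \<odot> (0, z)) - avg mu f g\<bar> \<le> B)"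

lemma vertD: "vert z B \<Longrightarrow> f \<in> borel_measurable borel \<Longrightarrow> (\<And>x. \<bar>f x\<bar> \<le> 1) \<Longrightarrow> \<bar>avg mu f (g \<odot> (0, z)) - avg mu f g\<bar> \<le> B"
  unfolding vert_def by blast

lemma vertI: "(\<And>f g. f \<in> borel_measurable borel \<Longrightarrow> (\<And>x. \<bar>f x\<bar> \<le> 1) \<Longrightarrow> \<bar>avg mu f (g \<odot> (0, z)) - avg mu f g\<bar> \<le> B) \<Longrightarrow> vert z B"
  unfolding vert_def by blast

lemma vert_nonneg: "vert z B \<Longrightarrow> 0 \<le> B"
  using vertD[of z B "\<lambda>_. 0" 0] by (auto intro: order_trans[OF abs_ge_zero])

lemma vert_mono: "vert z B \<Longrightarrow> B \<le> B' \<Longrightarrow> vert z B'"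
  unfolding vert_def by (meson order_trans)

lemma vert_2: "vert z 2"
proof (rule vertI)
  fix f :: "'b \<times> 'c \<Rightarrow> real" and g assume f: "f \<in> borel_measurable borel" and b: "\<And>x. \<bar>f x\<bar> \<le> (1::real)"
  have "\<bar>avg mu f h\<bar> \<le> 1" for h by (rule avg_bound(1)[OF f b mu.prob_space_axioms sets_mu])
  from this[of g] this[of "g \<odot> (0, z)"] show "\<bar>avg mu f (g \<odot> (0, z)) - avg mu f g\<bar> \<le> 2" by linarith
qed

lemma vert_minus: "vert z B \<Longrightarrow> vert (- z) B"
proof (rule vertI)
  fix f :: "'b \<times> 'c \<Rightarrow> real" and g assume v: "vert z B" and f: "f \<in> borel_measurable borel" "\<And>x. \<bar>f x\<bar> \<le> (1::real)"
  show "\<bar>avg mu f (g \<odot> (0, - z)) - avg mu f g\<bar> \<le> B"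
    using vertD[OF v f, of "g \<odot> (0, - z)"] by (simp add: gm_vertical abs_minus_commute zero_prod_def[symmetric])
qed

lemma vert_add: "vert y B \<Longrightarrow> vert z B' \<Longrightarrow> vert (y + z) (B + B')"
proof (rule vertI)
  fix f :: "'b \<times> 'c \<Rightarrow> real" and g assume v: "vert y B" "vert z B'" and f: "f \<in> borel_measurable borel" "\<And>x. \<bar>f x\<bar> \<le> (1::real)"
  show "\<bar>avg mu f (g \<odot> (0, y + z)) - avg mu f g\<bar> \<le> B + B'"
    using vertD[OF v(1) f, of g] vertD[OF v(2) f, of "g \<odot> (0, y)"] by (simp add: gm_vertical)
qed

text \<open>Four horizontal moves of size \<open>sqrt s\<close> close up to the commutator, so the
  horizontal bound gives the Hoelder exponent one half vertically.\<close>

lemma vert_commutator: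
  assumes s: "0 \<le> s"
  shows "vert (s *\<^sub>R (2 *\<^sub>R beta u v)) (2 * lipc * (norm u + norm v) * sqrt s)"
proof (rule vertI)
  fix f :: "'b \<times> 'c \<Rightarrow> real" and g assume f: "f \<in> borel_measurable borel" "\<And>x. \<bar>f x\<bar> \<le> (1::real)"
  let ?u = "sqrt s *\<^sub>R u" and ?v = "sqrt s *\<^sub>R v"
  have "(0, s *\<^sub>R (2 *\<^sub>R beta u v)) = (?u, 0) \<odot> (?v, 0) \<odot> (- ?u, 0) \<odot> (- ?v, 0)"
    using s unfolding commutator_horizontal by (simp add: scaleR_left scaleR_right)
  then have e: "g \<odot> (0, s *\<^sub>R (2 *\<^sub>R beta u v)) = g \<odot> (?u, 0) \<odot> (?v, 0) \<odot> (- ?u, 0) \<odot> (- ?v, 0)"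
    by (simp add: gm_assoc)
  note h = horizontal_lipschitz[OF f]
  show "\<bar>avg mu f (g \<odot> (0, s *\<^sub>R (2 *\<^sub>R beta u v))) - avg mu f g\<bar> \<le> 2 * lipc * (norm u + norm v) * sqrt s"
    unfolding e
    using h[of g ?u] h[of "g \<odot> (?u, 0)" ?v] h[of "g \<odot> (?u, 0) \<odot> (?v, 0)" "- ?u"] h[of "g \<odot> (?u, 0) \<odot> (?v, 0) \<odot> (- ?u, 0)" "- ?v"] s
    by (simp add: algebra_simps)
qed

text \<open>With \<open>\<Delta>\<close> the difference along \<open>z\<close>, \<open>2 \<Delta>\<close> is the difference along \<open>2 z\<close> minus \<open>\<Delta>^2\<close>, and \<open>\<Delta>^2\<close>
  is split over the two factors of the semigroup because \<open>z\<close> is central.\<close>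
lemma vert_half:
  assumes v: "vert (2 *\<^sub>R z) B"
  shows "vert z (B / 2 + B\<^sup>2 / 2)"
proof (rule vertI)
  fix f :: "'b \<times> 'c \<Rightarrow> real" and g assume f [measurable]: "f \<in> borel_measurable borel" and b: "\<And>x. \<bar>f x\<bar> \<le> (1::real)"
  define a where "a = sqrt (1 / 2)"
  have a: "a > 0" "a\<^sup>2 = 1 / 2" by (auto simp: a_def)
  have B0: "0 \<le> B" by (rule vert_nonneg[OF v])
  \<comment> \<open>Vertical lengths scale like time: rescaling the half-time average to full time
    turns \<open>z\<close> into \<open>2 z\<close>, and the hypothesis on \<open>2 z\<close> bounds
    it.\<close>
  have vs: "\<bar>avg (muS a) h (x \<odot> (0, z)) - avg (muS a) h x\<bar> \<le> B" if [measurable]: "h \<in> borel_measurable borel" and hb: "\<And>x. \<bar>h x\<bar> \<le> 1" for h x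
  proof -
    have "dil (1 / a) (x \<odot> (0, z)) = dil (1 / a) x \<odot> (0, 2 *\<^sub>R z)"
    proof -
      have "1 / a\<^sup>2 = 2" by (simp add: a(2))
      then show ?thesis unfolding dil_gm by (simp add: dil_def power_divide)
    qed
    then show ?thesis using a vertD[OF v, of "\<lambda>x. h (dil a x)" "dil (1 / a) x"] hb by (simp add: avg_muS_scale)
  qed
  define F where "F = avg (muS a) f"
  have F [measurable]: "F \<in> borel_measurable borel" unfolding F_def by measurable
  have Fb: "\<bar>F x\<bar> \<le> 1" for x unfolding F_def by (rule avg_bound(1)[OF f b prob_space_muS sets_muS])
  define dF where "dF x = F (x \<odot> (0, z)) - F x" for x
  have [measurable]: "dF \<in> borel_measurable borel" unfolding dF_def by measurable
  have dFb: "\<bar>dF x\<bar> \<le> B" for x unfolding dF_def F_def by (rule vs[OF f b])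
  have G: "avg mu f x = avg (muS a) F x" for x
    using avg_semigroup[OF f b, of 1 1 x] by (simp add: F_def a_def)
  have dG: "avg mu f (x \<odot> (0, z)) - avg mu f x = avg (muS a) dF x" for x
  proof -
    have e: "x \<odot> (0, z) \<odot> w = x \<odot> w \<odot> (0, z)" for w by (simp add: gm_assoc central)
    have i: "integrable (muS a) (\<lambda>w. F (y \<odot> w))" for y
      by (rule avg_bound(2)[OF F Fb prob_space_muS sets_muS])
    show ?thesis using i[of x] i[of "x \<odot> (0, z)"] unfolding G
      by (simp add: avg_def dF_def e)
  qed
  \<comment> \<open>The difference \<open>dF\<close> is itself bounded by \<open>B\<close>; divided
    by \<open>B\<close> it is an admissible test, and the other half of the time contributes the
    second factor \<open>B\<close>.\<close>
  have ddG: "\<bar>avg (muS a) dF (g \<odot> (0, z)) - avg (muS a) dF g\<bar> \<le> B\<^sup>2"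
  proof (cases "B = 0")
    case True
    then have "dF = (\<lambda>_. 0)" using dFb by (auto simp: fun_eq_iff)
    then show ?thesis by (simp add: avg_def)
  next
    case False
    then have B: "B > 0" using B0 by simp
    have "\<bar>avg (muS a) (\<lambda>x. dF x / B) (g \<odot> (0, z)) - avg (muS a) (\<lambda>x. dF x / B) g\<bar> \<le> B"
      by (rule vs) (use dFb B in auto)
    then have "\<bar>(avg (muS a) dF (g \<odot> (0, z)) - avg (muS a) dF g) / B\<bar> \<le> B" by (simp add: avg_def diff_divide_distrib)
    then show ?thesis using B by (simp add: abs_divide pos_divide_le_eq power2_eq_square)
  qed
  have "\<bar>avg mu f (g \<odot> (0, 2 *\<^sub>R z)) - avg mu f g\<bar> \<le> B" by (rule vertD[OF v f b])
  moreover have "g \<odot> (0, z) \<odot> (0, z) = g \<odot> (0, 2 *\<^sub>R z)" by (simp add: gm_vertical scaleR_2)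
  ultimately show "\<bar>avg mu f (g \<odot> (0, z)) - avg mu f g\<bar> \<le> B / 2 + B\<^sup>2 / 2"
    using ddG dG[of g] dG[of "g \<odot> (0, z)"] by (simp add: abs_le_iff)
qed

text \<open>Each halving of the displacement replaces a bound \<open>B\<close> by
  \<open>B / 2 + B^2 / 2\<close>, which is the recursion of \<open>halving\<close> with start value
  \<open>1 / 4\<close>.\<close>

lemma vert_halving:
  assumes "\<And>s. 0 \<le> s \<Longrightarrow> s \<le> s0 \<Longrightarrow> vert (s *\<^sub>R z) (1 / 4)"
  shows "0 \<le> s \<Longrightarrow> s \<le> s0 / 2 ^ k \<Longrightarrow> vert (s *\<^sub>R z) (halving k)"
proof (induction k arbitrary: s)
  case (Suc k)
  have "vert ((2 * s) *\<^sub>R z) (halving k)" using Suc.prems by (intro Suc.IH) (auto simp: field_simps)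
  then show ?case using vert_half[of "s *\<^sub>R z" "halving k"] by simp
qed (use assms in simp)

definition vlip :: "'c \<Rightarrow> bool" where
  "vlip z \<longleftrightarrow> (\<exists>C. \<forall>s. vert (s *\<^sub>R z) (C * \<bar>s\<bar>))"

text \<open>The Hoelder bound is used once, to reach the value \<open>1 / 4\<close> at which the
  recursion starts. From there the bound decays geometrically at the rate of the displacement
  itself, which is Lipschitz continuity.\<close>

lemma vlip_beta: "vlip (beta u v)"
proof -
  let ?z = "2 *\<^sub>R beta u v"
  define c where "c = 2 * lipc * (norm u + norm v) + 1"
  have c: "c > 0" using lipc_nonneg by (simp add: c_def add_nonneg_pos)
  \<comment> \<open>Solves \<open>c * sqrt s0 = 1 / 4\<close>.\<close>
  define s0 where "s0 = (1 / (4 * c))\<^sup>2"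
  have s0: "s0 > 0" "sqrt s0 = 1 / (4 * c)" using c by (auto simp: s0_def)
  have base: "vert (s *\<^sub>R ?z) (1 / 4)" if s: "0 \<le> s" "s \<le> s0" for s
  proof (rule vert_mono[OF vert_commutator[OF s(1)]])
    have "2 * lipc * (norm u + norm v) * sqrt s \<le> c * sqrt s0"
      using s lipc_nonneg by (intro mult_mono) (auto simp: c_def)
    then show "2 * lipc * (norm u + norm v) * sqrt s \<le> 1 / 4" using c by (simp add: s0)
  qed
  have main: "vert (s *\<^sub>R ?z) ((2 / s0) * s)" if s: "0 < s" for s
  proof (cases "s \<le> s0")
    \<comment> \<open>Beyond \<open>s0\<close> the trivial bound 2 is already below the linear
      one.\<close>
    case False
    then show ?thesis using s0(1) by (intro vert_mono[OF vert_2]) (simp add: field_simps)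
  next
    case True
    obtain n where n: "(1 / 2) ^ n < s / s0" using real_arch_pow_inv[of "s / s0" "1 / 2"] s s0(1) by auto
    \<comment> \<open>The dyadic scale of \<open>s\<close>: the ratio \<open>s / s0\<close> lies
      between the powers of one half with exponents \<open>Suc k\<close> and \<open>k\<close>. The
      upper estimate makes \<open>vert_halving\<close> applicable, the lower one turns its bound
      into a multiple of \<open>s\<close>.\<close>
    define k where "k = (LEAST n. (1 / 2) ^ Suc n < s / s0)"
    have ex: "\<exists>n. (1 / 2) ^ Suc n < s / s0"
    proof
      have "(1 / 2 :: real) ^ Suc n \<le> (1 / 2) ^ n" by simp
      then show "(1 / 2) ^ Suc n < s / s0" using n by (rule le_less_trans)
    qed
    have k1: "(1 / 2) ^ Suc k < s / s0" unfolding k_def by (rule LeastI_ex[OF ex])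
    have k2: "s / s0 \<le> (1 / 2) ^ k"
    proof (cases k)
      case 0
      then show ?thesis using True s0(1) by simp
    next
      case (Suc k')
      then have "\<not> (1 / 2) ^ Suc k' < s / s0" using not_less_Least[of k' "\<lambda>n. (1 / 2) ^ Suc n < s / s0"] by (simp add: k_def)
      then show ?thesis using Suc by simp
    qed
    have "vert (s *\<^sub>R ?z) (halving k)"
      by (rule vert_halving[OF base]) (use s s0(1) k2 in \<open>auto simp: field_simps power_divide\<close>)
    then show ?thesis
    proof (rule vert_mono)
      have "halving k \<le> (1 / 2) ^ Suc k" using halving_le[of k] by simp
      also have "\<dots> \<le> s / s0" using k1 by simp
      also have "\<dots> \<le> (2 / s0) * s" using s s0(1) by (simp add: field_simps)
      finally show "halving k \<le> (2 / s0) * s" .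
    qed
  qed
  have "vert (s *\<^sub>R beta u v) ((1 / s0) * \<bar>s\<bar>)" for s
  proof (cases s "0 :: real" rule: linorder_cases)
    case greater
    then show ?thesis using main[of "s / 2"] by simp
  next
    case equal
    then show ?thesis by (intro vertI) (simp add: zero_prod_def[symmetric])
  next
    case less
    then show ?thesis using vert_minus[OF main[of "- s / 2"]] by simp
  qed
  then show ?thesis unfolding vlip_def by blast
qed

text \<open>Directions with a Lipschitz bound form a subspace, and it contains the values of
  \<open>beta\<close>.\<close>

lemma vlip_all: "vlip z"
proof -
  have "z \<in> span {beta u v |u v. True}" using spanning by simp
  then show ?thesis
  proof (induction rule: span_induct_alt)
    case base
    show ?case unfolding vlip_def by (intro exI[of _ 0] allI vertI) (simp add: zero_prod_def[symmetric])
  next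
    case (step c x y)
    then have "vlip x" using vlip_beta by auto
    then obtain C where C: "\<And>s. vert (s *\<^sub>R x) (C * \<bar>s\<bar>)" unfolding vlip_def by blast
    obtain C' where C': "\<And>s. vert (s *\<^sub>R y) (C' * \<bar>s\<bar>)" using step unfolding vlip_def by blast
    have "vert (s *\<^sub>R (c *\<^sub>R x + y)) ((C * \<bar>c\<bar> + C') * \<bar>s\<bar>)" for s
      using vert_add[OF C[of "s * c"] C'[of s]] by (simp add: scaleR_add_right algebra_simps abs_mult)
    then show ?case unfolding vlip_def by blast
  qed
qed

lemma vert_lipschitz: obtains C where "C \<ge> 0" "\<And>z. vert z (C * norm z)"
proof -
  have "\<forall>c\<in>Basis. \<exists>C. \<forall>s. vert (s *\<^sub>R c) (C * \<bar>s\<bar>)" using vlip_all unfolding vlip_def by blast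
  then obtain K where K: "\<And>c s. c \<in> Basis \<Longrightarrow> vert (s *\<^sub>R c) (K c * \<bar>s\<bar>)" by metis
  have K0: "0 \<le> K c" if "c \<in> Basis" for c using vert_nonneg[OF K[OF that, of 1]] by simp
  have sum: "vert (\<Sum>c\<in>A. h c) (\<Sum>c\<in>A. B c)" if "finite A" "\<And>c. c \<in> A \<Longrightarrow> vert (h c) (B c)" for A and h :: "'c \<Rightarrow> 'c" and B
    using that
  proof (induction A rule: finite_induct)
    case empty
    show ?case by (intro vertI) (simp add: zero_prod_def[symmetric])
  qed (simp add: vert_add)
  show ?thesis
  proof (rule that[of "\<Sum>c\<in>Basis. K c"])
    show "0 \<le> (\<Sum>c\<in>Basis. K c)" by (intro sum_nonneg K0)
    fix z
    have "vert (\<Sum>c\<in>Basis. (z \<bullet> c) *\<^sub>R c) (\<Sum>c\<in>Basis. K c * \<bar>z \<bullet> c\<bar>)" by (rule sum) (auto intro: K)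
    then have "vert z (\<Sum>c\<in>Basis. K c * \<bar>z \<bullet> c\<bar>)" by (simp add: euclidean_representation)
    then show "vert z ((\<Sum>c\<in>Basis. K c) * norm z)"
      by (rule vert_mono) (auto simp: sum_distrib_right intro!: sum_mono mult_left_mono K0 Basis_le_norm)
  qed
qed

text \<open>Every increment is a horizontal one followed by a vertical one, and the two bounds add
  up.\<close>

lemma lipschitz:
  obtains L where "L \<ge> 0" "\<And>f M g k. f \<in> borel_measurable borel \<Longrightarrow> (\<And>x. \<bar>f x\<bar> \<le> M) \<Longrightarrow> \<bar>avg mu f (g \<odot> k) - avg mu f g\<bar> \<le> L * M * norm k"
proof -
  obtain C where C: "C \<ge> 0" "\<And>z. vert z (C * norm z)" using vert_lipschitz by blast
  show ?thesis
  proof (rule that[of "lipc + C"])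
    show "0 \<le> lipc + C" using C lipc_nonneg by simp
    fix f :: "'b \<times> 'c \<Rightarrow> real" and M g k assume f [measurable]: "f \<in> borel_measurable borel" and M: "\<And>x. \<bar>f x\<bar> \<le> M"
    show "\<bar>avg mu f (g \<odot> k) - avg mu f g\<bar> \<le> (lipc + C) * M * norm k"
    proof (cases "M = 0")
      case True
      then have "f = (\<lambda>_. 0)" using M by (auto simp: fun_eq_iff)
      then show ?thesis using True by (simp add: avg_def)
    next
      case False
      then have M0: "M > 0" using M[of 0] by linarith
      have e: "g \<odot> k = g \<odot> (fst k, 0) \<odot> (0, snd k)" using horizontal_vertical[of k] by (simp add: gm_assoc)
      have "\<bar>avg mu (\<lambda>x. f x / M) (g \<odot> k) - avg mu (\<lambda>x. f x / M) (g \<odot> (fst k, 0))\<bar> \<le> C * norm (snd k)"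
        unfolding e by (rule vertD[OF C(2)]) (use M M0 in auto)
      then have "\<bar>(avg mu f (g \<odot> k) - avg mu f (g \<odot> (fst k, 0))) / M\<bar> \<le> C * norm (snd k)"
        by (simp add: avg_def diff_divide_distrib)
      then have "\<bar>avg mu f (g \<odot> k) - avg mu f (g \<odot> (fst k, 0))\<bar> \<le> C * norm (snd k) * M"
        using M0 by (simp add: abs_divide pos_divide_le_eq)
      moreover have "\<bar>avg mu f (g \<odot> (fst k, 0)) - avg mu f g\<bar> \<le> lipc * norm (fst k) * M" by (rule horizontal_lipschitz[OF f M])
      moreover have "C * norm (snd k) * M \<le> C * norm k * M"
        using C M0 norm_snd_le[of "snd k" "fst k"] by (intro mult_right_mono mult_left_mono) auto
      moreover have "lipc * norm (fst k) * M \<le> lipc * norm k * M"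
        using lipc_nonneg M0 norm_fst_le[of "fst k" "snd k"] by (intro mult_right_mono mult_left_mono) auto
      ultimately show ?thesis by (simp add: algebra_simps)
    qed
  qed
qed

lemma lipschitz_muS:
  assumes a: "a > 0"
  obtains L where "L \<ge> 0" "\<And>f M g k. f \<in> borel_measurable borel \<Longrightarrow> (\<And>x. \<bar>f x\<bar> \<le> M) \<Longrightarrow> \<bar>avg (muS a) f (g \<odot> k) - avg (muS a) f g\<bar> \<le> L * M * norm k"
proof -
  obtain L where L: "L \<ge> 0" "\<And>f M g k. f \<in> borel_measurable borel \<Longrightarrow> (\<And>x. \<bar>f x\<bar> \<le> M) \<Longrightarrow> \<bar>avg mu f (g \<odot> k) - avg mu f g\<bar> \<le> L * M * norm k"
    using lipschitz by blast
  define c where "c = 1 / a + (1 / a)\<^sup>2"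
  have c: "0 \<le> c" using a by (simp add: c_def)
  show ?thesis
  proof (rule that[of "L * c"])
    show "0 \<le> L * c" using L c by simp
    fix f :: "'b \<times> 'c \<Rightarrow> real" and M g k assume f [measurable]: "f \<in> borel_measurable borel" and M: "\<And>x. \<bar>f x\<bar> \<le> M"
    have M0: "0 \<le> M" using M[of 0] by linarith
    have "\<bar>avg (muS a) f (g \<odot> k) - avg (muS a) f g\<bar> \<le> L * M * norm (dil (1 / a) k)"
      using a L(2)[of "\<lambda>x. f (dil a x)" M "dil (1 / a) g" "dil (1 / a) k"] M by (simp add: avg_muS_scale dil_gm)
    also have "\<dots> \<le> L * M * (c * norm k)"
      using a L M0 norm_dil_le[of "1 / a" k] by (intro mult_left_mono) (auto simp: c_def)
    finally show "\<bar>avg (muS a) f (g \<odot> k) - avg (muS a) f g\<bar> \<le> L * c * M * norm k" by (simp add: ac_simps)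
  qed
qed

lemma taylor_bound_of_lipschitz:
  assumes t: "taylor F D C" and L: "\<And>k. \<bar>F (g \<odot> k) - F g\<bar> \<le> L * norm k"
  shows "norm (D g) \<le> L"
proof (rule field_le_epsilon)
  fix e :: real assume e: "e > 0"
  show "norm (D g) \<le> L + e"
  proof (cases "D g = 0")
    case True
    obtain k :: "'b \<times> 'c" where k: "norm k = 1" by (rule vector_choose_size[OF zero_le_one])
    have "0 \<le> L" using L[of k] k by (simp add: order_trans[OF abs_ge_zero])
    then show ?thesis using True e by simp
  next
    case False
    define n where "n = norm (D g)"
    have n: "n > 0" using False by (simp add: n_def)
    \<comment> \<open>The step along the derivative is short enough for the quadratic error per unit
      length to stay below \<open>e\<close>; the added 1 guards against
      \<open>C = 0\<close>.\<close>
    define s where "s = e / (n * (\<bar>C\<bar> + 1))"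
    have s: "s > 0" using e n by (simp add: s_def)
    let ?k = "s *\<^sub>R D g"
    have nk: "norm ?k = s * n" using s by (simp add: n_def)
    have "D g \<bullet> ?k = s * n\<^sup>2" by (simp add: n_def power2_norm_eq_inner)
    then have "s * n\<^sup>2 \<le> L * (s * n) + C * (s * n)\<^sup>2"
      using taylorD[OF t, of g ?k] L[of ?k] unfolding nk by linarith
    then have "(s * n) * n \<le> (s * n) * (L + C * (s * n))" by (simp add: power2_eq_square algebra_simps)
    then have "n \<le> L + C * (s * n)" using s n by (simp add: mult_le_cancel_left_pos)
    also have "C * (s * n) \<le> e"
    proof -
      have "s * n = e / (\<bar>C\<bar> + 1)" using n by (simp add: s_def)
      moreover have "C * (e / (\<bar>C\<bar> + 1)) \<le> (\<bar>C\<bar> + 1) * (e / (\<bar>C\<bar> + 1))" using e by (intro mult_right_mono) auto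
      ultimately show ?thesis by simp
    qed
    finally show ?thesis by (simp add: n_def)
  qed
qed

lemma taylor_diff:
  assumes "taylor F D C" "taylor F' D' C'"
  shows "taylor (\<lambda>x. F x - F' x) (\<lambda>x. D x - D' x) (C + C')"
  unfolding taylor_def
proof (intro allI)
  fix g k
  show "\<bar>F (g \<odot> k) - F' (g \<odot> k) - (F g - F' g) - (D g - D' g) \<bullet> k\<bar> \<le> (C + C') * (norm k)\<^sup>2"
    using taylorD[OF assms(1), of g k] taylorD[OF assms(2), of g k]
    by (simp add: inner_diff_left distrib_right abs_le_iff)
qed

text \<open>The horizontal derivative of a dilated function carries a factor \<open>a\<close>, whose
  square turns the duration \<open>tau\<close> into \<open>tau * a^2\<close>.\<close>

lemma sharp_bound_taylor_muS:
  assumes f [measurable]: "f \<in> borel_measurable borel" and M: "\<And>g. \<bar>f g\<bar> \<le> M" and tf: "taylor f Df Cf"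
    and t: "taylor (avg (muS a) f) D C" and a: "0 < a"
  shows "tau * a\<^sup>2 * (fst (D g) \<bullet> u)\<^sup>2 \<le> hdim * (norm u)\<^sup>2 * (avg (muS a) (\<lambda>x. (f x)\<^sup>2) g - (avg (muS a) f g)\<^sup>2)"
proof -
  let ?f = "\<lambda>x. f (dil a x)"
  let ?c = "(a + a\<^sup>2)\<^sup>2"
  have sq: "(norm (dil a k))\<^sup>2 \<le> ?c * (norm k)\<^sup>2" for k
  proof -
    have "(norm (dil a k))\<^sup>2 \<le> ((a + a\<^sup>2) * norm k)\<^sup>2" by (intro power_mono norm_dil_le a) auto
    then show ?thesis by (simp only: power_mult_distrib)
  qed
  have scale: "taylor (\<lambda>x. F (dil a x)) (\<lambda>x. dil a (D (dil a x))) (\<bar>C\<bar> * ?c)" if "taylor F D C" for F D C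
    unfolding taylor_def
  proof (intro allI)
    fix g k
    have "\<bar>F (dil a (g \<odot> k)) - F (dil a g) - dil a (D (dil a g)) \<bullet> k\<bar> \<le> C * (norm (dil a k))\<^sup>2"
      using taylorD[OF that, of "dil a g" "dil a k"] by (simp add: dil_gm inner_dil)
    also have "\<dots> \<le> \<bar>C\<bar> * (norm (dil a k))\<^sup>2" by (intro mult_right_mono) auto
    also have "\<dots> \<le> \<bar>C\<bar> * (?c * (norm k)\<^sup>2)" by (intro mult_left_mono sq) auto
    finally show "\<bar>F (dil a (g \<odot> k)) - F (dil a g) - dil a (D (dil a g)) \<bullet> k\<bar> \<le> \<bar>C\<bar> * ?c * (norm k)\<^sup>2" by (simp add: mult.assoc)
  qed
  have e: "avg (muS a) h (dil a x) = avg mu (\<lambda>x. h (dil a x)) x" if [measurable]: "h \<in> borel_measurable borel" for h :: "'b \<times> 'c \<Rightarrow> real" and x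
    using a by (simp add: avg_muS_scale)
  have "taylor (avg mu ?f) (\<lambda>x. dil a (D (dil a x))) (\<bar>C\<bar> * ?c)"
    using scale[OF t] by (simp add: e[OF f])
  from sharp_bound_taylor[OF _ _ scale[OF tf] this, of M "dil (1 / a) g" u] M
  have "tau * (fst (dil a (D (dil a (dil (1 / a) g)))) \<bullet> u)\<^sup>2
    \<le> hdim * (norm u)\<^sup>2 * (avg mu (\<lambda>x. (?f x)\<^sup>2) (dil (1 / a) g) - (avg mu ?f (dil (1 / a) g))\<^sup>2)"
    by simp
  then show ?thesis
    using a avg_muS_scale[of f a g] avg_muS_scale[of "\<lambda>x. (f x)\<^sup>2" a g] by (simp add: power_mult_distrib mult.assoc)
qed

text \<open>First order expansion along the group at a single point. It becomes ordinary
  differentiability later, since group increments from a fixed point depend linearly on the additive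
  ones.\<close>

definition has_left_derivative :: "('b \<times> 'c \<Rightarrow> real) \<Rightarrow> 'b \<times> 'c \<Rightarrow> 'b \<times> 'c \<Rightarrow> bool" where
  "has_left_derivative u D g \<longleftrightarrow> (\<forall>e>0. \<exists>d>0. \<forall>k. norm k < d \<longrightarrow> \<bar>u (g \<odot> k) - u g - D \<bullet> k\<bar> \<le> e * norm k)"

lemma avg_diff:
  assumes f: "f \<in> borel_measurable borel" "\<And>g. \<bar>f g\<bar> \<le> M" and h: "h \<in> borel_measurable borel" "\<And>g. \<bar>h g\<bar> \<le> M'"
    and N: "prob_space N" "sets N = sets borel"
  shows "avg N (\<lambda>x. f x - h x) g = avg N f g - avg N h g"
  using avg_bound(2)[OF f N, of g] avg_bound(2)[OF h N, of g] by (simp add: avg_def)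

text \<open>Writing \<open>P_1 f = P_(1-s) (P_s f)\<close> with \<open>s = 1/(j+1)\<close> replaces \<open>f\<close> by a Lipschitz function, whose
  mollifications converge uniformly; by Jensen's inequality this does not increase the variance.\<close>
lemma left_derivative_step:
  assumes f [measurable]: "f \<in> borel_measurable borel" and M: "\<And>g. \<bar>f g\<bar> \<le> M" and j: "1 \<le> j"
  obtains D where "has_left_derivative (avg mu f) D g"
    "tau * (real j / real (j + 1)) * (norm (fst D))\<^sup>2 \<le> hdim * (avg mu (\<lambda>x. (f x)\<^sup>2) g - (avg mu f g)\<^sup>2)"
proof -
  define a where "a = sqrt (real j / real (j + 1))"
  define b where "b = sqrt (real 1 / real (j + 1))"
  have a: "a > 0" "a\<^sup>2 = real j / real (j + 1)" using j by (simp_all add: a_def)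
  have b: "b > 0" by (simp add: b_def)
  define F where "F = avg (muS b) f"
  have F [measurable]: "F \<in> borel_measurable borel" unfolding F_def by measurable
  have FM: "\<bar>F x\<bar> \<le> M" for x unfolding F_def by (rule avg_bound(1)[OF f M prob_space_muS sets_muS])
  have M0: "0 \<le> M" using M[of 0] by linarith
  have G: "avg mu f x = avg (muS a) F x" for x
    using avg_semigroup[OF f M j, of 1 x] by (simp add: F_def a_def b_def)
  obtain Lb where Lb: "Lb \<ge> 0" "\<And>x k. \<bar>F (x \<odot> k) - F x\<bar> \<le> Lb * M * norm k"
    using lipschitz_muS[OF b] f M unfolding F_def by metis
  obtain La where La: "La \<ge> 0" "\<And>h M g k. h \<in> borel_measurable borel \<Longrightarrow> (\<And>x. \<bar>h x\<bar> \<le> M) \<Longrightarrow> \<bar>avg (muS a) h (g \<odot> k) - avg (muS a) h g\<bar> \<le> La * M * norm k"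
    using lipschitz_muS[OF a(1)] by blast
  define Fn where "Fn n = mollify (1 / real (Suc n)) F" for n
  have Fnm [measurable]: "Fn n \<in> borel_measurable borel" for n unfolding Fn_def by measurable
  have FnM: "\<bar>Fn n x\<bar> \<le> M" for n x
    unfolding Fn_def using mollify_bound(2)[OF F FM, of "1 / real (Suc n)" x 0 M] FM by simp
  \<comment> \<open>Bounds the uniform distance of \<open>F\<close> from its mollification over
    balls of radius \<open>sqrt (1 / Suc n)\<close>, by the Lipschitz constant of
    \<open>F\<close>.\<close>
  define d where "d n = Lb * M * sqrt (1 / real (Suc n))" for n
  have d0: "0 \<le> d n" for n using Lb(1) M0 by (simp add: d_def)
  have dlim: "d \<longlonglongrightarrow> 0"
  proof -
    have "(\<lambda>n. sqrt (1 / real (Suc n))) \<longlonglongrightarrow> sqrt 0" by (intro tendsto_real_sqrt LIMSEQ_Suc lim_1_over_n)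
    then show ?thesis unfolding d_def[abs_def] by (intro tendsto_mult_right_zero) simp
  qed
  have Fnd: "\<bar>Fn n x - F x\<bar> \<le> d n" for n x
    unfolding Fn_def
  proof (rule mollify_bound(2)[OF F FM])
    fix k :: "'b \<times> 'c" assume k: "norm k \<le> sqrt (1 / real (Suc n))"
    have "Lb * M * norm k \<le> d n" unfolding d_def using k Lb(1) M0 by (intro mult_left_mono) auto
    then show "\<bar>F (x \<odot> k) - F x\<bar> \<le> d n" using Lb(2)[of x k] by linarith
  qed auto
  define un where "un n = avg (muS a) (Fn n)" for n
  have mS: "integrable (muS a) (\<lambda>w. (norm w)\<^sup>2)"
  proof -
    have "integrable mu (\<lambda>w. (norm (dil a w))\<^sup>2)"
    proof (rule Bochner_Integration.integrable_bound)
      show "integrable mu (\<lambda>w. (a + a\<^sup>2)\<^sup>2 * (norm w)\<^sup>2)" using moment2 by simp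
      show "AE w in mu. norm ((norm (dil a w))\<^sup>2) \<le> norm ((a + a\<^sup>2)\<^sup>2 * (norm w)\<^sup>2)"
      proof (rule AE_I2)
        fix w
        have "(norm (dil a w))\<^sup>2 \<le> ((a + a\<^sup>2) * norm w)\<^sup>2" by (intro power_mono norm_dil_le a) auto
        then show "norm ((norm (dil a w))\<^sup>2) \<le> norm ((a + a\<^sup>2)\<^sup>2 * (norm w)\<^sup>2)" by (simp add: power_mult_distrib)
      qed
    qed measurable
    then show ?thesis unfolding muS_def by (subst integrable_distr_eq) auto
  qed
  have "\<exists>D C Df Cf. taylor (un n) D C \<and> taylor (Fn n) Df Cf" for n
  proof -
    obtain Df Cf where t: "taylor (Fn n) Df Cf"
      unfolding Fn_def using taylor_mollify[OF F FM, of "1 / real (Suc n)"] by auto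
    obtain D C where "taylor (un n) D C"
      unfolding un_def using taylor_avg[OF Fnm FnM t prob_space_muS sets_muS mS] by blast
    with t show ?thesis by blast
  qed
  then obtain D C Df Cf where T: "\<And>n. taylor (un n) (D n) (C n)" "\<And>n. taylor (Fn n) (Df n) (Cf n)"
    by metis
  \<comment> \<open>The error \<open>un n - avg mu f\<close> is the average of the small function
    \<open>Fn n - F\<close>, so its Lipschitz constant is small too. This yields convergence of the
    derivatives, not only of the functions.\<close>
  have ud: "\<bar>(un n (x \<odot> k) - avg mu f (x \<odot> k)) - (un n x - avg mu f x)\<bar> \<le> La * d n * norm k" for n x k
    using La(2)[of "\<lambda>x. Fn n x - F x" "d n" x k] Fnd[of n]
    by (simp add: un_def G avg_diff[OF Fnm FnM F FM prob_space_muS sets_muS])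
  have Dd: "norm (D n g - D m g) \<le> La * (d n + d m)" for n m
  proof (rule taylor_bound_of_lipschitz[OF taylor_diff[OF T(1)[of n] T(1)[of m]]])
    fix k
    show "\<bar>un n (g \<odot> k) - un m (g \<odot> k) - (un n g - un m g)\<bar> \<le> La * (d n + d m) * norm k"
      using ud[of n g k] ud[of m g k] by (simp add: distrib_left distrib_right abs_le_iff)
  qed
  have "Cauchy (\<lambda>n. D n g)"
  proof (rule metric_CauchyI)
    fix e :: real assume e: "e > 0"
    have "(\<lambda>n. La * d n) \<longlonglongrightarrow> 0" by (rule tendsto_mult_right_zero[OF dlim])
    then have "\<forall>\<^sub>F n in sequentially. La * d n < e / 2" using e by (intro order_tendstoD(2)) auto
    then obtain N where N: "\<And>n. n \<ge> N \<Longrightarrow> La * d n < e / 2" unfolding eventually_sequentially by blast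
    show "\<exists>N. \<forall>m\<ge>N. \<forall>n\<ge>N. dist (D m g) (D n g) < e"
    proof (intro exI allI impI)
      fix m n assume "m \<ge> N" "n \<ge> N"
      then show "dist (D m g) (D n g) < e" using N[of m] N[of n] Dd[of m n] by (simp add: dist_norm distrib_left)
    qed
  qed
  then obtain D0 where D0: "(\<lambda>n. D n g) \<longlonglongrightarrow> D0" using convergent_eq_Cauchy by blast
  have D0d: "norm (D n g - D0) \<le> La * d n" for n
  proof (rule LIMSEQ_le[OF tendsto_norm[OF tendsto_diff[OF tendsto_const D0]]])
    show "(\<lambda>m. La * (d n + d m)) \<longlonglongrightarrow> La * d n"
      using tendsto_mult_left[OF tendsto_add[OF tendsto_const[of "d n"] dlim], of La] by simp
  qed (use Dd in auto)
  show ?thesis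
  proof (rule that[of D0])
    show "has_left_derivative (avg mu f) D0 g"
      unfolding has_left_derivative_def
    proof (intro allI impI)
      fix e :: real assume e: "e > 0"
      have "(\<lambda>n. La * d n) \<longlonglongrightarrow> 0" by (rule tendsto_mult_right_zero[OF dlim])
      then have "\<forall>\<^sub>F n in sequentially. La * d n < e / 3" using e by (intro order_tendstoD(2)) auto
      then obtain n where n: "La * d n < e / 3" unfolding eventually_sequentially by blast
      define s where "s = e / (3 * (\<bar>C n\<bar> + 1))"
      have s: "s > 0" using e by (simp add: s_def)
      show "\<exists>r>0. \<forall>k. norm k < r \<longrightarrow> \<bar>avg mu f (g \<odot> k) - avg mu f g - D0 \<bullet> k\<bar> \<le> e * norm k"
      proof (intro exI[of _ s] conjI allI impI s)
        fix k :: "'b \<times> 'c" assume k: "norm k < s"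
        have 1: "\<bar>(un n (g \<odot> k) - avg mu f (g \<odot> k)) - (un n g - avg mu f g)\<bar> \<le> e / 3 * norm k"
          using ud[of n g k] mult_right_mono[of "La * d n" "e / 3" "norm k"] n by simp
        have 2: "\<bar>un n (g \<odot> k) - un n g - D n g \<bullet> k\<bar> \<le> e / 3 * norm k"
        proof -
          have "C n * norm k \<le> (\<bar>C n\<bar> + 1) * s" using k by (intro mult_mono) auto
          also have "\<dots> = e / 3"
          proof -
            have "c * (e / (3 * c)) = e / 3" if "c > 0" for c :: real using that by simp
            from this[of "\<bar>C n\<bar> + 1"] show ?thesis unfolding s_def by simp
          qed
          finally have "C n * norm k * norm k \<le> e / 3 * norm k" by (intro mult_right_mono) auto
          then show ?thesis using taylorD[OF T(1), of n g k] by (simp add: power2_eq_square)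
        qed
        have 3: "\<bar>(D n g - D0) \<bullet> k\<bar> \<le> e / 3 * norm k"
        proof (rule order_trans[OF Cauchy_Schwarz_ineq2 mult_right_mono])
          show "norm (D n g - D0) \<le> e / 3" using D0d[of n] n by linarith
        qed simp
        have "e * norm k = e / 3 * norm k + e / 3 * norm k + e / 3 * norm k" by simp
        then show "\<bar>avg mu f (g \<odot> k) - avg mu f g - D0 \<bullet> k\<bar> \<le> e * norm k"
          using 1 2 3 unfolding inner_diff_left by linarith
      qed
    qed
    have unl: "(\<lambda>n. un n g) \<longlonglongrightarrow> avg mu f g"
    proof (rule LIM_zero_cancel, rule Lim_null_comparison[OF _ dlim])
      have "\<bar>un n g - avg mu f g\<bar> \<le> d n" for n
        using avg_bound(1)[of "\<lambda>x. Fn n x - F x" "d n" "muS a" g] Fnd[of n] prob_space_muS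
        by (simp add: un_def G avg_diff[OF Fnm FnM F FM prob_space_muS sets_muS])
      then show "\<forall>\<^sub>F n in sequentially. norm (un n g - avg mu f g) \<le> d n" by simp
    qed
    have sqM: "\<bar>(h x)\<^sup>2\<bar> \<le> M\<^sup>2" if "\<And>x. \<bar>h x\<bar> \<le> M" for h :: "'b \<times> 'c \<Rightarrow> real" and x
      using power_mono[OF that[of x], of 2] by simp
    have sql: "(\<lambda>n. avg (muS a) (\<lambda>x. (Fn n x)\<^sup>2) g) \<longlonglongrightarrow> avg (muS a) (\<lambda>x. (F x)\<^sup>2) g"
    proof (rule LIM_zero_cancel, rule Lim_null_comparison)
      have "\<bar>(Fn n x)\<^sup>2 - (F x)\<^sup>2\<bar> \<le> 2 * M * d n" for n x
      proof -
        have "(Fn n x)\<^sup>2 - (F x)\<^sup>2 = (Fn n x + F x) * (Fn n x - F x)" by (simp add: power2_eq_square algebra_simps)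
        then have "\<bar>(Fn n x)\<^sup>2 - (F x)\<^sup>2\<bar> = \<bar>Fn n x + F x\<bar> * \<bar>Fn n x - F x\<bar>" by (simp only: abs_mult)
        also have "\<dots> \<le> (2 * M) * d n" using FnM[of n x] FM[of x] M0 by (intro mult_mono Fnd) auto
        finally show ?thesis .
      qed
      then have "\<bar>avg (muS a) (\<lambda>x. (Fn n x)\<^sup>2 - (F x)\<^sup>2) g\<bar> \<le> 2 * M * d n" for n
        by (intro avg_bound(1)[OF _ _ prob_space_muS sets_muS]) auto
      moreover have "avg (muS a) (\<lambda>x. (Fn n x)\<^sup>2 - (F x)\<^sup>2) g = avg (muS a) (\<lambda>x. (Fn n x)\<^sup>2) g - avg (muS a) (\<lambda>x. (F x)\<^sup>2) g" for n
        by (rule avg_diff[OF _ sqM[OF FnM] _ sqM[OF FM] prob_space_muS sets_muS]) auto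
      ultimately show "\<forall>\<^sub>F n in sequentially. norm (avg (muS a) (\<lambda>x. (Fn n x)\<^sup>2) g - avg (muS a) (\<lambda>x. (F x)\<^sup>2) g) \<le> 2 * M * d n"
        by simp
      show "(\<lambda>n. 2 * M * d n) \<longlonglongrightarrow> 0" by (rule tendsto_mult_right_zero[OF dlim])
    qed
    have jensen: "avg (muS a) (\<lambda>x. (F x)\<^sup>2) g \<le> avg mu (\<lambda>x. (f x)\<^sup>2) g"
    proof -
      have "(F x)\<^sup>2 \<le> avg (muS b) (\<lambda>x. (f x)\<^sup>2) x" for x
      proof -
        interpret S: prob_space "muS b" by (rule prob_space_muS)
        have i1: "integrable (muS b) (\<lambda>w. f (x \<odot> w))" by (rule avg_bound(2)[OF f M prob_space_muS sets_muS])
        have i2: "integrable (muS b) (\<lambda>w. (f (x \<odot> w))\<^sup>2)"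
          by (rule avg_bound(2)[OF _ sqM[OF M] prob_space_muS sets_muS]) simp
        have "0 \<le> (\<integral>w. (f (x \<odot> w) - F x)\<^sup>2 \<partial>muS b)" by (intro Bochner_Integration.integral_nonneg) auto
        also have "(\<integral>w. (f (x \<odot> w) - F x)\<^sup>2 \<partial>muS b) = (\<integral>w. (f (x \<odot> w))\<^sup>2 - 2 * F x * f (x \<odot> w) + (F x)\<^sup>2 \<partial>muS b)"
          by (simp add: power2_diff algebra_simps)
        also have "\<dots> = avg (muS b) (\<lambda>x. (f x)\<^sup>2) x - 2 * F x * F x + (F x)\<^sup>2"
          using i1 i2 S.prob_space by (simp add: avg_def F_def)
        finally show ?thesis by (simp add: power2_eq_square)
      qed
      moreover have i1: "integrable (muS a) (\<lambda>w. (F (g \<odot> w))\<^sup>2)"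
        by (rule avg_bound(2)[OF _ sqM[OF FM] prob_space_muS sets_muS]) simp
      moreover have "integrable (muS a) (\<lambda>w. avg (muS b) (\<lambda>x. (f x)\<^sup>2) (g \<odot> w))"
        by (rule avg_bound(2)[OF _ avg_bound(1)[OF _ sqM[OF M] prob_space_muS sets_muS] prob_space_muS sets_muS]) auto
      ultimately have "avg (muS a) (\<lambda>x. (F x)\<^sup>2) g \<le> avg (muS a) (avg (muS b) (\<lambda>x. (f x)\<^sup>2)) g"
        unfolding avg_def[of "muS a"] by (intro integral_mono) auto
      also have "\<dots> = avg mu (\<lambda>x. (f x)\<^sup>2) g"
        unfolding a_def b_def
        by (rule avg_semigroup[where f="\<lambda>x. (f x)\<^sup>2" and M="M\<^sup>2", symmetric]) (use sqM[OF M] j in auto)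
      finally show ?thesis .
    qed
    have fin: "tau * a\<^sup>2 * (fst D0 \<bullet> u)\<^sup>2 \<le> hdim * (norm u)\<^sup>2 * (avg mu (\<lambda>x. (f x)\<^sup>2) g - (avg mu f g)\<^sup>2)" for u
    proof -
      have "tau * a\<^sup>2 * (fst D0 \<bullet> u)\<^sup>2 \<le> hdim * (norm u)\<^sup>2 * (avg (muS a) (\<lambda>x. (F x)\<^sup>2) g - (avg mu f g)\<^sup>2)"
      proof (rule LIMSEQ_le)
        show "(\<lambda>n. tau * a\<^sup>2 * (fst (D n g) \<bullet> u)\<^sup>2) \<longlonglongrightarrow> tau * a\<^sup>2 * (fst D0 \<bullet> u)\<^sup>2" by (intro tendsto_intros D0)
        show "(\<lambda>n. hdim * (norm u)\<^sup>2 * (avg (muS a) (\<lambda>x. (Fn n x)\<^sup>2) g - (un n g)\<^sup>2)) \<longlonglongrightarrow> hdim * (norm u)\<^sup>2 * (avg (muS a) (\<lambda>x. (F x)\<^sup>2) g - (avg mu f g)\<^sup>2)"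
          by (intro tendsto_intros sql unl)
        show "\<exists>N. \<forall>n\<ge>N. tau * a\<^sup>2 * (fst (D n g) \<bullet> u)\<^sup>2 \<le> hdim * (norm u)\<^sup>2 * (avg (muS a) (\<lambda>x. (Fn n x)\<^sup>2) g - (un n g)\<^sup>2)"
          using sharp_bound_taylor_muS[OF Fnm FnM T(2) _ a(1)] T(1) unfolding un_def by blast
      qed
      also have "\<dots> \<le> hdim * (norm u)\<^sup>2 * (avg mu (\<lambda>x. (f x)\<^sup>2) g - (avg mu f g)\<^sup>2)"
        using jensen by (intro mult_left_mono) (auto simp: hdim_def)
      finally show ?thesis .
    qed
    let ?V = "avg mu (\<lambda>x. (f x)\<^sup>2) g - (avg mu f g)\<^sup>2"
    have V0: "0 \<le> ?V"
      unfolding variance_avg[OF f M, symmetric] by (intro Bochner_Integration.integral_nonneg) auto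
    show "tau * (real j / real (j + 1)) * (norm (fst D0))\<^sup>2 \<le> hdim * ?V"
    proof (cases "fst D0 = 0")
      case True
      then show ?thesis using V0 by (simp add: hdim_def)
    next
      case False
      define N where "N = (norm (fst D0))\<^sup>2"
      have N: "N > 0" using False by (simp add: N_def)
      \<comment> \<open>The best direction is the derivative itself; one factor of its squared norm
        cancels.\<close>
      have "tau * a\<^sup>2 * N\<^sup>2 \<le> hdim * N * ?V"
        using fin[of "fst D0"] unfolding N_def power2_norm_eq_inner .
      then have "N * (tau * a\<^sup>2 * N) \<le> N * (hdim * ?V)" by (simp add: power2_eq_square ac_simps)
      then show ?thesis using N unfolding a(2) N_def[symmetric] by (simp only: mult_le_cancel_left_pos)
    qed
  qed
qed

text \<open>By uniqueness the derivative does not depend on \<open>j\<close>, and for large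
  \<open>j\<close> the loss factor \<open>j / (j + 1)\<close> tends to 1, which recovers the sharp
  constant.\<close>

theorem left_derivative_bound:
  assumes f [measurable]: "f \<in> borel_measurable borel" and M: "\<And>g. \<bar>f g\<bar> \<le> M"
  obtains D where "has_left_derivative (avg mu f) D g"
    "tau * (norm (fst D))\<^sup>2 \<le> hdim * (avg mu (\<lambda>x. (f x)\<^sup>2) g - (avg mu f g)\<^sup>2)"
proof -
  obtain D where D: "has_left_derivative (avg mu f) D g"
    using left_derivative_step[OF f M, of 1 g] by (metis order_refl)
  have "tau * (real j / real (j + 1)) * (norm (fst D))\<^sup>2 \<le> hdim * (avg mu (\<lambda>x. (f x)\<^sup>2) g - (avg mu f g)\<^sup>2)" if j: "1 \<le> j" for j
  proof -
    obtain D' where D': "has_left_derivative (avg mu f) D' g"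
      "tau * (real j / real (j + 1)) * (norm (fst D'))\<^sup>2 \<le> hdim * (avg mu (\<lambda>x. (f x)\<^sup>2) g - (avg mu f g)\<^sup>2)"
      using left_derivative_step[OF f M j, of g] by blast
    have "D = D'"
      by (rule taylor_unique[where u="avg mu f" and g=g]) (use D D'(1) in \<open>unfold has_left_derivative_def, blast+\<close>)
    with D' show ?thesis by simp
  qed
  moreover have "(\<lambda>j. tau * (real j / real (j + 1)) * (norm (fst D))\<^sup>2) \<longlonglongrightarrow> tau * 1 * (norm (fst D))\<^sup>2"
  proof (intro tendsto_intros)
    show "(\<lambda>j. real j / real (j + 1)) \<longlonglongrightarrow> 1" using LIMSEQ_n_over_Suc_n by simp
  qed
  ultimately have "tau * 1 * (norm (fst D))\<^sup>2 \<le> hdim * (avg mu (\<lambda>x. (f x)\<^sup>2) g - (avg mu f g)\<^sup>2)"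
    by (intro LIMSEQ_le_const2) auto
  with D that show ?thesis by simp
qed

end

section \<open>Random walks\<close>

definition gauss_scaled :: "real \<Rightarrow> 'a::euclidean_space measure" where
  "gauss_scaled h = distr gauss borel (\<lambda>x. sqrt h *\<^sub>R x)"

lemma sets_gauss_scaled [measurable_cong, simp]: "sets (gauss_scaled h) = sets borel"
  and space_gauss_scaled [simp]: "space (gauss_scaled h) = UNIV"
  by (auto simp: gauss_scaled_def)

lemma prob_space_gauss_scaled: "prob_space (gauss_scaled h :: 'a::euclidean_space measure)"
  unfolding gauss_scaled_def by (rule gauss.prob_space_distr) simp

lemma nn_integral_gauss_scaled:
  "f \<in> borel_measurable borel \<Longrightarrow> (\<integral>\<^sup>+x. f x \<partial>gauss_scaled h) = (\<integral>\<^sup>+x. f (sqrt h *\<^sub>R x) \<partial>gauss)"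
  unfolding gauss_scaled_def by (subst nn_integral_distr) auto

lemma gauss_odd:
  fixes f :: "'a::euclidean_space \<Rightarrow> real"
  assumes [measurable]: "f \<in> borel_measurable borel" and odd: "\<And>x. f (- x) = - f x"
  shows "(\<integral>x. f x \<partial>gauss) = 0"
proof -
  have "(\<integral>x. f x \<partial>gauss) = (\<integral>x. f x \<partial>distr gauss borel uminus)" by (simp only: gauss_uminus)
  also have "\<dots> = (\<integral>x. f (- x) \<partial>gauss)" by (subst integral_distr) auto
  finally show ?thesis by (simp add: odd)
qed

definition gauss_m2 :: "'a::euclidean_space itself \<Rightarrow> real" where
  "gauss_m2 _ = (\<integral>x. (norm (x::'a))\<^sup>2 \<partial>gauss)"

lemma gauss_m2_nonneg: "0 \<le> gauss_m2 TYPE('a::euclidean_space)"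
  unfolding gauss_m2_def by (intro Bochner_Integration.integral_nonneg) auto

text \<open>The cross term is odd in the Gaussian variable and integrates to 0. This orthogonality
  of martingale increments drives the second moment estimates for the walks.\<close>

lemma nn_integral_gauss_increment:
  fixes l :: "'a::euclidean_space \<Rightarrow> 'z::euclidean_space"
  assumes l: "linear l" and c: "\<And>x. norm (l x) \<le> c * norm x" and h: "0 \<le> h"
  shows "(\<integral>\<^sup>+y. ennreal ((norm (r + l y))\<^sup>2) \<partial>gauss_scaled h) \<le> ennreal ((norm r)\<^sup>2 + c\<^sup>2 * h * gauss_m2 TYPE('a))"
proof -
  have lc [measurable]: "l \<in> borel_measurable borel"
    by (rule borel_measurable_continuous_onI) (rule linear_continuous_on, rule linear_conv_bounded_linear[THEN iffD1, OF l])
  have ls: "l (sqrt h *\<^sub>R x) = sqrt h *\<^sub>R l x" for x by (rule linear_cmul[OF l])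
  have eq: "(norm (r + l (sqrt h *\<^sub>R x)))\<^sup>2 = (norm r)\<^sup>2 + 2 * sqrt h * (r \<bullet> l x) + h * (norm (l x))\<^sup>2" for x
    unfolding ls power2_norm_eq_inner using h
    by (simp add: inner_add_left inner_add_right inner_commute[of "l x" r] distrib_left mult.assoc[symmetric])
  have sqb: "(norm (l x))\<^sup>2 \<le> c\<^sup>2 * (norm x)\<^sup>2" for x
    using power_mono[OF c[of x], of 2] by (simp add: power_mult_distrib)
  have i2: "integrable gauss (\<lambda>x::'a. (norm (l x))\<^sup>2)"
    by (rule Bochner_Integration.integrable_bound[of _ "\<lambda>x. c\<^sup>2 * (norm x)\<^sup>2"]) (use sqb gauss_norm_moment in auto)
  have i1: "integrable gauss (\<lambda>x::'a. r \<bullet> l x)"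
  proof (rule Bochner_Integration.integrable_bound[of _ "\<lambda>x. (norm r)\<^sup>2 + (norm (l x))\<^sup>2"])
    show "integrable gauss (\<lambda>x::'a. (norm r)\<^sup>2 + (norm (l x))\<^sup>2)" using i2 by simp
    show "AE x in gauss. norm (r \<bullet> l x) \<le> norm ((norm r)\<^sup>2 + (norm (l x))\<^sup>2)"
    proof (rule AE_I2)
      fix x :: 'a
      have "\<bar>r \<bullet> l x\<bar> \<le> norm r * norm (l x)" by (rule Cauchy_Schwarz_ineq2)
      moreover have "2 * (norm r * norm (l x)) \<le> (norm r)\<^sup>2 + (norm (l x))\<^sup>2"
        using zero_le_power2[of "norm r - norm (l x)"] unfolding power2_diff by simp
      moreover have "0 \<le> norm r * norm (l x)" by simp
      ultimately show "norm (r \<bullet> l x) \<le> norm ((norm r)\<^sup>2 + (norm (l x))\<^sup>2)" unfolding real_norm_def by linarith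
    qed
  qed measurable
  have "(\<integral>x. r \<bullet> l x \<partial>gauss) = 0"
    by (rule gauss_odd) (use linear_neg[OF l] in auto)
  then have I: "(\<integral>x. (norm (r + l (sqrt h *\<^sub>R x)))\<^sup>2 \<partial>gauss) = (norm r)\<^sup>2 + h * (\<integral>x. (norm (l x))\<^sup>2 \<partial>gauss)"
    unfolding eq using i1 i2 gauss.prob_space[where 'a='a] by simp
  have ii: "integrable gauss (\<lambda>x. (norm (r + l (sqrt h *\<^sub>R x)))\<^sup>2)" unfolding eq using i1 i2 by simp
  have "(\<integral>\<^sup>+y. ennreal ((norm (r + l y))\<^sup>2) \<partial>gauss_scaled h) = (\<integral>\<^sup>+x. ennreal ((norm (r + l (sqrt h *\<^sub>R x)))\<^sup>2) \<partial>gauss)"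
    by (rule nn_integral_gauss_scaled) measurable
  also have "\<dots> = ennreal (\<integral>x. (norm (r + l (sqrt h *\<^sub>R x)))\<^sup>2 \<partial>gauss)"
    by (rule nn_integral_eq_integral[OF ii]) auto
  also have "\<dots> \<le> ennreal ((norm r)\<^sup>2 + c\<^sup>2 * h * gauss_m2 TYPE('a))"
  proof (rule ennreal_leI)
    have "(\<integral>x. (norm (l x))\<^sup>2 \<partial>gauss) \<le> (\<integral>x. c\<^sup>2 * (norm (x::'a))\<^sup>2 \<partial>gauss)"
      by (rule integral_mono) (use i2 gauss_norm_moment sqb in auto)
    also have "\<dots> = c\<^sup>2 * gauss_m2 TYPE('a)" by (simp add: gauss_m2_def)
    finally have "h * (\<integral>x. (norm (l x))\<^sup>2 \<partial>gauss) \<le> h * (c\<^sup>2 * gauss_m2 TYPE('a))" using h by (rule mult_left_mono)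
    then show "(\<integral>x. (norm (r + l (sqrt h *\<^sub>R x)))\<^sup>2 \<partial>gauss) \<le> (norm r)\<^sup>2 + c\<^sup>2 * h * gauss_m2 TYPE('a)"
      unfolding I by (simp add: ac_simps)
  qed
  finally show ?thesis .
qed

context step2_group
begin

text \<open>The vertical part is the left-point Riemann sum of the stochastic area, so the
  discretised process is exactly a random walk on the group.\<close>

primrec walk :: "(nat \<Rightarrow> 'b) \<Rightarrow> nat \<Rightarrow> 'b \<times> 'c" where
  "walk x 0 = 0"
| "walk x (Suc n) = walk x n \<odot> (x n, 0)"

lemma walk_cong: "(\<And>k. k < n \<Longrightarrow> x k = y k) \<Longrightarrow> walk x n = walk y n"
  by (induction n) auto

lemma fst_walk: "fst (walk x n) = (\<Sum>k<n. x k)"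
  by (induction n) auto

lemma snd_walk: "snd (walk x n) = (\<Sum>k<n. beta (\<Sum>i<k. x i) (x k))"
  by (induction n) (auto simp: gm_def fst_walk)

text \<open>\<open>n - n mod j\<close> is the start of the block containing \<open>n\<close>, so the
  sum restarts at every multiple of \<open>j\<close>.\<close>

definition block_sum :: "nat \<Rightarrow> (nat \<Rightarrow> 'b) \<Rightarrow> nat \<Rightarrow> 'b" where
  "block_sum j x n = (\<Sum>i\<in>{n - n mod j..<n}. x i)"

text \<open>\<open>refine j x n\<close> is the vertical error of a walk whose increments are grouped in blocks
  of length \<open>j\<close>.\<close>
primrec refine :: "nat \<Rightarrow> (nat \<Rightarrow> 'b) \<Rightarrow> nat \<Rightarrow> 'c" where
  "refine j x 0 = 0"
| "refine j x (Suc n) = refine j x n + beta (block_sum j x n) (x n)"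

lemma refine_cong: "(\<And>k. k < n \<Longrightarrow> x k = y k) \<Longrightarrow> refine j x n = refine j y n"
proof (induction n)
  case (Suc n)
  have "block_sum j x n = block_sum j y n" unfolding block_sum_def by (intro sum.cong) (use Suc.prems in auto)
  with Suc show ?case by simp
qed simp

lemma block_sum_Suc: "block_sum j x (Suc n) = (if Suc n mod j = 0 then 0 else block_sum j x n + x n)"
proof (cases "Suc n mod j = 0")
  case False
  then have m: "Suc n mod j = Suc (n mod j)" by (simp add: mod_Suc split: if_splits)
  have "{Suc n - Suc n mod j..<Suc n} = insert n {n - n mod j..<n}" unfolding m by auto
  then show ?thesis using False by (simp add: block_sum_def add.commute)
qed (simp add: block_sum_def)

text \<open>Within a block the coarse walk pairs its position at the start of the block with the
  whole block increment, whereas the fine walk also records the pairings of increments inside the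
  block; \<open>refine\<close> collects exactly these.\<close>

lemma walk_refine:
  fixes x :: "nat \<Rightarrow> 'b"
  assumes j: "1 \<le> j"
  defines "X \<equiv> \<lambda>i. \<Sum>l<j. x (i * j + l)"
  shows "fst (walk x (i * j)) = fst (walk X i)"
    and "snd (walk x (i * j)) = snd (walk X i) + refine j x (i * j)"
proof -
  \<comment> \<open>The induction inside a block needs the identity at every intermediate position,
    where the coarse walk is continued by pairing its position at the block start with the partial
    block sum.\<close>
  have inv: "l \<le> j \<Longrightarrow> fst (walk x (i * j + l)) = fst (walk X i) + (\<Sum>k<l. x (i * j + k)) \<and>
      snd (walk x (i * j + l)) = snd (walk X i) + beta (fst (walk X i)) (\<Sum>k<l. x (i * j + k)) + refine j x (i * j + l)"
    if base: "fst (walk x (i * j)) = fst (walk X i)" "snd (walk x (i * j)) = snd (walk X i) + refine j x (i * j)" for i l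
  proof (induction l)
    case 0
    then show ?case using base by (simp add: zero_right)
  next
    case (Suc l)
    then have IH: "fst (walk x (i * j + l)) = fst (walk X i) + (\<Sum>k<l. x (i * j + k))"
      "snd (walk x (i * j + l)) = snd (walk X i) + beta (fst (walk X i)) (\<Sum>k<l. x (i * j + k)) + refine j x (i * j + l)"
      by auto
    have lj: "l < j" using Suc.prems by simp
    then have "(i * j + l) mod j = l" by simp
    then have "block_sum j x (i * j + l) = (\<Sum>k\<in>{i * j..<i * j + l}. x k)" by (simp add: block_sum_def)
    also have "\<dots> = (\<Sum>k<l. x (i * j + k))"
      using sum.shift_bounds_nat_ivl[of x 0 "i * j" l] by (simp add: lessThan_atLeast0 add.commute)
    finally have b: "block_sum j x (i * j + l) = (\<Sum>k<l. x (i * j + k))" .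
    show ?case using IH by (simp add: gm_def b add_left add_right)
  qed
  have "fst (walk x (i * j)) = fst (walk X i) \<and> snd (walk x (i * j)) = snd (walk X i) + refine j x (i * j)"
  proof (induction i)
    case (Suc i)
    then show ?case using inv[of i j] by (simp add: add.commute[of j] gm_def X_def)
  qed simp
  then show "fst (walk x (i * j)) = fst (walk X i)" "snd (walk x (i * j)) = snd (walk X i) + refine j x (i * j)" by auto
qed

definition gprod :: "real \<Rightarrow> nat \<Rightarrow> (nat \<Rightarrow> 'b) measure" where
  "gprod h n = PiM {..<n} (\<lambda>_. gauss_scaled h)"

lemma borel_measurable_beta [measurable (raw)]:
  assumes [measurable]: "f \<in> borel_measurable M" "g \<in> borel_measurable M"
  shows "(\<lambda>x. beta (f x) (g x)) \<in> borel_measurable M"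
  by (rule borel_measurable_continuous_Pair[OF assms])
     (rule continuous_on[OF continuous_on_fst[OF continuous_on_id] continuous_on_snd[OF continuous_on_id]])

lemma walk_measurable:
  assumes "\<And>k. k < n \<Longrightarrow> (\<lambda>w. x w k) \<in> borel_measurable M"
  shows "(\<lambda>w. walk (x w) n) \<in> borel_measurable M"
  using assms
proof (induction n)
  case (Suc n)
  have [measurable]: "(\<lambda>w. walk (x w) n) \<in> borel_measurable M" "(\<lambda>w. x w n) \<in> borel_measurable M"
    using Suc by auto
  show ?case by simp
qed simp

lemma block_sum_measurable:
  assumes "\<And>k. k < n \<Longrightarrow> (\<lambda>w. x w k) \<in> borel_measurable M"
  shows "(\<lambda>w. block_sum j (x w) n) \<in> borel_measurable M"
  unfolding block_sum_def by (intro borel_measurable_sum) (use assms in auto)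

lemma refine_measurable:
  assumes "\<And>k. k < n \<Longrightarrow> (\<lambda>w. x w k) \<in> borel_measurable M"
  shows "(\<lambda>w. refine j (x w) n) \<in> borel_measurable M"
  using assms
proof (induction n)
  case (Suc n)
  have [measurable]: "(\<lambda>w. refine j (x w) n) \<in> borel_measurable M" "(\<lambda>w. x w n) \<in> borel_measurable M"
    "(\<lambda>w. block_sum j (x w) n) \<in> borel_measurable M"
    using Suc by (auto intro!: block_sum_measurable)
  show ?case by simp
qed simp

lemma gprod_component: "k < n \<Longrightarrow> (\<lambda>x. x k) \<in> borel_measurable (gprod h n)"
  unfolding gprod_def using measurable_component_singleton[of k "{..<n}" "\<lambda>_. gauss_scaled h :: 'b measure"]
  by (simp add: measurable_cong_sets[OF refl sets_gauss_scaled])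

lemma nn_integral_gprod_Suc:
  assumes "f \<in> borel_measurable (gprod h (Suc n))"
  shows "(\<integral>\<^sup>+x. f x \<partial>gprod h (Suc n)) = (\<integral>\<^sup>+x. \<integral>\<^sup>+y. f (x(n := y)) \<partial>gauss_scaled h \<partial>gprod h n)"
proof -
  interpret product_sigma_finite "\<lambda>_::nat. gauss_scaled h :: 'b measure"
    by (simp add: product_sigma_finite_def prob_space_gauss_scaled prob_space_imp_sigma_finite)
  show ?thesis using assms unfolding gprod_def lessThan_Suc
    by (intro product_nn_integral_insert) auto
qed

text \<open>Each increment adds at most \<open>h * gauss_m2\<close> by orthogonality, and the sum is
  reset at the end of a block.\<close>

lemma block_sum_moment:
  assumes j: "1 \<le> j" and h: "0 \<le> h"
  shows "(\<integral>\<^sup>+x. ennreal ((norm (block_sum j x n))\<^sup>2) \<partial>gprod h n) \<le> ennreal (real (n mod j) * (h * gauss_m2 TYPE('b)))"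
proof (induction n)
  case 0
  show ?case by (simp add: block_sum_def)
next
  case (Suc n)
  have m: "(\<lambda>x. block_sum j x (Suc n)) \<in> borel_measurable (gprod h (Suc n))"
    by (intro block_sum_measurable gprod_component)
  show ?case
  proof (cases "Suc n mod j = 0")
    case True
    then show ?thesis by (simp add: block_sum_Suc)
  next
    case False
    have ms: "Suc n mod j = Suc (n mod j)" using False by (simp add: mod_Suc split: if_splits)
    interpret P: prob_space "gprod h n"
      unfolding gprod_def by (intro prob_space_PiM prob_space_gauss_scaled)
    have bm [measurable]: "(\<lambda>x. block_sum j x n) \<in> borel_measurable (gprod h n)"
      by (intro block_sum_measurable gprod_component)
    have up: "block_sum j (x(n := y)) (Suc n) = block_sum j x n + y" for x y
    proof -
      have "block_sum j (x(n := y)) n = block_sum j x n" unfolding block_sum_def by (intro sum.cong) auto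
      then show ?thesis using False by (simp add: block_sum_Suc)
    qed
    have "(\<integral>\<^sup>+x. ennreal ((norm (block_sum j x (Suc n)))\<^sup>2) \<partial>gprod h (Suc n))
        = (\<integral>\<^sup>+x. \<integral>\<^sup>+y. ennreal ((norm (block_sum j (x(n := y)) (Suc n)))\<^sup>2) \<partial>gauss_scaled h \<partial>gprod h n)"
      by (rule nn_integral_gprod_Suc) (use m in measurable)
    also have "\<dots> \<le> (\<integral>\<^sup>+x. ennreal ((norm (block_sum j x n))\<^sup>2 + 1\<^sup>2 * h * gauss_m2 TYPE('b)) \<partial>gprod h n)"
      unfolding up by (intro nn_integral_mono nn_integral_gauss_increment h) (auto simp: linear_ident)
    also have "\<dots> = (\<integral>\<^sup>+x. ennreal ((norm (block_sum j x n))\<^sup>2) \<partial>gprod h n) + ennreal (h * gauss_m2 TYPE('b))"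
      using h gauss_m2_nonneg[where 'a='b] P.emeasure_space_1 by (subst ennreal_plus) (auto simp: nn_integral_add)
    also have "\<dots> \<le> ennreal (real (n mod j) * (h * gauss_m2 TYPE('b))) + ennreal (h * gauss_m2 TYPE('b))"
      by (intro add_right_mono Suc.IH)
    also have "\<dots> = ennreal (real (Suc n mod j) * (h * gauss_m2 TYPE('b)))"
      using h gauss_m2_nonneg[where 'a='b] unfolding ms by (subst ennreal_plus[symmetric]) (auto simp: algebra_simps)
    finally show ?thesis .
  qed
qed

text \<open>By orthogonality each step contributes at most a constant times the second moment of a
  block sum times that of one increment. With \<open>n = j * N\<close> and
  \<open>h = T / (j * N)\<close> the total is of order \<open>1 / N\<close>, uniformly in
  \<open>j\<close>.\<close>

lemma refine_moment:
  assumes j: "1 \<le> j" and h: "0 \<le> h" and K: "\<And>a b. norm (beta a b) \<le> norm a * norm b * K"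
  shows "(\<integral>\<^sup>+x. ennreal ((norm (refine j x n))\<^sup>2) \<partial>gprod h n) \<le> ennreal (real n * (K\<^sup>2 * real j * (h * gauss_m2 TYPE('b))\<^sup>2))"
proof (induction n)
  case 0
  show ?case by simp
next
  case (Suc n)
  let ?g = "gauss_m2 TYPE('b)"
  have g0: "0 \<le> ?g" by (rule gauss_m2_nonneg)
  have bm [measurable]: "(\<lambda>x. block_sum j x n) \<in> borel_measurable (gprod h n)"
    by (intro block_sum_measurable gprod_component)
  have rm [measurable]: "(\<lambda>x. refine j x n) \<in> borel_measurable (gprod h n)"
    by (intro refine_measurable gprod_component)
  have rm' [measurable]: "(\<lambda>x. refine j x (Suc n)) \<in> borel_measurable (gprod h (Suc n))"
    by (intro refine_measurable gprod_component)
  have up: "refine j (x(n := y)) (Suc n) = refine j x n + beta (block_sum j x n) y" for x y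
  proof -
    have "block_sum j (x(n := y)) n = block_sum j x n" unfolding block_sum_def by (intro sum.cong) auto
    moreover have "refine j (x(n := y)) n = refine j x n" by (intro refine_cong) auto
    ultimately show ?thesis by simp
  qed
  have "(\<integral>\<^sup>+x. ennreal ((norm (refine j x (Suc n)))\<^sup>2) \<partial>gprod h (Suc n))
      = (\<integral>\<^sup>+x. \<integral>\<^sup>+y. ennreal ((norm (refine j (x(n := y)) (Suc n)))\<^sup>2) \<partial>gauss_scaled h \<partial>gprod h n)"
    by (rule nn_integral_gprod_Suc) measurable
  also have "\<dots> \<le> (\<integral>\<^sup>+x. ennreal ((norm (refine j x n))\<^sup>2 + (K * norm (block_sum j x n))\<^sup>2 * h * ?g) \<partial>gprod h n)"
    unfolding up
  proof (intro nn_integral_mono nn_integral_gauss_increment h)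
    fix x y
    show "linear (beta (block_sum j x n))" by (rule linearI) (auto simp: add_right scaleR_right)
    show "norm (beta (block_sum j x n) y) \<le> K * norm (block_sum j x n) * norm y"
      using K[of "block_sum j x n" y] by (simp add: ac_simps)
  qed
  also have "\<dots> = (\<integral>\<^sup>+x. ennreal ((norm (refine j x n))\<^sup>2) + ennreal (K\<^sup>2 * h * ?g) * ennreal ((norm (block_sum j x n))\<^sup>2) \<partial>gprod h n)"
    using h g0 by (intro nn_integral_cong) (simp add: ennreal_mult'[symmetric] power_mult_distrib ac_simps)
  also have "\<dots> = (\<integral>\<^sup>+x. ennreal ((norm (refine j x n))\<^sup>2) \<partial>gprod h n) + ennreal (K\<^sup>2 * h * ?g) * (\<integral>\<^sup>+x. ennreal ((norm (block_sum j x n))\<^sup>2) \<partial>gprod h n)"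
    by (subst nn_integral_add) (auto simp: nn_integral_cmult)
  also have "\<dots> \<le> ennreal (real n * (K\<^sup>2 * real j * (h * ?g)\<^sup>2)) + ennreal (K\<^sup>2 * h * ?g) * ennreal (real j * (h * ?g))"
  proof (intro add_mono Suc.IH mult_left_mono)
    have "real (n mod j) * (h * ?g) \<le> real j * (h * ?g)"
      using j h g0 by (intro mult_right_mono) (auto simp: less_imp_le)
    then show "(\<integral>\<^sup>+x. ennreal ((norm (block_sum j x n))\<^sup>2) \<partial>gprod h n) \<le> ennreal (real j * (h * ?g))"
      using block_sum_moment[OF j h, of n] by (meson ennreal_leI order_trans)
  qed simp
  also have "\<dots> = ennreal (real (Suc n) * (K\<^sup>2 * real j * (h * ?g)\<^sup>2))"
  proof -
    have "ennreal (K\<^sup>2 * h * ?g) * ennreal (real j * (h * ?g)) = ennreal (K\<^sup>2 * real j * (h * ?g)\<^sup>2)"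
      using h g0 by (subst ennreal_mult''[symmetric]) (auto simp: power2_eq_square ac_simps)
    then show ?thesis
      using h g0 by (simp add: ennreal_plus[symmetric] distrib_right del: ennreal_plus)
  qed
  finally show ?case .
qed

section \<open>Laws of Gaussian walks on the group\<close>

definition rw :: "real \<Rightarrow> nat \<Rightarrow> ('b \<times> 'c) measure" where
  "rw h n = distr (gprod h n) borel (\<lambda>x. walk x n)"

lemma sets_rw [measurable_cong, simp]: "sets (rw h n) = sets borel"
  by (simp add: rw_def)

lemma walk_gprod_measurable: "(\<lambda>x. walk x n) \<in> borel_measurable (gprod h n)"
  by (intro walk_measurable gprod_component)

lemma prob_space_rw: "prob_space (rw h n)"
proof -
  interpret P: prob_space "gprod h n"
    unfolding gprod_def by (intro prob_space_PiM prob_space_gauss_scaled)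
  show ?thesis unfolding rw_def by (rule P.prob_space_distr[OF walk_gprod_measurable])
qed

lemma nn_integral_rw_0:
  assumes [measurable]: "f \<in> borel_measurable borel"
  shows "(\<integral>\<^sup>+g. f g \<partial>rw h 0) = f 0"
proof -
  interpret P: prob_space "gprod h 0"
    unfolding gprod_def by (intro prob_space_PiM prob_space_gauss_scaled)
  show ?thesis unfolding rw_def
    by (subst nn_integral_distr[OF walk_gprod_measurable]) (auto simp: P.emeasure_space_1)
qed

lemma nn_integral_rw_Suc:
  assumes [measurable]: "f \<in> borel_measurable borel"
  shows "(\<integral>\<^sup>+g. f g \<partial>rw h (Suc n)) = (\<integral>\<^sup>+g. \<integral>\<^sup>+y. f (g \<odot> (y, 0)) \<partial>gauss_scaled h \<partial>rw h n)"
proof -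
  interpret G: prob_space "gauss_scaled h :: 'b measure" by (rule prob_space_gauss_scaled)
  note wm [measurable] = walk_gprod_measurable
  have up: "walk (x(n := y)) (Suc n) = walk x n \<odot> (y, 0)" for x y
  proof -
    have "walk (x(n := y)) n = walk x n" by (rule walk_cong) auto
    then show ?thesis by simp
  qed
  have "(\<integral>\<^sup>+g. f g \<partial>rw h (Suc n)) = (\<integral>\<^sup>+x. f (walk x (Suc n)) \<partial>gprod h (Suc n))"
    unfolding rw_def by (rule nn_integral_distr[OF wm]) simp
  also have "\<dots> = (\<integral>\<^sup>+x. \<integral>\<^sup>+y. f (walk (x(n := y)) (Suc n)) \<partial>gauss_scaled h \<partial>gprod h n)"
    by (rule nn_integral_gprod_Suc) (rule measurable_compose[OF wm assms])
  also have "\<dots> = (\<integral>\<^sup>+x. \<integral>\<^sup>+y. f (walk x n \<odot> (y, 0)) \<partial>gauss_scaled h \<partial>gprod h n)" unfolding up ..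
  also have "\<dots> = (\<integral>\<^sup>+g. \<integral>\<^sup>+y. f (g \<odot> (y, 0)) \<partial>gauss_scaled h \<partial>rw h n)"
    unfolding rw_def by (rule nn_integral_distr[OF wm, symmetric]) measurable
  finally show ?thesis .
qed

text \<open>The last \<open>q\<close> steps form a fresh walk, multiplied from the right by
  independence of the increments.\<close>

lemma nn_integral_rw_add:
  assumes f [measurable]: "f \<in> borel_measurable borel"
  shows "(\<integral>\<^sup>+g. f g \<partial>rw h (p + q)) = (\<integral>\<^sup>+g. \<integral>\<^sup>+k. f (g \<odot> k) \<partial>rw h q \<partial>rw h p)"
  using f
proof (induction q arbitrary: f)
  case 0
  note [measurable] = 0
  show ?case by (simp add: nn_integral_rw_0)
next
  case (Suc q)
  note [measurable] = Suc.prems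
  interpret G: prob_space "gauss_scaled h :: 'b measure" by (rule prob_space_gauss_scaled)
  have "(\<integral>\<^sup>+g. f g \<partial>rw h (p + Suc q)) = (\<integral>\<^sup>+g. \<integral>\<^sup>+y. f (g \<odot> (y, 0)) \<partial>gauss_scaled h \<partial>rw h (p + q))"
    by (simp add: nn_integral_rw_Suc)
  also have "\<dots> = (\<integral>\<^sup>+g. \<integral>\<^sup>+k. \<integral>\<^sup>+y. f (g \<odot> k \<odot> (y, 0)) \<partial>gauss_scaled h \<partial>rw h q \<partial>rw h p)"
    by (rule Suc.IH) measurable
  also have "\<dots> = (\<integral>\<^sup>+g. \<integral>\<^sup>+k. f (g \<odot> k) \<partial>rw h (Suc q) \<partial>rw h p)"
    by (simp add: nn_integral_rw_Suc gm_assoc)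
  finally show ?case .
qed

text \<open>\<open>dil r\<close> is multiplicative and scales the Gaussian increments, so the walk
  obeys an exact diffusive scaling.\<close>

lemma nn_integral_rw_scale:
  assumes f [measurable]: "f \<in> borel_measurable borel" and r: "0 \<le> r"
  shows "(\<integral>\<^sup>+g. f g \<partial>rw (r\<^sup>2 * h) n) = (\<integral>\<^sup>+g. f (dil r g) \<partial>rw h n)"
  using f
proof (induction n arbitrary: f)
  case 0
  note [measurable] = 0
  show ?case by (simp add: nn_integral_rw_0 dil_def zero_prod_def)
next
  case (Suc n)
  note [measurable] = Suc.prems
  interpret G: prob_space "gauss_scaled (r\<^sup>2 * h) :: 'b measure" by (rule prob_space_gauss_scaled)
  interpret G': prob_space "gauss_scaled h :: 'b measure" by (rule prob_space_gauss_scaled)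
  have s: "sqrt (r\<^sup>2 * h) = r * sqrt h" using r by (simp add: real_sqrt_mult)
  have "(\<integral>\<^sup>+g. f g \<partial>rw (r\<^sup>2 * h) (Suc n)) = (\<integral>\<^sup>+g. \<integral>\<^sup>+y. f (g \<odot> (y, 0)) \<partial>gauss_scaled (r\<^sup>2 * h) \<partial>rw (r\<^sup>2 * h) n)"
    by (rule nn_integral_rw_Suc) measurable
  also have "\<dots> = (\<integral>\<^sup>+g. \<integral>\<^sup>+y. f (dil r g \<odot> (y, 0)) \<partial>gauss_scaled (r\<^sup>2 * h) \<partial>rw h n)"
    by (rule Suc.IH) measurable
  also have "\<dots> = (\<integral>\<^sup>+g. \<integral>\<^sup>+y. f (dil r (g \<odot> (y, 0))) \<partial>gauss_scaled h \<partial>rw h n)"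
    by (intro nn_integral_cong) (simp add: nn_integral_gauss_scaled s dil_gm, simp add: dil_def)
  also have "\<dots> = (\<integral>\<^sup>+g. f (dil r g) \<partial>rw h (Suc n))"
    by (rule nn_integral_rw_Suc[symmetric]) measurable
  finally show ?case .
qed

end

section \<open>The law of the Brownian endpoint\<close>

lemma measure_eq_of_continuous:
  fixes N1 N2 :: "'a::euclidean_space measure"
  assumes prob: "prob_space N1" "prob_space N2"
    and sets [measurable_cong]: "sets N1 = sets borel" "sets N2 = sets borel"
    and C: "\<And>h :: 'a \<Rightarrow> real. continuous_on UNIV h \<Longrightarrow> (\<And>x. \<bar>h x\<bar> \<le> 1) \<Longrightarrow> (\<integral>x. h x \<partial>N1) = (\<integral>x. h x \<partial>N2)"
  shows "N1 = N2"
proof (rule measure_eqI)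
  interpret N1: prob_space N1 by fact
  interpret N2: prob_space N2 by fact
  show "sets N1 = sets N2" using sets by simp
  fix A assume "A \<in> sets N1"
  then have A: "A \<in> sets borel" using sets by simp
  have "2 * (measure N1 A - measure N2 A) \<le> 0"
  proof (rule measure_le_of_continuous[OF prob sets _ A])
    fix h :: "'a \<Rightarrow> real" assume h: "continuous_on UNIV h" "\<And>x. \<bar>h x\<bar> \<le> 1"
    show "(\<integral>x. h x \<partial>N1) - (\<integral>x. h x \<partial>N2) \<le> 0" using C[OF h] by simp
  qed
  moreover have "2 * (measure N2 A - measure N1 A) \<le> 0"
  proof (rule measure_le_of_continuous[OF prob(2,1) sets(2,1) _ A])
    fix h :: "'a \<Rightarrow> real" assume h: "continuous_on UNIV h" "\<And>x. \<bar>h x\<bar> \<le> 1"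
    show "(\<integral>x. h x \<partial>N2) - (\<integral>x. h x \<partial>N1) \<le> 0" using C[OF h] by simp
  qed
  ultimately show "emeasure N1 A = emeasure N2 A"
    by (simp add: N1.emeasure_eq_measure N2.emeasure_eq_measure)
qed

text \<open>A finite expected sum takes the place of the Borel--Cantelli lemma.\<close>

lemma AE_summable:
  fixes Z :: "nat \<Rightarrow> 'a \<Rightarrow> real"
  assumes [measurable]: "\<And>n. Z n \<in> borel_measurable M" and Z0: "\<And>n x. 0 \<le> Z n x"
    and b: "\<And>n. (\<integral>\<^sup>+x. ennreal (Z n x) \<partial>M) \<le> ennreal (b n)" and b0: "\<And>n. 0 \<le> b n" and sb: "summable b"
  shows "AE x in M. summable (\<lambda>n. Z n x)"
proof -
  have "(\<integral>\<^sup>+x. (\<Sum>n. ennreal (Z n x)) \<partial>M) = (\<Sum>n. \<integral>\<^sup>+x. ennreal (Z n x) \<partial>M)"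
    by (rule nn_integral_suminf) measurable
  also have "\<dots> \<le> (\<Sum>n. ennreal (b n))" by (intro suminf_le b) auto
  also have "\<dots> = ennreal (\<Sum>n. b n)" by (rule suminf_ennreal2[OF b0 sb])
  finally have "(\<integral>\<^sup>+x. (\<Sum>n. ennreal (Z n x)) \<partial>M) \<noteq> \<infinity>"
    by (metis ennreal_less_top infinity_ennreal_def less_le_not_le top.extremum)
  then have "AE x in M. (\<Sum>n. ennreal (Z n x)) \<noteq> \<infinity>"
    by (intro nn_integral_PInf_AE) measurable
  then show ?thesis
    by eventually_elim (rule summable_suminf_not_top, use Z0 in auto)
qed

text \<open>Brownian motion enters through the laws of its increments and their independence along
  grids, which is what the comparison with random walks consumes. \<open>T\<close> is the terminal
  time and becomes \<open>tau\<close>.\<close>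

locale brownian_path = step2_group beta + prob_space M
  for beta :: "'b::euclidean_space \<Rightarrow> 'b \<Rightarrow> 'c::euclidean_space" and M :: "'a measure" +
  fixes B :: "real \<Rightarrow> 'a \<Rightarrow> 'b" and T :: real
  assumes T_pos: "0 < T"
    and B_measurable [measurable]: "B t \<in> borel_measurable M"
    and increments: "0 \<le> s \<Longrightarrow> s < t \<Longrightarrow> distr M borel (\<lambda>w. B t w - B s w) = gauss_scaled (t - s)"
    and indep_increments: "0 \<le> ts 0 \<Longrightarrow> (\<And>k. k < n \<Longrightarrow> ts k \<le> ts (Suc k)) \<Longrightarrow>
      indep_vars (\<lambda>_. borel) (\<lambda>k w. B (ts (Suc k)) w - B (ts k) w) {..<n}"
    and beta_spanning: "span {beta u v |u v. True} = UNIV"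
begin

definition incr :: "nat \<Rightarrow> 'a \<Rightarrow> nat \<Rightarrow> 'b" where
  "incr N w k = B (real (Suc k) * T / real N) w - B (real k * T / real N) w"

definition endpoint :: "nat \<Rightarrow> 'a \<Rightarrow> 'b \<times> 'c" where
  "endpoint N w = walk (incr N w) N"

lemma incr_measurable [measurable]: "(\<lambda>w. incr N w k) \<in> borel_measurable M"
  unfolding incr_def by measurable

lemma endpoint_measurable [measurable]: "endpoint N \<in> borel_measurable M"
  unfolding endpoint_def[abs_def] by (rule walk_measurable) measurable

lemma distr_incr:
  assumes N: "1 \<le> N"
  shows "distr M (PiM {..<N} (\<lambda>_. borel)) (\<lambda>w. \<lambda>k\<in>{..<N}. incr N w k) = gprod (T / real N) N"
proof -
  have ne: "{..<N} \<noteq> {}" using N by (auto simp: lessThan_empty_iff)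
  have iv: "indep_vars (\<lambda>_. borel) (\<lambda>k w. incr N w k) {..<N}"
    unfolding incr_def
    by (rule indep_increments[where ts="\<lambda>k. real k * T / real N"]) (use T_pos in \<open>auto intro!: divide_right_mono mult_right_mono\<close>)
  have "distr M (PiM {..<N} (\<lambda>_. borel)) (\<lambda>w. \<lambda>k\<in>{..<N}. incr N w k) = PiM {..<N} (\<lambda>k. distr M borel (\<lambda>w. incr N w k))"
    using indep_vars_iff_distr_eq_PiM[OF ne, where M'="\<lambda>_. borel" and X="\<lambda>k w. incr N w k"] iv by simp
  also have "\<dots> = gprod (T / real N) N"
    unfolding gprod_def
  proof (rule PiM_cong)
    fix k assume "k \<in> {..<N}"
    have d: "real (Suc k) * T / real N - real k * T / real N = T / real N"
      using N by (simp add: field_simps)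
    have "real k * T / real N < real (Suc k) * T / real N" using T_pos N by (intro divide_strict_right_mono) auto
    from increments[OF _ this] show "distr M borel (\<lambda>w. incr N w k) = gauss_scaled (T / real N)"
      unfolding incr_def d using T_pos by simp
  qed simp
  finally show ?thesis .
qed

text \<open>\<open>incr N w\<close> is a function on all of \<open>nat\<close>, while the product
  measure lives on \<open>{..<N}\<close>; hypothesis \<open>c\<close> bridges the two.\<close>

lemma nn_integral_incr:
  assumes N: "1 \<le> N" and f: "f \<in> borel_measurable (gprod (T / real N) N)"
    and c: "\<And>x y. (\<And>k. k < N \<Longrightarrow> x k = y k) \<Longrightarrow> f x = f y"
  shows "(\<integral>\<^sup>+w. f (incr N w) \<partial>M) = (\<integral>\<^sup>+x. f x \<partial>gprod (T / real N) N)"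
proof -
  have m: "(\<lambda>w. \<lambda>k\<in>{..<N}. incr N w k) \<in> M \<rightarrow>\<^sub>M PiM {..<N} (\<lambda>_. borel)" by measurable
  have f': "f \<in> borel_measurable (PiM {..<N} (\<lambda>_. borel))"
    using f by (subst measurable_cong_sets[OF _ refl]) (auto simp: distr_incr[OF N, symmetric])
  have "(\<integral>\<^sup>+x. f x \<partial>gprod (T / real N) N) = (\<integral>\<^sup>+w. f (\<lambda>k\<in>{..<N}. incr N w k) \<partial>M)"
    unfolding distr_incr[OF N, symmetric] by (rule nn_integral_distr[OF m]) (use f' in simp)
  also have "\<dots> = (\<integral>\<^sup>+w. f (incr N w) \<partial>M)"
    by (intro nn_integral_cong c) auto
  finally show ?thesis by simp
qed

lemma nn_integral_endpoint:
  assumes N: "1 \<le> N" and [measurable]: "f \<in> borel_measurable borel"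
  shows "(\<integral>\<^sup>+w. f (endpoint N w) \<partial>M) = (\<integral>\<^sup>+g. f g \<partial>rw (T / real N) N)"
proof -
  have "(\<integral>\<^sup>+w. f (endpoint N w) \<partial>M) = (\<integral>\<^sup>+x. f (walk x N) \<partial>gprod (T / real N) N)"
    unfolding endpoint_def
  proof (rule nn_integral_incr[OF N])
    show "(\<lambda>x. f (walk x N)) \<in> borel_measurable (gprod (T / real N) N)"
      by (rule measurable_compose[OF walk_gprod_measurable]) fact
    show "f (walk x N) = f (walk y N)" if "\<And>k. k < N \<Longrightarrow> x k = y k" for x y
      using walk_cong[OF that] by simp
  qed
  also have "\<dots> = (\<integral>\<^sup>+g. f g \<partial>rw (T / real N) N)"
    unfolding rw_def by (rule nn_integral_distr[OF walk_gprod_measurable, symmetric]) simp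
  finally show ?thesis .
qed

lemma fst_endpoint:
  assumes N: "1 \<le> N"
  shows "fst (endpoint N w) = B T w - B 0 w"
proof -
  have "fst (endpoint N w) = (\<Sum>k<N. B (real (Suc k) * T / real N) w - B (real k * T / real N) w)"
    by (simp add: endpoint_def fst_walk incr_def)
  also have "\<dots> = B (real N * T / real N) w - B (real 0 * T / real N) w"
    by (rule sum_lessThan_telescope)
  finally show ?thesis using N by simp
qed

definition bconst :: real where
  "bconst = (SOME K. 0 < K \<and> (\<forall>a b. norm (beta a b) \<le> norm a * norm b * K))"

lemma bconst: "norm (beta a b) \<le> norm a * norm b * bconst"
proof -
  have "0 < bconst \<and> (\<forall>a b. norm (beta a b) \<le> norm a * norm b * bconst)"
    unfolding bconst_def using pos_bounded by (rule someI_ex)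
  then show ?thesis by blast
qed

definition l2const :: real where
  "l2const = (bconst * T * gauss_m2 TYPE('b))\<^sup>2"

text \<open>Coarse increments are sums of fine ones, so the two areas differ by
  \<open>refine\<close>, and the rate \<open>1 / N\<close> does not depend on the refinement factor
  \<open>j\<close>.\<close>

lemma area_refinement:
  assumes j: "1 \<le> j" and N: "1 \<le> N"
  shows "(\<integral>\<^sup>+w. ennreal ((norm (snd (endpoint (j * N) w) - snd (endpoint N w)))\<^sup>2) \<partial>M) \<le> ennreal (l2const / real N)"
proof -
  have jN: "1 \<le> j * N" using j N by simp
  let ?h = "T / real (j * N)"
  have "snd (endpoint (j * N) w) - snd (endpoint N w) = refine j (incr (j * N) w) (j * N)" for w
  proof -
    have "(\<Sum>l<j. incr (j * N) w (i * j + l)) = incr N w i" for i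
    proof -
      have "(\<Sum>l<j. incr (j * N) w (i * j + l))
          = (\<Sum>l<j. B (real (i * j + Suc l) * T / real (j * N)) w - B (real (i * j + l) * T / real (j * N)) w)"
        by (simp add: incr_def)
      also have "\<dots> = B (real (i * j + j) * T / real (j * N)) w - B (real (i * j + 0) * T / real (j * N)) w"
        by (rule sum_lessThan_telescope)
      also have "real (i * j + j) * T / real (j * N) = real (Suc i) * T / real N"
        using j N by (simp add: field_simps)
      also have "real (i * j + 0) * T / real (j * N) = real i * T / real N"
        using j N by (simp add: field_simps)
      finally show ?thesis by (simp add: incr_def)
    qed
    then show ?thesis
      using walk_refine(2)[OF j, of "incr (j * N) w" N] by (simp add: endpoint_def mult.commute[of N j])
  qed
  then have "(\<integral>\<^sup>+w. ennreal ((norm (snd (endpoint (j * N) w) - snd (endpoint N w)))\<^sup>2) \<partial>M)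
      = (\<integral>\<^sup>+w. ennreal ((norm (refine j (incr (j * N) w) (j * N)))\<^sup>2) \<partial>M)" by simp
  also have "\<dots> = (\<integral>\<^sup>+x. ennreal ((norm (refine j x (j * N)))\<^sup>2) \<partial>gprod ?h (j * N))"
  proof (rule nn_integral_incr[OF jN])
    have [measurable]: "(\<lambda>x. refine j x (j * N)) \<in> borel_measurable (gprod ?h (j * N))"
      by (intro refine_measurable gprod_component)
    show "(\<lambda>x. ennreal ((norm (refine j x (j * N)))\<^sup>2)) \<in> borel_measurable (gprod ?h (j * N))" by measurable
    show "ennreal ((norm (refine j x (j * N)))\<^sup>2) = ennreal ((norm (refine j y (j * N)))\<^sup>2)" if "\<And>k. k < j * N \<Longrightarrow> x k = y k" for x y
    proof -
      have "refine j x (j * N) = refine j y (j * N)" by (rule refine_cong) (rule that)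
      then show ?thesis by simp
    qed
  qed
  also have "\<dots> \<le> ennreal (real (j * N) * (bconst\<^sup>2 * real j * (?h * gauss_m2 TYPE('b))\<^sup>2))"
    by (rule refine_moment[OF j _ bconst]) (use T_pos in simp)
  also have "real (j * N) * (bconst\<^sup>2 * real j * (?h * gauss_m2 TYPE('b))\<^sup>2) = l2const / real N"
    using j N by (simp add: l2const_def power_mult_distrib power_divide power2_eq_square)
  finally show ?thesis .
qed

lemma l2const_nonneg: "0 \<le> l2const"
  by (simp add: l2const_def)

lemma endpoint_1: "snd (endpoint (Suc 0) w) = 0"
  by (simp add: endpoint_def snd_walk zero_left)

text \<open>The one-step grid has no area, hence the refinement estimate against it is a moment
  bound.\<close>

lemma area_moment:
  assumes N: "1 \<le> N"
  shows "(\<integral>\<^sup>+w. ennreal ((norm (snd (endpoint N w)))\<^sup>2) \<partial>M) \<le> ennreal l2const"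
  using area_refinement[OF N, of 1] by (simp add: endpoint_1)

definition area :: "'a \<Rightarrow> 'c" where
  "area w = lim (\<lambda>n. snd (endpoint (2 ^ n) w))"

lemma area_measurable [measurable]: "area \<in> borel_measurable M"
  unfolding area_def[abs_def] by measurable

text \<open>The mean square distance of consecutive dyadic areas decays like
  \<open>1 / 2 ^ n\<close>, so the distances themselves are almost surely summable.\<close>

lemma area_dyadic: "AE w in M. (\<lambda>n. snd (endpoint (2 ^ n) w)) \<longlonglongrightarrow> area w"
proof -
  define d where "d n w = norm (snd (endpoint (2 ^ Suc n) w) - snd (endpoint (2 ^ n) w))" for n w
  define s where "s = sqrt (1 / 2 :: real)"
  have s: "0 < s" "s < 1" "s\<^sup>2 = 1 / 2" by (auto simp: s_def)
  have [measurable]: "d n \<in> borel_measurable M" for n unfolding d_def[abs_def] by measurable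
  have "AE w in M. summable (\<lambda>n. d n w)"
  proof (rule AE_summable[where b="\<lambda>n. (1 + l2const) * s ^ n"])
    fix n
    have sn: "0 < s ^ n" using s by simp
    have "(\<integral>\<^sup>+w. ennreal (d n w) \<partial>M) \<le> (\<integral>\<^sup>+w. ennreal (s ^ n) + ennreal (1 / s ^ n) * ennreal ((d n w)\<^sup>2) \<partial>M)"
    proof (rule nn_integral_mono)
      fix w
      \<comment> \<open>In place of Cauchy--Schwarz, the norm is traded for its square with weight
        \<open>s ^ n\<close>, which balances against the decay \<open>s ^ (2 * n)\<close> of the
        second moment.\<close>
      have "d n w \<le> s ^ n + 1 / s ^ n * (d n w)\<^sup>2"
      proof -
        have d0: "0 \<le> d n w" by (simp add: d_def)
        have "d n w * s ^ n \<le> s ^ n * s ^ n + (d n w)\<^sup>2"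
        proof -
          have "2 * (d n w * s ^ n) \<le> (d n w)\<^sup>2 + (s ^ n)\<^sup>2"
            using zero_le_power2[of "d n w - s ^ n"] unfolding power2_diff by simp
          moreover have "0 \<le> d n w * s ^ n" using d0 sn by simp
          ultimately show ?thesis unfolding power2_eq_square[of "s ^ n"] by linarith
        qed
        then have "d n w \<le> (s ^ n * s ^ n + (d n w)\<^sup>2) / s ^ n" using sn by (simp add: le_divide_eq)
        then show ?thesis using sn s(1) by (simp add: add_divide_distrib)
      qed
      then show "ennreal (d n w) \<le> ennreal (s ^ n) + ennreal (1 / s ^ n) * ennreal ((d n w)\<^sup>2)"
        using sn by (simp add: ennreal_mult'[symmetric] ennreal_plus[symmetric] ennreal_leI del: ennreal_plus)
    qed
    also have "\<dots> = ennreal (s ^ n) + ennreal (1 / s ^ n) * (\<integral>\<^sup>+w. ennreal ((d n w)\<^sup>2) \<partial>M)"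
      by (subst nn_integral_add) (auto simp: nn_integral_cmult emeasure_space_1)
    also have "\<dots> \<le> ennreal (s ^ n) + ennreal (1 / s ^ n) * ennreal (l2const / 2 ^ n)"
      using area_refinement[of 2 "2 ^ n"] by (intro add_left_mono mult_left_mono) (auto simp: d_def)
    also have "\<dots> = ennreal ((1 + l2const) * s ^ n)"
    proof -
      have "(2::real) ^ n * (s ^ n * s ^ n) = (2 * s\<^sup>2) ^ n" by (simp add: power_mult_distrib power2_eq_square)
      then have "(2::real) ^ n * (s ^ n * s ^ n) = 1" unfolding s(3) by simp
      then have "1 / (s ^ n * 2 ^ n) = s ^ n" using sn by (simp add: divide_eq_eq ac_simps)
      moreover have "1 / s ^ n * (l2const / 2 ^ n) = l2const * (1 / (s ^ n * 2 ^ n))" by simp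
      ultimately have "1 / s ^ n * (l2const / 2 ^ n) = l2const * s ^ n" by (simp only:)
      then show ?thesis using sn l2const_nonneg
        by (simp add: ennreal_mult'[symmetric] ennreal_plus[symmetric] distrib_right del: ennreal_plus)
    qed
    finally show "(\<integral>\<^sup>+w. ennreal (d n w) \<partial>M) \<le> ennreal ((1 + l2const) * s ^ n)" .
  next
    show "summable (\<lambda>n. (1 + l2const) * s ^ n)" using s by (intro summable_mult summable_geometric) auto
  qed (use s l2const_nonneg in \<open>auto simp: d_def\<close>)
  then show ?thesis
  proof eventually_elim
    case (elim w)
    have "summable (\<lambda>n. snd (endpoint (2 ^ Suc n) w) - snd (endpoint (2 ^ n) w))"
      by (rule summable_norm_cancel) (use elim in \<open>simp add: d_def\<close>)
    then have "convergent (\<lambda>n. \<Sum>k<n. snd (endpoint (2 ^ Suc k) w) - snd (endpoint (2 ^ k) w))"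
      by (rule summable_iff_convergent[THEN iffD1])
    then have "convergent (\<lambda>n. snd (endpoint (2 ^ n) w) - snd (endpoint (2 ^ 0) w))"
      by (simp only: sum_lessThan_telescope[of "\<lambda>k. snd (endpoint (2 ^ k) w)"])
    then have "convergent (\<lambda>n. snd (endpoint (2 ^ n) w))" by (simp add: endpoint_1)
    then show ?case unfolding area_def by (simp add: convergent_LIMSEQ_iff)
  qed
qed

text \<open>Splitting time in the ratio \<open>p : q\<close> uses grids with
  \<open>(p + q) * 2 ^ n\<close> steps, and all such grids must lead to the same limit. The distance
  to the dyadic grid is almost surely square summable.\<close>

lemma area_limit:
  assumes c: "1 \<le> c"
  shows "AE w in M. (\<lambda>n. snd (endpoint (c * 2 ^ n) w)) \<longlonglongrightarrow> area w"
proof -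
  have "AE w in M. summable (\<lambda>n. (norm (snd (endpoint (c * 2 ^ n) w) - snd (endpoint (2 ^ n) w)))\<^sup>2)"
  proof (rule AE_summable[where b="\<lambda>n. l2const * (1 / 2) ^ n"])
    show "(\<integral>\<^sup>+w. ennreal ((norm (snd (endpoint (c * 2 ^ n) w) - snd (endpoint (2 ^ n) w)))\<^sup>2) \<partial>M) \<le> ennreal (l2const * (1 / 2) ^ n)" for n
      using area_refinement[OF c, of "2 ^ n"] by (simp add: power_divide)
    show "summable (\<lambda>n. l2const * (1 / 2) ^ n)" by (intro summable_mult summable_geometric) auto
  qed (use l2const_nonneg in auto)
  with area_dyadic show ?thesis
  proof eventually_elim
    case (elim w)
    have "(\<lambda>n. (norm (snd (endpoint (c * 2 ^ n) w) - snd (endpoint (2 ^ n) w)))\<^sup>2) \<longlonglongrightarrow> 0"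
      by (rule summable_LIMSEQ_zero[OF elim(2)])
    then have "(\<lambda>n. sqrt ((norm (snd (endpoint (c * 2 ^ n) w) - snd (endpoint (2 ^ n) w)))\<^sup>2)) \<longlonglongrightarrow> sqrt 0"
      by (rule tendsto_real_sqrt)
    then have "(\<lambda>n. snd (endpoint (c * 2 ^ n) w) - snd (endpoint (2 ^ n) w)) \<longlonglongrightarrow> 0"
      by (simp add: tendsto_norm_zero_iff)
    from tendsto_add[OF this elim(1)] show ?case by simp
  qed
qed

definition final :: "'a \<Rightarrow> 'b \<times> 'c" where
  "final w = (B T w - B 0 w, area w)"

lemma final_measurable [measurable]: "final \<in> borel_measurable M"
  unfolding final_def[abs_def] by measurable

lemma endpoint_limit:
  assumes c: "1 \<le> c"
  shows "AE w in M. (\<lambda>n. endpoint (c * 2 ^ n) w) \<longlonglongrightarrow> final w"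
  using area_limit[OF c]
proof eventually_elim
  case (elim w)
  have "fst (endpoint (c * 2 ^ n) w) = B T w - B 0 w" for n
    using fst_endpoint[of "c * 2 ^ n" w] c by simp
  then have "(\<lambda>n. fst (endpoint (c * 2 ^ n) w)) \<longlonglongrightarrow> B T w - B 0 w" by simp
  from tendsto_Pair[OF this elim] show ?case by (simp add: final_def)
qed

definition mu :: "('b \<times> 'c) measure" where
  "mu = distr M borel final"

lemma sets_mu [measurable_cong, simp]: "sets mu = sets borel"
  by (simp add: mu_def)

lemma prob_space_mu: "prob_space mu"
  unfolding mu_def by (rule prob_space_distr) measurable

text \<open>The first \<open>p * n\<close> and the last \<open>q * n\<close> steps are independent
  walks. Their common step size is \<open>a^2\<close> or \<open>b^2\<close> times that of a full
  grid with as many steps, a factor that becomes a dilation.\<close>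

lemma endpoint_split_law:
  assumes p: "1 \<le> p" and q: "1 \<le> q" and n: "1 \<le> n"
  defines "a \<equiv> sqrt (real p / real (p + q))" and "b \<equiv> sqrt (real q / real (p + q))"
  shows "distr M borel (endpoint ((p + q) * n))
    = distr (M \<Otimes>\<^sub>M M) borel (\<lambda>x. dil a (endpoint (p * n) (fst x)) \<odot> dil b (endpoint (q * n) (snd x)))"
proof (rule measure_eqI)
  fix A assume "A \<in> sets (distr M borel (endpoint ((p + q) * n)))"
  then have A [measurable]: "A \<in> sets borel" by simp
  let ?i = "indicator A :: _ \<Rightarrow> ennreal"
  let ?h = "T / real ((p + q) * n)"
  interpret R: prob_space "rw h m" for h m by (rule prob_space_rw)
  have ab: "0 \<le> a" "0 \<le> b" by (auto simp: a_def b_def)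
  have ha: "?h = a\<^sup>2 * (T / real (p * n))" and hb: "?h = b\<^sup>2 * (T / real (q * n))"
    using p q n by (simp_all add: a_def b_def field_simps)
  have "emeasure (distr M borel (endpoint ((p + q) * n))) A = (\<integral>\<^sup>+g. ?i g \<partial>distr M borel (endpoint ((p + q) * n)))" by simp
  also have "\<dots> = (\<integral>\<^sup>+w. ?i (endpoint ((p + q) * n) w) \<partial>M)" by (rule nn_integral_distr) auto
  also have "\<dots> = (\<integral>\<^sup>+g. ?i g \<partial>rw ?h ((p + q) * n))" using p q n by (intro nn_integral_endpoint) auto
  also have "(p + q) * n = p * n + q * n" by (simp add: algebra_simps)
  also have "(\<integral>\<^sup>+g. ?i g \<partial>rw (T / real (p * n + q * n)) (p * n + q * n)) = (\<integral>\<^sup>+g. \<integral>\<^sup>+k. ?i (g \<odot> k) \<partial>rw (T / real (p * n + q * n)) (q * n) \<partial>rw (T / real (p * n + q * n)) (p * n))"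
    by (rule nn_integral_rw_add) measurable
  also have "p * n + q * n = (p + q) * n" by (simp add: algebra_simps)
  also have "(\<integral>\<^sup>+g. \<integral>\<^sup>+k. ?i (g \<odot> k) \<partial>rw ?h (q * n) \<partial>rw ?h (p * n)) = (\<integral>\<^sup>+g. \<integral>\<^sup>+k. ?i (g \<odot> dil b k) \<partial>rw (T / real (q * n)) (q * n) \<partial>rw ?h (p * n))"
    unfolding hb using ab by (intro nn_integral_cong nn_integral_rw_scale) auto
  also have "\<dots> = (\<integral>\<^sup>+g. \<integral>\<^sup>+k. ?i (dil a g \<odot> dil b k) \<partial>rw (T / real (q * n)) (q * n) \<partial>rw (T / real (p * n)) (p * n))"
    unfolding ha using ab by (intro nn_integral_rw_scale) auto
  also have "\<dots> = (\<integral>\<^sup>+w. \<integral>\<^sup>+k. ?i (dil a (endpoint (p * n) w) \<odot> dil b k) \<partial>rw (T / real (q * n)) (q * n) \<partial>M)"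
    using p n by (intro nn_integral_endpoint[symmetric]) auto
  also have "\<dots> = (\<integral>\<^sup>+w. \<integral>\<^sup>+w'. ?i (dil a (endpoint (p * n) w) \<odot> dil b (endpoint (q * n) w')) \<partial>M \<partial>M)"
    using q n by (intro nn_integral_cong nn_integral_endpoint[symmetric]) auto
  also have "\<dots> = (\<integral>\<^sup>+x. ?i (dil a (endpoint (p * n) (fst x)) \<odot> dil b (endpoint (q * n) (snd x))) \<partial>(M \<Otimes>\<^sub>M M))"
    by (subst nn_integral_fst[symmetric]) auto
  also have "\<dots> = (\<integral>\<^sup>+g. ?i g \<partial>distr (M \<Otimes>\<^sub>M M) borel (\<lambda>x. dil a (endpoint (p * n) (fst x)) \<odot> dil b (endpoint (q * n) (snd x))))"
    by (rule nn_integral_distr[symmetric]) auto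
  also have "\<dots> = emeasure (distr (M \<Otimes>\<^sub>M M) borel (\<lambda>x. dil a (endpoint (p * n) (fst x)) \<odot> dil b (endpoint (q * n) (snd x)))) A" by simp
  finally show "emeasure (distr M borel (endpoint ((p + q) * n))) A = emeasure (distr (M \<Otimes>\<^sub>M M) borel (\<lambda>x. dil a (endpoint (p * n) (fst x)) \<odot> dil b (endpoint (q * n) (snd x)))) A" .
qed simp

text \<open>The discrete identity is exact. Almost sure convergence on the three families of grids
  carries it over to bounded continuous tests, which determine the law.\<close>

lemma mu_stable:
  assumes p: "1 \<le> p" and q: "1 \<le> q"
  shows "distr (mu \<Otimes>\<^sub>M mu) borel (\<lambda>(v, w). dil (sqrt (real p / real (p + q))) v \<odot> dil (sqrt (real q / real (p + q))) w) = mu"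
proof -
  define a where "a = sqrt (real p / real (p + q))"
  define b where "b = sqrt (real q / real (p + q))"
  have pM: "prob_space M" and sM: "sigma_finite_measure M" by unfold_locales
  interpret mu: prob_space mu by (rule prob_space_mu)
  interpret MM: pair_prob_space M M ..
  interpret mm: pair_prob_space mu mu ..
  have mumu: "mu \<Otimes>\<^sub>M mu = distr (M \<Otimes>\<^sub>M M) (borel \<Otimes>\<^sub>M borel) (\<lambda>(x, y). (final x, final y))"
    unfolding mu_def by (rule pair_measure_distr) (auto intro!: prob_space_imp_sigma_finite prob_space_distr)
  have "distr (mu \<Otimes>\<^sub>M mu) borel (\<lambda>(v, w). dil a v \<odot> dil b w) = mu"
  proof (rule measure_eq_of_continuous[OF _ prob_space_mu _ sets_mu])
    show "prob_space (distr (mu \<Otimes>\<^sub>M mu) borel (\<lambda>(v, w). dil a v \<odot> dil b w))"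
      by (rule mm.prob_space_distr) measurable
    fix h :: "'b \<times> 'c \<Rightarrow> real" assume hc: "continuous_on UNIV h" and h1: "\<And>x. \<bar>h x\<bar> \<le> 1"
    have [measurable]: "h \<in> borel_measurable borel" by (rule borel_measurable_continuous_onI[OF hc])
    have L1: "(\<lambda>n. \<integral>w. h (endpoint ((p + q) * 2 ^ n) w) \<partial>M) \<longlonglongrightarrow> (\<integral>w. h (final w) \<partial>M)"
    proof (rule integral_dominated_convergence[where w="\<lambda>_. 1"])
      show "AE w in M. (\<lambda>n. h (endpoint ((p + q) * 2 ^ n) w)) \<longlonglongrightarrow> h (final w)"
        using endpoint_limit[of "p + q"] p
        by (auto elim!: eventually_mono intro: continuous_on_tendsto_compose[OF hc])
    qed (use h1 in auto)
    have L2: "(\<lambda>n. \<integral>x. h (dil a (endpoint (p * 2 ^ n) (fst x)) \<odot> dil b (endpoint (q * 2 ^ n) (snd x))) \<partial>(M \<Otimes>\<^sub>M M))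
      \<longlonglongrightarrow> (\<integral>x. h (dil a (final (fst x)) \<odot> dil b (final (snd x))) \<partial>(M \<Otimes>\<^sub>M M))"
    proof (rule integral_dominated_convergence[where w="\<lambda>_. 1"])
      have P1: "AE x in M \<Otimes>\<^sub>M M. (\<lambda>n. endpoint (p * 2 ^ n) (fst x)) \<longlonglongrightarrow> final (fst x)"
        by (rule AE_distrD[OF measurable_fst]) (unfold distr_pair_fst, rule endpoint_limit[OF p])
      have P2: "AE x in M \<Otimes>\<^sub>M M. (\<lambda>n. endpoint (q * 2 ^ n) (snd x)) \<longlonglongrightarrow> final (snd x)"
        by (rule AE_distrD[OF measurable_snd]) (unfold distr_pair_snd[OF pM sM], rule endpoint_limit[OF q])
      show "AE x in M \<Otimes>\<^sub>M M. (\<lambda>n. h (dil a (endpoint (p * 2 ^ n) (fst x)) \<odot> dil b (endpoint (q * 2 ^ n) (snd x)))) \<longlonglongrightarrow> h (dil a (final (fst x)) \<odot> dil b (final (snd x)))"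
        using P1 P2
      proof eventually_elim
        case (elim x)
        have c: "continuous_on UNIV (\<lambda>p. h (dil a (fst p) \<odot> dil b (snd p)))"
          by (rule continuous_on_compose2[OF hc]) (auto intro!: continuous_on_gm continuous_on_dil continuous_intros)
        show ?case
          using continuous_on_tendsto_compose[OF c tendsto_Pair[OF elim]] by simp
      qed
    qed (use h1 in auto)
    have "(\<integral>w. h (endpoint ((p + q) * 2 ^ n) w) \<partial>M) = (\<integral>x. h (dil a (endpoint (p * 2 ^ n) (fst x)) \<odot> dil b (endpoint (q * 2 ^ n) (snd x))) \<partial>(M \<Otimes>\<^sub>M M))" for n
    proof -
      have "(\<integral>w. h (endpoint ((p + q) * 2 ^ n) w) \<partial>M) = (\<integral>g. h g \<partial>distr M borel (endpoint ((p + q) * 2 ^ n)))"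
        by (rule integral_distr[symmetric]) auto
      also have "\<dots> = (\<integral>g. h g \<partial>distr (M \<Otimes>\<^sub>M M) borel (\<lambda>x. dil a (endpoint (p * 2 ^ n) (fst x)) \<odot> dil b (endpoint (q * 2 ^ n) (snd x))))"
        unfolding a_def b_def by (subst endpoint_split_law[OF p q]) auto
      also have "\<dots> = (\<integral>x. h (dil a (endpoint (p * 2 ^ n) (fst x)) \<odot> dil b (endpoint (q * 2 ^ n) (snd x))) \<partial>(M \<Otimes>\<^sub>M M))"
        by (rule integral_distr) auto
      finally show ?thesis .
    qed
    with L1 L2 have "(\<integral>w. h (final w) \<partial>M) = (\<integral>x. h (dil a (final (fst x)) \<odot> dil b (final (snd x))) \<partial>(M \<Otimes>\<^sub>M M))"
      by (simp add: LIMSEQ_unique)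
    moreover have "(\<integral>x. h x \<partial>mu) = (\<integral>w. h (final w) \<partial>M)" unfolding mu_def by (rule integral_distr) auto
    moreover have "(\<integral>x. h x \<partial>distr (mu \<Otimes>\<^sub>M mu) borel (\<lambda>(v, w). dil a v \<odot> dil b w)) = (\<integral>x. h (dil a (fst x) \<odot> dil b (snd x)) \<partial>(mu \<Otimes>\<^sub>M mu))"
      by (subst integral_distr) (auto simp: split_beta')
    moreover have "(\<integral>x. h (dil a (fst x) \<odot> dil b (snd x)) \<partial>(mu \<Otimes>\<^sub>M mu)) = (\<integral>x. h (dil a (final (fst x)) \<odot> dil b (final (snd x))) \<partial>(M \<Otimes>\<^sub>M M))"
      unfolding mumu by (subst integral_distr) (auto simp: split_beta')
    ultimately show "(\<integral>x. h x \<partial>distr (mu \<Otimes>\<^sub>M mu) borel (\<lambda>(v, w). dil a v \<odot> dil b w)) = (\<integral>x. h x \<partial>mu)" by simp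
  qed simp
  then show ?thesis by (simp add: a_def b_def)
qed

lemma integral_mu_fst:
  fixes h :: "'b \<Rightarrow> real"
  assumes [measurable]: "h \<in> borel_measurable borel"
  shows "integrable mu (\<lambda>w. h (fst w)) \<longleftrightarrow> integrable gauss (\<lambda>x. h (sqrt T *\<^sub>R x))"
    and "(\<integral>w. h (fst w) \<partial>mu) = (\<integral>x. h (sqrt T *\<^sub>R x) \<partial>gauss)"
proof -
  have d: "distr M borel (\<lambda>w. B T w - B 0 w) = gauss_scaled T" using increments[of 0 T] T_pos by simp
  have "integrable mu (\<lambda>w. h (fst w)) \<longleftrightarrow> integrable (distr M borel (\<lambda>w. B T w - B 0 w)) h"
    unfolding mu_def by (subst (1 2) integrable_distr_eq) (auto simp: final_def)
  also have "\<dots> \<longleftrightarrow> integrable gauss (\<lambda>x. h (sqrt T *\<^sub>R x))"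
    unfolding d gauss_scaled_def by (subst integrable_distr_eq) auto
  finally show "integrable mu (\<lambda>w. h (fst w)) \<longleftrightarrow> integrable gauss (\<lambda>x. h (sqrt T *\<^sub>R x))" .
  have "(\<integral>w. h (fst w) \<partial>mu) = (\<integral>x. h x \<partial>distr M borel (\<lambda>w. B T w - B 0 w))"
    unfolding mu_def by (subst (1 2) integral_distr) (auto simp: final_def)
  also have "\<dots> = (\<integral>x. h (sqrt T *\<^sub>R x) \<partial>gauss)"
    unfolding d gauss_scaled_def by (subst integral_distr) auto
  finally show "(\<integral>w. h (fst w) \<partial>mu) = (\<integral>x. h (sqrt T *\<^sub>R x) \<partial>gauss)" .
qed

text \<open>Fatou's lemma along the dyadic grids, with their uniform second moment.\<close>

lemma integrable_area: "integrable M (\<lambda>w. (norm (area w))\<^sup>2)"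
proof (rule integrableI_nonneg)
  have "(\<integral>\<^sup>+w. ennreal ((norm (area w))\<^sup>2) \<partial>M) = (\<integral>\<^sup>+w. liminf (\<lambda>n. ennreal ((norm (snd (endpoint (2 ^ n) w)))\<^sup>2)) \<partial>M)"
  proof (rule nn_integral_cong_AE)
    show "AE w in M. ennreal ((norm (area w))\<^sup>2) = liminf (\<lambda>n. ennreal ((norm (snd (endpoint (2 ^ n) w)))\<^sup>2))"
      using area_dyadic
    proof eventually_elim
      case (elim w)
      have "(\<lambda>n. ennreal ((norm (snd (endpoint (2 ^ n) w)))\<^sup>2)) \<longlonglongrightarrow> ennreal ((norm (area w))\<^sup>2)"
        by (intro tendsto_ennrealI tendsto_intros elim)
      then show ?case using lim_imp_Liminf[OF sequentially_bot] by metis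
    qed
  qed
  also have "\<dots> \<le> liminf (\<lambda>n. \<integral>\<^sup>+w. ennreal ((norm (snd (endpoint (2 ^ n) w)))\<^sup>2) \<partial>M)"
    by (rule nn_integral_liminf) measurable
  also have "\<dots> \<le> liminf (\<lambda>n. ennreal l2const)"
    by (intro Liminf_mono always_eventually allI area_moment) simp
  also have "\<dots> < \<infinity>" by (simp add: Liminf_const)
  finally show "(\<integral>\<^sup>+w. ennreal ((norm (area w))\<^sup>2) \<partial>M) < \<infinity>" .
qed auto

lemma mu_marginal: "\<exists>C>0. \<forall>A\<in>sets borel. emeasure mu (fst -` A) \<le> ennreal C * emeasure lborel A"
proof -
  let ?c = "(1 / sqrt (2 * pi)) ^ DIM('b)"
  let ?s = "sqrt T"
  have s: "?s > 0" using T_pos by simp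
  show ?thesis
  proof (intro exI[of _ "?c * (1 / ?s) ^ DIM('b)"] conjI ballI)
    show "0 < ?c * (1 / ?s) ^ DIM('b)" using s by simp
    fix A :: "'b set" assume A [measurable]: "A \<in> sets borel"
    have d: "distr M borel (\<lambda>w. B T w - B 0 w) = gauss_scaled T" using increments[of 0 T] T_pos by simp
    have "emeasure mu (fst -` A) = emeasure (distr M borel (\<lambda>w. B T w - B 0 w)) A"
    proof -
      have f: "fst -` A \<in> sets (borel :: ('b \<times> 'c) measure)"
        using measurable_sets[OF borel_measurable_fst_snd(1)[OF measurable_ident], of A] A by simp
      have "emeasure mu (fst -` A) = emeasure M (final -` (fst -` A) \<inter> space M)"
        unfolding mu_def by (rule emeasure_distr[OF final_measurable f])
      also have "final -` (fst -` A) \<inter> space M = (\<lambda>w. B T w - B 0 w) -` A \<inter> space M" by (auto simp: final_def)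
      also have "emeasure M \<dots> = emeasure (distr M borel (\<lambda>w. B T w - B 0 w)) A"
        by (rule emeasure_distr[symmetric]) auto
      finally show ?thesis .
    qed
    also have "\<dots> = (\<integral>\<^sup>+x. indicator A x \<partial>gauss_scaled T)" unfolding d by simp
    also have "\<dots> = (\<integral>\<^sup>+x. indicator A (?s *\<^sub>R x) \<partial>gauss)" by (rule nn_integral_gauss_scaled) measurable
    also have "\<dots> = (\<integral>\<^sup>+x. ennreal (gauss_density x) * indicator A (?s *\<^sub>R x) \<partial>lborel)"
      unfolding gauss_def by (rule nn_integral_density) measurable
    also have "\<dots> \<le> (\<integral>\<^sup>+x. ennreal ?c * indicator A (?s *\<^sub>R x) \<partial>lborel)"
      by (intro nn_integral_mono mult_right_mono ennreal_leI gauss_density_le) simp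
    also have "\<dots> = ennreal ?c * (\<integral>\<^sup>+x. indicator A (?s *\<^sub>R x) \<partial>lborel)" by (rule nn_integral_cmult) measurable
    also have "(\<integral>\<^sup>+x. indicator A (?s *\<^sub>R x) \<partial>lborel) = ennreal ((1 / ?s) ^ DIM('b)) * emeasure lborel A"
    proof -
      have "(\<integral>\<^sup>+x. indicator A (?s *\<^sub>R x) \<partial>lborel) = (\<integral>\<^sup>+x. ennreal ((1 / ?s) ^ DIM('b)) * indicator A (?s *\<^sub>R (0 + (1 / ?s) *\<^sub>R x)) \<partial>lborel)"
        by (rule nn_integral_lborel_affine) (use s in auto)
      also have "\<dots> = (\<integral>\<^sup>+x. ennreal ((1 / ?s) ^ DIM('b)) * indicator A x \<partial>lborel)" using T_pos by simp
      also have "\<dots> = ennreal ((1 / ?s) ^ DIM('b)) * emeasure lborel A" by (subst nn_integral_cmult) auto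
      finally show ?thesis .
    qed
    also have "ennreal ?c * (ennreal ((1 / ?s) ^ DIM('b)) * emeasure lborel A) = ennreal (?c * (1 / ?s) ^ DIM('b)) * emeasure lborel A"
      using s by (subst ennreal_mult[of ?c]) (auto simp: mult.assoc)
    finally show "emeasure mu (fst -` A) \<le> ennreal (?c * (1 / ?s) ^ DIM('b)) * emeasure lborel A" .
  qed
qed

lemma stable_law_mu: "stable_law beta mu T"
proof (rule stable_law.intro)
  show "step2_group beta" by (rule step2_group_axioms)
  show "prob_space mu" by (rule prob_space_mu)
  show "stable_law_axioms beta mu T"
  proof (rule stable_law_axioms.intro)
    show "sets mu = sets borel" by simp
    show "\<exists>C>0. \<forall>A\<in>sets borel. emeasure mu (fst -` A) \<le> ennreal C * emeasure lborel A" by (rule mu_marginal)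
    show "0 < T" by (rule T_pos)
    show "integrable mu (\<lambda>w. (norm w)\<^sup>2)"
    proof -
      have "integrable mu (\<lambda>w. (norm (fst w))\<^sup>2)"
        using gauss_norm_moment[where 'a='b] by (subst integral_mu_fst) (auto simp: power_mult_distrib)
      moreover have "integrable mu (\<lambda>w. (norm (snd w))\<^sup>2)"
        unfolding mu_def using integrable_area by (subst integrable_distr_eq) (auto simp: final_def)
      ultimately have "integrable mu (\<lambda>w. (norm (fst w))\<^sup>2 + (norm (snd w))\<^sup>2)" by simp
      then show ?thesis by (simp add: norm_prod_def)
    qed
    show "(\<integral>w. (fst w \<bullet> u) * (fst w \<bullet> v) \<partial>mu) = T * (u \<bullet> v)" for u v
    proof -
      have "(\<integral>w. (fst w \<bullet> u) * (fst w \<bullet> v) \<partial>mu) = (\<integral>x. (sqrt T *\<^sub>R x \<bullet> u) * (sqrt T *\<^sub>R x \<bullet> v) \<partial>gauss)"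
        by (rule integral_mu_fst(2)) measurable
      also have "\<dots> = (\<integral>x. T * ((x \<bullet> u) * (x \<bullet> v)) \<partial>gauss)"
      proof -
        have "(sqrt T *\<^sub>R x \<bullet> u) * (sqrt T *\<^sub>R x \<bullet> v) = (sqrt T * sqrt T) * ((x \<bullet> u) * (x \<bullet> v))" for x
          by simp
        then have "(sqrt T *\<^sub>R x \<bullet> u) * (sqrt T *\<^sub>R x \<bullet> v) = T * ((x \<bullet> u) * (x \<bullet> v))" for x
          using T_pos by simp
        then show ?thesis by presburger
      qed
      finally show ?thesis by (simp add: gauss_moment)
    qed
    show "(\<integral>w. (fst w \<bullet> u) * indicator {w. norm (fst w) \<le> r} w \<partial>mu) = 0" for u r
    proof -
      have "(\<integral>w. (fst w \<bullet> u) * indicator {w. norm (fst w) \<le> r} w \<partial>mu) = (\<integral>w. (fst w \<bullet> u) * indicator {b. norm b \<le> r} (fst w) \<partial>mu)"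
        by (simp add: indicator_def)
      also have "\<dots> = (\<integral>x. (sqrt T *\<^sub>R x \<bullet> u) * indicator {b. norm b \<le> r} (sqrt T *\<^sub>R x) \<partial>gauss)"
        by (rule integral_mu_fst(2)) measurable
      also have "\<dots> = 0" by (rule gauss_odd) (auto simp: indicator_def)
      finally show ?thesis .
    qed
    show "distr (mu \<Otimes>\<^sub>M mu) borel (\<lambda>(v, w). dil (sqrt (real p / real (p + q))) v \<odot> dil (sqrt (real q / real (p + q))) w) = mu"
      if "1 \<le> p" "1 \<le> q" for p q by (rule mu_stable[OF that])
    show "span {beta u v |u v. True} = UNIV" by (rule beta_spanning)
  qed
qed

end

section \<open>The semigroup\<close>

lemma gauss_scaled_normal_density:
  assumes h: "0 < h"
  shows "density lborel (\<lambda>z::real^'m. \<Prod>i\<in>UNIV. ennreal (normal_density 0 (sqrt h) (z $ i))) = gauss_scaled h"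
proof (rule measure_eqI)
  let ?s = "sqrt h"
  have s: "?s > 0" using h by simp
  have dens: "(\<Prod>i\<in>UNIV. ennreal (normal_density 0 ?s (z $ i))) = ennreal ((1 / ?s) ^ DIM(real^'m) * gauss_density ((1 / ?s) *\<^sub>R z))" for z :: "real^'m"
  proof -
    have "(\<Prod>i\<in>UNIV. normal_density 0 ?s (z $ i)) = (\<Prod>i\<in>(UNIV::'m set). (1 / sqrt (2 * pi * h)) * exp (- (z $ i)\<^sup>2 / (2 * h)))"
      using h by (simp add: normal_density_def)
    also have "\<dots> = (1 / sqrt (2 * pi * h)) ^ CARD('m) * exp (\<Sum>i\<in>UNIV. - (z $ i)\<^sup>2 / (2 * h))"
      by (simp add: prod_dividef exp_sum power_one_over)
    also have "(\<Sum>i\<in>UNIV. - (z $ i)\<^sup>2 / (2 * h)) = - (norm ((1 / ?s) *\<^sub>R z))\<^sup>2 / 2"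
    proof -
      have "(\<Sum>i\<in>UNIV. - (z $ i)\<^sup>2 / (2 * h)) = - ((\<Sum>i\<in>UNIV. (z $ i)\<^sup>2) / (2 * h))"
        by (simp add: sum_divide_distrib sum_negf)
      also have "(\<Sum>i\<in>UNIV. (z $ i)\<^sup>2) = (norm z)\<^sup>2"
        unfolding power2_norm_eq_inner by (simp add: inner_vec_def power2_eq_square)
      finally show ?thesis using h by (simp add: power_divide)
    qed
    also have "(1 / sqrt (2 * pi * h)) ^ CARD('m) * exp (- (norm ((1 / ?s) *\<^sub>R z))\<^sup>2 / 2) = (1 / ?s) ^ DIM(real^'m) * gauss_density ((1 / ?s) *\<^sub>R z)"
      using h by (simp add: gauss_density_eq real_sqrt_mult power_mult_distrib power_divide)
    finally show ?thesis by (simp add: prod_ennreal)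
  qed
  fix A assume "A \<in> sets (density lborel (\<lambda>z::real^'m. \<Prod>i\<in>UNIV. ennreal (normal_density 0 ?s (z $ i))))"
  then have A [measurable]: "A \<in> sets borel" by simp
  let ?f = "\<lambda>z::real^'m. ennreal (gauss_density ((1 / ?s) *\<^sub>R z)) * indicator A z"
  have "emeasure (density lborel (\<lambda>z::real^'m. \<Prod>i\<in>UNIV. ennreal (normal_density 0 ?s (z $ i)))) A
      = (\<integral>\<^sup>+z. ennreal ((1 / ?s) ^ DIM(real^'m) * gauss_density ((1 / ?s) *\<^sub>R z)) * indicator A z \<partial>lborel)"
    unfolding dens by (rule emeasure_density) auto
  also have "\<dots> = (\<integral>\<^sup>+x. ennreal (?s ^ DIM(real^'m)) * (ennreal ((1 / ?s) ^ DIM(real^'m) * gauss_density ((1 / ?s) *\<^sub>R (0 + ?s *\<^sub>R x))) * indicator A (0 + ?s *\<^sub>R x)) \<partial>lborel)"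
    by (rule nn_integral_lborel_affine) (use s in auto)
  also have "\<dots> = (\<integral>\<^sup>+x. ennreal (gauss_density x) * indicator A (?s *\<^sub>R x) \<partial>lborel)"
  proof (rule nn_integral_cong)
    fix x :: "real^'m"
    have "ennreal (?s ^ DIM(real^'m)) * ennreal ((1 / ?s) ^ DIM(real^'m) * gauss_density ((1 / ?s) *\<^sub>R (?s *\<^sub>R x))) = ennreal (gauss_density x)"
      using s by (subst ennreal_mult'[symmetric]) (auto simp: power_one_over)
    then show "ennreal (?s ^ DIM(real^'m)) * (ennreal ((1 / ?s) ^ DIM(real^'m) * gauss_density ((1 / ?s) *\<^sub>R (0 + ?s *\<^sub>R x))) * indicator A (0 + ?s *\<^sub>R x)) = ennreal (gauss_density x) * indicator A (?s *\<^sub>R x)"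
      by (simp only: add_0 mult.assoc[symmetric])
  qed
  also have "\<dots> = (\<integral>\<^sup>+x. indicator A (?s *\<^sub>R x) \<partial>gauss)"
    unfolding gauss_def by (rule nn_integral_density[symmetric]) auto
  also have "\<dots> = (\<integral>\<^sup>+x. indicator A x \<partial>gauss_scaled h)" by (rule nn_integral_gauss_scaled[symmetric]) measurable
  also have "\<dots> = emeasure (gauss_scaled h) A" by simp
  finally show "emeasure (density lborel (\<lambda>z::real^'m. \<Prod>i\<in>UNIV. ennreal (normal_density 0 ?s (z $ i)))) A = emeasure (gauss_scaled h) A" .
qed simp

lemma AE_tendsto_imp_tendsto_in_prob:
  assumes "prob_space M" and [measurable]: "\<And>n. S n \<in> borel_measurable M" "Y \<in> borel_measurable M"
    and ae: "AE w in M. (\<lambda>n. S n w) \<longlonglongrightarrow> Y w"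
  shows "tendsto_in_prob M S Y"
  unfolding tendsto_in_prob_def
proof (intro allI impI)
  fix e :: real assume e: "e > 0"
  interpret prob_space M by fact
  have "(\<lambda>n. \<integral>w. indicator {w \<in> space M. dist (S n w) (Y w) > e} w \<partial>M) \<longlonglongrightarrow> (\<integral>w. (0::real) \<partial>M)"
  proof (rule integral_dominated_convergence[where w="\<lambda>_. 1"])
    show "AE w in M. (\<lambda>n. indicator {w \<in> space M. dist (S n w) (Y w) > e} w) \<longlonglongrightarrow> (0::real)"
      using ae
    proof eventually_elim
      case (elim w)
      have "\<forall>\<^sub>F n in sequentially. dist (S n w) (Y w) < e" using elim e by (rule tendstoD)
      then have "\<forall>\<^sub>F n in sequentially. indicator {w \<in> space M. dist (S n w) (Y w) > e} w = (0::real)"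
        by eventually_elim (auto simp: indicator_def)
      then show ?case by (rule tendsto_eventually)
    qed
  qed (auto simp: indicator_def)
  then show "(\<lambda>n. measure M {w \<in> space M. dist (S n w) (Y w) > e}) \<longlonglongrightarrow> 0" by simp
qed

lemma tendsto_in_prob_unique:
  assumes "prob_space M" and [measurable]: "\<And>n. S n \<in> borel_measurable M" "Y \<in> borel_measurable M" "Z \<in> borel_measurable M"
    and Y: "tendsto_in_prob M S Y" and Z: "tendsto_in_prob M S Z"
  shows "AE w in M. Y w = Z w"
proof -
  interpret prob_space M by fact
  have z: "measure M {w \<in> space M. dist (Y w) (Z w) > 2 * e} = 0" if e: "e > 0" for e
  proof -
    have "measure M {w \<in> space M. dist (Y w) (Z w) > 2 * e} \<le> measure M {w \<in> space M. dist (S n w) (Y w) > e} + measure M {w \<in> space M. dist (S n w) (Z w) > e}" for n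
    proof -
      have "{w \<in> space M. dist (Y w) (Z w) > 2 * e} \<subseteq> {w \<in> space M. dist (S n w) (Y w) > e} \<union> {w \<in> space M. dist (S n w) (Z w) > e}"
      proof (rule subsetI)
        fix w assume "w \<in> {w \<in> space M. dist (Y w) (Z w) > 2 * e}"
        then show "w \<in> {w \<in> space M. dist (S n w) (Y w) > e} \<union> {w \<in> space M. dist (S n w) (Z w) > e}"
          using dist_triangle3[of "Y w" "Z w" "S n w"] by auto
      qed
      then have "measure M {w \<in> space M. dist (Y w) (Z w) > 2 * e} \<le> measure M ({w \<in> space M. dist (S n w) (Y w) > e} \<union> {w \<in> space M. dist (S n w) (Z w) > e})"
        by (rule finite_measure_mono) measurable
      also have "\<dots> \<le> measure M {w \<in> space M. dist (S n w) (Y w) > e} + measure M {w \<in> space M. dist (S n w) (Z w) > e}"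
        by (rule measure_Un_le) measurable
      finally show ?thesis .
    qed
    moreover have "(\<lambda>n. measure M {w \<in> space M. dist (S n w) (Y w) > e} + measure M {w \<in> space M. dist (S n w) (Z w) > e}) \<longlonglongrightarrow> 0 + 0"
      using Y Z e unfolding tendsto_in_prob_def by (intro tendsto_add) auto
    ultimately have "measure M {w \<in> space M. dist (Y w) (Z w) > 2 * e} \<le> 0 + 0"
      by (intro LIMSEQ_le_const) auto
    then show ?thesis using measure_nonneg[of M "{w \<in> space M. dist (Y w) (Z w) > 2 * e}"] by linarith
  qed
  have "AE w in M. dist (Y w) (Z w) \<le> 2 * (1 / real (Suc n))" for n
    using z[of "1 / real (Suc n)"]
    by (subst AE_iff_measurable[OF _ refl]) (auto simp: not_le emeasure_eq_measure)
  then have "AE w in M. \<forall>n. dist (Y w) (Z w) \<le> 2 * (1 / real (Suc n))" unfolding AE_all_countable by blast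
  then show ?thesis
  proof eventually_elim
    case (elim w)
    have "(\<lambda>n. 2 * (1 / real (Suc n))) \<longlonglongrightarrow> 2 * 0" by (intro tendsto_mult tendsto_const LIMSEQ_Suc lim_1_over_n)
    then have "dist (Y w) (Z w) \<le> 2 * 0" by (rule LIMSEQ_le_const) (use elim in auto)
    then show ?case by simp
  qed
qed

section \<open>The group attached to the stochastic equation\<close>

definition vform :: "('d \<Rightarrow> real^'m^'m) \<Rightarrow> real^'m \<Rightarrow> real^'m \<Rightarrow> real^'d" where
  "vform S u v = (\<chi> l. (S l *v u) \<bullet> v)"

lemma step2_group_vform:
  fixes S :: "'d::finite \<Rightarrow> real^'m^'m"
  assumes sk: "\<And>l. skew (S l)"
  shows "step2_group (vform S)"
proof -
  have "bilinear (vform S)"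
    unfolding bilinear_def vform_def
    by (auto intro!: linearI simp: vec_eq_iff inner_add_right inner_add_left matrix_vector_right_distrib matrix_vector_mult_scaleR)
  then have b: "bounded_bilinear (vform S)" by (simp add: bilinear_conv_bounded_bilinear)
  have "(S l *v u) \<bullet> u = 0" for l u
  proof -
    have "(S l *v u) \<bullet> u = u \<bullet> (transpose (S l) *v u)"
      using adjoint_works[OF matrix_vector_mul_linear[of "S l"], of u u] by (simp add: adjoint_matrix)
    also have "\<dots> = - (u \<bullet> (S l *v u))"
      using sk[of l] by (simp add: skew_def vec_eq_iff matrix_vector_mult_def sum_negf inner_vec_def)
    finally show ?thesis by (simp add: inner_commute)
  qed
  then have "vform S u u = 0" for u by (simp add: vform_def vec_eq_iff)
  with b show ?thesis by (simp add: step2_group_def step2_group_axioms_def)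
qed

lemma vform_axis: "vform S (axis j 1) (axis i 1) $ l = S l $ i $ j"
  by (simp add: vform_def inner_axis matrix_vector_mult_basis column_def)

text \<open>A vector \<open>a\<close> orthogonal to all values of the form annihilates every entry
  of the combination of the \<open>S l\<close> with weights \<open>a\<close>, hence also its
  antisymmetric part, and the lower bound forces \<open>a = 0\<close>.\<close>

lemma vform_spanning:
  fixes S :: "'d::finite \<Rightarrow> real^'m^'m"
  assumes lam: "lam > 0" and hoer: "\<And>a::real^'d. (\<Sum>i\<in>UNIV. \<Sum>j\<in>UNIV. \<bar>\<Sum>l\<in>UNIV. (S l - transpose (S l)) $ i $ j * a $ l\<bar>\<^sup>2) \<ge> lam * (norm a)\<^sup>2"
  shows "span {vform S u v |u v. True} = UNIV"
proof (rule ccontr)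
  assume "span {vform S u v |u v. True} \<noteq> UNIV"
  then obtain a where a: "a \<noteq> 0" "\<And>x. x \<in> span {vform S u v |u v. True} \<Longrightarrow> a \<bullet> x = 0"
    using span_not_UNIV_orthogonal by blast
  have z: "(\<Sum>l\<in>UNIV. S l $ i $ j * a $ l) = 0" for i j
  proof -
    have "a \<bullet> vform S (axis j 1) (axis i 1) = 0" by (rule a(2)) (auto intro: span_base)
    then show ?thesis by (simp add: inner_vec_def vform_axis mult.commute)
  qed
  have "(\<Sum>l\<in>UNIV. (S l - transpose (S l)) $ i $ j * a $ l) = 0" for i j
    using z[of i j] z[of j i] by (simp add: transpose_def left_diff_distrib sum_subtractf)
  then have "lam * (norm a)\<^sup>2 \<le> 0" using hoer[of a] by simp
  then show False using lam a(1) by (simp add: mult_le_0_iff)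
qed

lemma brownian_path_of_brownian_motion:
  fixes B :: "real \<Rightarrow> 'a \<Rightarrow> real^'m" and S :: "'d::finite \<Rightarrow> real^'m^'m"
  assumes bm: "brownian_motion M B" and sk: "\<And>l. skew (S l)"
    and span: "span {vform S u v |u v. True} = UNIV" and t: "0 < t"
  shows "brownian_path (vform S) M B t"
proof -
  have pM: "prob_space M" and m: "\<And>t. B t \<in> borel_measurable M" using bm by (auto simp: brownian_motion_def)
  show ?thesis
  proof (rule brownian_path.intro[OF step2_group_vform[OF sk] pM], rule brownian_path_axioms.intro)
    show "distr M borel (\<lambda>w. B t w - B s w) = gauss_scaled (t - s)" if "0 \<le> s" "s < t" for s t
    proof -
      have "distributed M lborel (\<lambda>w. B t w - B s w) (\<lambda>z. \<Prod>i\<in>UNIV. ennreal (normal_density 0 (sqrt (t - s)) (z $ i)))"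
        using bm that by (simp add: brownian_motion_def)
      then have "distr M lborel (\<lambda>w. B t w - B s w) = gauss_scaled (t - s)"
        using that gauss_scaled_normal_density[of "t - s", where 'm='m] by (simp add: distributed_distr_eq_density)
      then show ?thesis by (simp cong: distr_cong)
    qed
    show "prob_space.indep_vars M (\<lambda>_. borel) (\<lambda>k w. B (ts (Suc k)) w - B (ts k) w) {..<n}"
      if "0 \<le> ts 0" "\<And>k. k < n \<Longrightarrow> ts k \<le> ts (Suc k)" for ts :: "nat \<Rightarrow> real" and n
      using bm that by (simp add: brownian_motion_def)
  qed (use m span t in auto)
qed

text \<open>The integrand splits into the starting point, whose Riemann sums telescope, and the
  Brownian part, whose left-point sums are the vertical coordinate of \<open>endpoint\<close> on the
  same dyadic grid.\<close>

lemma ito_integral_area: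
  fixes B :: "real \<Rightarrow> 'a \<Rightarrow> real^'m" and A :: "'d::finite \<Rightarrow> real^'m^'m" and \<sigma> :: "real^'m^'m"
  assumes bm: "brownian_motion M B" and bp: "brownian_path (vform (\<lambda>l. A l ** \<sigma>)) M B t"
  shows "ito_integral_is M B (\<lambda>s w. A l *v Xproc \<sigma> B x s w) t
    (\<lambda>w. (A l *v x) \<bullet> (B t w - B 0 w) + brownian_path.area (vform (\<lambda>l. A l ** \<sigma>)) B t w $ l)"
proof -
  interpret brownian_path "vform (\<lambda>l. A l ** \<sigma>)" M B t by fact
  let ?R = "\<lambda>n w. \<Sum>k<2^n. (A l *v Xproc \<sigma> B x (real k * t / 2^n) w) \<bullet> (B (real (Suc k) * t / 2^n) w - B (real k * t / 2^n) w)"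
  have am [measurable]: "(\<lambda>w. area w $ l) \<in> borel_measurable M"
    using area_measurable by (rule measurable_compose) (intro borel_measurable_continuous_onI continuous_intros)
  have vm: "(\<lambda>w. N *v f w) \<in> borel_measurable M" if "f \<in> borel_measurable M" for N :: "real^'m^'m" and f
    using that by (rule measurable_compose) (intro borel_measurable_continuous_onI matrix_vector_mult_linear_continuous_on)
  have Xm: "(\<lambda>w. A l *v Xproc \<sigma> B x s w) \<in> borel_measurable M" for s
    unfolding Xproc_def by (intro vm borel_measurable_add borel_measurable_const B_measurable)
  have R: "?R n w = (A l *v x) \<bullet> (B t w - B 0 w) + snd (endpoint (2 ^ n) w) $ l" if B0: "B 0 w = 0" for n w
  proof -
    let ?N = "2 ^ n :: nat"
    have sumi: "(\<Sum>i<k. incr ?N w i) = B (real k * t / real ?N) w" for k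
      using sum_lessThan_telescope[of "\<lambda>i. B (real i * t / real ?N) w" k] B0 by (simp add: incr_def)
    have "?R n w = (\<Sum>k<?N. (A l *v x) \<bullet> incr ?N w k + (A l ** \<sigma> *v B (real k * t / real ?N) w) \<bullet> incr ?N w k)"
      by (intro sum.cong) (auto simp: Xproc_def incr_def matrix_vector_right_distrib inner_add_left matrix_vector_mul_assoc)
    also have "\<dots> = (A l *v x) \<bullet> (\<Sum>k<?N. incr ?N w k) + (\<Sum>k<?N. (A l ** \<sigma> *v (\<Sum>i<k. incr ?N w i)) \<bullet> incr ?N w k)"
      by (simp only: sum.distrib inner_sum_right[symmetric] sumi[symmetric])
    also have "(\<Sum>k<?N. incr ?N w k) = B t w - B 0 w"
      using fst_endpoint[of ?N w] by (simp add: endpoint_def fst_walk)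
    also have "(\<Sum>k<?N. (A l ** \<sigma> *v (\<Sum>i<k. incr ?N w i)) \<bullet> incr ?N w k) = snd (endpoint ?N w) $ l"
      by (simp add: endpoint_def snd_walk vform_def sum_component)
    finally show ?thesis .
  qed
  have B0: "AE w in M. B 0 w = 0" using bm by (simp add: brownian_motion_def)
  show ?thesis
    unfolding ito_integral_is_def
  proof
    show "(\<lambda>w. (A l *v x) \<bullet> (B t w - B 0 w) + area w $ l) \<in> borel_measurable M" by measurable
    show "tendsto_in_prob M ?R (\<lambda>w. (A l *v x) \<bullet> (B t w - B 0 w) + area w $ l)"
    proof (rule AE_tendsto_imp_tendsto_in_prob[OF prob_space_axioms])
      show "?R n \<in> borel_measurable M" for n
        by (intro borel_measurable_sum borel_measurable_inner Xm borel_measurable_diff B_measurable)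
      show "(\<lambda>w. (A l *v x) \<bullet> (B t w - B 0 w) + area w $ l) \<in> borel_measurable M" by measurable
      show "AE w in M. (\<lambda>n. ?R n w) \<longlonglongrightarrow> (A l *v x) \<bullet> (B t w - B 0 w) + area w $ l"
        using B0 area_dyadic
      proof eventually_elim
        case (elim w)
        show ?case unfolding R[OF elim(1)] by (intro tendsto_intros elim(2))
      qed
    qed
  qed
qed

text \<open>\<open>Yproc\<close> picks its Ito integrals by \<open>SOME\<close>; as limits in probability are almost surely
  unique, every choice has the law of the area process.\<close>
lemma Psg_eq_avg:
  fixes B :: "real \<Rightarrow> 'a \<Rightarrow> real^'m" and A :: "'d::finite \<Rightarrow> real^'m^'m" and \<sigma> :: "real^'m^'m"
    and f :: "(real^'m) \<times> (real^'d) \<Rightarrow> real"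
  assumes bm: "brownian_motion M B" and bp: "brownian_path (vform (\<lambda>l. A l ** \<sigma>)) M B t"
    and f [measurable]: "f \<in> borel_measurable borel"
  shows "Psg M \<sigma> A B t f (\<sigma> *v u, y)
    = step2_group.avg (vform (\<lambda>l. A l ** \<sigma>)) (brownian_path.mu (vform (\<lambda>l. A l ** \<sigma>)) M B t) (\<lambda>g. f (\<sigma> *v fst g, snd g)) (u, y)"
proof -
  interpret brownian_path "vform (\<lambda>l. A l ** \<sigma>)" M B t by fact
  let ?z = "(\<sigma> *v u, y)"
  define I where "I l = (SOME I. ito_integral_is M B (\<lambda>s w. A l *v Xproc \<sigma> B (\<sigma> *v u) s w) t I)" for l
  have ex: "\<exists>J. ito_integral_is M B (\<lambda>s w. A l *v Xproc \<sigma> B (\<sigma> *v u) s w) t J" for l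
    by (rule exI) (rule ito_integral_area[OF bm bp])
  have I: "ito_integral_is M B (\<lambda>s w. A l *v Xproc \<sigma> B (\<sigma> *v u) s w) t (I l)" for l
    unfolding I_def by (rule someI_ex[OF ex])
  have Im: "I l \<in> borel_measurable M" for l using I[of l] by (simp add: ito_integral_is_def)
  have vm: "(\<lambda>w. N *v h w) \<in> borel_measurable M" if "h \<in> borel_measurable M" for N :: "real^'m^'m" and h
    using that by (rule measurable_compose) (intro borel_measurable_continuous_onI matrix_vector_mult_linear_continuous_on)
  have Xm: "Xproc \<sigma> B x s \<in> borel_measurable M" for x s
    unfolding Xproc_def[abs_def] by (intro vm borel_measurable_add borel_measurable_const B_measurable)
  have IA: "AE w in M. I l w = (A l *v (\<sigma> *v u)) \<bullet> (B t w - B 0 w) + area w $ l" for l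
  proof (rule tendsto_in_prob_unique[OF prob_space_axioms])
    let ?R = "\<lambda>n w. \<Sum>k<2^n. (A l *v Xproc \<sigma> B (\<sigma> *v u) (real k * t / 2^n) w) \<bullet> (B (real (Suc k) * t / 2^n) w - B (real k * t / 2^n) w)"
    show "?R n \<in> borel_measurable M" for n
      by (intro borel_measurable_sum borel_measurable_inner vm Xm borel_measurable_diff B_measurable)
    show "tendsto_in_prob M ?R (I l)" using I[of l] by (simp add: ito_integral_is_def)
    show "tendsto_in_prob M ?R (\<lambda>w. (A l *v (\<sigma> *v u)) \<bullet> (B t w - B 0 w) + area w $ l)"
      "(\<lambda>w. (A l *v (\<sigma> *v u)) \<bullet> (B t w - B 0 w) + area w $ l) \<in> borel_measurable M"
      using ito_integral_area[OF bm bp, of l "\<sigma> *v u"] by (simp_all add: ito_integral_is_def)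
  qed (rule Im)
  have Ym: "Yproc M \<sigma> A B ?z t \<in> borel_measurable M"
  proof (subst borel_measurable_euclidean_space, rule ballI)
    fix i :: "real^'d" assume "i \<in> Basis"
    then obtain l where i: "i = axis l 1" by (auto simp: Basis_vec_def)
    show "(\<lambda>w. Yproc M \<sigma> A B ?z t w \<bullet> i) \<in> borel_measurable M"
      using Im[of l] by (simp add: i inner_axis Yproc_def I_def)
  qed
  have Phi [measurable]: "(\<lambda>g. f (\<sigma> *v fst g, snd g)) \<in> borel_measurable (borel :: ((real^'m) \<times> (real^'d)) measure)"
  proof -
    have c: "continuous_on UNIV (\<lambda>g::(real^'m) \<times> (real^'d). (\<sigma> *v fst g, snd g))"
      by (intro continuous_on_Pair continuous_on_compose2[OF matrix_vector_mult_linear_continuous_on[where A=\<sigma> and S=UNIV]] continuous_on_fst continuous_on_snd continuous_on_id) auto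
    show ?thesis by (rule measurable_compose[OF borel_measurable_continuous_onI[OF c] f])
  qed
  have B0: "AE w in M. B 0 w = 0" using bm by (simp add: brownian_motion_def)
  have IAall: "AE w in M. \<forall>l. I l w = (A l *v (\<sigma> *v u)) \<bullet> (B t w - B 0 w) + area w $ l"
    using AE_finite_allI[OF finite[of UNIV] IA] by simp
  have "Psg M \<sigma> A B t f ?z = (\<integral>w. f (Xproc \<sigma> B (\<sigma> *v u) t w, Yproc M \<sigma> A B ?z t w) \<partial>M)"
    by (simp add: Psg_def)
  also have "\<dots> = (\<integral>w. f (\<sigma> *v fst (gm (u, y) (final w)), snd (gm (u, y) (final w))) \<partial>M)"
  proof (rule integral_cong_AE)
    show "(\<lambda>w. f (Xproc \<sigma> B (\<sigma> *v u) t w, Yproc M \<sigma> A B ?z t w)) \<in> borel_measurable M"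
      by (rule measurable_compose[OF borel_measurable_Pair[OF Xm Ym] f])
    show "(\<lambda>w. f (\<sigma> *v fst (gm (u, y) (final w)), snd (gm (u, y) (final w)))) \<in> borel_measurable M"
      by (rule measurable_compose[OF _ Phi, where f="\<lambda>w. gm (u, y) (final w)"]) measurable
    show "AE w in M. f (Xproc \<sigma> B (\<sigma> *v u) t w, Yproc M \<sigma> A B ?z t w) = f (\<sigma> *v fst (gm (u, y) (final w)), snd (gm (u, y) (final w)))"
      using B0 IAall
    proof eventually_elim
      case (elim w)
      have "Xproc \<sigma> B (\<sigma> *v u) t w = \<sigma> *v fst (gm (u, y) (final w))"
        using elim by (simp add: Xproc_def final_def matrix_vector_right_distrib)
      moreover have "Yproc M \<sigma> A B ?z t w = snd (gm (u, y) (final w))"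
        using elim by (simp add: Yproc_def I_def[symmetric] vec_eq_iff gm_def final_def vform_def matrix_vector_mul_assoc)
      ultimately show ?case by simp
    qed
  qed
  also have "\<dots> = avg mu (\<lambda>g. f (\<sigma> *v fst g, snd g)) (u, y)"
    unfolding avg_def mu_def
    by (rule integral_distr[symmetric, OF final_measurable]) (rule measurable_compose[OF _ Phi], measurable)
  finally show ?thesis .
qed

theorem theorem3p1:
  fixes M :: "'a measure" and B :: "real \<Rightarrow> 'a \<Rightarrow> real^'m"
    and \<sigma> :: "real^'m^'m" and A :: "'d::finite \<Rightarrow> real^'m^'m"
    and f :: "(real^'m) \<times> (real^'d) \<Rightarrow> real" and t :: real
  assumes m2: "CARD('m) \<ge> 2"
    and bm: "brownian_motion M B"
    and inv: "invertible \<sigma>"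
    and hoer: "\<exists>lam>0. \<forall>a::real^'d.
          (\<Sum>i\<in>UNIV. \<Sum>j\<in>UNIV. \<bar>\<Sum>l\<in>UNIV. (A l ** \<sigma> - transpose \<sigma> ** transpose (A l)) $ i $ j * a $ l\<bar>^2)
            \<ge> lam * (norm a)^2"
    and A2: "\<forall>l l' l''. transpose (A l) = - A l \<and> \<sigma> ** A l = A l ** \<sigma> \<and> A l ** A l' = A l' ** A l
          \<and> skew (A l ** \<sigma>) \<and> skew (A l ** A l' ** A l'' ** \<sigma>) \<and> skew (A l ** \<sigma> ** \<sigma> ** transpose \<sigma>)"
    and fmeas: "f \<in> borel_measurable borel"
    and fbdd: "bounded (range f)"
    and tpos: "t > 0"
  shows "\<forall>z. Psg M \<sigma> A B t f differentiable (at z) \<and>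
          Gamma_op \<sigma> A (Psg M \<sigma> A B t f) z
            \<le> (real CARD('m) + 2 * real CARD('d)) / (2 * t) *
               (Psg M \<sigma> A B t (\<lambda>w. (f w)^2) z - (Psg M \<sigma> A B t f z)^2)"
proof
  fix z :: "(real^'m) \<times> (real^'d)"
  define S where "S = (\<lambda>l. A l ** \<sigma>)"
  have sk: "skew (S l)" for l using A2 by (auto simp: S_def)
  obtain lam where lam: "lam > 0"
    "\<And>a::real^'d. (\<Sum>i\<in>UNIV. \<Sum>j\<in>UNIV. \<bar>\<Sum>l\<in>UNIV. (A l ** \<sigma> - transpose \<sigma> ** transpose (A l)) $ i $ j * a $ l\<bar>^2) \<ge> lam * (norm a)^2"
    using hoer by blast
  \<comment> \<open>Transposing the product identifies the matrices of the Hoermander condition with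
    \<open>S l - transpose (S l)\<close>.\<close>
  have span: "span {vform S u v |u v. True} = UNIV"
    by (rule vform_spanning[OF lam(1)]) (use lam(2) in \<open>simp only: S_def matrix_transpose_mul\<close>)
  have bp: "brownian_path (vform S) M B t"
    by (rule brownian_path_of_brownian_motion[OF bm sk span tpos])
  interpret bp: brownian_path "vform S" M B t by (rule bp)
  interpret sl: stable_law "vform S" bp.mu t by (rule bp.stable_law_mu)
  define F where "F = (\<lambda>g::(real^'m) \<times> (real^'d). f (\<sigma> *v fst g, snd g))"
  have c: "continuous_on UNIV (\<lambda>g::(real^'m) \<times> (real^'d). (\<sigma> *v fst g, snd g))"
    by (intro continuous_on_Pair continuous_on_compose2[OF matrix_vector_mult_linear_continuous_on[where A=\<sigma> and S=UNIV]] continuous_on_fst continuous_on_snd continuous_on_id) auto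
  have Fm: "F \<in> borel_measurable borel"
    unfolding F_def by (rule measurable_compose[OF borel_measurable_continuous_onI[OF c] fmeas])
  obtain K where K: "\<And>x. \<bar>f x\<bar> \<le> K"
    using fbdd unfolding bounded_iff by auto
  have FK: "\<bar>F g\<bar> \<le> K" for g unfolding F_def by (rule K)
  obtain si where inv1: "\<sigma> ** si = mat 1" and inv2: "si ** \<sigma> = mat 1"
    using inv unfolding invertible_def by blast
  have ssi: "\<sigma> *v (si *v x) = x" for x by (simp add: matrix_vector_mul_assoc inv1)
  \<comment> \<open>Undoes \<open>x = \<sigma> u\<close> on the horizontal part and so carries the
    semigroup to the group average.\<close>
  define Psi where "Psi x = (si *v fst x, snd x)" for x :: "(real^'m) \<times> (real^'d)"
  let ?G = "bp.avg bp.mu F"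
  let ?P = "Psg M \<sigma> A B t"
  have P: "?P h x = bp.avg bp.mu (\<lambda>g. h (\<sigma> *v fst g, snd g)) (Psi x)"
    if "h \<in> borel_measurable borel" for h :: "(real^'m) \<times> (real^'d) \<Rightarrow> real" and x
    using Psg_eq_avg[OF bm bp[unfolded S_def] that, of "si *v fst x" "snd x"] by (simp add: ssi Psi_def S_def)
  have PG: "?P f x = ?G (Psi x)" for x unfolding F_def by (rule P[OF fmeas])
  have PG2: "?P (\<lambda>w. (f w)\<^sup>2) x = bp.avg bp.mu (\<lambda>g. (F g)\<^sup>2) (Psi x)" for x
    unfolding F_def by (rule P) (use fmeas in simp)
  obtain D where D: "sl.has_left_derivative ?G D (Psi z)"
    and Db: "t * (norm (fst D))\<^sup>2 \<le> bp.hdim * (bp.avg bp.mu (\<lambda>x. (F x)\<^sup>2) (Psi z) - (?G (Psi z))\<^sup>2)"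
    using sl.left_derivative_bound[OF Fm FK] by blast
  define u where "u = si *v fst z"
  \<comment> \<open>The group increment from \<open>Psi z\<close> to \<open>Psi (z + h)\<close>; the
    subtracted term undoes the twist of the product at the base point. It is linear in
    \<open>h\<close>, so the expansion along the group yields a Frechet derivative.\<close>
  define k where "k h = (si *v fst h, snd h - vform S u (si *v fst h))" for h :: "(real^'m) \<times> (real^'d)"
  have shift: "Psi (z + h) = bp.gm (Psi z) (k h)" for h
    by (simp add: Psi_def k_def u_def bp.gm_def matrix_vector_right_distrib)
  have kl: "linear k"
    by (rule linearI) (simp_all add: k_def matrix_vector_right_distrib matrix_vector_mult_scaleR bp.add_right bp.scaleR_right algebra_simps)
  obtain C where C: "C > 0" "\<And>h. norm (k h) \<le> C * norm h"
    using linear_bounded_pos[OF kl] by blast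
  have der: "(?P f has_derivative (\<lambda>h. D \<bullet> k h)) (at z)"
    unfolding has_derivative_at_alt
  proof (intro conjI allI impI)
    have "linear (\<lambda>h. D \<bullet> k h)"
      using kl by (intro linearI) (simp_all add: linear_add linear_cmul inner_add_right)
    then show "bounded_linear (\<lambda>h. D \<bullet> k h)" by (simp add: linear_conv_bounded_linear)
    fix e :: real assume e: "e > 0"
    then have "e / C > 0" using C by simp
    then obtain d where d: "d > 0" "\<And>x. norm x < d \<Longrightarrow> \<bar>?G (bp.gm (Psi z) x) - ?G (Psi z) - D \<bullet> x\<bar> \<le> e / C * norm x"
      using D unfolding sl.has_left_derivative_def by blast
    show "\<exists>d>0. \<forall>y. norm (y - z) < d \<longrightarrow> norm (?P f y - ?P f z - D \<bullet> k (y - z)) \<le> e * norm (y - z)"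
    proof (intro exI[of _ "d / C"] conjI allI impI)
      show "0 < d / C" using d C by simp
      fix y assume y: "norm (y - z) < d / C"
      have "norm (k (y - z)) \<le> C * norm (y - z)" by (rule C)
      also have "\<dots> < d" using y C(1) by (simp add: pos_less_divide_eq mult.commute)
      finally have "\<bar>?G (bp.gm (Psi z) (k (y - z))) - ?G (Psi z) - D \<bullet> k (y - z)\<bar> \<le> e / C * norm (k (y - z))" by (rule d(2))
      also have "\<dots> \<le> e / C * (C * norm (y - z))" using e C by (intro mult_left_mono) auto
      also have "\<dots> = e * norm (y - z)" using C(1) by simp
      finally show "norm (?P f y - ?P f z - D \<bullet> k (y - z)) \<le> e * norm (y - z)"
        using shift[of "y - z"] by (simp add: PG)
    qed
  qed
  \<comment> \<open>The fields \<open>X_i\<close> are the left-invariant fields of the horizontal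
    basis vectors, so \<open>X_i P_t f\<close> is a horizontal component of
    \<open>D\<close>.\<close>
  have kv: "k (vfield \<sigma> A i z) = (axis i 1, 0)" for i
  proof -
    have "fst (vfield \<sigma> A i z) = \<sigma> *v axis i 1"
      by (simp add: vfield_def matrix_vector_mult_basis column_def)
    then have "si *v fst (vfield \<sigma> A i z) = axis i 1" by (simp add: matrix_vector_mul_assoc inv2)
    moreover have "snd (vfield \<sigma> A i z) = vform S u (axis i 1)"
      by (simp add: vfield_def vform_def vec_eq_iff S_def u_def inner_axis matrix_vector_mul_assoc[symmetric] ssi)
    ultimately show ?thesis by (simp add: k_def)
  qed
  have "Xop \<sigma> A i (?P f) z = fst D $ i" for i
    unfolding Xop_def frechet_derivative_at[OF der, symmetric] kv by (simp add: inner_prod_def inner_axis)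
  moreover have "(norm (fst D))\<^sup>2 = (\<Sum>i\<in>UNIV. (fst D $ i)\<^sup>2)"
    unfolding power2_norm_eq_inner by (simp add: inner_vec_def power2_eq_square)
  ultimately have "Gamma_op \<sigma> A (?P f) z = 1 / 2 * (norm (fst D))\<^sup>2"
    by (simp add: Gamma_op_def)
  \<comment> \<open>The factor one half of \<open>Gamma_op\<close> and \<open>tau = t\<close> turn
    \<open>hdim / tau\<close> into the constant of the theorem.\<close>
  also have "\<dots> \<le> (real CARD('m) + 2 * real CARD('d)) / (2 * t) * (?P (\<lambda>w. (f w)\<^sup>2) z - (?P f z)\<^sup>2)"
    using Db tpos unfolding PG PG2 bp.hdim_def by (simp add: field_simps)
  finally have "Gamma_op \<sigma> A (?P f) z \<le> (real CARD('m) + 2 * real CARD('d)) / (2 * t) * (?P (\<lambda>w. (f w)\<^sup>2) z - (?P f z)\<^sup>2)" .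
  moreover have "?P f differentiable (at z)" using der by (rule differentiableI)
  ultimately show "?P f differentiable (at z) \<and> Gamma_op \<sigma> A (?P f) z
      \<le> (real CARD('m) + 2 * real CARD('d)) / (2 * t) * (?P (\<lambda>w. (f w)^2) z - (?P f z)^2)" by blast
qed

end
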